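(* Let $R$ be a commutative Noetherian ring. Assume that $\mathcal{C}$ is a smashing $R$-linear triangulated category, an essentially small triangulated subcategory $\mathcal{C}^0$ of the subcategory $\mathcal{C}^{(\aleph_0)}$ of compact objects generates it, and $w^0$ is an essentially bounded below (resp. above, both) weight structure on $\mathcal{C}^0$. Choose a weak Serre subcategory $\mathcal{A}\subset R\text{-}\mathrm{Mod}$. Let $t$ be the $t$-structure on $\mathcal{C}$ strictly orthogonal to $w^0$ (it exists), and let $t_{\mathcal{A}}$ be its restriction to the triangulated subcategory $\mathcal{C}_{\mathcal{A}}$ of $\mathcal{C}$ (it exists as well). Let $\mathcal{C}^{0}_+$ (resp. $\mathcal{C}^0_-$, $\mathcal{C}^0_b$) be the full subcategory of $\mathcal{C}$ of those $M$ such that the functor $\mathcal{C}(-,M)|_{\mathcal{C}^0}$ is locally bounded below (resp. above, both). Then $t_{\mathcal{A}}$ restricts to the intersection subcategory $\mathcal{C}_{\mathcal{A}}\cap\mathcal{C}^0_+$ (resp. $\mathcal{C}_{\mathcal{A}}\cap\mathcal{C}^0_-$, $\mathcal{C}_{\mathcal{A}}\cap\mathcal{C}^0_b$), and the heart of this restriction is naturally equivalent to the category of $R$-linear functors from $(\underline{Hw}^0)^{op}$ into $\mathcal{A}$.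
   Context: Conventions: all coproducts are small; subcategories are strictly full; $X\perp Y$ means $\mathcal{C}(X,Y)=0$, for classes $D\perp E$ means $X\perp Y$ for all $X\in D$, $Y\in E$; $D^{\perp}=\{Y\in\mathrm{Obj}\,\mathcal{C}:\ X\perp Y\ \forall X\in D\}$. Smashing means having all small coproducts. $M$ is compact if $\mathcal{C}(M,-)$ respects coproducts. $\mathcal{C}^0$ generates $\mathcal{C}$ if the smallest triangulated subcategory of $\mathcal{C}$ that contains $\mathcal{C}^0$ and is closed under $\mathcal{C}$-coproducts is $\mathcal{C}$. For a cohomological functor $H$ put $H^i(M)=H(M[-i])$; $H$ is locally bounded below (resp. above) if for every $M$ we have $H^i(M)=0$ for $i\ll 0$ (resp. $i\gg 0$). A weak Serre subcategory of an abelian category is a strictly full subcategory containing the kernels and cokernels of all its morphisms and closed under extensions. $\mathcal{C}_{\mathcal{A}}$ is the full subcategory of $\mathcal{C}$ of those $N$ such that the $R$-module $\mathcal{C}(M,N)$ belongs to $\mathcal{A}$ for every $M\in\mathrm{Obj}\,\mathcal{C}^0$. A weight structure $w^0=(\mathcal{C}^0_{w^0\le 0},\mathcal{C}^0_{w^0\ge 0})$ on $\mathcal{C}^0$ is a pair of classes of objects closed under retracts such that $\mathcal{C}^0_{w^0\le 0}\subset \mathcal{C}^0_{w^0\le 0}[1]$, $\mathcal{C}^0_{w^0\ge 0}[1]\subset \mathcal{C}^0_{w^0\ge 0}$, $\mathcal{C}^0_{w^0\le 0}\perp \mathcal{C}^0_{w^0\ge 0}[1]$, and every object $M$ of $\mathcal{C}^0$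 fits into a distinguished triangle $L\to M\to R'\to L[1]$ with $L\in \mathcal{C}^0_{w^0\le 0}$, $R'\in\mathcal{C}^0_{w^0\ge 0}[1]$. $\underline{Hw}^0$ is the full subcategory with objects $\mathcal{C}^0_{w^0\le 0}\cap \mathcal{C}^0_{w^0\ge 0}$. With $\mathcal{C}^0_{w^0\le i}=\mathcal{C}^0_{w^0\le 0}[i]$, $\mathcal{C}^0_{w^0\ge i}=\mathcal{C}^0_{w^0\ge 0}[i]$, an object is left (resp. right) degenerate if it lies in $\bigcap_{i\in\mathbb{Z}}\mathcal{C}^0_{w^0\ge i}$ (resp. $\bigcap_{i\in\mathbb{Z}}\mathcal{C}^0_{w^0\le i}$). $M$ is essentially positive if for $\tilde M=M\oplus M[1]$ there is a distinguished triangle $RD\to\tilde M\to Y\to RD[1]$ with $Y\in\mathcal{C}^0_{w^0\ge 0}$ and $RD$ right degenerate; $M$ is essentially negative if for $\tilde M=M\oplus M[-1]$ there is a distinguished triangle $X\to\tilde M\to LD\to X[1]$ with $X\in\mathcal{C}^0_{w^0\le 0}$ and $LD$ left degenerate. $w^0$ is essentially bounded below (resp. above) if for every $M\in\mathrm{Obj}\,\mathcal{C}^0$ there is $n\in\mathbb{Z}$ such that $M[-n]$ is essentially positive (resp. negative). A $t$-structure $t=(\mathcal{C}_{t\le 0},\mathcal{C}_{t\ge 0})$ on $\mathcal{C}$ (homological convention) is a pair of classes of objects closed under isomorphism such that $\mathcal{C}_{t\le 0}\subset \mathcal{C}_{t\le 0}[1]$, $\mathcal{C}_{t\ge 0}[1]\subset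 \mathcal{C}_{t\ge 0}$, $\mathcal{C}_{t\ge 0}[1]\perp \mathcal{C}_{t\le 0}$, and every object $M$ fits into a distinguished triangle $L_tM\to M\to R_tM\to L_tM[1]$ with $L_tM\in \mathcal{C}_{t\ge 0}$, $R_tM\in\mathcal{C}_{t\le 0}[-1]$. $\mathcal{C}_{t\le i}=\mathcal{C}_{t\le 0}[i]$, $\mathcal{C}_{t\ge i}=\mathcal{C}_{t\ge 0}[i]$; its heart is the full subcategory with objects $\mathcal{C}_{t\le 0}\cap \mathcal{C}_{t\ge 0}$. A $t$-structure restricts to a full triangulated subcategory if intersecting both of its classes with the objects of this subcategory gives a $t$-structure on it. $t$ is strictly orthogonal to $w^0$ if $\mathcal{C}_{t\ge 1}=(\mathcal{C}^0_{w^0\le 0})^{\perp}$ and $\mathcal{C}_{t\le -1}=(\mathcal{C}^0_{w^0\ge 0})^{\perp}$. *)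

theory Defs
  imports "HOL-Algebra.Module" "HOL-Algebra.Ring_Divisibility" "HOL-Library.FuncSet"
    "HOL-Library.Countable_Set"
begin

unbundle cardinal_syntax

section \<open>Size\<close>

text \<open>
  Smallness is measured by a type \<^typ>\<open>'u\<close>, whose cardinality \<open>\<kappa>\<close> is required to be uncountable and
  regular: a set is small if it has fewer than \<open>\<kappa>\<close> elements. If \<open>\<kappa>\<close> is strongly inaccessible this is
  smallness with respect to a Grothendieck universe. Every small set is in bijection with a subset
  of \<^typ>\<open>'u\<close>, so small families are indexed by sets of type \<open>'u set\<close>, and the elements of
  small modules are taken from \<^typ>\<open>'u\<close>.
\<close>

definition size_universe :: "'u itself \<Rightarrow> bool" where
  "size_universe _ \<longleftrightarrow> uncountable (UNIV :: 'u set) \<and> regularCard |UNIV :: 'u set|"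

definition small :: "'u itself \<Rightarrow> 'a set \<Rightarrow> bool" where
  "small _ S \<longleftrightarrow> |S| <o |UNIV :: 'u set|"


section \<open>Categories and functors\<close>

record ('o, 'm) cat =
  Obj :: "'o set"
  Hom :: "'o \<Rightarrow> 'o \<Rightarrow> 'm set"
  Idn :: "'o \<Rightarrow> 'm"
  Cmp :: "'m \<Rightarrow> 'm \<Rightarrow> 'm"  (infixl \<open>\<cdot>\<index>\<close> 70)

locale category =
  fixes C :: "('o, 'm, 'z) cat_scheme" (structure)
  assumes Idn_closed: "X \<in> Obj C \<Longrightarrow> Idn C X \<in> Hom C X X"
    and Cmp_closed: "\<lbrakk>X \<in> Obj C; Y \<in> Obj C; Z \<in> Obj C; f \<in> Hom C X Y; g \<in> Hom C Y Z\<rbrakk>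
      \<Longrightarrow> g \<cdot> f \<in> Hom C X Z"
    and Cmp_assoc: "\<lbrakk>X \<in> Obj C; Y \<in> Obj C; Z \<in> Obj C; W \<in> Obj C;
        f \<in> Hom C X Y; g \<in> Hom C Y Z; h \<in> Hom C Z W\<rbrakk> \<Longrightarrow> (h \<cdot> g) \<cdot> f = h \<cdot> (g \<cdot> f)"
    and Idn_left: "\<lbrakk>X \<in> Obj C; Y \<in> Obj C; f \<in> Hom C X Y\<rbrakk> \<Longrightarrow> Idn C Y \<cdot> f = f"
    and Idn_right: "\<lbrakk>X \<in> Obj C; Y \<in> Obj C; f \<in> Hom C X Y\<rbrakk> \<Longrightarrow> f \<cdot> Idn C X = f"
    and Hom_disjoint: "\<lbrakk>X \<in> Obj C; Y \<in> Obj C; X' \<in> Obj C; Y' \<in> Obj C;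
        f \<in> Hom C X Y; f \<in> Hom C X' Y'\<rbrakk> \<Longrightarrow> X = X' \<and> Y = Y'"

text \<open>All further structure on a category is inherited by its full subcategories
  because only \<^const>\<open>Obj\<close> is changed.\<close>

definition full_sub :: "('o, 'm, 'z) cat_scheme \<Rightarrow> 'o set \<Rightarrow> ('o, 'm, 'z) cat_scheme" where
  "full_sub C S = C\<lparr>Obj := S\<rparr>"

definition is_iso :: "('o, 'm, 'z) cat_scheme \<Rightarrow> 'o \<Rightarrow> 'o \<Rightarrow> 'm \<Rightarrow> bool" where
  "is_iso C X Y f \<longleftrightarrow> f \<in> Hom C X Y \<and>
     (\<exists>g \<in> Hom C Y X. g \<cdot>\<^bsub>C\<^esub> f = Idn C X \<and> f \<cdot>\<^bsub>C\<^esub> g = Idn C Y)"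

definition isomorphic :: "('o, 'm, 'z) cat_scheme \<Rightarrow> 'o \<Rightarrow> 'o \<Rightarrow> bool" where
  "isomorphic C X Y \<longleftrightarrow> (\<exists>f. is_iso C X Y f)"

definition iso_closed :: "('o, 'm, 'z) cat_scheme \<Rightarrow> 'o set \<Rightarrow> bool" where
  "iso_closed C S \<longleftrightarrow> (\<forall>X \<in> S. \<forall>Y \<in> Obj C. isomorphic C X Y \<longrightarrow> Y \<in> S)"

definition retract_closed :: "('o, 'm, 'z) cat_scheme \<Rightarrow> 'o set \<Rightarrow> bool" where
  "retract_closed C S \<longleftrightarrow> (\<forall>X \<in> S. \<forall>Y \<in> Obj C. \<forall>i \<in> Hom C Y X. \<forall>p \<in> Hom C X Y.
     p \<cdot>\<^bsub>C\<^esub> i = Idn C Y \<longrightarrow> Y \<in> S)"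

definition is_zero_object :: "('o, 'm, 'z) cat_scheme \<Rightarrow> 'o \<Rightarrow> bool" where
  "is_zero_object C Z \<longleftrightarrow> Z \<in> Obj C \<and>
     (\<forall>X \<in> Obj C. (\<exists>!f. f \<in> Hom C Z X) \<and> (\<exists>!f. f \<in> Hom C X Z))"

definition is_coproduct ::
  "('o, 'm, 'z) cat_scheme \<Rightarrow> 'i set \<Rightarrow> ('i \<Rightarrow> 'o) \<Rightarrow> 'o \<Rightarrow> ('i \<Rightarrow> 'm) \<Rightarrow> bool" where
  "is_coproduct C I X Y \<iota> \<longleftrightarrow>
     X \<in> I \<rightarrow> Obj C \<and> Y \<in> Obj C \<and> (\<forall>i \<in> I. \<iota> i \<in> Hom C (X i) Y) \<and>
     (\<forall>Z \<in> Obj C. \<forall>f. (\<forall>i \<in> I. f i \<in> Hom C (X i) Z) \<longrightarrow>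
        (\<exists>!h. h \<in> Hom C Y Z \<and> (\<forall>i \<in> I. h \<cdot>\<^bsub>C\<^esub> \<iota> i = f i)))"

text \<open>Hom-sets are required to be small only where this matters. If \<open>\<kappa>\<close> is not a strong limit, then a
  category with small coproducts all of whose hom-sets are small has no object with two distinct
  endomorphisms.\<close>

definition small_homs_from :: "'u itself \<Rightarrow> ('o, 'm, 'z) cat_scheme \<Rightarrow> 'o set \<Rightarrow> bool" where
  "small_homs_from U C S \<longleftrightarrow> (\<forall>X \<in> S. \<forall>Y \<in> Obj C. small U (Hom C X Y))"

definition essentially_small :: "'u itself \<Rightarrow> ('o, 'm, 'z) cat_scheme \<Rightarrow> bool" where
  "essentially_small U C \<longleftrightarrow> small_homs_from U C (Obj C) \<and>
     (\<exists>S \<subseteq> Obj C. small U S \<and> (\<forall>X \<in> Obj C. \<exists>Y \<in> S. isomorphic C X Y))"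

definition smashing :: "'u itself \<Rightarrow> ('o, 'm, 'z) cat_scheme \<Rightarrow> bool" where
  "smashing U C \<longleftrightarrow> (\<forall>(I :: 'u set) X. small U I \<and> X \<in> I \<rightarrow> Obj C \<longrightarrow>
     (\<exists>Y \<iota>. is_coproduct C I X Y \<iota>))"

definition coproduct_closed :: "'u itself \<Rightarrow> ('o, 'm, 'z) cat_scheme \<Rightarrow> 'o set \<Rightarrow> bool" where
  "coproduct_closed U C S \<longleftrightarrow> (\<forall>(I :: 'u set) X Y \<iota>.
     small U I \<and> X \<in> I \<rightarrow> S \<and> is_coproduct C I X Y \<iota> \<longrightarrow> Y \<in> S)"

record ('o, 'm, 'p, 'n) cfun =
  fob :: "'o \<Rightarrow> 'p"
  far :: "'m \<Rightarrow> 'n"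

definition is_functor ::
  "('o, 'm, 'y) cat_scheme \<Rightarrow> ('p, 'n, 'z) cat_scheme \<Rightarrow> ('o, 'm, 'p, 'n) cfun \<Rightarrow> bool" where
  "is_functor A B F \<longleftrightarrow>
     fob F \<in> Obj A \<rightarrow> Obj B \<and>
     (\<forall>X \<in> Obj A. \<forall>Y \<in> Obj A. far F \<in> Hom A X Y \<rightarrow> Hom B (fob F X) (fob F Y)) \<and>
     (\<forall>X \<in> Obj A. far F (Idn A X) = Idn B (fob F X)) \<and>
     (\<forall>X \<in> Obj A. \<forall>Y \<in> Obj A. \<forall>Z \<in> Obj A. \<forall>f \<in> Hom A X Y. \<forall>g \<in> Hom A Y Z.
        far F (g \<cdot>\<^bsub>A\<^esub> f) = far F g \<cdot>\<^bsub>B\<^esub> far F f)"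

definition fun_id :: "('o, 'm, 'o, 'm) cfun" where
  "fun_id = \<lparr>fob = (\<lambda>X. X), far = (\<lambda>f. f)\<rparr>"

definition fun_comp ::
  "('p, 'n, 'q, 'l) cfun \<Rightarrow> ('o, 'm, 'p, 'n) cfun \<Rightarrow> ('o, 'm, 'q, 'l) cfun" where
  "fun_comp G F = \<lparr>fob = fob G \<circ> fob F, far = far G \<circ> far F\<rparr>"

definition nat_trans ::
  "('o, 'm, 'y) cat_scheme \<Rightarrow> ('p, 'n, 'z) cat_scheme \<Rightarrow>
   ('o, 'm, 'p, 'n) cfun \<Rightarrow> ('o, 'm, 'p, 'n) cfun \<Rightarrow> ('o \<Rightarrow> 'n) \<Rightarrow> bool" where
  "nat_trans A B F G \<eta> \<longleftrightarrow>
     (\<forall>X \<in> Obj A. \<eta> X \<in> Hom B (fob F X) (fob G X)) \<and>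
     (\<forall>X \<in> Obj A. \<forall>Y \<in> Obj A. \<forall>f \<in> Hom A X Y.
        \<eta> Y \<cdot>\<^bsub>B\<^esub> far F f = far G f \<cdot>\<^bsub>B\<^esub> \<eta> X)"

definition nat_isomorphic ::
  "('o, 'm, 'y) cat_scheme \<Rightarrow> ('p, 'n, 'z) cat_scheme \<Rightarrow>
   ('o, 'm, 'p, 'n) cfun \<Rightarrow> ('o, 'm, 'p, 'n) cfun \<Rightarrow> bool" where
  "nat_isomorphic A B F G \<longleftrightarrow>
     (\<exists>\<eta>. nat_trans A B F G \<eta> \<and> (\<forall>X \<in> Obj A. is_iso B (fob F X) (fob G X) (\<eta> X)))"

definition is_equivalence ::
  "('o, 'm, 'y) cat_scheme \<Rightarrow> ('p, 'n, 'z) cat_scheme \<Rightarrow> ('o, 'm, 'p, 'n) cfun \<Rightarrow> bool" where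
  "is_equivalence A B F \<longleftrightarrow> is_functor A B F \<and>
     (\<exists>G. is_functor B A G \<and>
        nat_isomorphic A A (fun_comp G F) fun_id \<and> nat_isomorphic B B (fun_comp F G) fun_id)"


section \<open>Linear categories\<close>

record ('o, 'm, 'r) lcat = "('o, 'm) cat" +
  hadd :: "'m \<Rightarrow> 'm \<Rightarrow> 'm"
  hzero :: "'o \<Rightarrow> 'o \<Rightarrow> 'm"
  hscale :: "'r \<Rightarrow> 'm \<Rightarrow> 'm"

text \<open>The fields \<^const>\<open>mult\<close> and \<^const>\<open>one\<close> of a module record play no role.\<close>

definition hom_mod :: "('o, 'm, 'r, 'z) lcat_scheme \<Rightarrow> 'o \<Rightarrow> 'o \<Rightarrow> ('r, 'm) module" where
  "hom_mod C X Y = \<lparr>carrier = Hom C X Y, mult = undefined, one = undefined,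
     zero = hzero C X Y, add = hadd C, smult = hscale C\<rparr>"

definition is_biproduct ::
  "('o, 'm, 'r, 'z) lcat_scheme \<Rightarrow> 'o \<Rightarrow> 'o \<Rightarrow> 'o \<Rightarrow> bool" where
  "is_biproduct C X Y Z \<longleftrightarrow> Z \<in> Obj C \<and>
     (\<exists>i \<in> Hom C X Z. \<exists>j \<in> Hom C Y Z. \<exists>p \<in> Hom C Z X. \<exists>q \<in> Hom C Z Y.
        p \<cdot>\<^bsub>C\<^esub> i = Idn C X \<and> q \<cdot>\<^bsub>C\<^esub> j = Idn C Y \<and>
        p \<cdot>\<^bsub>C\<^esub> j = hzero C Y X \<and> q \<cdot>\<^bsub>C\<^esub> i = hzero C X Y \<and>
        hadd C (i \<cdot>\<^bsub>C\<^esub> p) (j \<cdot>\<^bsub>C\<^esub> q) = Idn C Z)"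

locale linear_category = category C
  for R :: "('r, 'k) ring_scheme" and C :: "('o, 'm, 'r, 'z) lcat_scheme" (structure) +
  assumes hom_module: "\<lbrakk>X \<in> Obj C; Y \<in> Obj C\<rbrakk> \<Longrightarrow> module R (hom_mod C X Y)"
    and Cmp_hadd_left: "\<lbrakk>X \<in> Obj C; Y \<in> Obj C; Z \<in> Obj C;
        f \<in> Hom C X Y; g \<in> Hom C Y Z; g' \<in> Hom C Y Z\<rbrakk>
      \<Longrightarrow> hadd C g g' \<cdot> f = hadd C (g \<cdot> f) (g' \<cdot> f)"
    and Cmp_hadd_right: "\<lbrakk>X \<in> Obj C; Y \<in> Obj C; Z \<in> Obj C;
        f \<in> Hom C X Y; f' \<in> Hom C X Y; g \<in> Hom C Y Z\<rbrakk>
      \<Longrightarrow> g \<cdot> hadd C f f' = hadd C (g \<cdot> f) (g \<cdot> f')"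
    and Cmp_hscale_left: "\<lbrakk>X \<in> Obj C; Y \<in> Obj C; Z \<in> Obj C;
        r \<in> carrier R; f \<in> Hom C X Y; g \<in> Hom C Y Z\<rbrakk>
      \<Longrightarrow> hscale C r g \<cdot> f = hscale C r (g \<cdot> f)"
    and Cmp_hscale_right: "\<lbrakk>X \<in> Obj C; Y \<in> Obj C; Z \<in> Obj C;
        r \<in> carrier R; f \<in> Hom C X Y; g \<in> Hom C Y Z\<rbrakk>
      \<Longrightarrow> g \<cdot> hscale C r f = hscale C r (g \<cdot> f)"

locale additive_linear_category = linear_category R C
  for R :: "('r, 'k) ring_scheme" and C :: "('o, 'm, 'r, 'z) lcat_scheme" (structure) +
  assumes zero_object_exists: "\<exists>Z. is_zero_object C Z"
    and biproduct_exists: "\<lbrakk>X \<in> Obj C; Y \<in> Obj C\<rbrakk> \<Longrightarrow> \<exists>Z. is_biproduct C X Y Z"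

definition op_cat :: "('o, 'm, 'r, 'z) lcat_scheme \<Rightarrow> ('o, 'm, 'r, 'z) lcat_scheme" where
  "op_cat C = C\<lparr>Hom := (\<lambda>X Y. Hom C Y X), Cmp := (\<lambda>g f. f \<cdot>\<^bsub>C\<^esub> g),
     hzero := (\<lambda>X Y. hzero C Y X)\<rparr>"

definition is_linear_functor ::
  "('r, 'k) ring_scheme \<Rightarrow> ('o, 'm, 'r, 'y) lcat_scheme \<Rightarrow> ('p, 'n, 'r, 'z) lcat_scheme \<Rightarrow>
   ('o, 'm, 'p, 'n) cfun \<Rightarrow> bool" where
  "is_linear_functor R A B F \<longleftrightarrow> is_functor A B F \<and>
     (\<forall>X \<in> Obj A. \<forall>Y \<in> Obj A. \<forall>f \<in> Hom A X Y. \<forall>g \<in> Hom A X Y.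
        far F (hadd A f g) = hadd B (far F f) (far F g)) \<and>
     (\<forall>X \<in> Obj A. \<forall>Y \<in> Obj A. \<forall>r \<in> carrier R. \<forall>f \<in> Hom A X Y.
        far F (hscale A r f) = hscale B r (far F f))"

definition mid :: "'a \<times> 'b \<times> 'c \<Rightarrow> 'b" where
  "mid x = fst (snd x)"

text \<open>The category of linear functors. An arrow is a triple consisting of its source, the family
  of components and its target, so that hom-sets are disjoint. Functors and families are
  required to be extensional, so that equality of functors and of natural transformations is
  equality on the source category.\<close>

definition fun_cat ::
  "('r, 'k) ring_scheme \<Rightarrow> ('o, 'm, 'r, 'y) lcat_scheme \<Rightarrow> ('p, 'n, 'r, 'z) lcat_scheme \<Rightarrow>
   (('o, 'm, 'p, 'n) cfun,
    ('o, 'm, 'p, 'n) cfun \<times> ('o \<Rightarrow> 'n) \<times> ('o, 'm, 'p, 'n) cfun) cat" where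
  "fun_cat R A B = \<lparr>
     Obj = {F. is_linear_functor R A B F \<and> fob F \<in> extensional (Obj A) \<and>
              far F \<in> extensional (\<Union>X \<in> Obj A. \<Union>Y \<in> Obj A. Hom A X Y)},
     Hom = (\<lambda>F G. {(F, \<eta>, G) | \<eta>. nat_trans A B F G \<eta> \<and> \<eta> \<in> extensional (Obj A)}),
     Idn = (\<lambda>F. (F, (\<lambda>X \<in> Obj A. Idn B (fob F X)), F)),
     Cmp = (\<lambda>(_, \<theta>, H) (F, \<eta>, _). (F, (\<lambda>X \<in> Obj A. \<theta> X \<cdot>\<^bsub>B\<^esub> \<eta> X), H))\<rparr>"

definition is_kernel ::
  "('o, 'm, 'r, 'z) lcat_scheme \<Rightarrow> 'o \<Rightarrow> 'o \<Rightarrow> 'm \<Rightarrow> 'o \<Rightarrow> 'm \<Rightarrow> bool" where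
  "is_kernel C X Y f K k \<longleftrightarrow> K \<in> Obj C \<and> k \<in> Hom C K X \<and> f \<cdot>\<^bsub>C\<^esub> k = hzero C K Y \<and>
     (\<forall>T \<in> Obj C. \<forall>u \<in> Hom C T X. f \<cdot>\<^bsub>C\<^esub> u = hzero C T Y \<longrightarrow>
        (\<exists>!v. v \<in> Hom C T K \<and> k \<cdot>\<^bsub>C\<^esub> v = u))"

definition is_cokernel ::
  "('o, 'm, 'r, 'z) lcat_scheme \<Rightarrow> 'o \<Rightarrow> 'o \<Rightarrow> 'm \<Rightarrow> 'o \<Rightarrow> 'm \<Rightarrow> bool" where
  "is_cokernel C X Y f Q q \<longleftrightarrow> Q \<in> Obj C \<and> q \<in> Hom C Y Q \<and> q \<cdot>\<^bsub>C\<^esub> f = hzero C X Q \<and>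
     (\<forall>T \<in> Obj C. \<forall>u \<in> Hom C Y T. u \<cdot>\<^bsub>C\<^esub> f = hzero C X T \<longrightarrow>
        (\<exists>!v. v \<in> Hom C Q T \<and> v \<cdot>\<^bsub>C\<^esub> q = u))"

definition short_exact ::
  "('o, 'm, 'r, 'z) lcat_scheme \<Rightarrow> 'o \<Rightarrow> 'o \<Rightarrow> 'o \<Rightarrow> 'm \<Rightarrow> 'm \<Rightarrow> bool" where
  "short_exact C X Y Z i p \<longleftrightarrow> i \<in> Hom C X Y \<and> p \<in> Hom C Y Z \<and>
     is_kernel C Y Z p X i \<and> is_cokernel C X Y i Z p"

definition weak_serre :: "('o, 'm, 'r, 'z) lcat_scheme \<Rightarrow> 'o set \<Rightarrow> bool" where
  "weak_serre C S \<longleftrightarrow> S \<subseteq> Obj C \<and> S \<noteq> {} \<and> iso_closed C S \<and>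
     (\<forall>X \<in> S. \<forall>Y \<in> S. \<forall>f \<in> Hom C X Y. \<forall>K k. is_kernel C X Y f K k \<longrightarrow> K \<in> S) \<and>
     (\<forall>X \<in> S. \<forall>Y \<in> S. \<forall>f \<in> Hom C X Y. \<forall>Q q. is_cokernel C X Y f Q q \<longrightarrow> Q \<in> S) \<and>
     (\<forall>X \<in> S. \<forall>Z \<in> S. \<forall>Y \<in> Obj C. \<forall>i p. short_exact C X Y Z i p \<longrightarrow> Y \<in> S)"


section \<open>The category of small modules\<close>

definition lin_map ::
  "('r, 'k) ring_scheme \<Rightarrow> ('r, 'a) module \<Rightarrow> ('r, 'b) module \<Rightarrow> ('a \<Rightarrow> 'b) set" where
  "lin_map R M N = {f. f \<in> carrier M \<rightarrow> carrier N \<and>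
     (\<forall>x \<in> carrier M. \<forall>y \<in> carrier M. f (x \<oplus>\<^bsub>M\<^esub> y) = f x \<oplus>\<^bsub>N\<^esub> f y) \<and>
     (\<forall>r \<in> carrier R. \<forall>x \<in> carrier M. f (r \<odot>\<^bsub>M\<^esub> x) = r \<odot>\<^bsub>N\<^esub> f x)}"

definition mod_iso ::
  "('r, 'k) ring_scheme \<Rightarrow> ('r, 'a) module \<Rightarrow> ('r, 'b) module \<Rightarrow> ('a \<Rightarrow> 'b) set" where
  "mod_iso R M N = {f \<in> lin_map R M N. bij_betw f (carrier M) (carrier N)}"

definition Rmod ::
  "('r, 'k) ring_scheme \<Rightarrow>
   (('r, 'u) module, ('r, 'u) module \<times> ('u \<Rightarrow> 'u) \<times> ('r, 'u) module, 'r) lcat" where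
  "Rmod R = \<lparr>
     Obj = {M. module R M \<and> small TYPE('u) (carrier M)},
     Hom = (\<lambda>M N. {(M, f, N) | f. f \<in> lin_map R M N \<and> f \<in> extensional (carrier M)}),
     Idn = (\<lambda>M. (M, (\<lambda>x \<in> carrier M. x), M)),
     Cmp = (\<lambda>(_, g, P) (M, f, _). (M, compose (carrier M) g f, P)),
     hadd = (\<lambda>(M, f, N) (_, g, _). (M, (\<lambda>x \<in> carrier M. f x \<oplus>\<^bsub>N\<^esub> g x), N)),
     hzero = (\<lambda>M N. (M, (\<lambda>x \<in> carrier M. \<zero>\<^bsub>N\<^esub>), N)),
     hscale = (\<lambda>r (M, f, N). (M, (\<lambda>x \<in> carrier M. r \<odot>\<^bsub>N\<^esub> f x), N))\<rparr>"

text \<open>Membership of a module over an arbitrary carrier type in an isomorphism-closed class of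
  modules over \<^typ>\<open>'u\<close>.\<close>

definition belongs_to ::
  "('r, 'k) ring_scheme \<Rightarrow> ('r, 'a) module \<Rightarrow> ('r, 'u) module set \<Rightarrow> bool" where
  "belongs_to R M \<A> \<longleftrightarrow> (\<exists>N \<in> \<A>. mod_iso R M N \<noteq> {})"


section \<open>Triangulated categories\<close>

record ('o, 'm, 'r) tcat = "('o, 'm, 'r) lcat" +
  Sh :: "'o \<Rightarrow> 'o"
  ShA :: "'m \<Rightarrow> 'm"
  Tri :: "'o \<Rightarrow> 'o \<Rightarrow> 'o \<Rightarrow> 'm \<Rightarrow> 'm \<Rightarrow> 'm \<Rightarrow> bool"

text \<open>The field \<^const>\<open>Tri\<close> is only ever used through the following predicate, which makes
  sense in full subcategories as well.\<close>

definition dist_tri ::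
  "('o, 'm, 'r, 'z) tcat_scheme \<Rightarrow> 'o \<Rightarrow> 'o \<Rightarrow> 'o \<Rightarrow> 'm \<Rightarrow> 'm \<Rightarrow> 'm \<Rightarrow> bool" where
  "dist_tri C X Y Z f g h \<longleftrightarrow> X \<in> Obj C \<and> Y \<in> Obj C \<and> Z \<in> Obj C \<and>
     f \<in> Hom C X Y \<and> g \<in> Hom C Y Z \<and> h \<in> Hom C Z (Sh C X) \<and> Tri C X Y Z f g h"

locale triangulated_category = additive_linear_category R C
  for R :: "('r, 'k) ring_scheme" and C :: "('o, 'm, 'r, 'z) tcat_scheme" (structure) +
  assumes Sh_bij: "bij_betw (Sh C) (Obj C) (Obj C)"
    and ShA_bij: "\<lbrakk>X \<in> Obj C; Y \<in> Obj C\<rbrakk>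
      \<Longrightarrow> bij_betw (ShA C) (Hom C X Y) (Hom C (Sh C X) (Sh C Y))"
    and Sh_linear: "is_linear_functor R C C \<lparr>fob = Sh C, far = ShA C\<rparr>"
    and TR1_iso: "\<lbrakk>dist_tri C X Y Z f g h; X' \<in> Obj C; Y' \<in> Obj C; Z' \<in> Obj C;
        f' \<in> Hom C X' Y'; g' \<in> Hom C Y' Z'; h' \<in> Hom C Z' (Sh C X');
        is_iso C X X' a; is_iso C Y Y' b; is_iso C Z Z' c;
        b \<cdot> f = f' \<cdot> a; c \<cdot> g = g' \<cdot> b; ShA C a \<cdot> h = h' \<cdot> c\<rbrakk>
      \<Longrightarrow> dist_tri C X' Y' Z' f' g' h'"
    and TR1_id: "\<lbrakk>X \<in> Obj C; is_zero_object C Z\<rbrakk>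
      \<Longrightarrow> dist_tri C X X Z (Idn C X) (hzero C X Z) (hzero C Z (Sh C X))"
    and TR1_cone: "\<lbrakk>X \<in> Obj C; Y \<in> Obj C; f \<in> Hom C X Y\<rbrakk> \<Longrightarrow> \<exists>Z g h. dist_tri C X Y Z f g h"
    and TR2: "\<lbrakk>X \<in> Obj C; Y \<in> Obj C; Z \<in> Obj C;
        f \<in> Hom C X Y; g \<in> Hom C Y Z; h \<in> Hom C Z (Sh C X)\<rbrakk>
      \<Longrightarrow> dist_tri C X Y Z f g h \<longleftrightarrow>
          dist_tri C Y Z (Sh C X) g h (\<ominus>\<^bsub>hom_mod C (Sh C X) (Sh C Y)\<^esub> ShA C f)"
    and TR3: "\<lbrakk>dist_tri C X Y Z f g h; dist_tri C X' Y' Z' f' g' h';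
        a \<in> Hom C X X'; b \<in> Hom C Y Y'; b \<cdot> f = f' \<cdot> a\<rbrakk>
      \<Longrightarrow> \<exists>c \<in> Hom C Z Z'. c \<cdot> g = g' \<cdot> b \<and> ShA C a \<cdot> h = h' \<cdot> c"
    and TR4: "\<lbrakk>dist_tri C X Y Z' f f1 f2; dist_tri C Y Z X' g g1 g2;
        dist_tri C X Z Y' (g \<cdot> f) k1 k2\<rbrakk>
      \<Longrightarrow> \<exists>u \<in> Hom C Z' Y'. \<exists>v \<in> Hom C Y' X'.
          dist_tri C Z' Y' X' u v (ShA C f1 \<cdot> g2) \<and>
          u \<cdot> f1 = k1 \<cdot> g \<and> k2 \<cdot> u = f2 \<and> v \<cdot> k1 = g1 \<and> g2 \<cdot> v = ShA C f \<cdot> k2"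

definition shift :: "('o, 'm, 'r, 'z) tcat_scheme \<Rightarrow> int \<Rightarrow> 'o \<Rightarrow> 'o" where
  "shift C i X = (if 0 \<le> i then (Sh C ^^ nat i) X
     else (inv_into (Obj C) (Sh C) ^^ nat (- i)) X)"

definition orth :: "('o, 'm, 'r, 'z) lcat_scheme \<Rightarrow> 'o \<Rightarrow> 'o \<Rightarrow> bool" where
  "orth C X Y \<longleftrightarrow> Hom C X Y = {hzero C X Y}"

definition class_orth :: "('o, 'm, 'r, 'z) lcat_scheme \<Rightarrow> 'o set \<Rightarrow> 'o set \<Rightarrow> bool" where
  "class_orth C D E \<longleftrightarrow> (\<forall>X \<in> D. \<forall>Y \<in> E. orth C X Y)"

definition right_orth :: "('o, 'm, 'r, 'z) lcat_scheme \<Rightarrow> 'o set \<Rightarrow> 'o set" where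
  "right_orth C D = {Y \<in> Obj C. \<forall>X \<in> D. orth C X Y}"

definition tri_subcat :: "('o, 'm, 'r, 'z) tcat_scheme \<Rightarrow> 'o set \<Rightarrow> bool" where
  "tri_subcat C S \<longleftrightarrow> S \<subseteq> Obj C \<and> S \<noteq> {} \<and> iso_closed C S \<and>
     shift C 1 ` S \<subseteq> S \<and> shift C (-1) ` S \<subseteq> S \<and>
     (\<forall>X \<in> S. \<forall>Y \<in> S. \<forall>Z f g h. dist_tri C X Y Z f g h \<longrightarrow> Z \<in> S)"

text \<open>\<open>C(M,-)\<close> respects coproducts: for each small coproduct, the canonical map from the direct
  sum of the \<open>C(M, X i)\<close> to \<open>C(M, Y)\<close> is bijective.\<close>

definition compact_objects :: "'u itself \<Rightarrow> ('o, 'm, 'r, 'z) lcat_scheme \<Rightarrow> 'o set" where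
  "compact_objects U C = {M \<in> Obj C. \<forall>(I :: 'u set) X Y \<iota>.
     small U I \<and> is_coproduct C I X Y \<iota> \<longrightarrow>
     bij_betw
       (\<lambda>\<phi>. \<Oplus>\<^bsub>hom_mod C M Y\<^esub>i \<in> {i \<in> I. \<phi> i \<noteq> hzero C M (X i)}. \<iota> i \<cdot>\<^bsub>C\<^esub> \<phi> i)
       {\<phi> \<in> (\<Pi>\<^sub>E i \<in> I. Hom C M (X i)). finite {i \<in> I. \<phi> i \<noteq> hzero C M (X i)}}
       (Hom C M Y)}"

definition generates :: "'u itself \<Rightarrow> ('o, 'm, 'r, 'z) tcat_scheme \<Rightarrow> 'o set \<Rightarrow> bool" where
  "generates U C S \<longleftrightarrow>
     \<Inter> {D. tri_subcat C D \<and> S \<subseteq> D \<and> coproduct_closed U C D} = Obj C"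


section \<open>Weight structures\<close>

text \<open>A weight structure is a pair \<open>(C\<^bsub>w\<le>0\<^esub>, C\<^bsub>w\<ge>0\<^esub>)\<close>.\<close>

definition weight_structure ::
  "('o, 'm, 'r, 'z) tcat_scheme \<Rightarrow> 'o set \<times> 'o set \<Rightarrow> bool" where
  "weight_structure C w \<longleftrightarrow>
     fst w \<subseteq> Obj C \<and> snd w \<subseteq> Obj C \<and>
     retract_closed C (fst w) \<and> retract_closed C (snd w) \<and>
     fst w \<subseteq> shift C 1 ` fst w \<and> shift C 1 ` snd w \<subseteq> snd w \<and>
     class_orth C (fst w) (shift C 1 ` snd w) \<and>
     (\<forall>M \<in> Obj C. \<exists>L \<in> fst w. \<exists>R' \<in> shift C 1 ` snd w. \<exists>f g h. dist_tri C L M R' f g h)"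

definition left_degenerate :: "('o, 'm, 'r, 'z) tcat_scheme \<Rightarrow> 'o set \<times> 'o set \<Rightarrow> 'o set" where
  "left_degenerate C w = (\<Inter>i :: int. shift C i ` snd w)"

definition right_degenerate :: "('o, 'm, 'r, 'z) tcat_scheme \<Rightarrow> 'o set \<times> 'o set \<Rightarrow> 'o set" where
  "right_degenerate C w = (\<Inter>i :: int. shift C i ` fst w)"

definition ess_positive ::
  "('o, 'm, 'r, 'z) tcat_scheme \<Rightarrow> 'o set \<times> 'o set \<Rightarrow> 'o \<Rightarrow> bool" where
  "ess_positive C w M \<longleftrightarrow> (\<exists>M2. is_biproduct C M (shift C 1 M) M2 \<and>
     (\<exists>RD \<in> right_degenerate C w. \<exists>Y \<in> snd w. \<exists>f g h. dist_tri C RD M2 Y f g h))"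

definition ess_negative ::
  "('o, 'm, 'r, 'z) tcat_scheme \<Rightarrow> 'o set \<times> 'o set \<Rightarrow> 'o \<Rightarrow> bool" where
  "ess_negative C w M \<longleftrightarrow> (\<exists>M2. is_biproduct C M (shift C (-1) M) M2 \<and>
     (\<exists>X \<in> fst w. \<exists>LD \<in> left_degenerate C w. \<exists>f g h. dist_tri C X M2 LD f g h))"

definition ess_bounded_below ::
  "('o, 'm, 'r, 'z) tcat_scheme \<Rightarrow> 'o set \<times> 'o set \<Rightarrow> bool" where
  "ess_bounded_below C w \<longleftrightarrow> (\<forall>M \<in> Obj C. \<exists>n :: int. ess_positive C w (shift C (- n) M))"

definition ess_bounded_above ::
  "('o, 'm, 'r, 'z) tcat_scheme \<Rightarrow> 'o set \<times> 'o set \<Rightarrow> bool" where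
  "ess_bounded_above C w \<longleftrightarrow> (\<forall>M \<in> Obj C. \<exists>n :: int. ess_negative C w (shift C (- n) M))"

text \<open>For a weight structure as well as for a t-structure.\<close>

definition heart :: "'o set \<times> 'o set \<Rightarrow> 'o set" where
  "heart p = fst p \<inter> snd p"


section \<open>t-structures\<close>

text \<open>A t-structure is a pair \<open>(C\<^bsub>t\<le>0\<^esub>, C\<^bsub>t\<ge>0\<^esub>)\<close>, in the homological convention.\<close>

definition t_structure ::
  "('o, 'm, 'r, 'z) tcat_scheme \<Rightarrow> 'o set \<times> 'o set \<Rightarrow> bool" where
  "t_structure C t \<longleftrightarrow>
     fst t \<subseteq> Obj C \<and> snd t \<subseteq> Obj C \<and>
     iso_closed C (fst t) \<and> iso_closed C (snd t) \<and>
     fst t \<subseteq> shift C 1 ` fst t \<and> shift C 1 ` snd t \<subseteq> snd t \<and>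
     class_orth C (shift C 1 ` snd t) (fst t) \<and>
     (\<forall>M \<in> Obj C. \<exists>L \<in> snd t. \<exists>R' \<in> shift C (-1) ` fst t. \<exists>f g h. dist_tri C L M R' f g h)"

definition t_restriction :: "'o set \<times> 'o set \<Rightarrow> 'o set \<Rightarrow> 'o set \<times> 'o set" where
  "t_restriction t S = (fst t \<inter> S, snd t \<inter> S)"

definition t_restricts ::
  "('o, 'm, 'r, 'z) tcat_scheme \<Rightarrow> 'o set \<times> 'o set \<Rightarrow> 'o set \<Rightarrow> bool" where
  "t_restricts C t S \<longleftrightarrow> tri_subcat C S \<and> t_structure (full_sub C S) (t_restriction t S)"

definition strictly_orthogonal ::
  "('o, 'm, 'r, 'z) tcat_scheme \<Rightarrow> 'o set \<times> 'o set \<Rightarrow> 'o set \<times> 'o set \<Rightarrow> bool" where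
  "strictly_orthogonal C t w \<longleftrightarrow>
     shift C 1 ` snd t = right_orth C (fst w) \<and> shift C (-1) ` fst t = right_orth C (snd w)"


section \<open>Subcategories defined by conditions on hom-modules, and their hearts\<close>

definition sub_A ::
  "('r, 'k) ring_scheme \<Rightarrow> ('o, 'm, 'r, 'z) lcat_scheme \<Rightarrow> 'o set \<Rightarrow> ('r, 'u) module set \<Rightarrow> 'o set"
  where "sub_A R C C0 \<A> = {N \<in> Obj C. \<forall>M \<in> C0. belongs_to R (hom_mod C M N) \<A>}"

text \<open>Boundedness conditions on the values \<open>H\<^sup>i(M) = H(M[-i])\<close> of a cohomological functor
  (of which only the values on objects matter).\<close>

definition loc_bounded_below ::
  "('o, 'm, 'r, 'z) tcat_scheme \<Rightarrow> ('o \<Rightarrow> ('r, 'a) module) \<Rightarrow> bool" where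
  "loc_bounded_below C H \<longleftrightarrow> (\<forall>M \<in> Obj C. \<exists>k :: int. \<forall>i \<le> k.
     carrier (H (shift C (- i) M)) = {\<zero>\<^bsub>H (shift C (- i) M)\<^esub>})"

definition loc_bounded_above ::
  "('o, 'm, 'r, 'z) tcat_scheme \<Rightarrow> ('o \<Rightarrow> ('r, 'a) module) \<Rightarrow> bool" where
  "loc_bounded_above C H \<longleftrightarrow> (\<forall>M \<in> Obj C. \<exists>k :: int. \<forall>i \<ge> k.
     carrier (H (shift C (- i) M)) = {\<zero>\<^bsub>H (shift C (- i) M)\<^esub>})"

definition sub_plus :: "('o, 'm, 'r, 'z) tcat_scheme \<Rightarrow> 'o set \<Rightarrow> 'o set" where
  "sub_plus C C0 = {N \<in> Obj C. loc_bounded_below (full_sub C C0) (\<lambda>M. hom_mod C M N)}"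

definition sub_minus :: "('o, 'm, 'r, 'z) tcat_scheme \<Rightarrow> 'o set \<Rightarrow> 'o set" where
  "sub_minus C C0 = {N \<in> Obj C. loc_bounded_above (full_sub C C0) (\<lambda>M. hom_mod C M N)}"

definition sub_b :: "('o, 'm, 'r, 'z) tcat_scheme \<Rightarrow> 'o set \<Rightarrow> 'o set" where
  "sub_b C C0 = {N \<in> Obj C. loc_bounded_below (full_sub C C0) (\<lambda>M. hom_mod C M N) \<and>
     loc_bounded_above (full_sub C C0) (\<lambda>M. hom_mod C M N)}"

text \<open>\<open>\<Phi>\<close> is, up to a natural isomorphism \<open>\<rho>\<close>, the functor \<open>N \<mapsto> C(-,N)\<close> from the full subcategory
  on \<open>H\<close> to contravariant functors on the full subcategory on \<open>W\<close>. The isomorphism transports the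
  hom-modules, which consist of arrows of \<open>C\<close>, to modules over \<^typ>\<open>'u\<close>.\<close>

definition is_restricted_yoneda ::
  "('r, 'k) ring_scheme \<Rightarrow> ('o, 'm, 'r, 'z) lcat_scheme \<Rightarrow> 'o set \<Rightarrow> 'o set \<Rightarrow>
   ('o, 'm,
    ('o, 'm, ('r, 'u) module, ('r, 'u) module \<times> ('u \<Rightarrow> 'u) \<times> ('r, 'u) module) cfun,
    ('o, 'm, ('r, 'u) module, ('r, 'u) module \<times> ('u \<Rightarrow> 'u) \<times> ('r, 'u) module) cfun \<times>
    ('o \<Rightarrow> ('r, 'u) module \<times> ('u \<Rightarrow> 'u) \<times> ('r, 'u) module) \<times>
    ('o, 'm, ('r, 'u) module, ('r, 'u) module \<times> ('u \<Rightarrow> 'u) \<times> ('r, 'u) module) cfun) cfun \<Rightarrow> bool"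
  where
  "is_restricted_yoneda R C W H \<Phi> \<longleftrightarrow> (\<exists>\<rho>.
     (\<forall>N \<in> H. \<forall>P \<in> W. \<rho> N P \<in> mod_iso R (hom_mod C P N) (fob (fob \<Phi> N) P)) \<and>
     (\<forall>N \<in> H. \<forall>P \<in> W. \<forall>P' \<in> W. \<forall>f \<in> Hom C P' P. \<forall>x \<in> Hom C P N.
        \<rho> N P' (x \<cdot>\<^bsub>C\<^esub> f) = mid (far (fob \<Phi> N) f) (\<rho> N P x)) \<and>
     (\<forall>N \<in> H. \<forall>N' \<in> H. \<forall>P \<in> W. \<forall>g \<in> Hom C N N'. \<forall>x \<in> Hom C P N.
        \<rho> N' P (g \<cdot>\<^bsub>C\<^esub> x) = mid (mid (far \<Phi> g) P) (\<rho> N P x)))"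

definition naturally_equivalent ::
  "('r, 'k) ring_scheme \<Rightarrow> ('o, 'm, 'r, 'z) lcat_scheme \<Rightarrow> 'o set \<Rightarrow> 'o set \<Rightarrow>
   ('r, 'u) module set \<Rightarrow> bool" where
  "naturally_equivalent R C H W \<A> \<longleftrightarrow> (\<exists>\<Phi>.
     is_equivalence (full_sub C H)
       (fun_cat R (op_cat (full_sub C W)) (full_sub (Rmod R) \<A>)) \<Phi> \<and>
     is_restricted_yoneda R C W H \<Phi>)"

end

theory Submission
  imports Defs
begin

text \<open>
  Write \<open>wle i\<close>, \<open>wge i\<close> for the objects of \<open>C0\<close> of weight at most and at least \<open>i\<close>, and \<open>tge i\<close>, \<open>tle i\<close>
  for the objects of \<open>C\<close> that are right orthogonal to \<open>wle (i - 1)\<close> and \<open>wge (i + 1)\<close>. Strict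
  orthogonality forces the t-structure to be \<open>(tle 0, tge 0)\<close>, which gives uniqueness.

  Existence. For an object \<open>N\<close>, kill all arrows from objects of weight at least \<open>i\<close> by taking the cone of
  a coproduct of such objects, and repeat. The homotopy colimit \<open>R\<close> of the resulting sequence lies in
  \<open>tle (i - 1)\<close>, because objects of \<open>C0\<close> are compact, and the fibre of \<open>N \<rightarrow> R\<close> lies in \<open>tge i\<close>
  (\<open>hocolim\<close>, \<open>kill_maps_limit\<close>, \<open>t_dec\<close>). If \<open>N\<close> already lies in \<open>tge i\<close>, then so does \<open>R\<close>; weight
  decompositions make \<open>R\<close> right orthogonal to \<open>C0\<close>, so it is zero since \<open>C0\<close> generates. As every arrow
  from \<open>N\<close> to an object of \<open>tle (i - 1)\<close> extends to \<open>R\<close>, there are no such nonzero arrows (\<open>t_orth\<close>).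

  Restriction to the objects with values in \<open>\<A>\<close>. Let \<open>L \<rightarrow> N \<rightarrow> R'\<close> be the truncation triangle with \<open>L\<close> in
  \<open>tge 0\<close>. On objects of weight at least \<open>0\<close> the functors \<open>C(-,L)\<close> and \<open>C(-,N)\<close> agree, and weight
  decompositions present each \<open>C(M,L)\<close> as a cokernel of a map between values of \<open>C(-,L)\<close> on such
  objects (\<open>truncation_CA\<close>). A five-term exact sequence with four terms in \<open>\<A>\<close> has its middle term in
  \<open>\<A>\<close> (\<open>belongs_to_five\<close>), so \<open>L\<close> has values in \<open>\<A>\<close>, and so has \<open>R'\<close>.

  Bounds. Essential boundedness exhibits each object of \<open>C0\<close>, up to shifts and retracts, as an extension
  of an object of weight at least \<open>0\<close> by a right degenerate object, or of a left degenerate object by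
  one of weight at most \<open>0\<close>. No shift of a right degenerate object has arrows to \<open>tge 0\<close>, and no shift of
  a left degenerate one has arrows to \<open>tle 0\<close>. So bounds for \<open>C(-,N)\<close> pass to truncations
  (\<open>truncation_bounded\<close>), and all objects of the heart satisfy them (\<open>heart_bounded\<close>). In each of the
  three cases the heart is therefore \<open>HA = tle 0 \<inter> tge 0 \<inter> CA\<close>.

  The equivalence. Let \<open>HW\<close> be the heart of \<open>w\<close>. A coproduct of objects of \<open>HW\<close> that covers all arrows from
  \<open>HW\<close> to an object of \<open>tge 0\<close> has its cone in \<open>tge 1\<close>. Thus arrows from \<open>tge 0\<close> to \<open>tle 0\<close> are detected by
  \<open>HW\<close> (\<open>HW_detect_zero\<close>), which makes the restricted Yoneda functor faithful. Applied to the fibre of a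
  cover, this also shows that a natural transformation descends from the cover (\<open>HW_full\<close>). A linear
  functor on \<open>HW\<close> is presented by two covers; the cone of the map between them, truncated, represents it
  (\<open>HW_represent\<close>). For \<open>N\<close> in the heart, all \<open>C(M,N)\<close> with \<open>M\<close> in \<open>C0\<close> arise from the values of
  \<open>C(-,N)\<close> on \<open>HW\<close> by kernels and cokernels, so the representing object has values in \<open>\<A>\<close> as soon as the
  functor does (\<open>CA_from_heart\<close>).
\<close>


section \<open>Small sets\<close>

lemma small_inj: "small TYPE('u) S \<Longrightarrow> \<exists>f :: 'a \<Rightarrow> 'u. inj_on f (S :: 'a set)"
  unfolding small_def
  by (metis card_of_ordLeq ordLess_imp_ordLeq)

lemma small_mono: "small TYPE('u) S \<Longrightarrow> |T| \<le>o |S| \<Longrightarrow> small TYPE('u) T"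
  unfolding small_def by (rule ordLeq_ordLess_trans)

lemma small_subset: "small TYPE('u) S \<Longrightarrow> T \<subseteq> S \<Longrightarrow> small TYPE('u) T"
  by (rule small_mono) (auto intro: card_of_mono1)

lemma small_image: "small TYPE('u) S \<Longrightarrow> small TYPE('u) (f ` S)"
  by (rule small_mono) (auto intro: card_of_image)

lemma size_universe_infinite:
  "size_universe TYPE('u) \<Longrightarrow> \<not> finite (UNIV :: 'u set)"
  unfolding size_universe_def using countable_finite by blast

lemma small_nat:
  assumes "size_universe TYPE('u)"
  shows "small TYPE('u) (UNIV :: nat set)"
proof -
  have "\<not> |UNIV :: 'u set| \<le>o |UNIV :: nat set|"
  proof
    assume "|UNIV :: 'u set| \<le>o |UNIV :: nat set|"
    then obtain f :: "'u \<Rightarrow> nat" where "inj f"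
      using card_of_ordLeq[of "UNIV :: 'u set" "UNIV :: nat set"] by auto
    then have "countable (UNIV :: 'u set)" unfolding countable_def by blast
    then show False using assms unfolding size_universe_def by simp
  qed
  then show ?thesis unfolding small_def by (simp add: not_ordLeq_iff_ordLess card_of_Well_order)
qed

lemma small_Sigma:
  assumes "size_universe TYPE('u)" "small TYPE('u) I" "\<And>i. i \<in> I \<Longrightarrow> small TYPE('u) (S i)"
  shows "small TYPE('u) (Sigma I S)"
proof -
  have "stable |UNIV :: 'u set|"
    using assms(1) size_universe_infinite[OF assms(1)]
    by (intro regularCard_stable card_of_Card_order) (simp_all add: size_universe_def Field_card_of)
  then show ?thesis using assms(2,3) unfolding small_def by (rule stable_elim)
qed

section \<open>Categories and linear categories\<close>

context category
begin

text \<open>Source and target are carried along as objects, so that the side conditions of the category laws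
  compose when facts are combined.\<close>

definition ar :: "'m \<Rightarrow> 'o \<Rightarrow> 'o \<Rightarrow> bool" where
  "ar f X Y \<longleftrightarrow> X \<in> Obj C \<and> Y \<in> Obj C \<and> f \<in> Hom C X Y"

lemma arI: "X \<in> Obj C \<Longrightarrow> Y \<in> Obj C \<Longrightarrow> f \<in> Hom C X Y \<Longrightarrow> ar f X Y"
  by (simp add: ar_def)

lemma arD: "ar f X Y \<Longrightarrow> X \<in> Obj C" "ar f X Y \<Longrightarrow> Y \<in> Obj C" "ar f X Y \<Longrightarrow> f \<in> Hom C X Y"
  by (simp_all add: ar_def)

lemma ar_Idn: "X \<in> Obj C \<Longrightarrow> ar (Idn C X) X X"
  by (simp add: ar_def Idn_closed)

lemma ar_Cmp: "ar f X Y \<Longrightarrow> ar g Y Z \<Longrightarrow> ar (g \<cdot> f) X Z"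
  by (auto simp: ar_def intro: Cmp_closed)

lemma assoc: "ar f X Y \<Longrightarrow> ar g Y Z \<Longrightarrow> ar h Z W \<Longrightarrow> (h \<cdot> g) \<cdot> f = h \<cdot> (g \<cdot> f)"
  unfolding ar_def by (elim conjE) (rule Cmp_assoc)

lemma idl: "ar f X Y \<Longrightarrow> Idn C Y \<cdot> f = f" and idr: "ar f X Y \<Longrightarrow> f \<cdot> Idn C X = f"
  by (auto simp: ar_def intro: Idn_left Idn_right)

lemma is_iso_ar: "is_iso C X Y f \<Longrightarrow> X \<in> Obj C \<Longrightarrow> Y \<in> Obj C \<Longrightarrow>
    \<exists>g. ar f X Y \<and> ar g Y X \<and> g \<cdot> f = Idn C X \<and> f \<cdot> g = Idn C Y"
  unfolding is_iso_def ar_def by blast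

lemma coproduct_map:
  assumes "is_coproduct C I X Y \<iota>" "Z \<in> Obj C" "\<And>i. i \<in> I \<Longrightarrow> ar (f i) (X i) Z"
  shows "\<exists>h. ar h Y Z \<and> (\<forall>i\<in>I. h \<cdot> \<iota> i = f i)"
  using assms unfolding is_coproduct_def ar_def by (metis (no_types, lifting))

lemma coproduct_ar:
  assumes "is_coproduct C I X Y \<iota>" "i \<in> I" shows "ar (\<iota> i) (X i) Y"
  using assms unfolding is_coproduct_def ar_def by blast

lemma coproduct_eq:
  assumes c: "is_coproduct C I X Y \<iota>" and h: "ar h Y Z" and h': "ar h' Y Z"
    and e: "\<And>i. i \<in> I \<Longrightarrow> h \<cdot> \<iota> i = h' \<cdot> \<iota> i"
  shows "h = h'"
proof -
  have 1: "\<forall>i\<in>I. h \<cdot> \<iota> i \<in> Hom C (X i) Z"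
    using coproduct_ar[OF c] h ar_Cmp arD(3) by metis
  have "\<forall>f. (\<forall>i\<in>I. f i \<in> Hom C (X i) Z) \<longrightarrow> (\<exists>!k. k \<in> Hom C Y Z \<and> (\<forall>i \<in> I. k \<cdot> \<iota> i = f i))"
    using c h unfolding is_coproduct_def ar_def by blast
  from this[THEN spec, of "\<lambda>i. h \<cdot> \<iota> i"] 1
  have "\<exists>!k. k \<in> Hom C Y Z \<and> (\<forall>i \<in> I. k \<cdot> \<iota> i = h \<cdot> \<iota> i)" by blast
  then show ?thesis using h h' e unfolding ar_def by (metis (no_types, lifting))
qed

lemma coproduct_reindex:
  assumes f: "inj_on f I" and X: "\<And>i. i \<in> I \<Longrightarrow> X (f i) = X' i"
  shows "is_coproduct C (f ` I) X Y \<iota> \<longleftrightarrow> is_coproduct C I X' Y (\<lambda>i. \<iota> (f i))"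
    (is "?l = ?r")
proof -
  have a: "(\<forall>g. (\<forall>i\<in>f ` I. g i \<in> Hom C (X i) Z) \<longrightarrow>
      (\<exists>!h. h \<in> Hom C Y Z \<and> (\<forall>i\<in>f ` I. h \<cdot> \<iota> i = g i))) \<longleftrightarrow>
    (\<forall>g. (\<forall>i\<in>I. g i \<in> Hom C (X' i) Z) \<longrightarrow>
      (\<exists>!h. h \<in> Hom C Y Z \<and> (\<forall>i\<in>I. h \<cdot> \<iota> (f i) = g i)))" (is "?a = ?b") for Z
  proof
    assume h: ?a show ?b
    proof (intro allI impI)
      fix g assume g: "\<forall>i\<in>I. g i \<in> Hom C (X' i) Z"
      show "\<exists>!h. h \<in> Hom C Y Z \<and> (\<forall>i\<in>I. h \<cdot> \<iota> (f i) = g i)"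
        using h[THEN spec, of "\<lambda>j. g (inv_into I f j)"] g X f by (simp add: inv_into_f_f)
    qed
  next
    assume h: ?b show ?a
    proof (intro allI impI)
      fix g assume g: "\<forall>i\<in>f ` I. g i \<in> Hom C (X i) Z"
      show "\<exists>!h. h \<in> Hom C Y Z \<and> (\<forall>i\<in>f ` I. h \<cdot> \<iota> i = g i)"
        using h[THEN spec, of "\<lambda>j. g (f j)"] g X f by simp
    qed
  qed
  show ?thesis unfolding is_coproduct_def a using X by (simp add: Pi_iff)
qed

text \<open>Coproducts are postulated for index sets of elements of \<open>'u\<close>; a small index set of another type
  embeds there.\<close>

lemma smashing_coproduct:
  assumes sm: "smashing TYPE('u) C" and I: "small TYPE('u) (I :: 'i set)" and X: "X \<in> I \<rightarrow> Obj C"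
  shows "\<exists>Y \<iota>. is_coproduct C I X Y \<iota>"
proof -
  obtain f :: "'i \<Rightarrow> 'u" where f: "inj_on f I" using small_inj[OF I] by blast
  define X' where "X' = (\<lambda>j. X (inv_into I f j))"
  have e: "X' (f i) = X i" if "i \<in> I" for i using that f by (simp add: X'_def)
  have "X' \<in> f ` I \<rightarrow> Obj C" using X e by auto
  then obtain Y \<iota> where "is_coproduct C (f ` I) X' Y \<iota>"
    using sm small_image[OF I] unfolding smashing_def by blast
  then show ?thesis using coproduct_reindex[OF f, of X' X] e by blast
qed

end

context linear_category
begin

abbreviation hom :: "'o \<Rightarrow> 'o \<Rightarrow> ('r, 'm) module" where "hom X Y \<equiv> hom_mod C X Y"

definition hneg :: "'o \<Rightarrow> 'o \<Rightarrow> 'm \<Rightarrow> 'm" where "hneg X Y f = \<ominus>\<^bsub>hom X Y\<^esub> f"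

lemma hom_simps [simp]: "carrier (hom X Y) = Hom C X Y" "\<zero>\<^bsub>hom X Y\<^esub> = hzero C X Y"
  "add (hom X Y) = hadd C" "smult (hom X Y) = hscale C"
  by (simp_all add: hom_mod_def)

lemma hom_group: "X \<in> Obj C \<Longrightarrow> Y \<in> Obj C \<Longrightarrow> abelian_group (hom X Y)"
  using hom_module by (rule module.axioms(2))

lemma ar_zero: "X \<in> Obj C \<Longrightarrow> Y \<in> Obj C \<Longrightarrow> ar (hzero C X Y) X Y"
  using abelian_monoid.zero_closed[OF abelian_group.axioms(1)[OF hom_group]]
  by (simp add: ar_def)

lemma ar_add: "ar f X Y \<Longrightarrow> ar g X Y \<Longrightarrow> ar (hadd C f g) X Y"
  using abelian_monoid.a_closed[OF abelian_group.axioms(1)[OF hom_group], of X Y f g]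
  by (simp add: ar_def)

lemma ar_neg: "ar f X Y \<Longrightarrow> ar (hneg X Y f) X Y"
  using abelian_group.a_inv_closed[OF hom_group, of X Y f] by (simp add: ar_def hneg_def)

lemma ar_scale: "r \<in> carrier R \<Longrightarrow> ar f X Y \<Longrightarrow> ar (hscale C r f) X Y"
  using module.smult_closed[OF hom_module, of X Y r f] by (simp add: ar_def)

lemma add_zero: "ar f X Y \<Longrightarrow> hadd C f (hzero C X Y) = f" "ar f X Y \<Longrightarrow> hadd C (hzero C X Y) f = f"
  using abelian_monoid.r_zero[OF abelian_group.axioms(1)[OF hom_group], of X Y f]
    abelian_monoid.l_zero[OF abelian_group.axioms(1)[OF hom_group], of X Y f]
  by (simp_all add: ar_def)

lemma add_comm: "ar f X Y \<Longrightarrow> ar g X Y \<Longrightarrow> hadd C f g = hadd C g f"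
  using abelian_monoid.a_comm[OF abelian_group.axioms(1)[OF hom_group], of X Y f g]
  by (simp add: ar_def)

lemma add_assoc: "ar f X Y \<Longrightarrow> ar g X Y \<Longrightarrow> ar h X Y \<Longrightarrow> hadd C (hadd C f g) h = hadd C f (hadd C g h)"
  using abelian_monoid.a_assoc[OF abelian_group.axioms(1)[OF hom_group], of X Y f g h]
  by (simp add: ar_def)

lemma add_neg: "ar f X Y \<Longrightarrow> hadd C f (hneg X Y f) = hzero C X Y"
  using abelian_group.r_neg[OF hom_group, of X Y f] by (simp add: ar_def hneg_def)

lemma neg_unique: "ar f X Y \<Longrightarrow> ar g X Y \<Longrightarrow> hadd C f g = hzero C X Y \<Longrightarrow> g = hneg X Y f"
  using abelian_group.minus_equality[OF hom_group, of X Y g f] add_comm[of f X Y g]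
  by (simp add: ar_def hneg_def)

lemma eq_diff: "ar f X Y \<Longrightarrow> ar g X Y \<Longrightarrow> hadd C f (hneg X Y g) = hzero C X Y \<Longrightarrow> f = g"
  by (metis abelian_group.minus_minus arD hneg_def hom_group hom_simps(1) neg_unique ar_neg add_comm)

lemma neg_neg: "ar f X Y \<Longrightarrow> hneg X Y (hneg X Y f) = f"
  by (metis add_comm add_neg ar_neg neg_unique)

lemma add_idem: "ar f X Y \<Longrightarrow> hadd C f f = f \<Longrightarrow> f = hzero C X Y"
  by (metis add_assoc add_neg add_zero(1) ar_neg)

lemma cmp_add_left: "ar f X Y \<Longrightarrow> ar g Y Z \<Longrightarrow> ar g' Y Z \<Longrightarrow> hadd C g g' \<cdot> f = hadd C (g \<cdot> f) (g' \<cdot> f)"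
  unfolding ar_def by (elim conjE) (rule Cmp_hadd_left)

lemma cmp_add_right: "ar f X Y \<Longrightarrow> ar f' X Y \<Longrightarrow> ar g Y Z \<Longrightarrow> g \<cdot> hadd C f f' = hadd C (g \<cdot> f) (g \<cdot> f')"
  unfolding ar_def by (elim conjE) (rule Cmp_hadd_right)

lemma cmp_zero_left: "ar f X Y \<Longrightarrow> Z \<in> Obj C \<Longrightarrow> hzero C Y Z \<cdot> f = hzero C X Z"
  by (rule add_idem) (metis add_zero(1) ar_Cmp ar_zero arD cmp_add_left)+

lemma cmp_zero_right: "ar g Y Z \<Longrightarrow> X \<in> Obj C \<Longrightarrow> g \<cdot> hzero C X Y = hzero C X Z"
  by (rule add_idem) (metis add_zero(1) ar_Cmp ar_zero arD cmp_add_right)+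

lemma cmp_neg_left: "ar f X Y \<Longrightarrow> ar g Y Z \<Longrightarrow> hneg Y Z g \<cdot> f = hneg X Z (g \<cdot> f)"
  by (rule neg_unique)
    (simp_all add: ar_Cmp ar_neg add_neg cmp_zero_left arD(2) flip: cmp_add_left)

lemma cmp_neg_right: "ar f X Y \<Longrightarrow> ar g Y Z \<Longrightarrow> g \<cdot> hneg X Y f = hneg X Z (g \<cdot> f)"
  by (rule neg_unique)
    (simp_all add: ar_Cmp[of _ X Y] ar_neg add_neg cmp_zero_right arD(1) flip: cmp_add_right)

lemma neg_zero_iff: "ar f X Y \<Longrightarrow> hneg X Y f = hzero C X Y \<longleftrightarrow> f = hzero C X Y"
  by (metis add_neg add_zero(1) add_zero(2) ar_neg ar_zero arD)

lemma cmp_diff_left: "ar f X Y \<Longrightarrow> ar g Y Z \<Longrightarrow> ar g' Y Z \<Longrightarrow>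
    hadd C g (hneg Y Z g') \<cdot> f = hadd C (g \<cdot> f) (hneg X Z (g' \<cdot> f))"
  by (simp add: cmp_add_left cmp_neg_left ar_neg)

lemma cmp_diff_right: "ar f X Y \<Longrightarrow> ar f' X Y \<Longrightarrow> ar g Y Z \<Longrightarrow>
    g \<cdot> hadd C f (hneg X Y f') = hadd C (g \<cdot> f) (hneg X Z (g \<cdot> f'))"
  by (simp add: cmp_add_right cmp_neg_right ar_neg)

lemma orthI: "X \<in> Obj C \<Longrightarrow> Y \<in> Obj C \<Longrightarrow> (\<And>f. ar f X Y \<Longrightarrow> f = hzero C X Y) \<Longrightarrow> orth C X Y"
  unfolding orth_def using ar_zero by (fastforce simp: ar_def)

lemma orthD: "orth C X Y \<Longrightarrow> ar f X Y \<Longrightarrow> f = hzero C X Y"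
  unfolding orth_def ar_def by auto

lemma orth_retract:
  assumes o: "orth C X Z" and i: "ar i Y X" and p: "ar p X Y" and pi: "p \<cdot> i = Idn C Y" and Z: "Z \<in> Obj C"
  shows "orth C Y Z"
proof (rule orthI)
  fix f assume f: "ar f Y Z"
  have "f \<cdot> p = hzero C X Z" using o f p by (metis orthD ar_Cmp)
  then have "(f \<cdot> p) \<cdot> i = hzero C Y Z" using i Z by (simp add: cmp_zero_left)
  then show "f = hzero C Y Z" using assoc[OF i p f] pi idr[OF f] by simp
qed (use i Z arD in auto)

lemma orth_retract_right:
  assumes o: "orth C Z X" and i: "ar i Y X" and p: "ar p X Y" and pi: "p \<cdot> i = Idn C Y" and Z: "Z \<in> Obj C"
  shows "orth C Z Y"
proof (rule orthI)
  fix f assume f: "ar f Z Y"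
  have "i \<cdot> f = hzero C Z X" using o f i by (metis orthD ar_Cmp)
  then have "p \<cdot> (i \<cdot> f) = hzero C Z Y" using p Z by (simp add: cmp_zero_right)
  then show "f = hzero C Z Y" using assoc[OF f i p] pi idl[OF f] by simp
qed (use i Z arD in auto)

lemma orth_iso:
  assumes "isomorphic C X X'" "X \<in> Obj C" "X' \<in> Obj C" "Y \<in> Obj C"
  shows "orth C X Y \<longleftrightarrow> orth C X' Y" "orth C Y X \<longleftrightarrow> orth C Y X'"
proof -
  obtain f g where "ar f X X'" "ar g X' X" "g \<cdot> f = Idn C X" "f \<cdot> g = Idn C X'"
    using assms is_iso_ar unfolding isomorphic_def by blast
  then show "orth C X Y \<longleftrightarrow> orth C X' Y" "orth C Y X \<longleftrightarrow> orth C Y X'"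
    using orth_retract orth_retract_right assms by meson+
qed

lemma orth_coproduct:
  assumes c: "is_coproduct C I X Y \<iota>" and "\<And>i. i \<in> I \<Longrightarrow> orth C (X i) Z" and Z: "Z \<in> Obj C"
  shows "orth C Y Z"
proof (rule orthI)
  fix f assume f: "ar f Y Z"
  have "f \<cdot> \<iota> i = hzero C Y Z \<cdot> \<iota> i" if "i \<in> I" for i
    using coproduct_ar[OF c that] f assms(2)[OF that] Z by (metis ar_Cmp orthD cmp_zero_left)
  then show "f = hzero C Y Z" using coproduct_eq[OF c f] f ar_zero arD by metis
qed (use c Z in \<open>auto simp: is_coproduct_def\<close>)

lemma coproduct_projections:
  assumes c: "is_coproduct C I X Y \<iota>"
  shows "\<exists>\<pi>. \<forall>i\<in>I. ar (\<pi> i) Y (X i) \<and>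
     (\<forall>j\<in>I. \<pi> i \<cdot> \<iota> j = (if i = j then Idn C (X i) else hzero C (X j) (X i)))"
proof -
  have X: "X i \<in> Obj C" if "i \<in> I" for i using c that unfolding is_coproduct_def by auto
  have "\<exists>h. ar h Y (X i) \<and>
     (\<forall>j\<in>I. h \<cdot> \<iota> j = (if i = j then Idn C (X i) else hzero C (X j) (X i)))" if "i \<in> I" for i
    by (rule coproduct_map[OF c X[OF that]]) (auto intro: ar_Idn ar_zero X that)
  then show ?thesis by (metis (no_types, lifting))
qed

lemma cmp_finsum:
  assumes g: "ar g Y Z" and M: "M \<in> Obj C"
    and "finite K" and "\<And>i. i \<in> K \<Longrightarrow> ar (a i) M Y"
  shows "g \<cdot> (\<Oplus>\<^bsub>hom M Y\<^esub>i\<in>K. a i) = (\<Oplus>\<^bsub>hom M Z\<^esub>i\<in>K. g \<cdot> a i)"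
  using assms(3,4)
proof (induction K rule: finite_induct)
  case empty
  have "abelian_monoid (hom M Y)" "abelian_monoid (hom M Z)"
    using hom_group g M arD abelian_group.axioms(1) by metis+
  then show ?case using cmp_zero_right[OF g M] by (simp add: abelian_monoid.finsum_empty)
next
  case (insert k K)
  have ag: "abelian_monoid (hom M Y)" "abelian_monoid (hom M Z)"
    using hom_group g M arD abelian_group.axioms(1) by metis+
  have a: "a \<in> K \<rightarrow> carrier (hom M Y)" "a k \<in> carrier (hom M Y)"
    using insert arD by auto
  have ga: "(\<lambda>i. g \<cdot> a i) \<in> K \<rightarrow> carrier (hom M Z)" "g \<cdot> a k \<in> carrier (hom M Z)"
    using insert g ar_Cmp arD(3) by (auto; metis)+
  have s: "ar (\<Oplus>\<^bsub>hom M Y\<^esub>i\<in>K. a i) M Y"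
    using abelian_monoid.finsum_closed[OF ag(1) a(1)] g M arD by (auto intro: arI)
  have "g \<cdot> (\<Oplus>\<^bsub>hom M Y\<^esub>i\<in>insert k K. a i) = g \<cdot> hadd C (a k) (\<Oplus>\<^bsub>hom M Y\<^esub>i\<in>K. a i)"
    using abelian_monoid.finsum_insert[OF ag(1) insert(1,2) a] by simp
  also have "\<dots> = hadd C (g \<cdot> a k) (g \<cdot> (\<Oplus>\<^bsub>hom M Y\<^esub>i\<in>K. a i))"
    using cmp_add_right[OF _ s g] insert by simp
  also have "\<dots> = hadd C (g \<cdot> a k) (\<Oplus>\<^bsub>hom M Z\<^esub>i\<in>K. g \<cdot> a i)" using insert by simp
  also have "\<dots> = (\<Oplus>\<^bsub>hom M Z\<^esub>i\<in>insert k K. g \<cdot> a i)"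
    using abelian_monoid.finsum_insert[OF ag(2) insert(1,2) ga] by simp
  finally show ?case .
qed

text \<open>The definition of compactness, transported along an embedding of the index set into \<open>'u\<close>.\<close>

lemma compact_factors:
  assumes M: "M \<in> compact_objects TYPE('u) C" and I: "small TYPE('u) (I :: 'i set)"
    and c: "is_coproduct C I X Y \<iota>" and f: "f \<in> Hom C M Y"
  shows "\<exists>K \<phi>. finite K \<and> K \<subseteq> I \<and> (\<forall>i\<in>K. ar (\<phi> i) M (X i)) \<and> f = (\<Oplus>\<^bsub>hom M Y\<^esub>i\<in>K. \<iota> i \<cdot> \<phi> i)"
proof -
  obtain e :: "'i \<Rightarrow> 'u" where e: "inj_on e I" using small_inj[OF I] by blast
  define e' where "e' = inv_into I e"
  have e': "e' (e i) = i" if "i \<in> I" for i using e that by (simp add: e'_def)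
  define J where "J = e ` I"
  define X' where "X' = (\<lambda>j. X (e' j))"
  define \<iota>' where "\<iota>' = (\<lambda>j. \<iota> (e' j))"
  have 0: "is_coproduct C I X Y (\<lambda>i. \<iota>' (e i))"
    using c unfolding is_coproduct_def \<iota>'_def by (simp add: e')
  have c': "is_coproduct C J X' Y \<iota>'"
    unfolding J_def using coproduct_reindex[OF e, of X' X Y \<iota>'] 0 e' by (simp add: X'_def)
  have MY: "M \<in> Obj C" "Y \<in> Obj C" using M c by (auto simp: compact_objects_def is_coproduct_def)
  have "bij_betw
       (\<lambda>\<phi>. \<Oplus>\<^bsub>hom_mod C M Y\<^esub>i \<in> {i \<in> J. \<phi> i \<noteq> hzero C M (X' i)}. \<iota>' i \<cdot> \<phi> i)
       {\<phi> \<in> (\<Pi>\<^sub>E i \<in> J. Hom C M (X' i)). finite {i \<in> J. \<phi> i \<noteq> hzero C M (X' i)}}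
       (Hom C M Y)"
    using M small_image[OF I] c' unfolding compact_objects_def J_def by blast
  then obtain \<phi> where \<phi>: "\<phi> \<in> (\<Pi>\<^sub>E i \<in> J. Hom C M (X' i))"
    and fin: "finite {i \<in> J. \<phi> i \<noteq> hzero C M (X' i)}"
    and feq: "f = (\<Oplus>\<^bsub>hom_mod C M Y\<^esub>i \<in> {i \<in> J. \<phi> i \<noteq> hzero C M (X' i)}. \<iota>' i \<cdot> \<phi> i)"
    using f unfolding bij_betw_def by auto
  define K where "K = e' ` {i \<in> J. \<phi> i \<noteq> hzero C M (X' i)}"
  have eq: "{i \<in> J. \<phi> i \<noteq> hzero C M (X' i)} = e ` K"
    unfolding K_def J_def by (force simp: e')
  have KI: "K \<subseteq> I" unfolding K_def J_def using e' by auto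
  have a: "ar (\<phi> (e i)) M (X i)" if "i \<in> K" for i
  proof -
    have i: "i \<in> I" using KI that by blast
    then have "\<phi> (e i) \<in> Hom C M (X' (e i))" using \<phi> unfolding J_def by auto
    moreover have "X i \<in> Obj C" using c i unfolding is_coproduct_def by auto
    ultimately show ?thesis using MY i by (simp add: ar_def X'_def e')
  qed
  have b: "(\<lambda>j. \<iota>' j \<cdot> \<phi> j) \<in> e ` K \<rightarrow> carrier (hom M Y)"
  proof
    fix j assume "j \<in> e ` K"
    then obtain i where i: "i \<in> K" "j = e i" by blast
    have "ar (\<iota> i) (X i) Y" using coproduct_ar[OF c] i KI by blast
    moreover have "\<iota>' j = \<iota> i" using i KI e' by (auto simp: \<iota>'_def)
    ultimately show "\<iota>' j \<cdot> \<phi> j \<in> carrier (hom M Y)"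
      using a[OF i(1)] i(2) ar_Cmp arD(3) by fastforce
  qed
  have "f = (\<Oplus>\<^bsub>hom M Y\<^esub>i\<in>K. \<iota>' (e i) \<cdot> \<phi> (e i))"
    unfolding feq eq
    by (rule abelian_monoid.finsum_reindex[OF abelian_group.axioms(1)[OF hom_group[OF MY]]])
      (use b inj_on_subset[OF e KI] in auto)
  also have "\<dots> = (\<Oplus>\<^bsub>hom M Y\<^esub>i\<in>K. \<iota> i \<cdot> \<phi> (e i))"
    by (rule abelian_monoid.finsum_cong'[OF abelian_group.axioms(1)[OF hom_group[OF MY]]])
      (use KI e' a coproduct_ar[OF c] ar_Cmp arD(3) in \<open>fastforce simp: \<iota>'_def\<close>)+
  finally have feq': "f = (\<Oplus>\<^bsub>hom M Y\<^esub>i\<in>K. \<iota> i \<cdot> \<phi> (e i))" .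
  have "finite K" using fin unfolding K_def by (rule finite_imageI)
  then show ?thesis using a KI feq'
    by (intro exI[of _ K] exI[of _ "\<lambda>i. \<phi> (e i)"]) simp
qed

text \<open>The form in which compactness is used most often: additive statements about arrows from a compact
  object to a coproduct need to be checked only on arrows through a single summand, because every
  arrow is a finite sum of those.\<close>

lemma compact_induct [consumes 4, case_names zero add incl]:
  assumes M: "M \<in> compact_objects TYPE('u) C" and I: "small TYPE('u) (I :: 'i set)"
    and c: "is_coproduct C I X Y \<iota>" and f: "ar f M Y"
    and z: "P (hzero C M Y)"
    and a: "\<And>g h. ar g M Y \<Longrightarrow> ar h M Y \<Longrightarrow> P g \<Longrightarrow> P h \<Longrightarrow> P (hadd C g h)"
    and i: "\<And>i u. i \<in> I \<Longrightarrow> ar u M (X i) \<Longrightarrow> P (\<iota> i \<cdot> u)"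
  shows "P f"
proof -
  obtain K \<phi> where K: "finite K" "K \<subseteq> I" "\<forall>i\<in>K. ar (\<phi> i) M (X i)"
    and feq: "f = (\<Oplus>\<^bsub>hom M Y\<^esub>i\<in>K. \<iota> i \<cdot> \<phi> i)"
    using compact_factors[OF M I c arD(3)[OF f]] by blast
  have ag: "abelian_monoid (hom M Y)" using f arD hom_group abelian_group.axioms(1) by metis
  have "P (\<Oplus>\<^bsub>hom M Y\<^esub>i\<in>K. \<iota> i \<cdot> \<phi> i)" using K
  proof (induction K rule: finite_induct)
    case empty
    show ?case using z by (simp add: abelian_monoid.finsum_empty[OF ag])
  next
    case (insert k K)
    have b: "ar (\<iota> i \<cdot> \<phi> i) M Y" if "i \<in> insert k K" for i
      using insert.prems that coproduct_ar[OF c] by (meson ar_Cmp subsetD)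
    have s: "ar (\<Oplus>\<^bsub>hom M Y\<^esub>i\<in>K. \<iota> i \<cdot> \<phi> i) M Y"
      by (rule arI) (use f arD b abelian_monoid.finsum_closed[OF ag, of "\<lambda>i. \<iota> i \<cdot> \<phi> i" K] in auto)
    have "(\<Oplus>\<^bsub>hom M Y\<^esub>i\<in>insert k K. \<iota> i \<cdot> \<phi> i) = hadd C (\<iota> k \<cdot> \<phi> k) (\<Oplus>\<^bsub>hom M Y\<^esub>i\<in>K. \<iota> i \<cdot> \<phi> i)"
      using abelian_monoid.finsum_insert[OF ag insert(1,2), of "\<lambda>i. \<iota> i \<cdot> \<phi> i"] b arD(3) by simp
    then show ?case using a[OF b s] i insert by auto
  qed
  then show ?thesis using feq by simp
qed

text \<open>The arrow is a finite sum of arrows \<open>\<iota> i \<cdot> \<phi> i\<close>, and composition with \<open>\<pi> i\<close> recovers \<open>\<phi> i\<close>.\<close>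

lemma compact_components:
  assumes M: "M \<in> compact_objects TYPE('u) C" and I: "small TYPE('u) (I :: 'i set)"
    and c: "is_coproduct C I X Y \<iota>" and f: "ar f M Y"
    and \<pi>: "\<And>i. i \<in> I \<Longrightarrow> ar (\<pi> i) Y (X i)"
    and \<pi>\<iota>: "\<And>i j. i \<in> I \<Longrightarrow> j \<in> I \<Longrightarrow> \<pi> i \<cdot> \<iota> j = (if i = j then Idn C (X i) else hzero C (X j) (X i))"
  shows "finite {i\<in>I. \<pi> i \<cdot> f \<noteq> hzero C M (X i)}"
    and "(\<And>i. i \<in> I \<Longrightarrow> \<pi> i \<cdot> f = hzero C M (X i)) \<Longrightarrow> f = hzero C M Y"
proof -
  obtain K \<phi> where K: "finite K" "K \<subseteq> I" "\<And>i. i\<in>K \<Longrightarrow> ar (\<phi> i) M (X i)"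
    and feq: "f = (\<Oplus>\<^bsub>hom M Y\<^esub>i\<in>K. \<iota> i \<cdot> \<phi> i)"
    using compact_factors[OF M I c arD(3)[OF f]] by blast
  have MO: "M \<in> Obj C" using f arD by blast
  have am: "abelian_monoid (hom M (X i))" if "i \<in> I" for i
    using MO \<pi>[OF that] arD hom_group abelian_group.axioms(1) by metis
  have b: "ar (\<iota> i \<cdot> \<phi> i) M Y" if "i \<in> K" for i
    using K that coproduct_ar[OF c] by (meson ar_Cmp subsetD)
  have k: "\<pi> i \<cdot> (\<iota> j \<cdot> \<phi> j) = (if i = j then \<phi> i else hzero C M (X i))" if "i \<in> I" "j \<in> K" for i j
  proof -
    have j: "j \<in> I" using that K by blast
    have "\<pi> i \<cdot> (\<iota> j \<cdot> \<phi> j) = (\<pi> i \<cdot> \<iota> j) \<cdot> \<phi> j"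
      by (rule assoc[OF K(3)[OF that(2)] coproduct_ar[OF c j] \<pi>[OF that(1)], symmetric])
    then show ?thesis
      using \<pi>\<iota>[OF that(1) j] idl[OF K(3)[OF that(2)]]
        cmp_zero_left[OF K(3)[OF that(2)] arD(2)[OF \<pi>[OF that(1)]]] by (cases "i = j") simp_all
  qed
  have s: "\<pi> i \<cdot> f = (\<Oplus>\<^bsub>hom M (X i)\<^esub>j\<in>K. if i = j then \<phi> i else hzero C M (X i))" if i: "i \<in> I" for i
  proof -
    have "\<pi> i \<cdot> f = (\<Oplus>\<^bsub>hom M (X i)\<^esub>j\<in>K. \<pi> i \<cdot> (\<iota> j \<cdot> \<phi> j))"
      unfolding feq by (rule cmp_finsum[OF \<pi>[OF i] MO K(1) b])
    also have "\<dots> = (\<Oplus>\<^bsub>hom M (X i)\<^esub>j\<in>K. if i = j then \<phi> i else hzero C M (X i))"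
      by (rule abelian_monoid.finsum_cong'[OF am[OF i] refl])
       (use k[OF i] K(3) arD(3) arD(3)[OF ar_zero[OF MO arD(2)[OF \<pi>[OF i]]]] in auto)
    finally show ?thesis .
  qed
  have 1: "\<pi> i \<cdot> f = \<phi> i" if i: "i \<in> K" for i
    using s[of i] abelian_monoid.finsum_singleton[OF am, of i i K "\<lambda>_. \<phi> i", unfolded hom_simps]
      K(1,3) subsetD[OF K(2) i] i arD(3) by auto
  have 2: "\<pi> i \<cdot> f = hzero C M (X i)" if i: "i \<in> I" "i \<notin> K" for i
  proof -
    have "(\<Oplus>\<^bsub>hom M (X i)\<^esub>j\<in>K. if i = j then \<phi> i else hzero C M (X i)) = (\<Oplus>\<^bsub>hom M (X i)\<^esub>j\<in>K. \<zero>\<^bsub>hom M (X i)\<^esub>)"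
      by (rule abelian_monoid.finsum_cong'[OF am[OF i(1)] refl])
        (use i ar_zero[OF MO] \<pi>[OF i(1)] arD in auto)
    then show ?thesis using s[OF i(1)] abelian_monoid.finsum_zero[OF am[OF i(1)]] by simp
  qed
  show "finite {i\<in>I. \<pi> i \<cdot> f \<noteq> hzero C M (X i)}"
    by (rule finite_subset[OF _ K(1)]) (use 2 in auto)
  assume z: "\<And>i. i \<in> I \<Longrightarrow> \<pi> i \<cdot> f = hzero C M (X i)"
  have am': "abelian_monoid (hom M Y)" using f arD hom_group abelian_group.axioms(1) by metis
  have "f = (\<Oplus>\<^bsub>hom M Y\<^esub>i\<in>K. \<zero>\<^bsub>hom M Y\<^esub>)" unfolding feq
  proof (rule abelian_monoid.finsum_cong'[OF am' refl])
    fix i assume i: "i \<in> K"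
    then have "\<phi> i = hzero C M (X i)" using 1 z K(2) by (metis subsetD)
    then show "\<iota> i \<cdot> \<phi> i = \<zero>\<^bsub>hom M Y\<^esub>"
      using cmp_zero_right coproduct_ar[OF c] i K(2) MO by (metis hom_simps(2) subsetD)
  qed (use f arD ar_zero in auto)
  then show "f = hzero C M Y" using abelian_monoid.finsum_zero[OF am'] by simp
qed

end

section \<open>Exactness in triangulated categories\<close>

context triangulated_category
begin

lemma Sh_Obj: "X \<in> Obj C \<Longrightarrow> Sh C X \<in> Obj C"
  using Sh_bij by (auto simp: bij_betw_def)

lemma ar_ShA: "ar f X Y \<Longrightarrow> ar (ShA C f) (Sh C X) (Sh C Y)"
  using ShA_bij[of X Y] Sh_Obj by (auto simp: ar_def bij_betw_def)

lemma ShA_inj: "ar f X Y \<Longrightarrow> ar g X Y \<Longrightarrow> ShA C f = ShA C g \<Longrightarrow> f = g"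
  using ShA_bij[of X Y] by (auto simp: ar_def bij_betw_def inj_on_def)

lemma ShA_surj: "ar g (Sh C X) (Sh C Y) \<Longrightarrow> X \<in> Obj C \<Longrightarrow> Y \<in> Obj C \<Longrightarrow> \<exists>f. ar f X Y \<and> ShA C f = g"
  using ShA_bij[of X Y] unfolding ar_def bij_betw_def by (metis imageE)

lemma ShA_Cmp: "ar f X Y \<Longrightarrow> ar g Y Z \<Longrightarrow> ShA C (g \<cdot> f) = ShA C g \<cdot> ShA C f"
  using Sh_linear unfolding is_linear_functor_def is_functor_def ar_def
  by (elim conjE) (simp (no_asm_use), blast)

lemma ShA_Idn: "X \<in> Obj C \<Longrightarrow> ShA C (Idn C X) = Idn C (Sh C X)"
  using Sh_linear unfolding is_linear_functor_def is_functor_def by simp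

lemma ShA_add: "ar f X Y \<Longrightarrow> ar g X Y \<Longrightarrow> ShA C (hadd C f g) = hadd C (ShA C f) (ShA C g)"
  using Sh_linear unfolding is_linear_functor_def ar_def by (auto simp del: split_paired_All)

lemma ShA_scale: "r \<in> carrier R \<Longrightarrow> ar f X Y \<Longrightarrow> ShA C (hscale C r f) = hscale C r (ShA C f)"
  using Sh_linear unfolding is_linear_functor_def ar_def by auto

lemma ShA_zero: "X \<in> Obj C \<Longrightarrow> Y \<in> Obj C \<Longrightarrow> ShA C (hzero C X Y) = hzero C (Sh C X) (Sh C Y)"
  by (rule add_idem) (metis ShA_add add_zero(1) ar_ShA ar_zero)+

lemma ShA_zero_iff: "ar f X Y \<Longrightarrow> ShA C f = hzero C (Sh C X) (Sh C Y) \<longleftrightarrow> f = hzero C X Y"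
  by (metis ShA_inj ShA_zero ar_zero arD(1,2))

text \<open>The shift is bijective on objects, so it has an inverse on the nose.\<close>

definition Si :: "'o \<Rightarrow> 'o" where "Si X = inv_into (Obj C) (Sh C) X"

lemma Si: "X \<in> Obj C \<Longrightarrow> Si X \<in> Obj C" "X \<in> Obj C \<Longrightarrow> Sh C (Si X) = X"
  "X \<in> Obj C \<Longrightarrow> Si (Sh C X) = X"
  using Sh_bij by (auto simp: Si_def bij_betw_def inv_into_into f_inv_into_f inv_into_f_f)

lemma tri_ar: "dist_tri C X Y Z f g h \<Longrightarrow> ar f X Y" "dist_tri C X Y Z f g h \<Longrightarrow> ar g Y Z"
  "dist_tri C X Y Z f g h \<Longrightarrow> ar h Z (Sh C X)"
  by (auto simp: dist_tri_def ar_def Sh_Obj)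

lemma rotate: "dist_tri C X Y Z f g h \<Longrightarrow>
    dist_tri C Y Z (Sh C X) g h (hneg (Sh C X) (Sh C Y) (ShA C f))"
  unfolding hneg_def using TR2[of X Y Z f g h] by (simp add: dist_tri_def)

lemma unrotate:
  assumes "dist_tri C X Y Z f g h"
  shows "\<exists>h'. dist_tri C (Si Z) X Y h' f g"
proof -
  note a = tri_ar[OF assms]
  have O: "X \<in> Obj C" "Y \<in> Obj C" "Z \<in> Obj C" using a arD by auto
  have "ar (hneg Z (Sh C X) h) (Sh C (Si Z)) (Sh C X)" using a(3) Si(2)[OF O(3)] ar_neg by simp
  then obtain h' where h': "ar h' (Si Z) X" "ShA C h' = hneg Z (Sh C X) h"
    using ShA_surj Si(1) O by blast
  have "h = hneg (Sh C (Si Z)) (Sh C X) (ShA C h')" using h' neg_neg[OF a(3)] Si(2)[OF O(3)] by simp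
  then have "dist_tri C (Si Z) X Y h' f g"
    using TR2[of "Si Z" X Y h' f g] assms a O h' Si[OF O(3)] by (simp add: hneg_def[symmetric] ar_def)
  then show ?thesis by blast
qed

lemma zero_hom: "is_zero_object C Z \<Longrightarrow> ar f X Z \<Longrightarrow> f = hzero C X Z"
  "is_zero_object C Z \<Longrightarrow> ar g Z X \<Longrightarrow> g = hzero C Z X"
  using ar_zero unfolding is_zero_object_def ar_def by blast+

lemma zero_orth: "is_zero_object C Z \<Longrightarrow> X \<in> Obj C \<Longrightarrow> orth C X Z" "is_zero_object C Z \<Longrightarrow> X \<in> Obj C \<Longrightarrow> orth C Z X"
  using zero_hom by (auto intro!: orthI simp: is_zero_object_def)

lemma zero_objectI:
  assumes "Z \<in> Obj C" "orth C Z Z" shows "is_zero_object C Z"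
proof -
  have id0: "Idn C Z = hzero C Z Z" using assms ar_Idn orthD by blast
  have 1: "f = hzero C Z X" if "ar f Z X" for f X
    using idr[OF that] cmp_zero_right[OF that assms(1)] id0 by simp
  have 2: "f = hzero C X Z" if "ar f X Z" for f X
    using idl[OF that] cmp_zero_left[OF that assms(1)] id0 by simp
  show ?thesis unfolding is_zero_object_def using assms(1) 1 2 ar_zero by (auto simp: ar_def) blast+
qed

lemma Sh_zero: "is_zero_object C Z \<Longrightarrow> is_zero_object C (Sh C Z)"
proof (rule zero_objectI)
  assume Z: "is_zero_object C Z"
  then have ZO: "Z \<in> Obj C" by (simp add: is_zero_object_def)
  then show "Sh C Z \<in> Obj C" by (rule Sh_Obj)
  show "orth C (Sh C Z) (Sh C Z)"
    by (rule orthI) (use ZO Sh_Obj ShA_surj zero_hom(1)[OF Z] ShA_zero in blast)+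
qed

text \<open>The trivial triangle on \<open>X\<close> maps to the given one by the identity and \<open>f\<close>, so the composite factors
  through a zero object.\<close>

lemma tri_comp_zero:
  assumes t: "dist_tri C X Y Z f g h"
  shows "g \<cdot> f = hzero C X Z"
proof -
  note a = tri_ar[OF t]
  have O: "X \<in> Obj C" "Y \<in> Obj C" "Z \<in> Obj C" using a arD by auto
  obtain Z0 where Z0: "is_zero_object C Z0" using zero_object_exists by blast
  have Z0O: "Z0 \<in> Obj C" using Z0 by (simp add: is_zero_object_def)
  obtain c where c: "c \<in> Hom C Z0 Z" "c \<cdot> hzero C X Z0 = g \<cdot> f"
    using TR3[OF TR1_id[OF O(1) Z0] t, of "Idn C X" f] O a idr[OF a(1)] Idn_closed arD by metis
  then show ?thesis using cmp_zero_right[of c Z0 Z X] Z0O O by (simp add: ar_def)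
qed

lemma tri_comp_zero': "dist_tri C X Y Z f g h \<Longrightarrow> h \<cdot> g = hzero C Y (Sh C X)"
  using tri_comp_zero rotate by blast

text \<open>The arrow \<open>u\<close> and a zero arrow form a square between the rotation of the trivial triangle on \<open>W\<close> and
  the rotation of the given triangle. Completing it to a morphism of triangles yields the shift of
  the desired lift.\<close>

lemma tri_lift:
  assumes t: "dist_tri C X Y Z f g h" and u: "ar u W Y" and z: "g \<cdot> u = hzero C W Z"
  shows "\<exists>v. ar v W X \<and> f \<cdot> v = u"
proof -
  note a = tri_ar[OF t]
  have O: "X \<in> Obj C" "Y \<in> Obj C" "Z \<in> Obj C" "W \<in> Obj C" using a u arD by auto
  obtain Z0 where Z0: "is_zero_object C Z0" using zero_object_exists by blast
  have Z0O: "Z0 \<in> Obj C" using Z0 by (simp add: is_zero_object_def)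
  note t0 = rotate[OF TR1_id[OF O(4) Z0]]
  have "hzero C Z0 Z \<cdot> hzero C W Z0 = g \<cdot> u"
    using z cmp_zero_left[OF ar_zero[OF O(4) Z0O] O(3)] by simp
  then obtain c where c: "c \<in> Hom C (Sh C W) (Sh C X)" and
    e: "ShA C u \<cdot> hneg (Sh C W) (Sh C W) (ShA C (Idn C W)) = hneg (Sh C X) (Sh C Y) (ShA C f) \<cdot> c"
    using TR3[OF t0 rotate[OF t] arD(3)[OF u] arD(3)[OF ar_zero[OF Z0O O(3)]]] by blast
  obtain v where v: "ar v W X" "ShA C v = c"
    using ShA_surj[of c W X] c O Sh_Obj by (auto simp: ar_def)
  have "hneg (Sh C W) (Sh C Y) (ShA C u) = hneg (Sh C W) (Sh C Y) (ShA C f \<cdot> c)"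
    using e cmp_neg_left[OF ar_ShA[OF v(1)] ar_ShA[OF a(1)]] v(2)
      cmp_neg_right[OF ar_Idn[OF Sh_Obj[OF O(4)]] ar_ShA[OF u]] idr[OF ar_ShA[OF u]] ShA_Idn[OF O(4)]
    by simp
  then have "ShA C u = ShA C (f \<cdot> v)"
    using neg_neg[OF ar_ShA[OF u]] neg_neg[OF ar_Cmp[OF ar_ShA[OF v(1)] ar_ShA[OF a(1)]]]
      ShA_Cmp[OF v(1) a(1)] v(2) by metis
  then show ?thesis using ShA_inj[OF u ar_Cmp[OF v(1) a(1)]] v(1) by auto
qed

text \<open>Dual to the previous lemma: the target is the triangle formed by a zero object and the identity of
  \<open>W\<close>.\<close>

lemma tri_extend:
  assumes t: "dist_tri C X Y Z f g h" and u: "ar u Y W" and z: "u \<cdot> f = hzero C X W"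
  shows "\<exists>v. ar v Z W \<and> v \<cdot> g = u"
proof -
  note a = tri_ar[OF t]
  have O: "X \<in> Obj C" "Y \<in> Obj C" "Z \<in> Obj C" "W \<in> Obj C" using a u arD by auto
  obtain Z0 where Z0: "is_zero_object C Z0" using zero_object_exists by blast
  have Z0O: "Z0 \<in> Obj C" using Z0 by (simp add: is_zero_object_def)
  have t0: "dist_tri C Z0 W W (hzero C Z0 W) (Idn C W) (hzero C W (Sh C Z0))"
  proof -
    have "hneg (Sh C Z0) (Sh C W) (ShA C (hzero C Z0 W)) = hzero C (Sh C Z0) (Sh C W)"
      using ShA_zero[OF Z0O O(4)] neg_zero_iff ar_zero Sh_Obj Z0O O(4) by simp
    then show ?thesis
      using TR2[of Z0 W W "hzero C Z0 W" "Idn C W" "hzero C W (Sh C Z0)"] Z0O O(4)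
        TR1_id[OF O(4) Sh_zero[OF Z0]] ar_zero[OF Z0O O(4)] ar_Idn[OF O(4)] ar_zero[OF O(4) Sh_Obj[OF Z0O]]
      by (simp add: hneg_def[symmetric] ar_def)
  qed
  have "u \<cdot> f = hzero C Z0 W \<cdot> hzero C X Z0"
    using z cmp_zero_left[OF ar_zero[OF O(1) Z0O] O(4)] by simp
  then obtain c where c: "c \<in> Hom C Z W" "c \<cdot> g = Idn C W \<cdot> u"
    using TR3[OF t t0 arD(3)[OF ar_zero[OF O(1) Z0O]] arD(3)[OF u]] by blast
  then show ?thesis using O idl[OF u] by (intro exI[of _ c]) (simp add: ar_def)
qed

lemma tri_lift2:
  assumes "dist_tri C X Y Z f g h" "ar u W Z" "h \<cdot> u = hzero C W (Sh C X)"
  shows "\<exists>v. ar v W Y \<and> g \<cdot> v = u"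
  using tri_lift[OF rotate[OF assms(1)] assms(2,3)] .

lemma tri_comp_zero3:
  assumes "dist_tri C X Y Z f g h" shows "ShA C f \<cdot> h = hzero C Z (Sh C Y)"
proof -
  note a = tri_ar[OF assms]
  have "hneg Z (Sh C Y) (ShA C f \<cdot> h) = hzero C Z (Sh C Y)"
    using tri_comp_zero'[OF rotate[OF assms]] cmp_neg_left[OF a(3) ar_ShA[OF a(1)]] by simp
  then show ?thesis using neg_zero_iff[OF ar_Cmp[OF a(3) ar_ShA[OF a(1)]]] by simp
qed

lemma tri_lift3:
  assumes t: "dist_tri C X Y Z f g h" and u: "ar u W (Sh C X)"
    and z: "ShA C f \<cdot> u = hzero C W (Sh C Y)"
  shows "\<exists>v. ar v W Z \<and> h \<cdot> v = u"
proof -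
  have "hneg (Sh C X) (Sh C Y) (ShA C f) \<cdot> u = hzero C W (Sh C Y)"
    using z cmp_neg_left[OF u ar_ShA[OF tri_ar(1)[OF t]]]
      neg_zero_iff[OF ar_Cmp[OF u ar_ShA[OF tri_ar(1)[OF t]]]] by simp
  then show ?thesis using tri_lift2[OF rotate[OF t] u] by blast
qed

lemma orth_Sh: "X \<in> Obj C \<Longrightarrow> Y \<in> Obj C \<Longrightarrow> orth C (Sh C X) (Sh C Y) \<longleftrightarrow> orth C X Y"
proof
  assume X: "X \<in> Obj C" and Y: "Y \<in> Obj C"
  show "orth C X Y" if o: "orth C (Sh C X) (Sh C Y)"
    by (rule orthI[OF X Y]) (use orthD[OF o] ar_ShA ShA_zero_iff in blast)
  show "orth C (Sh C X) (Sh C Y)" if o: "orth C X Y"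
    by (rule orthI[OF Sh_Obj[OF X] Sh_Obj[OF Y]])
      (use orthD[OF o] ShA_surj[OF _ X Y] ShA_zero[OF X Y] in blast)
qed

lemma orth_Si: "X \<in> Obj C \<Longrightarrow> Y \<in> Obj C \<Longrightarrow> orth C (Si X) Y \<longleftrightarrow> orth C X (Sh C Y)"
  using orth_Sh[of "Si X" Y] Si by simp

text \<open>The long exact sequences of \<open>C(W,-)\<close> and \<open>C(-,W)\<close>, reduced to statements about vanishing. In the
  names, \<open>mid\<close>, \<open>cone\<close> and \<open>fibre\<close> tell for which vertex of the triangle the conclusion is drawn, and
  a prime marks the contravariant version.\<close>

lemma orth_mid: "dist_tri C X Y Z f g h \<Longrightarrow> orth C W X \<Longrightarrow> orth C W Z \<Longrightarrow> W \<in> Obj C \<Longrightarrow> orth C W Y"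
proof (rule orthI)
  assume t: "dist_tri C X Y Z f g h" and o: "orth C W X" "orth C W Z" and W: "W \<in> Obj C"
  note a = tri_ar[OF t]
  show "u = hzero C W Y" if u: "ar u W Y" for u
  proof -
    obtain v where "ar v W X" "f \<cdot> v = u"
      using tri_lift[OF t u orthD[OF o(2) ar_Cmp[OF u a(2)]]] by blast
    then show ?thesis using orthD[OF o(1)] cmp_zero_right[OF a(1) W] by auto
  qed
qed (auto simp: dist_tri_def)

lemma orth_mid': "dist_tri C X Y Z f g h \<Longrightarrow> orth C X W \<Longrightarrow> orth C Z W \<Longrightarrow> W \<in> Obj C \<Longrightarrow> orth C Y W"
proof (rule orthI)
  assume t: "dist_tri C X Y Z f g h" and o: "orth C X W" "orth C Z W" and W: "W \<in> Obj C"
  note a = tri_ar[OF t]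
  show "u = hzero C Y W" if u: "ar u Y W" for u
  proof -
    obtain v where "ar v Z W" "v \<cdot> g = u"
      using tri_extend[OF t u orthD[OF o(1) ar_Cmp[OF a(1) u]]] by blast
    then show ?thesis using orthD[OF o(2)] cmp_zero_left[OF a(2) W] by auto
  qed
qed (auto simp: dist_tri_def)

lemma orth_cone: "dist_tri C X Y Z f g h \<Longrightarrow> orth C W Y \<Longrightarrow> orth C W (Sh C X) \<Longrightarrow> W \<in> Obj C \<Longrightarrow> orth C W Z"
  using orth_mid rotate by blast

lemma orth_cone': "dist_tri C X Y Z f g h \<Longrightarrow> orth C Y W \<Longrightarrow> orth C (Sh C X) W \<Longrightarrow> W \<in> Obj C \<Longrightarrow> orth C Z W"
  using orth_mid' rotate by blast

lemma orth_fibre: "dist_tri C X Y Z f g h \<Longrightarrow> orth C W (Si Z) \<Longrightarrow> orth C W Y \<Longrightarrow> W \<in> Obj C \<Longrightarrow> orth C W X"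
  using orth_mid unrotate by blast

section \<open>Integer shifts\<close>

lemma shift_nonneg: "shift C (int n) X = (Sh C ^^ n) X" by (simp add: shift_def)

lemma shift_neg: "shift C (- int n) X = (Si ^^ n) X"
proof -
  have "Si = inv_into (Obj C) (Sh C)" by (simp add: Si_def fun_eq_iff)
  then show ?thesis by (cases "n = 0") (simp_all add: shift_def)
qed

lemma shift_0 [simp]: "shift C 0 X = X" and shift_1: "shift C 1 X = Sh C X"
  and shift_m1: "shift C (-1) X = Si X"
  using shift_nonneg[of 0] shift_nonneg[of 1] shift_neg[of 1] by simp_all

lemma funpow_Obj: "X \<in> Obj C \<Longrightarrow> (Sh C ^^ n) X \<in> Obj C" "X \<in> Obj C \<Longrightarrow> (Si ^^ n) X \<in> Obj C"
  by (induction n) (auto simp: Sh_Obj Si)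

lemma shift_Obj: "X \<in> Obj C \<Longrightarrow> shift C i X \<in> Obj C"
  by (cases i rule: int_cases2) (auto simp: shift_nonneg shift_neg funpow_Obj)

lemma shift_Suc: assumes X: "X \<in> Obj C" shows "shift C (i + 1) X = Sh C (shift C i X)"
proof (cases "i \<ge> 0")
  case True
  then obtain n where i: "i = int n" using nonneg_int_cases by blast
  have e: "i + 1 = int (Suc n)" using i by simp
  show ?thesis unfolding e unfolding i shift_nonneg by simp
next
  case False
  define n where "n = nat (- i - 1)"
  have i: "i = - int (Suc n)" "i + 1 = - int n" using False by (auto simp: n_def)
  show ?thesis unfolding i(2) unfolding i(1) shift_neg using funpow_Obj(2)[OF X, of n] Si(2) by simp
qed

lemma shift_pred: "X \<in> Obj C \<Longrightarrow> shift C (i - 1) X = Si (shift C i X)"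
  using shift_Suc[of X "i - 1"] Si(3) shift_Obj by simp

lemma shift_add: "X \<in> Obj C \<Longrightarrow> shift C (i + j) X = shift C i (shift C j X)"
proof (induction i rule: int_induct[where k = 0])
  case (step1 i)
  then show ?case using shift_Suc[of X "i + j"] shift_Suc[of "shift C j X" i] shift_Obj
    by (simp add: algebra_simps)
next
  case (step2 i)
  then show ?case using shift_pred[of X "i + j"] shift_pred[of "shift C j X" i] shift_Obj
    by (simp add: algebra_simps)
qed simp

lemma Sh_shift: "X \<in> Obj C \<Longrightarrow> Sh C (shift C i X) = shift C (i + 1) X"
  and Si_shift: "X \<in> Obj C \<Longrightarrow> Si (shift C i X) = shift C (i - 1) X"
  by (simp_all add: shift_Suc shift_pred)

lemma shift_cancel: "X \<in> Obj C \<Longrightarrow> shift C i (shift C (- i) X) = X" "X \<in> Obj C \<Longrightarrow> shift C (- i) (shift C i X) = X"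
  by (simp_all flip: shift_add)

lemma shift_image: "A \<subseteq> Obj C \<Longrightarrow> X \<in> shift C i ` A \<longleftrightarrow> X \<in> Obj C \<and> shift C (- i) X \<in> A"
proof
  assume "A \<subseteq> Obj C" "X \<in> shift C i ` A"
  then show "X \<in> Obj C \<and> shift C (- i) X \<in> A" using shift_cancel(2) shift_Obj by auto
next
  assume "X \<in> Obj C \<and> shift C (- i) X \<in> A"
  then show "X \<in> shift C i ` A" using shift_cancel(1)[of X i] by (metis image_eqI)
qed

lemma orth_shift: "X \<in> Obj C \<Longrightarrow> Y \<in> Obj C \<Longrightarrow> orth C (shift C i X) (shift C i Y) \<longleftrightarrow> orth C X Y"
proof (induction i rule: int_induct[where k = 0])
  case (step1 i)
  then show ?case using orth_Sh[of "shift C i X" "shift C i Y"] shift_Obj by (simp add: Sh_shift)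
next
  case (step2 i)
  then show ?case using orth_Sh[of "shift C (i - 1) X" "shift C (i - 1) Y"] shift_Obj by (simp add: Sh_shift)
qed simp

lemma orth_shift_left: "X \<in> Obj C \<Longrightarrow> Y \<in> Obj C \<Longrightarrow> orth C (shift C i X) Y \<longleftrightarrow> orth C X (shift C (- i) Y)"
  using orth_shift[of "shift C i X" Y "- i"] shift_Obj shift_cancel(2)[of X i] by metis

lemma tri_Sh: "\<exists>f g h. dist_tri C X Y Z f g h \<Longrightarrow> \<exists>f g h. dist_tri C (Sh C X) (Sh C Y) (Sh C Z) f g h"
  using rotate by blast

lemma tri_Si: "\<exists>f g h. dist_tri C X Y Z f g h \<Longrightarrow> \<exists>f g h. dist_tri C (Si X) (Si Y) (Si Z) f g h"
  by (elim exE) (drule unrotate, elim exE, drule unrotate, elim exE, drule unrotate, blast)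

text \<open>Three rotations shift a triangle and change signs, which the existential quantifiers hide.\<close>

lemma tri_shift: assumes t: "dist_tri C X Y Z f g h"
  shows "\<exists>f g h. dist_tri C (shift C i X) (shift C i Y) (shift C i Z) f g h"
proof (induction i rule: int_induct[where k = 0])
  case base show ?case using t by auto
next
  case (step1 i)
  show ?case using tri_Sh[OF step1(2)] t by (simp add: Sh_shift dist_tri_def)
next
  case (step2 i)
  show ?case using tri_Si[OF step2(2)] t by (simp add: Si_shift dist_tri_def)
qed

text \<open>Exactness of \<open>C(W,-)\<close> at \<open>X\<close>, stated after a shift so that the connecting arrow \<open>h\<close> appears as it is.\<close>

lemma Si_lift:
  assumes t: "dist_tri C X Y Z f g h" and u: "ar u W X" and z: "f \<cdot> u = hzero C W Y"
  shows "\<exists>v. ar v (Sh C W) Z \<and> h \<cdot> v = ShA C u"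
proof (rule tri_lift3[OF t ar_ShA[OF u]])
  show "ShA C f \<cdot> ShA C u = hzero C (Sh C W) (Sh C Y)"
    using z ShA_Cmp[OF u tri_ar(1)[OF t]] ShA_zero u t by (simp add: dist_tri_def ar_def)
qed

end

section \<open>Full triangulated subcategories\<close>

lemma full_sub_simps [simp]:
  "Obj (full_sub C S) = S" "Hom (full_sub C S) = Hom C" "Idn (full_sub C S) = Idn C"
  "Cmp (full_sub C S) = Cmp C"
  by (simp_all add: full_sub_def)

lemma full_sub_lin_simps [simp]:
  "hadd (full_sub C S) = hadd C" "hzero (full_sub C S) = hzero C" "hscale (full_sub C S) = hscale C"
  by (simp_all add: full_sub_def)

lemma full_sub_tri_simps [simp]:
  "Sh (full_sub C S) = Sh C" "ShA (full_sub C S) = ShA C" "Tri (full_sub C S) = Tri C"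
  by (simp_all add: full_sub_def)

lemma full_sub_full_sub [simp]: "full_sub (full_sub C S) T = full_sub C T"
  by (simp add: full_sub_def)

lemma orth_full_sub [simp]: "orth (full_sub C S) = orth C"
  by (simp add: orth_def fun_eq_iff)

lemma hom_mod_full_sub [simp]: "hom_mod (full_sub C S) = hom_mod C"
  by (simp add: hom_mod_def fun_eq_iff)

lemma isomorphic_full_sub [simp]: "isomorphic (full_sub C S) = isomorphic C"
  by (simp add: isomorphic_def is_iso_def fun_eq_iff)

context triangulated_category
begin

lemma tri_full_sub: "S \<subseteq> Obj C \<Longrightarrow> X \<in> S \<Longrightarrow> Y \<in> S \<Longrightarrow> Z \<in> S \<Longrightarrow>
   dist_tri (full_sub C S) X Y Z f g h \<longleftrightarrow> dist_tri C X Y Z f g h"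
  by (auto simp: dist_tri_def)

lemma tri_full_subD: "S \<subseteq> Obj C \<Longrightarrow> dist_tri (full_sub C S) X Y Z f g h \<Longrightarrow> dist_tri C X Y Z f g h"
  by (auto simp: dist_tri_def)

lemma tri_subcatI:
  assumes "S \<subseteq> Obj C" "S \<noteq> {}" "iso_closed C S" "\<And>X. X \<in> S \<Longrightarrow> Sh C X \<in> S" "\<And>X. X \<in> S \<Longrightarrow> Si X \<in> S"
    "\<And>X Y Z f g h. dist_tri C X Y Z f g h \<Longrightarrow> X \<in> S \<Longrightarrow> Y \<in> S \<Longrightarrow> Z \<in> S"
  shows "tri_subcat C S"
  using assms unfolding tri_subcat_def by (auto simp: shift_1 shift_m1)

lemma tri_subcatD:
  assumes "tri_subcat C S"
  shows "S \<subseteq> Obj C" "S \<noteq> {}" "iso_closed C S" "\<And>X. X \<in> S \<Longrightarrow> Sh C X \<in> S" "\<And>X. X \<in> S \<Longrightarrow> Si X \<in> S"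
    "\<And>X Y Z f g h. dist_tri C X Y Z f g h \<Longrightarrow> X \<in> S \<Longrightarrow> Y \<in> S \<Longrightarrow> Z \<in> S"
proof -
  note d = assms[unfolded tri_subcat_def]
  show "S \<subseteq> Obj C" by (rule conjunct1[OF d])
  show "S \<noteq> {}" by (rule conjunct1[OF conjunct2[OF d]])
  show "iso_closed C S" by (rule conjunct1[OF conjunct2[OF conjunct2[OF d]]])
  have "shift C 1 ` S \<subseteq> S" by (rule conjunct1[OF conjunct2[OF conjunct2[OF conjunct2[OF d]]]])
  moreover have "shift C (-1) ` S \<subseteq> S" by (rule conjunct1[OF conjunct2[OF conjunct2[OF conjunct2[OF conjunct2[OF d]]]]])
  ultimately show "Sh C X \<in> S" "Si X \<in> S" if "X \<in> S" for X
    using that shift_1[of X] shift_m1[of X] by (metis imageI subsetD)+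
  have "\<forall>X \<in> S. \<forall>Y \<in> S. \<forall>Z f g h. dist_tri C X Y Z f g h \<longrightarrow> Z \<in> S"
    using assms unfolding tri_subcat_def by (elim conjE)
  then show "Z \<in> S" if "dist_tri C X Y Z f g h" "X \<in> S" "Y \<in> S" for X Y Z f g h
    using that by meson
qed

lemma tri_subcat_shift:
  assumes S: "tri_subcat C S" and X: "X \<in> S"
  shows "shift C i X \<in> S"
proof (induction i rule: int_induct[where k = 0])
  case (step1 i)
  then show ?case using tri_subcatD(4)[OF S] Sh_shift[of X i] tri_subcatD(1)[OF S] X by (metis subsetD)
next
  case (step2 i)
  then show ?case using tri_subcatD(5)[OF S] Si_shift[of X i] tri_subcatD(1)[OF S] X by (metis subsetD)
qed (use X in simp)

text \<open>The inverse of the restricted shift is the restriction of \<open>Si\<close>, as \<open>S\<close> is closed under \<open>Si\<close>. Hence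
  notions formed in \<open>full_sub C S\<close> can be evaluated in \<open>C\<close>.\<close>

lemma shift_full_sub: assumes S: "tri_subcat C S" and X: "X \<in> S"
  shows "shift (full_sub C S) i X = shift C i X"
proof -
  note SD = tri_subcatD[OF S]
  have inv: "inv_into S (Sh C) Y = Si Y" if "Y \<in> S" for Y
  proof (rule inv_into_f_eq)
    show "inj_on (Sh C) S" using Sh_bij SD(1) unfolding bij_betw_def by (blast intro: inj_on_subset)
  qed (use SD(1,5) Si that in auto)
  have 1: "(inv_into S (Sh C) ^^ n) X = (Si ^^ n) X \<and> (Si ^^ n) X \<in> S" for n
    by (induction n) (use X inv SD(5) in auto)
  show ?thesis
  proof (cases "0 \<le> i")
    case False
    then have "shift (full_sub C S) i X = (Si ^^ nat (- i)) X" using 1 by (simp add: shift_def)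
    then show ?thesis using shift_neg[of "nat (- i)" X] False by simp
  qed (simp add: shift_def)
qed

lemma tri_subcat_cone_mid:
  assumes S: "tri_subcat C S" and t: "dist_tri C X Y Z f g h" and "X \<in> S" "Z \<in> S"
  shows "Y \<in> S"
proof -
  obtain h' where "dist_tri C (Si Z) X Y h' f g" using unrotate[OF t] by blast
  then show ?thesis using tri_subcatD(5,6)[OF S] assms by blast
qed

lemma tri_subcat_full_sub:
  assumes S: "tri_subcat C S" and T: "tri_subcat C T" and ST: "S \<subseteq> T"
  shows "tri_subcat (full_sub C T) S"
proof -
  have i: "iso_closed (full_sub C T) S"
    using tri_subcatD(1,3)[OF S] tri_subcatD(1)[OF T] unfolding iso_closed_def by auto
  have s: "shift (full_sub C T) j X = shift C j X" if "X \<in> S" for j X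
    using shift_full_sub[OF T] that ST by blast
  show ?thesis unfolding tri_subcat_def
    using i tri_subcatD(2)[OF S] ST s tri_subcat_shift[OF S] tri_subcatD(6)[OF S]
      tri_full_subD[OF tri_subcatD(1)[OF T]] by (auto; blast)
qed

end

section \<open>Sequential homotopy colimits\<close>

context triangulated_category
begin

text \<open>The homotopy colimit of a sequence is the cone of \<open>1 - s\<close> on the coproduct of its terms, where \<open>s\<close>
  moves every summand to the next one along \<open>u\<close>. If \<open>P\<close> is compact, then \<open>1 - s\<close> is injective on
  arrows from \<open>P\<close>, since the components of an arrow fixed by \<open>s\<close> vanish one after the other. When this
  holds for the desuspension of \<open>P\<close>, each arrow from \<open>P\<close> to the cone lifts to the coproduct, and for
  compact \<open>P\<close> it then comes from a finite stage. If an
  arrow \<open>g\<close> to the first term dies in the cone, then \<open>\<iota> 0 \<cdot> g\<close> is of the form \<open>(1 - s) \<cdot> y\<close>, and the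
  components of \<open>y\<close> are the images of \<open>g\<close> in the terms of the sequence; only finitely many of them
  are nonzero. Finally, a compatible family of arrows is an arrow from the coproduct that kills
  \<open>1 - s\<close>.\<close>

lemma hocolim:
  assumes univ: "size_universe TYPE('u)" and sm: "smashing TYPE('u) C"
    and u: "\<And>k. ar (u k) (X k) (X (Suc k))"
  obtains j H where "\<And>k::nat. ar (j k) (X k) H" and "\<And>k. j (Suc k) \<cdot> u k = j k"
    and "\<And>P f. P \<in> compact_objects TYPE('u) C \<Longrightarrow> Si P \<in> compact_objects TYPE('u) C \<Longrightarrow> ar f P H \<Longrightarrow>
       \<exists>k g. ar g P (X k) \<and> f = j k \<cdot> g"
    and "\<And>P g. P \<in> compact_objects TYPE('u) C \<Longrightarrow> ar g P (X 0) \<Longrightarrow> j 0 \<cdot> g = hzero C P H \<Longrightarrow>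
       \<exists>y. y 0 = g \<and> (\<forall>k. ar (y k) P (X k) \<and> y (Suc k) = u k \<cdot> y k) \<and> (\<exists>k. y k = hzero C P (X k))"
    and "\<And>Y v. (\<And>k. ar (v k) (X k) Y) \<Longrightarrow> (\<And>k. v (Suc k) \<cdot> u k = v k) \<Longrightarrow> \<exists>v'. ar v' H Y \<and> v' \<cdot> j 0 = v 0"
proof -
  have XO: "X k \<in> Obj C" for k using u arD by blast
  have smn: "small TYPE('u) (UNIV :: nat set)" by (rule small_nat[OF univ])
  obtain Y \<iota> where c: "is_coproduct C (UNIV :: nat set) X Y \<iota>"
    using smashing_coproduct[OF sm smn, of X] XO by blast
  have YO: "Y \<in> Obj C" using c by (simp add: is_coproduct_def)
  note \<iota> = coproduct_ar[OF c UNIV_I]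
  obtain \<pi> where \<pi>: "\<And>i. ar (\<pi> i) Y (X i)"
    and \<pi>\<iota>: "\<And>i j. \<pi> i \<cdot> \<iota> j = (if i = j then Idn C (X i) else hzero C (X j) (X i))"
    using coproduct_projections[OF c] by (metis (no_types, lifting) UNIV_I)
  obtain s where s: "ar s Y Y" and s\<iota>: "\<And>k. s \<cdot> \<iota> k = \<iota> (Suc k) \<cdot> u k"
    using coproduct_map[OF c YO, of "\<lambda>k. \<iota> (Suc k) \<cdot> u k"] ar_Cmp[OF u \<iota>] by blast
  \<comment> \<open>the arrow \<open>1 - s\<close>, whose cone is the homotopy colimit\<close>
  define d where "d = hadd C (Idn C Y) (hneg Y Y s)"
  have d: "ar d Y Y" unfolding d_def by (intro ar_add ar_Idn YO ar_neg s)
  have dcomp: "d \<cdot> f = hadd C f (hneg A Y (s \<cdot> f))" if "ar f A Y" for f A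
    unfolding d_def using cmp_diff_left[OF that ar_Idn[OF YO] s] idl[OF that] by simp
  have compd: "f \<cdot> d = hadd C f (hneg Y A (f \<cdot> s))" if "ar f Y A" for f A
    unfolding d_def using cmp_diff_right[OF ar_Idn[OF YO] s that] idr[OF that] by simp
  have compd0: "f \<cdot> d = hzero C Y A \<longleftrightarrow> f \<cdot> s = f" if "ar f Y A" for f A
    unfolding compd[OF that] using eq_diff[OF that ar_Cmp[OF s that]] add_neg[OF that] by auto
  obtain R j0 \<delta> where t: "dist_tri C Y Y R d j0 \<delta>" using TR1_cone[OF YO YO arD(3)[OF d]] by blast
  note a = tri_ar[OF t]
  have RO: "R \<in> Obj C" using a arD by blast
  define j where "j = (\<lambda>k. j0 \<cdot> \<iota> k)"
  have j: "ar (j k) (X k) R" for k unfolding j_def by (rule ar_Cmp[OF \<iota> a(2)])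
  have js: "j0 \<cdot> s = j0" using tri_comp_zero[OF t] compd0[OF a(2)] by simp
  have ju: "j (Suc k) \<cdot> u k = j k" for k
  proof -
    have "j (Suc k) \<cdot> u k = j0 \<cdot> (s \<cdot> \<iota> k)"
      unfolding j_def s\<iota> using assoc[OF u \<iota> a(2)] by simp
    also have "\<dots> = j k" using assoc[OF \<iota> s a(2), of k] js by (simp add: j_def)
    finally show ?thesis .
  qed
  have \<pi>s0: "\<pi> 0 \<cdot> s = hzero C Y (X 0)"
  proof (rule coproduct_eq[OF c ar_Cmp[OF s \<pi>] ar_zero[OF YO XO]])
    fix k
    have "(\<pi> 0 \<cdot> s) \<cdot> \<iota> k = (\<pi> 0 \<cdot> \<iota> (Suc k)) \<cdot> u k"
      using assoc[OF \<iota> s \<pi>] assoc[OF u \<iota> \<pi>] s\<iota> by simp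
    then show "(\<pi> 0 \<cdot> s) \<cdot> \<iota> k = hzero C Y (X 0) \<cdot> \<iota> k"
      using \<pi>\<iota> cmp_zero_left[OF u XO] cmp_zero_left[OF \<iota> XO] by simp
  qed
  have \<pi>sSuc: "\<pi> (Suc m) \<cdot> s = u m \<cdot> \<pi> m" for m
  proof (rule coproduct_eq[OF c ar_Cmp[OF s \<pi>] ar_Cmp[OF \<pi> u]])
    fix k
    have 1: "(\<pi> (Suc m) \<cdot> s) \<cdot> \<iota> k = (\<pi> (Suc m) \<cdot> \<iota> (Suc k)) \<cdot> u k"
      using assoc[OF \<iota> s \<pi>] assoc[OF u \<iota> \<pi>] s\<iota> by simp
    have 2: "(u m \<cdot> \<pi> m) \<cdot> \<iota> k = u m \<cdot> (\<pi> m \<cdot> \<iota> k)"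
      by (rule assoc[OF \<iota> \<pi> u])
    show "(\<pi> (Suc m) \<cdot> s) \<cdot> \<iota> k = (u m \<cdot> \<pi> m) \<cdot> \<iota> k"
      unfolding 1 2 \<pi>\<iota> using idl[OF u] idr[OF u] cmp_zero_left[OF u XO] cmp_zero_right[OF u XO]
      by (cases "m = k") auto
  qed
  have ds: "s \<cdot> y = y" if y: "ar y A Y" and z: "d \<cdot> y = hzero C A Y" for y A
    using eq_diff[OF y ar_Cmp[OF y s]] dcomp[OF y] z by simp
  have dinj: "y = hzero C A Y"
    if A: "A \<in> compact_objects TYPE('u) C" and y: "ar y A Y" and z: "d \<cdot> y = hzero C A Y" for y A
  proof (rule compact_components(2)[OF A smn c y])
    have AO: "A \<in> Obj C" using y arD by blast
    note e = ds[OF y z]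
    show "\<pi> i \<cdot> y = hzero C A (X i)" for i
    proof (induction i)
      case 0
      have "\<pi> 0 \<cdot> y = (\<pi> 0 \<cdot> s) \<cdot> y" using assoc[OF y s \<pi>] e by simp
      then show ?case using \<pi>s0 cmp_zero_left[OF y XO] by simp
    next
      case (Suc i)
      have "\<pi> (Suc i) \<cdot> y = (\<pi> (Suc i) \<cdot> s) \<cdot> y" using assoc[OF y s \<pi>] e by simp
      also have "\<dots> = u i \<cdot> (\<pi> i \<cdot> y)" unfolding \<pi>sSuc by (rule assoc[OF y \<pi> u])
      finally show ?case using Suc cmp_zero_right[OF u AO] by simp
    qed
  qed (use \<pi> \<pi>\<iota> in auto)
  have jle: "\<exists>g'. ar g' A (X (k + n)) \<and> j k \<cdot> g = j (k + n) \<cdot> g'" if g: "ar g A (X k)" for g A k n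
  proof (induction n)
    case 0 then show ?case using g by auto
  next
    case (Suc n)
    then obtain g' where g': "ar g' A (X (k + n))" "j k \<cdot> g = j (k + n) \<cdot> g'" by blast
    then have "j k \<cdot> g = j (Suc (k + n)) \<cdot> (u (k + n) \<cdot> g')"
      using assoc[OF g'(1) u j] ju by metis
    then show ?case using ar_Cmp[OF g'(1) u] by auto
  qed
  have factor: "\<exists>k g. ar g P (X k) \<and> f = j k \<cdot> g"
    if P: "P \<in> compact_objects TYPE('u) C" "Si P \<in> compact_objects TYPE('u) C" and f: "ar f P R" for P f
  proof -
    have PO: "P \<in> Obj C" using f arD by blast
    have \<delta>f: "ar (\<delta> \<cdot> f) (Sh C (Si P)) (Sh C Y)" using ar_Cmp[OF f a(3)] Si(2)[OF PO] by simp
    obtain y where y: "ar y (Si P) Y" "ShA C y = \<delta> \<cdot> f"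
      using ShA_surj[OF \<delta>f Si(1)[OF PO] YO] by blast
    have "ShA C (d \<cdot> y) = (ShA C d \<cdot> \<delta>) \<cdot> f"
      using ShA_Cmp[OF y(1) d] y(2) assoc[OF f a(3) ar_ShA[OF d]] by simp
    also have "\<dots> = hzero C (Sh C (Si P)) (Sh C Y)"
      using tri_comp_zero3[OF t] cmp_zero_left[OF f Sh_Obj[OF YO]] Si(2)[OF PO] by simp
    finally have "d \<cdot> y = hzero C (Si P) Y" using ShA_zero_iff[OF ar_Cmp[OF y(1) d]] by simp
    then have "y = hzero C (Si P) Y" using dinj[OF P(2) y(1)] by simp
    then have "\<delta> \<cdot> f = hzero C P (Sh C Y)" using y ShA_zero[OF Si(1)[OF PO] YO] Si(2)[OF PO] by simp
    then obtain y' where y': "ar y' P Y" "j0 \<cdot> y' = f" using tri_lift2[OF t f] by blast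
    have "\<exists>k g. ar g P (X k) \<and> j0 \<cdot> y' = j k \<cdot> g"
    proof (rule compact_induct[OF P(1) smn c y'(1), of "\<lambda>y. \<exists>k g. ar g P (X k) \<and> j0 \<cdot> y = j k \<cdot> g"])
      show "\<exists>k g. ar g P (X k) \<and> j0 \<cdot> hzero C P Y = j k \<cdot> g"
        using cmp_zero_right[OF j PO] cmp_zero_right[OF a(2) PO] ar_zero[OF PO XO] by metis
    next
      fix g h assume gh: "ar g P Y" "ar h P Y"
        and "\<exists>k g'. ar g' P (X k) \<and> j0 \<cdot> g = j k \<cdot> g'" "\<exists>k g. ar g P (X k) \<and> j0 \<cdot> h = j k \<cdot> g"
      then obtain k g' l h' where 1: "ar g' P (X k)" "j0 \<cdot> g = j k \<cdot> g'" "ar h' P (X l)" "j0 \<cdot> h = j l \<cdot> h'"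
        by blast
      obtain g'' where g'': "ar g'' P (X (k + l))" "j k \<cdot> g' = j (k + l) \<cdot> g''" using jle[OF 1(1)] by blast
      obtain h'' where h'': "ar h'' P (X (k + l))" "j l \<cdot> h' = j (k + l) \<cdot> h''"
        using jle[OF 1(3), of k] by (auto simp: add.commute)
      have "j0 \<cdot> hadd C g h = j (k + l) \<cdot> hadd C g'' h''"
        using cmp_add_right[OF gh a(2)] cmp_add_right[OF g''(1) h''(1) j] 1 g'' h'' by simp
      then show "\<exists>k g'. ar g' P (X k) \<and> j0 \<cdot> hadd C g h = j k \<cdot> g'"
        using ar_add[OF g''(1) h''(1)] by blast
    next
      fix i v assume v: "ar v P (X i)"
      show "\<exists>k g. ar g P (X k) \<and> j0 \<cdot> (\<iota> i \<cdot> v) = j k \<cdot> g"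
        by (intro exI[of _ i] exI[of _ v]) (simp add: v assoc[OF v \<iota> a(2)] j_def)
    qed
    then show ?thesis using y' by auto
  qed
  have kernel: "\<exists>y. y 0 = g \<and> (\<forall>k. ar (y k) P (X k) \<and> y (Suc k) = u k \<cdot> y k) \<and> (\<exists>k. y k = hzero C P (X k))"
    if P: "P \<in> compact_objects TYPE('u) C" and g: "ar g P (X 0)" and z: "j 0 \<cdot> g = hzero C P R" for P g
  proof -
    have PO: "P \<in> Obj C" using g arD by blast
    have "j0 \<cdot> (\<iota> 0 \<cdot> g) = hzero C P R" using z assoc[OF g \<iota> a(2)] by (simp add: j_def)
    then obtain y where y: "ar y P Y" "d \<cdot> y = \<iota> 0 \<cdot> g" using tri_lift[OF t ar_Cmp[OF g \<iota>]] by blast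
    have *: "\<pi> k \<cdot> (\<iota> 0 \<cdot> g) = hadd C (\<pi> k \<cdot> y) (hneg P (X k) ((\<pi> k \<cdot> s) \<cdot> y))" for k
      unfolding y(2)[symmetric] dcomp[OF y(1)]
      using cmp_diff_right[OF y(1) ar_Cmp[OF y(1) s] \<pi>] assoc[OF y(1) s \<pi>] by simp
    have 0: "\<pi> 0 \<cdot> y = g"
    proof -
      have "hneg P (X 0) (hzero C P (X 0)) = hzero C P (X 0)"
        using neg_zero_iff[OF ar_zero[OF PO XO]] by simp
      then have "\<pi> 0 \<cdot> y = \<pi> 0 \<cdot> (\<iota> 0 \<cdot> g)"
        using *[of 0] \<pi>s0 cmp_zero_left[OF y(1) XO] add_zero(1)[OF ar_Cmp[OF y(1) \<pi>]] by simp
      also have "\<dots> = g" using assoc[OF g \<iota> \<pi>, of 0] \<pi>\<iota>[of 0 0] idl[OF g] by simp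
      finally show ?thesis .
    qed
    have Suc: "\<pi> (Suc k) \<cdot> y = u k \<cdot> (\<pi> k \<cdot> y)" for k
    proof -
      have "\<pi> (Suc k) \<cdot> (\<iota> 0 \<cdot> g) = hzero C P (X (Suc k))"
        using assoc[OF g \<iota> \<pi>, of "Suc k"] \<pi>\<iota>[of "Suc k" 0] cmp_zero_left[OF g XO] by simp
      then have "\<pi> (Suc k) \<cdot> y = (\<pi> (Suc k) \<cdot> s) \<cdot> y"
        using *[of "Suc k"] eq_diff[OF ar_Cmp[OF y(1) \<pi>] ar_Cmp[OF y(1) ar_Cmp[OF s \<pi>]]] by simp
      then show ?thesis using \<pi>sSuc assoc[OF y(1) \<pi> u] by simp
    qed
    have "finite {i\<in>UNIV. \<pi> i \<cdot> y \<noteq> hzero C P (X i)}"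
      by (rule compact_components(1)[OF P smn c y(1)]) (use \<pi> \<pi>\<iota> in auto)
    then have "\<exists>k. \<pi> k \<cdot> y = hzero C P (X k)"
      using infinite_UNIV_nat by (metis (mono_tags, lifting) UNIV_eq_I mem_Collect_eq UNIV_I)
    then show ?thesis using 0 Suc ar_Cmp[OF y(1) \<pi>] by (intro exI[of _ "\<lambda>k. \<pi> k \<cdot> y"]) auto
  qed
  have extend: "\<exists>v'. ar v' R Z \<and> v' \<cdot> j 0 = v 0"
    if v: "\<And>k. ar (v k) (X k) Z" and vu: "\<And>k. v (Suc k) \<cdot> u k = v k" for v Z
  proof -
    obtain w where w: "ar w Y Z" "\<And>k. w \<cdot> \<iota> k = v k"
      using coproduct_map[OF c, of Z v] v arD(2) by blast
    have "w \<cdot> s = w"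
    proof (rule coproduct_eq[OF c ar_Cmp[OF s w(1)] w(1)])
      fix k show "(w \<cdot> s) \<cdot> \<iota> k = w \<cdot> \<iota> k"
        using assoc[OF \<iota> s w(1), of k] assoc[OF u \<iota> w(1), of k] s\<iota> w(2) vu by simp
    qed
    then have "w \<cdot> d = hzero C Y Z" using compd0[OF w(1)] by simp
    then obtain v' where v': "ar v' R Z" "v' \<cdot> j0 = w" using tri_extend[OF t w(1)] by blast
    have "v' \<cdot> j 0 = v 0" using assoc[OF \<iota> a(2) v'(1), of 0] v'(2) w(2) by (simp add: j_def)
    then show ?thesis using v' by blast
  qed
  show ?thesis
    by (rule that[of j R]) (fact j, fact ju, fact factor, fact kernel, fact extend)
qed

end

section \<open>The t-structure orthogonal to a weight structure\<close>

text \<open>The parameter \<open>U\<close> makes \<open>'u\<close>, the type by which smallness is measured, a part of the locale.\<close>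

locale weight_setup = triangulated_category R C
  for R :: "('r, 'k) ring_scheme" and C :: "('o, 'm, 'r, 'z) tcat_scheme" (structure) +
  fixes U :: "'u itself" and C0 :: "'o set" and w :: "'o set \<times> 'o set"
  assumes univ: "size_universe TYPE('u)"
    and smash: "smashing TYPE('u) C"
    and C0_tri: "tri_subcat C C0"
    and C0_small: "essentially_small TYPE('u) (full_sub C C0)"
    and small_homs: "small_homs_from TYPE('u) C C0"
    and C0_compact: "C0 \<subseteq> compact_objects TYPE('u) C"
    and C0_gen: "generates TYPE('u) C C0"
    and ws: "weight_structure (full_sub C C0) w"
begin

text \<open>The classes of weight at most \<open>i\<close> and at least \<open>i\<close>, and their orthogonals. The latter are going to be
  \<open>C\<^bsub>t\<le>i\<^esub>\<close> and \<open>C\<^bsub>t\<ge>i\<^esub>\<close> for the orthogonal t-structure.\<close>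

definition wle :: "int \<Rightarrow> 'o set" where "wle i = shift C i ` fst w"
definition wge :: "int \<Rightarrow> 'o set" where "wge i = shift C i ` snd w"
definition tle :: "int \<Rightarrow> 'o set" where "tle i = {Y \<in> Obj C. \<forall>P \<in> wge (i + 1). orth C P Y}"
definition tge :: "int \<Rightarrow> 'o set" where "tge i = {Y \<in> Obj C. \<forall>P \<in> wle (i - 1). orth C P Y}"

lemma C0_Obj: "X \<in> C0 \<Longrightarrow> X \<in> Obj C" using tri_subcatD(1)[OF C0_tri] by blast

lemma C0_shift: "X \<in> C0 \<Longrightarrow> shift C i X \<in> C0" using tri_subcat_shift[OF C0_tri] by blast

lemma C0_Si: "X \<in> C0 \<Longrightarrow> Si X \<in> C0" using tri_subcatD(5)[OF C0_tri] by blast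
lemma C0_Sh: "X \<in> C0 \<Longrightarrow> Sh C X \<in> C0" using tri_subcatD(4)[OF C0_tri] by blast

lemma shift_C0: "X \<in> C0 \<Longrightarrow> shift (full_sub C C0) i X = shift C i X"
  using shift_full_sub[OF C0_tri] by blast

lemma w_C0: "fst w \<subseteq> C0" "snd w \<subseteq> C0"
  using ws by (simp_all add: weight_structure_def)

lemma w_Obj: "fst w \<subseteq> Obj C" "snd w \<subseteq> Obj C" using w_C0 C0_Obj by auto

lemma shift_w: "shift (full_sub C C0) i ` fst w = shift C i ` fst w"
  "shift (full_sub C C0) i ` snd w = shift C i ` snd w"
  by (rule image_cong[OF refl shift_C0], use w_C0 in blast)+

lemma wle_iff: "X \<in> wle i \<longleftrightarrow> X \<in> Obj C \<and> shift C (- i) X \<in> fst w"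
  and wge_iff: "X \<in> wge i \<longleftrightarrow> X \<in> Obj C \<and> shift C (- i) X \<in> snd w"
  unfolding wle_def wge_def by (simp_all add: shift_image w_Obj)

lemma wle_0: "wle 0 = fst w" and wge_0: "wge 0 = snd w"
  by (simp_all add: wle_def wge_def)

lemma wle_C0: "X \<in> wle i \<Longrightarrow> X \<in> C0" and wge_C0: "X \<in> wge i \<Longrightarrow> X \<in> C0"
  unfolding wle_def wge_def using w_C0 C0_shift by auto

lemma wle_Obj: "X \<in> wle i \<Longrightarrow> X \<in> Obj C" and wge_Obj: "X \<in> wge i \<Longrightarrow> X \<in> Obj C"
  using wle_C0 wge_C0 C0_Obj by auto

lemma wle_shift: "X \<in> wle i \<Longrightarrow> shift C j X \<in> wle (i + j)"
  and wge_shift: "X \<in> wge i \<Longrightarrow> shift C j X \<in> wge (i + j)"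
  unfolding wle_iff wge_iff by (auto simp: shift_Obj simp flip: shift_add)

lemma wle_Suc: "X \<in> wle i \<Longrightarrow> X \<in> wle (i + 1)"
proof -
  assume X: "X \<in> wle i"
  have "fst w \<subseteq> shift (full_sub C C0) 1 ` fst w" using ws by (simp add: weight_structure_def)
  also have "\<dots> = shift C 1 ` fst w" using shift_w by blast
  finally have "shift C (- i) X \<in> shift C 1 ` fst w" using X by (auto simp: wle_iff)
  then have "shift C (- 1) (shift C (- i) X) \<in> fst w" using shift_image[OF w_Obj(1)] by blast
  moreover have "shift C (- 1) (shift C (- i) X) = shift C (- (i + 1)) X"
  proof -
    have "- (i + 1) = - 1 + - i" by simp
    then show ?thesis using X shift_add[of X "- 1" "- i"] by (metis wle_iff)
  qed
  ultimately show "X \<in> wle (i + 1)" using X by (simp add: wle_iff)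
qed

lemma wge_Suc: "X \<in> wge (i + 1) \<Longrightarrow> X \<in> wge i"
proof -
  assume X: "X \<in> wge (i + 1)"
  have XO: "X \<in> Obj C" and 1: "shift C (- (i + 1)) X \<in> snd w" using X by (auto simp: wge_iff)
  have "shift (full_sub C C0) 1 ` snd w \<subseteq> snd w" using ws by (simp add: weight_structure_def)
  then have "shift C 1 (shift C (- (i + 1)) X) \<in> snd w" using 1 unfolding shift_w by blast
  then show "X \<in> wge i" using XO by (simp add: wge_iff flip: shift_add)
qed

lemma wle_mono: "i \<le> j \<Longrightarrow> X \<in> wle i \<Longrightarrow> X \<in> wle j"
  by (induction j rule: int_ge_induct) (auto intro: wle_Suc)

lemma wge_mono: "i \<le> j \<Longrightarrow> X \<in> wge j \<Longrightarrow> X \<in> wge i"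
  by (induction j rule: int_ge_induct) (auto intro: wge_Suc)

lemma w_orth: assumes A: "A \<in> wle i" and B: "B \<in> wge j" and ij: "i < j" shows "orth C A B"
proof -
  have B1: "B \<in> wge (i + 1)" using wge_mono[OF _ B] ij by simp
  have "class_orth C (fst w) (shift (full_sub C C0) 1 ` snd w)"
    using ws by (simp add: weight_structure_def class_orth_def)
  moreover have "shift (full_sub C C0) 1 ` snd w = shift C 1 ` snd w" by (rule shift_w)
  moreover have "shift C (- i) B \<in> shift C 1 ` snd w"
    using wge_shift[OF B1, of "- i"] by (simp add: wge_def)
  moreover have "shift C (- i) A \<in> fst w" using A by (simp add: wle_iff)
  ultimately have "orth C (shift C (- i) A) (shift C (- i) B)" unfolding class_orth_def by metis
  then show ?thesis using orth_shift A B wle_Obj wge_Obj by blast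
qed

lemma w_dec: assumes M: "M \<in> C0"
  shows "\<exists>A \<in> wle i. \<exists>B \<in> wge (i + 1). \<exists>f g h. dist_tri C A M B f g h"
proof -
  have "\<forall>M\<in>C0. \<exists>L\<in>fst w. \<exists>R'\<in>shift (full_sub C C0) 1 ` snd w. \<exists>f g h. dist_tri (full_sub C C0) L M R' f g h"
    using ws by (simp add: weight_structure_def)
  then obtain L R' f g h where L: "L \<in> fst w" and R': "R' \<in> shift (full_sub C C0) 1 ` snd w"
    and t: "dist_tri (full_sub C C0) L (shift C (- i) M) R' f g h" using C0_shift[OF M] by meson
  have "shift (full_sub C C0) 1 ` snd w = shift C 1 ` snd w" by (rule shift_w)
  then have R'': "R' \<in> wge 1" using R' by (simp add: wge_def)
  have L': "L \<in> wle 0" using L by (simp add: wle_0)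
  have "dist_tri C L (shift C (- i) M) R' f g h"
    using tri_full_subD[OF _ t] C0_Obj by blast
  then obtain f g h where "dist_tri C (shift C i L) (shift C i (shift C (- i) M)) (shift C i R') f g h"
    using tri_shift by blast
  then have "dist_tri C (shift C i L) M (shift C i R') f g h" using shift_cancel(1) M C0_Obj by simp
  moreover have "shift C i L \<in> wle i" using wle_shift[OF L', of i] by simp
  moreover have "shift C i R' \<in> wge (i + 1)" using wge_shift[OF R'', of i] by (simp add: add.commute)
  ultimately show ?thesis by blast
qed

text \<open>As the part of weight at most \<open>i - 1\<close> has no arrows to \<open>M\<close>, the decomposition triangle of \<open>M\<close> splits,
  and \<open>M\<close> is a retract of its part of weight at least \<open>i\<close>.\<close>

lemma wgeI: assumes M: "M \<in> C0" and o: "\<And>A. A \<in> wle (i - 1) \<Longrightarrow> orth C A M" shows "M \<in> wge i"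
proof -
  note MO = C0_Obj[OF M]
  define N where "N = shift C (- i) M"
  have N: "N \<in> C0" "N \<in> Obj C" unfolding N_def using C0_shift M C0_Obj by auto
  obtain A B f g h where A: "A \<in> wle (0 - 1)" and B: "B \<in> wge 0" and t: "dist_tri C A N B f g h"
    using w_dec[OF N(1), of "- 1"] by auto
  have "shift C i A \<in> wle (i - 1)" using wle_shift[OF A, of i] by simp
  then have "orth C A N" unfolding N_def using o orth_shift_left[of A M i] wle_Obj[OF A] MO by simp
  then have "Idn C N \<cdot> f = hzero C A N"
    using orthD ar_Cmp[OF tri_ar(1)[OF t] ar_Idn[OF N(2)]] by blast
  then obtain p where p: "ar p B N" "p \<cdot> g = Idn C N" using tri_extend[OF t ar_Idn[OF N(2)]] by blast
  have "retract_closed (full_sub C C0) (snd w)" using ws by (simp add: weight_structure_def)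
  then have "N \<in> snd w" unfolding retract_closed_def
    using B N p tri_ar(2)[OF t] unfolding ar_def by (simp add: wge_0) blast
  then show ?thesis using MO by (simp add: wge_iff N_def)
qed

lemma wleI: assumes M: "M \<in> C0" and o: "\<And>B. B \<in> wge (i + 1) \<Longrightarrow> orth C M B" shows "M \<in> wle i"
proof -
  note MO = C0_Obj[OF M]
  define N where "N = shift C (- i) M"
  have N: "N \<in> C0" "N \<in> Obj C" unfolding N_def using C0_shift M C0_Obj by auto
  obtain A B f g h where A: "A \<in> wle 0" and B: "B \<in> wge (0 + 1)" and t: "dist_tri C A N B f g h"
    using w_dec[OF N(1), of 0] by auto
  have "shift C i B \<in> wge (i + 1)" using wge_shift[OF B, of i] by (simp add: add.commute)
  then have "orth C N B" unfolding N_def using o orth_shift_left[of M B "- i"] wge_Obj[OF B] MO by simp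
  then have "g \<cdot> Idn C N = hzero C N B"
    using orthD ar_Cmp[OF ar_Idn[OF N(2)] tri_ar(2)[OF t]] by blast
  then obtain p where p: "ar p N A" "f \<cdot> p = Idn C N" using tri_lift[OF t ar_Idn[OF N(2)]] by blast
  have "retract_closed (full_sub C C0) (fst w)" using ws by (simp add: weight_structure_def)
  then have "N \<in> fst w" unfolding retract_closed_def
    using A N p tri_ar(1)[OF t] unfolding ar_def by (simp add: wle_0) blast
  then show ?thesis using MO by (simp add: wle_iff N_def)
qed

lemma wge_iso: "X \<in> wge i \<Longrightarrow> Y \<in> C0 \<Longrightarrow> isomorphic C X Y \<Longrightarrow> Y \<in> wge i"
proof (rule wgeI)
  fix A assume X: "X \<in> wge i" and Y: "Y \<in> C0" and i: "isomorphic C X Y" and A: "A \<in> wle (i - 1)"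
  have "orth C A X" using w_orth[OF A X] by simp
  then show "orth C A Y" using orth_iso(2)[OF i wge_Obj[OF X] C0_Obj[OF Y] wle_Obj[OF A]] by simp
qed

lemma wle_iso: "X \<in> wle i \<Longrightarrow> Y \<in> C0 \<Longrightarrow> isomorphic C X Y \<Longrightarrow> Y \<in> wle i"
proof (rule wleI)
  fix B assume X: "X \<in> wle i" and Y: "Y \<in> C0" and i: "isomorphic C X Y" and B: "B \<in> wge (i + 1)"
  have "orth C X B" using w_orth[OF X B] by simp
  then show "orth C Y B" using orth_iso(1)[OF i wle_Obj[OF X] C0_Obj[OF Y] wge_Obj[OF B]] by simp
qed

lemma tle_Obj: "Y \<in> tle i \<Longrightarrow> Y \<in> Obj C" and tge_Obj: "Y \<in> tge i \<Longrightarrow> Y \<in> Obj C"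
  by (simp_all add: tle_def tge_def)

lemma tle_orth: "Y \<in> tle i \<Longrightarrow> P \<in> wge j \<Longrightarrow> i < j \<Longrightarrow> orth C P Y"
  using wge_mono[of "i + 1" j P] by (simp add: tle_def)

lemma tge_orth: "Y \<in> tge i \<Longrightarrow> P \<in> wle j \<Longrightarrow> j < i \<Longrightarrow> orth C P Y"
  using wle_mono[of j "i - 1" P] by (simp add: tge_def)

lemma tle_mono: "i \<le> j \<Longrightarrow> Y \<in> tle i \<Longrightarrow> Y \<in> tle j"
  using tle_orth[of Y i] tle_def[of j] tle_Obj[of Y i] by simp

lemma tge_mono: "i \<le> j \<Longrightarrow> Y \<in> tge j \<Longrightarrow> Y \<in> tge i"
  using tge_orth[of Y j] tge_def[of i] tge_Obj[of Y j] by simp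

lemma tle_shift: assumes Y: "Y \<in> tle i" shows "shift C j Y \<in> tle (i + j)"
proof -
  note YO = tle_Obj[OF Y]
  have "orth C P (shift C j Y)" if P: "P \<in> wge (i + j + 1)" for P
  proof -
    have "shift C (- j) P \<in> wge (i + 1)" using wge_shift[OF P, of "- j"] by (simp add: algebra_simps)
    then have "orth C (shift C (- j) P) Y" using Y by (simp add: tle_def)
    then show ?thesis using orth_shift_left[of P Y "- j"] wge_Obj[OF P] YO by simp
  qed
  then show ?thesis using shift_Obj[OF YO] by (simp add: tle_def)
qed

lemma tge_shift: assumes Y: "Y \<in> tge i" shows "shift C j Y \<in> tge (i + j)"
proof -
  note YO = tge_Obj[OF Y]
  have "orth C P (shift C j Y)" if P: "P \<in> wle (i + j - 1)" for P
  proof -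
    have "shift C (- j) P \<in> wle (i - 1)" using wle_shift[OF P, of "- j"] by (simp add: algebra_simps)
    then have "orth C (shift C (- j) P) Y" using Y by (simp add: tge_def)
    then show ?thesis using orth_shift_left[of P Y "- j"] wle_Obj[OF P] YO by simp
  qed
  then show ?thesis using shift_Obj[OF YO] by (simp add: tge_def)
qed

lemma tge_Sh: "Y \<in> tge i \<Longrightarrow> Sh C Y \<in> tge (i + 1)" and tle_Sh: "Y \<in> tle i \<Longrightarrow> Sh C Y \<in> tle (i + 1)"
  and tge_Si: "Y \<in> tge i \<Longrightarrow> Si Y \<in> tge (i - 1)" and tle_Si: "Y \<in> tle i \<Longrightarrow> Si Y \<in> tle (i - 1)"
  using tge_shift[of Y i 1] tle_shift[of Y i 1] tge_shift[of Y i "- 1"] tle_shift[of Y i "- 1"]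
  by (simp_all add: shift_1 shift_m1)

lemma tge_ext: "dist_tri C X Y Z f g h \<Longrightarrow> X \<in> tge i \<Longrightarrow> Z \<in> tge i \<Longrightarrow> Y \<in> tge i"
  unfolding tge_def using orth_mid[of X Y Z f g h] wle_Obj by (simp add: dist_tri_def)

lemma tge_cone: "dist_tri C X Y Z f g h \<Longrightarrow> Y \<in> tge i \<Longrightarrow> X \<in> tge (i - 1) \<Longrightarrow> Z \<in> tge i"
  using tge_ext[OF rotate, of X Y Z f g h i] tge_Sh[of X "i - 1"] by simp

lemma wge_tge: "P \<in> wge i \<Longrightarrow> P \<in> tge i"
  using w_orth wge_Obj by (simp add: tge_def)

lemma tge_iso: "X \<in> tge i \<Longrightarrow> Y \<in> Obj C \<Longrightarrow> isomorphic C X Y \<Longrightarrow> Y \<in> tge i"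
  unfolding tge_def using orth_iso(2) wle_Obj by blast

lemma tle_iso: "X \<in> tle i \<Longrightarrow> Y \<in> Obj C \<Longrightarrow> isomorphic C X Y \<Longrightarrow> Y \<in> tle i"
  unfolding tle_def using orth_iso(2) wge_Obj by blast

lemma orth_compact_coproduct:
  assumes M: "M \<in> C0" and I: "small TYPE('u) (I :: 'i set)" and c: "is_coproduct C I X Y \<iota>"
    and o: "\<And>i. i \<in> I \<Longrightarrow> orth C M (X i)"
  shows "orth C M Y"
proof (rule orthI)
  show MO: "M \<in> Obj C" by (rule C0_Obj[OF M])
  show YO: "Y \<in> Obj C" using c by (simp add: is_coproduct_def)
  fix f assume f: "ar f M Y"
  show "f = hzero C M Y"
  proof (rule compact_induct[OF _ I c f, of "\<lambda>f. f = hzero C M Y"])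
    show "M \<in> compact_objects TYPE('u) C" using M C0_compact by blast
    show "hadd C g h = hzero C M Y" if "ar g M Y" "g = hzero C M Y" "h = hzero C M Y" for g h
      using that add_zero by simp
    show "\<iota> i \<cdot> u = hzero C M Y" if "i \<in> I" "ar u M (X i)" for i u
      using orthD[OF o[OF that(1)] that(2)] cmp_zero_right[OF coproduct_ar[OF c that(1)] MO] by simp
  qed simp
qed

lemma tge_coproduct:
  assumes "small TYPE('u) (I :: 'i set)" "is_coproduct C I X Y \<iota>" "\<And>j. j \<in> I \<Longrightarrow> X j \<in> tge i"
  shows "Y \<in> tge i"
  using orth_compact_coproduct[OF wle_C0 assms(1,2)] assms(2,3)
  by (auto simp: tge_def is_coproduct_def)

text \<open>The objects without arrows to any shift of \<open>N\<close> form a triangulated subcategory that is closed under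
  coproducts. It contains \<open>C0\<close>, so it contains \<open>N\<close>.\<close>

lemma C0_perp_zero:
  assumes N: "N \<in> Obj C" and o: "\<And>M. M \<in> C0 \<Longrightarrow> orth C M N"
  shows "is_zero_object C N"
proof (rule zero_objectI[OF N])
  define D where "D = {X \<in> Obj C. \<forall>i. orth C X (shift C i N)}"
  note sN = shift_Obj[OF N]
  have "tri_subcat C D"
  proof (rule tri_subcatI)
    show "D \<noteq> {}" using zero_object_exists zero_orth(2) sN by (auto simp: D_def is_zero_object_def)
    show "iso_closed C D" unfolding iso_closed_def D_def using orth_iso(1) sN by blast
    show "Sh C X \<in> D" if "X \<in> D" for X
    proof -
      have "orth C (Sh C X) (shift C i N)" for i
        using that orth_Sh[of X "shift C (i - 1) N"] sN Sh_shift[OF N, of "i - 1"] by (simp add: D_def)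
      then show ?thesis using that Sh_Obj by (simp add: D_def)
    qed
    show "Si X \<in> D" if "X \<in> D" for X
    proof -
      have "orth C (Si X) (shift C i N)" for i
        using that orth_Si[of X "shift C i N"] sN Sh_shift[OF N, of i] by (simp add: D_def)
      then show ?thesis using that Si by (simp add: D_def)
    qed
    show "Z \<in> D" if t: "dist_tri C X Y Z f g h" and X: "X \<in> D" and Y: "Y \<in> D" for X Y Z f g h
    proof -
      have "orth C (Sh C X) (shift C i N)" for i
        using X orth_Sh[of X "shift C (i - 1) N"] sN Sh_shift[OF N, of "i - 1"] by (simp add: D_def)
      then show ?thesis using orth_cone'[OF t] Y sN t by (simp add: D_def dist_tri_def)
    qed
  qed (auto simp: D_def)
  moreover have "C0 \<subseteq> D"
    using o orth_shift_left[of _ N "- i" for i] C0_shift C0_Obj N by (auto simp: D_def) (metis minus_minus)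
  moreover have "coproduct_closed TYPE('u) C D"
    unfolding coproduct_closed_def
  proof (intro allI impI, elim conjE)
    fix I :: "'u set" and X Y \<iota> assume X: "X \<in> I \<rightarrow> D" and c: "is_coproduct C I X Y \<iota>"
    have "orth C Y (shift C i N)" for i
      by (rule orth_coproduct[OF c _ sN]) (use X in \<open>auto simp: D_def\<close>)
    then show "Y \<in> D" using c by (simp add: D_def is_coproduct_def)
  qed
  ultimately have "Obj C \<subseteq> D" using C0_gen unfolding generates_def by blast
  then have "orth C N (shift C 0 N)" using N unfolding D_def by blast
  then show "orth C N N" by simp
qed

lemma C0_skeleton: "\<exists>S \<subseteq> C0. small TYPE('u) S \<and> (\<forall>X \<in> C0. \<exists>Y \<in> S. isomorphic C X Y)"
  using C0_small unfolding essentially_small_def by simp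

lemma small_hom: "M \<in> C0 \<Longrightarrow> N \<in> Obj C \<Longrightarrow> small TYPE('u) (Hom C M N)"
  using small_homs unfolding small_homs_from_def by blast

text \<open>There is one summand \<open>P\<close> for each arrow \<open>x\<close> to \<open>N\<close> from an object \<open>P\<close> of a small skeleton of \<open>\<P>\<close>. This is
  a small family because \<open>\<kappa>\<close> is regular.\<close>

lemma cover:
  assumes \<P>: "\<P> \<subseteq> C0" "\<And>X Y. X \<in> \<P> \<Longrightarrow> Y \<in> C0 \<Longrightarrow> isomorphic C X Y \<Longrightarrow> Y \<in> \<P>"
    and N: "N \<in> Obj C"
  shows "\<exists>(I :: ('o \<times> 'm) set) G \<iota> \<epsilon>. small TYPE('u) I \<and> (\<forall>P x. (P, x) \<in> I \<longrightarrow> P \<in> \<P> \<and> ar x P N) \<and>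
    is_coproduct C I fst G \<iota> \<and> ar \<epsilon> G N \<and> (\<forall>P x. (P, x) \<in> I \<longrightarrow> \<epsilon> \<cdot> \<iota> (P, x) = x) \<and>
    (\<forall>Q \<in> \<P>. \<forall>q. ar q Q N \<longrightarrow> (\<exists>P x e. (P, x) \<in> I \<and> ar e Q P \<and> q = x \<cdot> e)) \<and>
    (\<forall>Q \<in> \<P>. \<forall>q. ar q Q N \<longrightarrow> (\<exists>q'. ar q' Q G \<and> \<epsilon> \<cdot> q' = q))"
proof -
  obtain S where S: "S \<subseteq> C0" "small TYPE('u) S" "\<forall>X \<in> C0. \<exists>Y \<in> S. isomorphic C X Y"
    using C0_skeleton by blast
  define I where "I = Sigma (S \<inter> \<P>) (\<lambda>P. Hom C P N)"
  have I: "small TYPE('u) I" unfolding I_def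
    by (rule small_Sigma[OF univ small_subset[OF S(2)]]) (use small_hom N S(1) in auto)
  have mem: "P \<in> \<P> \<and> ar x P N" if "(P, x) \<in> I" for P x
    using that \<P>(1) C0_Obj N by (auto simp: I_def ar_def)
  have "fst i \<in> Obj C" if "i \<in> I" for i
    using mem[of "fst i" "snd i"] that arD(1) by simp blast
  then have "fst \<in> I \<rightarrow> Obj C" by blast
  then obtain G \<iota> where c: "is_coproduct C I fst G \<iota>" using smashing_coproduct[OF smash I] by blast
  obtain \<epsilon> where \<epsilon>: "ar \<epsilon> G N" "\<And>i. i \<in> I \<Longrightarrow> \<epsilon> \<cdot> \<iota> i = snd i"
    using coproduct_map[OF c N, of snd] mem by (metis prod.collapse)
  have 1: "\<exists>P x e. (P, x) \<in> I \<and> ar e Q P \<and> q = x \<cdot> e" if Q: "Q \<in> \<P>" and q: "ar q Q N" for Q q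
  proof -
    obtain P where P: "P \<in> S" "isomorphic C Q P" using S(3) Q \<P>(1) by blast
    have PP: "P \<in> \<P>" using \<P>(2)[OF Q _ P(2)] P(1) S(1) by blast
    have O: "P \<in> Obj C" "Q \<in> Obj C" using P(1) S(1) C0_Obj Q \<P>(1) by auto
    obtain e e' where e: "ar e Q P" "ar e' P Q" "e' \<cdot> e = Idn C Q"
      using P(2) is_iso_ar[OF _ O(2,1)] unfolding isomorphic_def by blast
    have "(P, q \<cdot> e') \<in> I" using P PP ar_Cmp[OF e(2) q] arD by (auto simp: I_def)
    moreover have "q = (q \<cdot> e') \<cdot> e" using assoc[OF e(1,2) q] e(3) idr[OF q] by simp
    ultimately show ?thesis using e(1) by blast
  qed
  have 2: "\<exists>q'. ar q' Q G \<and> \<epsilon> \<cdot> q' = q" if Q: "Q \<in> \<P>" and q: "ar q Q N" for Q q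
  proof -
    obtain P x e where e: "(P, x) \<in> I" "ar e Q P" "q = x \<cdot> e" using 1[OF Q q] by blast
    have i: "ar (\<iota> (P, x)) P G" using coproduct_ar[OF c e(1)] by simp
    have "\<epsilon> \<cdot> (\<iota> (P, x) \<cdot> e) = q" using assoc[OF e(2) i \<epsilon>(1)] \<epsilon>(2)[OF e(1)] e(3) by simp
    then show ?thesis using ar_Cmp[OF e(2) i] by blast
  qed
  show ?thesis using I mem c \<epsilon> 1 2
    by (intro exI[of _ I] exI[of _ G] exI[of _ \<iota>] exI[of _ \<epsilon>]) auto
qed

text \<open>The object \<open>X'\<close> is the cone of a cover \<open>G\<close> of \<open>X\<close> by objects of weight at least \<open>i\<close>. Objects of weight
  at most \<open>i - 1\<close> have no arrows to \<open>G\<close>, those of weight at most \<open>i\<close> have none to its shift, and \<open>G\<close> has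
  none to \<open>tle (i - 1)\<close>. The long exact sequences turn this into the other clauses.\<close>

lemma kill_maps:
  assumes X: "X \<in> Obj C"
  shows "\<exists>X' u. ar u X X' \<and> (\<forall>P \<in> wge i. \<forall>p. ar p P X \<longrightarrow> u \<cdot> p = hzero C P X') \<and>
    (\<forall>A \<in> wle (i - 1). \<forall>q. ar q A X \<longrightarrow> u \<cdot> q = hzero C A X' \<longrightarrow> q = hzero C A X) \<and>
    (\<forall>A \<in> wle i. \<forall>r. ar r A X' \<longrightarrow> (\<exists>q. ar q A X \<and> u \<cdot> q = r)) \<and>
    (\<forall>Y \<in> tle (i - 1). \<forall>v. ar v X Y \<longrightarrow> (\<exists>v'. ar v' X' Y \<and> v' \<cdot> u = v)) \<and>
    (X \<in> tge i \<longrightarrow> X' \<in> tge i)"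
proof -
  obtain I G \<iota> \<epsilon> where I: "small TYPE('u) (I :: ('o \<times> 'm) set)" and
    Iw: "\<And>P x. (P, x) \<in> I \<Longrightarrow> P \<in> wge i" and c: "is_coproduct C I fst G \<iota>" and \<epsilon>: "ar \<epsilon> G X"
    and cov: "\<And>Q q. Q \<in> wge i \<Longrightarrow> ar q Q X \<Longrightarrow> \<exists>q'. ar q' Q G \<and> \<epsilon> \<cdot> q' = q"
    using cover[of "wge i", OF _ _ X] wge_C0 wge_iso by (smt (verit, del_insts) subsetI)
  have G: "G \<in> tge i" by (rule tge_coproduct[OF I c]) (use Iw wge_tge in auto)
  have GO: "G \<in> Obj C" by (rule tge_Obj[OF G])
  obtain X' u \<delta> where t: "dist_tri C G X X' \<epsilon> u \<delta>" using TR1_cone[OF GO X arD(3)[OF \<epsilon>]] by blast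
  note a = tri_ar[OF t]
  have X'O: "X' \<in> Obj C" using a arD by blast
  have 1: "u \<cdot> p = hzero C P X'" if P: "P \<in> wge i" and p: "ar p P X" for P p
  proof -
    obtain q where q: "ar q P G" "\<epsilon> \<cdot> q = p" using cov[OF P p] by blast
    then have "u \<cdot> p = (u \<cdot> \<epsilon>) \<cdot> q" using assoc[OF q(1) a(1,2)] by simp
    then show ?thesis using tri_comp_zero[OF t] cmp_zero_left[OF q(1) X'O] by simp
  qed
  have 2: "q = hzero C A X" if A: "A \<in> wle (i - 1)" and q: "ar q A X" and z: "u \<cdot> q = hzero C A X'" for A q
  proof -
    obtain v where v: "ar v A G" "\<epsilon> \<cdot> v = q" using tri_lift[OF t q z] by blast
    have "orth C A G" using tge_orth[OF G A] by simp
    then show ?thesis using v orthD[OF _ v(1)] cmp_zero_right[OF a(1) wle_Obj[OF A]] by simp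
  qed
  have 3: "\<exists>q. ar q A X \<and> u \<cdot> q = r" if A: "A \<in> wle i" and r: "ar r A X'" for A r
  proof -
    have "orth C A (Sh C G)" using tge_orth[OF tge_Sh[OF G] A] by simp
    then show ?thesis using tri_lift2[OF t r] orthD ar_Cmp[OF r a(3)] by blast
  qed
  have 4: "\<exists>v'. ar v' X' Y \<and> v' \<cdot> u = v" if Y: "Y \<in> tle (i - 1)" and v: "ar v X Y" for Y v
  proof -
    have "orth C G Y"
    proof (rule orth_coproduct[OF c _ tle_Obj[OF Y]])
      fix k assume "k \<in> I"
      then show "orth C (fst k) Y" using tle_orth[OF Y Iw[of "fst k" "snd k"]] by simp
    qed
    then show ?thesis using tri_extend[OF t v] orthD ar_Cmp[OF a(1) v] by blast
  qed
  have 5: "X' \<in> tge i" if "X \<in> tge i" by (rule tge_cone[OF t that tge_mono[OF _ G]]) simp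
  show ?thesis using a(2) 1 2 3 4 5 by (intro exI[of _ X'] exI[of _ u]) auto
qed

text \<open>Iterating the preceding construction and passing to the homotopy colimit \<open>R\<close> kills all arrows from
  objects of weight at least \<open>i\<close>: by compactness such an arrow to \<open>R\<close> comes from a finite stage, and
  it dies at the next one. The other clauses hold at every stage and pass to the colimit.\<close>

lemma kill_maps_limit:
  assumes N: "N \<in> Obj C"
  shows "\<exists>R j. ar j N R \<and> R \<in> tle (i - 1) \<and>
    (\<forall>A \<in> wle (i - 1). \<forall>q. ar q A N \<longrightarrow> j \<cdot> q = hzero C A R \<longrightarrow> q = hzero C A N) \<and>
    (\<forall>A \<in> wle i. \<forall>r. ar r A R \<longrightarrow> (\<exists>q. ar q A N \<and> j \<cdot> q = r)) \<and>
    (\<forall>Y \<in> tle (i - 1). \<forall>v. ar v N Y \<longrightarrow> (\<exists>v'. ar v' R Y \<and> v' \<cdot> j = v)) \<and>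
    (N \<in> tge i \<longrightarrow> R \<in> tge i)"
proof -
  define good where "good = (\<lambda>X X' u. ar u X X' \<and> (\<forall>P \<in> wge i. \<forall>p. ar p P X \<longrightarrow> u \<cdot> p = hzero C P X') \<and>
    (\<forall>A \<in> wle (i - 1). \<forall>q. ar q A X \<longrightarrow> u \<cdot> q = hzero C A X' \<longrightarrow> q = hzero C A X) \<and>
    (\<forall>A \<in> wle i. \<forall>r. ar r A X' \<longrightarrow> (\<exists>q. ar q A X \<and> u \<cdot> q = r)) \<and>
    (\<forall>Y \<in> tle (i - 1). \<forall>v. ar v X Y \<longrightarrow> (\<exists>v'. ar v' X' Y \<and> v' \<cdot> u = v)) \<and>
    (X \<in> tge i \<longrightarrow> X' \<in> tge i))"
  have "\<forall>X\<in>Obj C. \<exists>p. good X (fst p) (snd p)" using kill_maps unfolding good_def by simp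
  then obtain p where p: "\<And>X. X \<in> Obj C \<Longrightarrow> good X (fst (p X)) (snd (p X))" by metis
  \<comment> \<open>the sequence obtained by iterating a choice of \<open>good\<close> arrows\<close>
  define X where "X = (\<lambda>k. ((\<lambda>X. fst (p X)) ^^ k) N)"
  define u where "u = (\<lambda>k. snd (p (X k)))"
  have X0: "X 0 = N" by (simp add: X_def)
  have XS: "X (Suc k) = fst (p (X k))" for k by (simp add: X_def)
  have XO: "X k \<in> Obj C" for k
  proof (induction k)
    case (Suc k) then show ?case using p[OF Suc] arD(2) unfolding XS good_def by blast
  qed (simp add: X0 N)
  have g: "good (X k) (X (Suc k)) (u k)" for k using p[OF XO] by (simp add: XS u_def)
  have u: "ar (u k) (X k) (X (Suc k))" for k using g by (simp add: good_def)
  show ?thesis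
  proof (rule hocolim[OF univ smash, of u X, OF u])
    fix j R assume j: "\<And>k. ar (j k) (X k) R" and ju: "\<And>k. j (Suc k) \<cdot> u k = j k"
      and fac: "\<And>P f. P \<in> compact_objects TYPE('u) C \<Longrightarrow> Si P \<in> compact_objects TYPE('u) C \<Longrightarrow> ar f P R \<Longrightarrow>
         \<exists>k g. ar g P (X k) \<and> f = j k \<cdot> g"
      and ker: "\<And>P g. P \<in> compact_objects TYPE('u) C \<Longrightarrow> ar g P (X 0) \<Longrightarrow> j 0 \<cdot> g = hzero C P R \<Longrightarrow>
         \<exists>y. y 0 = g \<and> (\<forall>k. ar (y k) P (X k) \<and> y (Suc k) = u k \<cdot> y k) \<and> (\<exists>k. y k = hzero C P (X k))"
      and ext: "\<And>Y v. (\<And>k. ar (v k) (X k) Y) \<Longrightarrow> (\<And>k. v (Suc k) \<cdot> u k = v k) \<Longrightarrow> \<exists>v'. ar v' R Y \<and> v' \<cdot> j 0 = v 0"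
    have RO: "R \<in> Obj C" using j arD by blast
    have fac0: "\<exists>k g. ar g P (X k) \<and> f = j k \<cdot> g" if "P \<in> C0" "ar f P R" for P f
      using fac that C0_compact C0_Si by blast
    have 1: "R \<in> tle (i - 1)"
    proof -
      have "orth C P R" if P: "P \<in> wge i" for P
      proof (rule orthI[OF wge_Obj[OF P] RO])
        fix f assume "ar f P R"
        then obtain k h where h: "ar h P (X k)" "f = j k \<cdot> h" using fac0[OF wge_C0[OF P]] by blast
        have "u k \<cdot> h = hzero C P (X (Suc k))" using g[of k] P h(1) unfolding good_def by blast
        then have "j (Suc k) \<cdot> (u k \<cdot> h) = hzero C P R" using cmp_zero_right[OF j wge_Obj[OF P]] by simp
        then show "f = hzero C P R" using assoc[OF h(1) u j] ju h(2) by simp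
      qed
      then show ?thesis using RO by (simp add: tle_def)
    qed
    have 2: "q = hzero C A N" if A: "A \<in> wle (i - 1)" and q: "ar q A N" and z: "j 0 \<cdot> q = hzero C A R" for A q
    proof -
      obtain y k where y: "y 0 = q" "\<And>k. ar (y k) A (X k)" "\<And>k. y (Suc k) = u k \<cdot> y k" "y k = hzero C A (X k)"
        using ker[OF subsetD[OF C0_compact wle_C0[OF A]], of q] q z unfolding X0 by blast
      have "y 0 = hzero C A (X 0)" using y(4)
      proof (induction k)
        case (Suc k)
        have "y k = hzero C A (X k)" using g[of k] A y(2)[of k] y(3)[of k] Suc(2) unfolding good_def by metis
        then show ?case by (rule Suc(1))
      qed
      then show ?thesis using y(1) X0 by simp
    qed
    have 3: "\<exists>q. ar q A N \<and> j 0 \<cdot> q = r" if A: "A \<in> wle i" and r: "ar r A R" for A r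
    proof -
      obtain k h where "ar h A (X k)" "r = j k \<cdot> h" using fac0[OF wle_C0[OF A] r] by blast
      then show ?thesis
      proof (induction k arbitrary: h)
        case (Suc k)
        obtain q where q: "ar q A (X k)" "u k \<cdot> q = h" using g[of k] A Suc(2) unfolding good_def by blast
        have "r = j k \<cdot> q" using Suc(3) q assoc[OF q(1) u j] ju by simp
        then show ?case using Suc(1)[OF q(1)] by blast
      qed (use X0 in auto)
    qed
    have 4: "\<exists>v'. ar v' R Y \<and> v' \<cdot> j 0 = v" if Y: "Y \<in> tle (i - 1)" and v: "ar v N Y" for Y v
    proof -
      have "\<exists>vs. \<forall>k. (ar (vs k) (X k) Y \<and> (k = 0 \<longrightarrow> vs k = v)) \<and> vs (Suc k) \<cdot> u k = vs k"
      proof (rule dependent_nat_choice)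
        show "\<exists>x. ar x (X 0) Y \<and> (0 = (0::nat) \<longrightarrow> x = v)" using v X0 by auto
        fix x k assume "ar x (X k) Y \<and> (k = 0 \<longrightarrow> x = v)"
        then show "\<exists>y. (ar y (X (Suc k)) Y \<and> (Suc k = 0 \<longrightarrow> y = v)) \<and> y \<cdot> u k = x"
          using g[of k] Y unfolding good_def by blast
      qed
      then obtain vs where vs: "\<And>k. ar (vs k) (X k) Y" "vs 0 = v" "\<And>k. vs (Suc k) \<cdot> u k = vs k" by blast
      show ?thesis using ext[of vs Y, OF vs(1,3)] vs(2) by simp
    qed
    have 5: "R \<in> tge i" if "N \<in> tge i"
    proof -
      have Xt: "X k \<in> tge i" for k
      proof (induction k)
        case (Suc k) then show ?case using g[of k] unfolding good_def by blast
      qed (simp add: X0 that)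
      have "orth C A R" if A: "A \<in> wle (i - 1)" for A
      proof (rule orthI[OF wle_Obj[OF A] RO])
        fix f assume "ar f A R"
        then obtain k h where h: "ar h A (X k)" "f = j k \<cdot> h" using fac0[OF wle_C0[OF A]] by blast
        then show "f = hzero C A R"
          using orthD[OF tge_orth[OF Xt A] h(1)] cmp_zero_right[OF j wle_Obj[OF A]] by simp
      qed
      then show ?thesis using RO by (simp add: tge_def)
    qed
    show ?thesis using j[of 0] 1 2 3 4 5 X0 by (intro exI[of _ R] exI[of _ "j 0"]) auto
  qed
qed

text \<open>The object \<open>L\<close> is the fibre of the arrow \<open>j\<close> from \<open>N\<close> to the colimit \<open>R\<close>. Objects of weight at most
  \<open>i - 1\<close> have no arrows to \<open>L\<close>, because on arrows from them \<open>j\<close> is injective, and on arrows from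
  their shifts it is surjective.\<close>

lemma t_dec:
  assumes N: "N \<in> Obj C"
  shows "\<exists>L \<in> tge i. \<exists>R \<in> tle (i - 1). \<exists>f g h. dist_tri C L N R f g h"
proof -
  obtain j R where j: "ar j N R" and R: "R \<in> tle (i - 1)"
    and inj: "\<And>A q. A \<in> wle (i - 1) \<Longrightarrow> ar q A N \<Longrightarrow> j \<cdot> q = hzero C A R \<Longrightarrow> q = hzero C A N"
    and sur: "\<And>A r. A \<in> wle i \<Longrightarrow> ar r A R \<Longrightarrow> (\<exists>q. ar q A N \<and> j \<cdot> q = r)"
    using kill_maps_limit[OF N, of i] by (elim exE conjE) blast
  have RO: "R \<in> Obj C" by (rule tle_Obj[OF R])
  obtain Z g h where "dist_tri C N R Z j g h" using TR1_cone[OF N RO arD(3)[OF j]] by blast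
  then obtain l where t: "dist_tri C (Si Z) N R l j g" using unrotate by blast
  define L where "L = Si Z"
  note t = t[folded L_def]
  note a = tri_ar[OF t]
  have LO: "L \<in> Obj C" using a arD by blast
  have "orth C A L" if A: "A \<in> wle (i - 1)" for A
  proof (rule orthI[OF wle_Obj[OF A] LO])
    note AO = wle_Obj[OF A]
    fix q assume q: "ar q A L"
    have "j \<cdot> (l \<cdot> q) = hzero C A R"
      using assoc[OF q a(1,2)] tri_comp_zero[OF t] cmp_zero_left[OF q RO] by simp
    then have "l \<cdot> q = hzero C A N" using inj[OF A ar_Cmp[OF q a(1)]] by blast
    then obtain r where r: "ar r (Sh C A) R" "g \<cdot> r = ShA C q" using Si_lift[OF t q] by blast
    have "Sh C A \<in> wle i" using wle_shift[OF A, of 1] by (simp add: shift_1)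
    then obtain r' where r': "ar r' (Sh C A) N" "j \<cdot> r' = r" using sur[OF _ r(1)] by blast
    have "ShA C q = hzero C (Sh C A) (Sh C L)"
      using r r' assoc[OF r'(1) a(2,3)] tri_comp_zero'[OF t] cmp_zero_left[OF r'(1) Sh_Obj[OF LO]] by simp
    then show "q = hzero C A L" using ShA_zero_iff[OF q] by simp
  qed
  then have "L \<in> tge i" using LO by (simp add: tge_def)
  then show ?thesis using R t by blast
qed

text \<open>If \<open>N\<close> lies in \<open>tge i\<close>, then so does the colimit \<open>R\<close>, which also lies in \<open>tle (i - 1)\<close>. By weight
  decompositions \<open>R\<close> is right orthogonal to \<open>C0\<close> and therefore zero. On the other hand, every arrow
  from \<open>N\<close> to \<open>Y\<close> extends to \<open>R\<close>.\<close>

lemma t_orth: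
  assumes N: "N \<in> tge i" and Y: "Y \<in> tle j" and ij: "j < i"
  shows "orth C N Y"
proof -
  note NO = tge_Obj[OF N] and YO = tle_Obj[OF Y]
  have Y': "Y \<in> tle (i - 1)" using tle_mono[OF _ Y] ij by simp
  obtain R f where f: "ar f N R" and R: "R \<in> tle (i - 1)" and R': "R \<in> tge i"
    and ext: "\<And>v. ar v N Y \<Longrightarrow> \<exists>v'. ar v' R Y \<and> v' \<cdot> f = v"
    using kill_maps_limit[OF NO, of i] N Y' by (elim exE conjE) blast
  have RO: "R \<in> Obj C" by (rule tle_Obj[OF R])
  have "orth C M R" if M: "M \<in> C0" for M
  proof -
    obtain A B f g h where A: "A \<in> wle (i - 1)" and B: "B \<in> wge i" and t: "dist_tri C A M B f g h"
      using w_dec[OF M, of "i - 1"] by auto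
    show ?thesis
      using orth_mid'[OF t] tge_orth[OF R' A] tle_orth[OF R B] RO by simp
  qed
  then have Z: "is_zero_object C R" by (rule C0_perp_zero[OF RO])
  show ?thesis
  proof (rule orthI[OF NO YO])
    fix v assume "ar v N Y"
    then obtain v' where v': "ar v' R Y" "v' \<cdot> f = v" using ext by blast
    then show "v = hzero C N Y" using zero_hom(2)[OF Z v'(1)] cmp_zero_left[OF f YO] by simp
  qed
qed

end

section \<open>Weak Serre subcategories of modules\<close>

lemma lin_mapD:
  assumes "f \<in> lin_map R M N"
  shows "x \<in> carrier M \<Longrightarrow> f x \<in> carrier N"
    "x \<in> carrier M \<Longrightarrow> y \<in> carrier M \<Longrightarrow> f (x \<oplus>\<^bsub>M\<^esub> y) = f x \<oplus>\<^bsub>N\<^esub> f y"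
    "r \<in> carrier R \<Longrightarrow> x \<in> carrier M \<Longrightarrow> f (r \<odot>\<^bsub>M\<^esub> x) = r \<odot>\<^bsub>N\<^esub> f x"
  using assms unfolding lin_map_def by auto

lemma lin_mapI:
  assumes "\<And>x. x \<in> carrier M \<Longrightarrow> f x \<in> carrier N"
    "\<And>x y. x \<in> carrier M \<Longrightarrow> y \<in> carrier M \<Longrightarrow> f (x \<oplus>\<^bsub>M\<^esub> y) = f x \<oplus>\<^bsub>N\<^esub> f y"
    "\<And>r x. r \<in> carrier R \<Longrightarrow> x \<in> carrier M \<Longrightarrow> f (r \<odot>\<^bsub>M\<^esub> x) = r \<odot>\<^bsub>N\<^esub> f x"
  shows "f \<in> lin_map R M N"
  using assms unfolding lin_map_def by auto

lemma module_closed: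
  assumes "module R M"
  shows "\<zero>\<^bsub>M\<^esub> \<in> carrier M" "x \<in> carrier M \<Longrightarrow> y \<in> carrier M \<Longrightarrow> x \<oplus>\<^bsub>M\<^esub> y \<in> carrier M"
    "r \<in> carrier R \<Longrightarrow> x \<in> carrier M \<Longrightarrow> r \<odot>\<^bsub>M\<^esub> x \<in> carrier M"
    "x \<in> carrier M \<Longrightarrow> \<ominus>\<^bsub>M\<^esub> x \<in> carrier M"
    "x \<in> carrier M \<Longrightarrow> x \<oplus>\<^bsub>M\<^esub> \<zero>\<^bsub>M\<^esub> = x"
proof -
  interpret module R M by fact
  show "\<zero>\<^bsub>M\<^esub> \<in> carrier M" "x \<in> carrier M \<Longrightarrow> y \<in> carrier M \<Longrightarrow> x \<oplus>\<^bsub>M\<^esub> y \<in> carrier M"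
    "r \<in> carrier R \<Longrightarrow> x \<in> carrier M \<Longrightarrow> r \<odot>\<^bsub>M\<^esub> x \<in> carrier M"
    "x \<in> carrier M \<Longrightarrow> \<ominus>\<^bsub>M\<^esub> x \<in> carrier M"
    "x \<in> carrier M \<Longrightarrow> x \<oplus>\<^bsub>M\<^esub> \<zero>\<^bsub>M\<^esub> = x" by auto
qed

lemma module_idem:
  assumes "module R M" "x \<in> carrier M" "x \<oplus>\<^bsub>M\<^esub> x = x" shows "x = \<zero>\<^bsub>M\<^esub>"
proof -
  interpret module R M by fact
  show ?thesis using assms(2,3) M.add.r_cancel_one[of x x] by simp
qed

lemma lin_map_zero:
  assumes "f \<in> lin_map R M N" "module R M" "module R N" shows "f \<zero>\<^bsub>M\<^esub> = \<zero>\<^bsub>N\<^esub>"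
  using module_idem[OF assms(3)] lin_mapD[OF assms(1)] module_closed[OF assms(2)] by metis

lemma lin_map_neg:
  assumes f: "f \<in> lin_map R M N" and M: "module R M" and N: "module R N" and x: "x \<in> carrier M"
  shows "f (\<ominus>\<^bsub>M\<^esub> x) = \<ominus>\<^bsub>N\<^esub> f x"
proof -
  interpret M: module R M by fact
  interpret N: module R N by fact
  have "f (\<ominus>\<^bsub>M\<^esub> x) \<oplus>\<^bsub>N\<^esub> f x = \<zero>\<^bsub>N\<^esub>"
    using lin_mapD(2)[OF f, of "\<ominus>\<^bsub>M\<^esub> x" x] x lin_map_zero[OF f M N] M.M.l_neg by simp
  then show ?thesis using N.M.minus_equality[of "f (\<ominus>\<^bsub>M\<^esub> x)" "f x"] lin_mapD(1)[OF f] x by simp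
qed

lemma lin_map_inj:
  assumes f: "f \<in> lin_map R M N" and M: "module R M" and N: "module R N"
    and k: "\<And>x. x \<in> carrier M \<Longrightarrow> f x = \<zero>\<^bsub>N\<^esub> \<Longrightarrow> x = \<zero>\<^bsub>M\<^esub>"
  shows "inj_on f (carrier M)"
proof (rule inj_onI)
  interpret M: module R M by fact
  interpret N: module R N by fact
  fix x y assume xy: "x \<in> carrier M" "y \<in> carrier M" "f x = f y"
  have "f (x \<oplus>\<^bsub>M\<^esub> \<ominus>\<^bsub>M\<^esub> y) = \<zero>\<^bsub>N\<^esub>"
    using xy lin_mapD[OF f] lin_map_neg[OF f M N] N.M.r_neg by simp
  then have "x \<oplus>\<^bsub>M\<^esub> \<ominus>\<^bsub>M\<^esub> y = \<zero>\<^bsub>M\<^esub>" using k xy by simp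
  then show "x = y" using xy M.M.minus_equality[of x "\<ominus>\<^bsub>M\<^esub> y"] M.M.minus_minus by simp
qed

lemma lin_map_comp: "f \<in> lin_map R M N \<Longrightarrow> g \<in> lin_map R N P \<Longrightarrow> (\<lambda>x. g (f x)) \<in> lin_map R M P"
  by (rule lin_mapI) (simp_all add: lin_mapD)

lemma mod_isoD: "f \<in> mod_iso R M N \<Longrightarrow> f \<in> lin_map R M N" "f \<in> mod_iso R M N \<Longrightarrow> bij_betw f (carrier M) (carrier N)"
  by (simp_all add: mod_iso_def)

lemma mod_isoI: "f \<in> lin_map R M N \<Longrightarrow> bij_betw f (carrier M) (carrier N) \<Longrightarrow> f \<in> mod_iso R M N"
  by (simp add: mod_iso_def)

lemma mod_iso_comp: "f \<in> mod_iso R M N \<Longrightarrow> g \<in> mod_iso R N P \<Longrightarrow> (\<lambda>x. g (f x)) \<in> mod_iso R M P"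
  using bij_betw_trans[of f "carrier M" "carrier N" g "carrier P"]
  by (auto simp: mod_iso_def lin_map_comp comp_def)

lemma mod_iso_inv:
  assumes f: "f \<in> mod_iso R M N" and M: "module R M"
  shows "inv_into (carrier M) f \<in> mod_iso R N M"
proof (rule mod_isoI)
  note b = mod_isoD(2)[OF f] and l = lin_mapD[OF mod_isoD(1)[OF f]]
  let ?g = "inv_into (carrier M) f"
  show "bij_betw ?g (carrier N) (carrier M)" using b by (rule bij_betw_inv_into)
  have fg: "f (?g y) = y" if "y \<in> carrier N" for y using b that by (rule bij_betw_inv_into_right)
  have gf: "?g (f x) = x" if "x \<in> carrier M" for x using b that by (rule bij_betw_inv_into_left)
  have gc: "?g y \<in> carrier M" if "y \<in> carrier N" for y
    using b that by (metis bij_betwE bij_betw_inv_into)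
  show "?g \<in> lin_map R N M"
  proof (rule lin_mapI)
    fix x y assume xy: "x \<in> carrier N" "y \<in> carrier N"
    have "x \<oplus>\<^bsub>N\<^esub> y = f (?g x \<oplus>\<^bsub>M\<^esub> ?g y)" using l(2)[OF gc gc] fg xy by simp
    then show "?g (x \<oplus>\<^bsub>N\<^esub> y) = ?g x \<oplus>\<^bsub>M\<^esub> ?g y"
      using gf module_closed(2)[OF M gc gc] xy by simp
  next
    fix r x assume rx: "r \<in> carrier R" "x \<in> carrier N"
    have "r \<odot>\<^bsub>N\<^esub> x = f (r \<odot>\<^bsub>M\<^esub> ?g x)" using l(3)[OF rx(1) gc] fg rx by simp
    then show "?g (r \<odot>\<^bsub>N\<^esub> x) = r \<odot>\<^bsub>M\<^esub> ?g x"
      using gf module_closed(3)[OF M rx(1) gc] rx by simp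
  qed (rule gc)
qed

lemma belongs_to_iso: "f \<in> mod_iso R M N \<Longrightarrow> belongs_to R N \<A> \<Longrightarrow> belongs_to R M \<A>"
  unfolding belongs_to_def using mod_iso_comp by blast

lemma belongs_to_iso': "f \<in> mod_iso R M N \<Longrightarrow> module R M \<Longrightarrow> belongs_to R M \<A> \<Longrightarrow> belongs_to R N \<A>"
  using belongs_to_iso mod_iso_inv by blast

lemma module_transfer:
  fixes R :: "('r, 'k) ring_scheme" and M :: "('r, 'a) module" and N :: "('r, 'b) module"
  assumes M: "module R M" and f: "bij_betw f (carrier M) (carrier N)"
    and add: "\<And>x y. x \<in> carrier M \<Longrightarrow> y \<in> carrier M \<Longrightarrow> f x \<oplus>\<^bsub>N\<^esub> f y = f (x \<oplus>\<^bsub>M\<^esub> y)"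
    and scale: "\<And>r x. r \<in> carrier R \<Longrightarrow> x \<in> carrier M \<Longrightarrow> r \<odot>\<^bsub>N\<^esub> f x = f (r \<odot>\<^bsub>M\<^esub> x)"
    and zero: "\<zero>\<^bsub>N\<^esub> = f \<zero>\<^bsub>M\<^esub>"
  shows "module R N"
proof -
  interpret M: module R M by fact
  have N: "carrier N = f ` carrier M" using f by (simp add: bij_betw_def)
  show ?thesis
  proof (rule moduleI)
    show "cring R" using M by (rule module.axioms(1))
    show "abelian_group N"
    proof (rule abelian_groupI)
      show "\<exists>y\<in>carrier N. y \<oplus>\<^bsub>N\<^esub> x = \<zero>\<^bsub>N\<^esub>" if "x \<in> carrier N" for x
      proof -
        have "x \<in> f ` carrier M" using that N by simp
        then obtain a where a: "x = f a" "a \<in> carrier M" by (rule imageE)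
        have "f (\<ominus>\<^bsub>M\<^esub> a) \<oplus>\<^bsub>N\<^esub> x = \<zero>\<^bsub>N\<^esub>" using a add[of "\<ominus>\<^bsub>M\<^esub> a" a] zero M.l_neg[OF a(2)] by simp
        then show ?thesis using a(2) N by (intro bexI[of _ "f (\<ominus>\<^bsub>M\<^esub> a)"]) simp_all
      qed
      show "x \<oplus>\<^bsub>N\<^esub> y = y \<oplus>\<^bsub>N\<^esub> x" if "x \<in> carrier N" "y \<in> carrier N" for x y
        using that unfolding N by (auto simp: add M.a_comm)
    qed (auto simp: N add zero M.a_assoc)
  qed (auto simp: N add scale M.smult_l_distr M.smult_r_distr M.smult_assoc1)
qed

lemma small_module_transfer:
  assumes M: "module R M" and s: "small TYPE('u) (carrier M)"
  shows "\<exists>N \<in> Obj (Rmod R :: (('r, 'u) module, _, 'r) lcat). mod_iso R M N \<noteq> {}"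
proof -
  obtain f :: "_ \<Rightarrow> 'u" where f: "inj_on f (carrier M)" using small_inj[OF s] by blast
  define g where "g = inv_into (carrier M) f"
  have g: "g (f x) = x" if "x \<in> carrier M" for x using f that by (simp add: g_def)
  define N :: "('r, 'u) module" where "N = \<lparr>carrier = f ` carrier M, mult = undefined, one = undefined,
     zero = f \<zero>\<^bsub>M\<^esub>, add = (\<lambda>x y. f (g x \<oplus>\<^bsub>M\<^esub> g y)), smult = (\<lambda>r x. f (r \<odot>\<^bsub>M\<^esub> g x))\<rparr>"
  have b: "bij_betw f (carrier M) (carrier N)" using f by (simp add: N_def bij_betw_def)
  have "module R N" by (rule module_transfer[OF M b]) (simp_all add: N_def g)
  moreover have "small TYPE('u) (carrier N)" using small_image[OF s] by (simp add: N_def)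
  moreover have "f \<in> mod_iso R M N"
    by (rule mod_isoI[OF lin_mapI b]) (simp_all add: N_def g)
  ultimately show ?thesis by (auto simp: Rmod_def)
qed

text \<open>Arrows of \<open>Rmod R\<close> have an extensional middle component. Restricting an arbitrary function allows
  composition and equality of arrows to be computed pointwise.\<close>

definition rarr where "rarr M f N = (M, restrict f (carrier M), N)"

lemma Rmod_simps:
  "M \<in> Obj (Rmod R) \<longleftrightarrow> module R M \<and> small TYPE('u) (carrier (M :: ('r, 'u) module))"
  "Idn (Rmod R) M = rarr M (\<lambda>x. x) M"
  "hzero (Rmod R) M N = rarr M (\<lambda>x. \<zero>\<^bsub>N\<^esub>) N"
  by (simp_all add: Rmod_def rarr_def)

lemma rarr_Hom: "f \<in> lin_map R M N \<Longrightarrow> module R M \<Longrightarrow> rarr M f N \<in> Hom (Rmod R) M N"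
proof -
  assume f: "f \<in> lin_map R M N" and M: "module R M"
  have "restrict f (carrier M) \<in> lin_map R M N"
    by (rule lin_mapI) (simp_all add: lin_mapD[OF f] module_closed[OF M])
  then show ?thesis by (simp add: Rmod_def rarr_def)
qed

lemma Rmod_HomE:
  assumes "a \<in> Hom (Rmod R) M N"
  obtains f where "f \<in> lin_map R M N" "a = rarr M f N"
proof -
  obtain f where "f \<in> lin_map R M N" "a = (M, f, N)" "f \<in> extensional (carrier M)"
    using assms by (auto simp: Rmod_def)
  then show ?thesis using that by (simp add: rarr_def extensional_restrict)
qed

lemma rarr_eq: "rarr M f N = rarr M g N \<longleftrightarrow> (\<forall>x \<in> carrier M. f x = g x)"
  unfolding rarr_def by (auto simp: fun_eq_iff restrict_def)

lemma mid_rarr: "x \<in> carrier M \<Longrightarrow> mid (rarr M f N) x = f x"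
  by (simp add: mid_def rarr_def)

lemma rarr_cmp: "(\<And>x. x \<in> carrier M \<Longrightarrow> f x \<in> carrier N) \<Longrightarrow>
    rarr N g P \<cdot>\<^bsub>Rmod R\<^esub> rarr M f N = rarr M (\<lambda>x. g (f x)) P"
  unfolding Rmod_def rarr_def by (auto simp: compose_def fun_eq_iff restrict_def)

lemma Rmod_category: "category (Rmod R :: (('r, 'u) module, _, 'r) lcat)"
proof
  fix X Y Z W :: "('r, 'u) module" and f g h
  assume O: "X \<in> Obj (Rmod R)" "Y \<in> Obj (Rmod R)"
  show "Idn (Rmod R) X \<in> Hom (Rmod R) X X"
    using O by (auto simp: Rmod_simps intro!: rarr_Hom lin_mapI)
  show "Idn (Rmod R) Y \<cdot>\<^bsub>Rmod R\<^esub> f = f" "f \<cdot>\<^bsub>Rmod R\<^esub> Idn (Rmod R) X = f" if f: "f \<in> Hom (Rmod R) X Y"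
    using f by (elim Rmod_HomE; simp add: Rmod_simps rarr_cmp lin_mapD)+
  assume f: "f \<in> Hom (Rmod R) X Y" and g: "g \<in> Hom (Rmod R) Y Z"
  then show "g \<cdot>\<^bsub>Rmod R\<^esub> f \<in> Hom (Rmod R) X Z"
    using O by (elim Rmod_HomE) (simp add: rarr_cmp lin_mapD rarr_Hom lin_map_comp Rmod_simps)
  assume h: "h \<in> Hom (Rmod R) Z W"
  from f g h show "h \<cdot>\<^bsub>Rmod R\<^esub> g \<cdot>\<^bsub>Rmod R\<^esub> f = h \<cdot>\<^bsub>Rmod R\<^esub> (g \<cdot>\<^bsub>Rmod R\<^esub> f)"
    by (elim Rmod_HomE) (simp add: rarr_cmp lin_mapD)
next
  fix X Y X' Y' :: "('r, 'u) module" and f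
  assume "f \<in> Hom (Rmod R) X Y" "f \<in> Hom (Rmod R) X' Y'"
  then show "X = X' \<and> Y = Y'" by (auto simp: Rmod_def)
qed

lemma submodule_module:
  fixes N :: "('r, 'u) module"
  assumes N: "module R N" and S: "S \<subseteq> carrier N" "\<zero>\<^bsub>N\<^esub> \<in> S"
    "\<And>x y. x \<in> S \<Longrightarrow> y \<in> S \<Longrightarrow> x \<oplus>\<^bsub>N\<^esub> y \<in> S" "\<And>r x. r \<in> carrier R \<Longrightarrow> x \<in> S \<Longrightarrow> r \<odot>\<^bsub>N\<^esub> x \<in> S"
    "\<And>x. x \<in> S \<Longrightarrow> \<ominus>\<^bsub>N\<^esub> x \<in> S"
  shows "module R (N\<lparr>carrier := S\<rparr>)"
proof -
  interpret N: module R N by fact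
  have c: "x \<in> carrier N" if "x \<in> S" for x using that S(1) by blast
  show ?thesis
  proof (rule moduleI)
    show "cring R" using N by (rule module.axioms(1))
    show "abelian_group (N\<lparr>carrier := S\<rparr>)"
    proof (rule abelian_groupI)
      show "\<exists>y\<in>carrier (N\<lparr>carrier := S\<rparr>). y \<oplus>\<^bsub>N\<lparr>carrier := S\<rparr>\<^esub> x = \<zero>\<^bsub>N\<lparr>carrier := S\<rparr>\<^esub>"
        if "x \<in> carrier (N\<lparr>carrier := S\<rparr>)" for x
        using that S(5)[of x] N.l_neg[OF c] by auto
      show "x \<oplus>\<^bsub>N\<lparr>carrier := S\<rparr>\<^esub> y = y \<oplus>\<^bsub>N\<lparr>carrier := S\<rparr>\<^esub> x"
        if "x \<in> carrier (N\<lparr>carrier := S\<rparr>)" "y \<in> carrier (N\<lparr>carrier := S\<rparr>)" for x y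
        using that c N.a_comm by simp
    qed (use S(2,3) c in \<open>auto simp: N.a_assoc\<close>)
  qed (use S(2-) c in \<open>auto simp: N.smult_l_distr N.smult_r_distr N.smult_assoc1\<close>)
qed

lemma Rmod_image_Obj:
  fixes N :: "('r, 'u) module"
  assumes N: "N \<in> Obj (Rmod R)" and f: "f \<in> lin_map R M N" and M: "module R M"
  shows "N\<lparr>carrier := f ` carrier M\<rparr> \<in> Obj (Rmod R)"
proof -
  have NM: "module R N" and Ns: "small TYPE('u) (carrier N)" using N by (auto simp: Rmod_simps)
  have "module R (N\<lparr>carrier := f ` carrier M\<rparr>)"
  proof (rule submodule_module[OF NM])
    show "\<zero>\<^bsub>N\<^esub> \<in> f ` carrier M"
      using lin_map_zero[OF f M NM] module_closed(1)[OF M] by (metis imageI)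
    show "x \<oplus>\<^bsub>N\<^esub> y \<in> f ` carrier M" if "x \<in> f ` carrier M" "y \<in> f ` carrier M" for x y
      using that lin_mapD(2)[OF f] module_closed(2)[OF M] by (auto simp: image_iff) metis
    show "r \<odot>\<^bsub>N\<^esub> x \<in> f ` carrier M" if "r \<in> carrier R" "x \<in> f ` carrier M" for r x
      using that lin_mapD(3)[OF f] module_closed(3)[OF M] by (auto simp: image_iff) metis
    show "\<ominus>\<^bsub>N\<^esub> x \<in> f ` carrier M" if "x \<in> f ` carrier M" for x
      using that lin_map_neg[OF f M NM] module_closed(4)[OF M] by (auto simp: image_iff) metis
  qed (use lin_mapD(1)[OF f] in auto)
  moreover have "small TYPE('u) (f ` carrier M)"
    by (rule small_subset[OF Ns]) (use lin_mapD(1)[OF f] in auto)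
  ultimately show ?thesis by (simp add: Rmod_simps)
qed

lemma Rmod_kernel_Obj:
  fixes N :: "('r, 'u) module"
  assumes N: "N \<in> Obj (Rmod R)" and g: "g \<in> lin_map R N P" and P: "module R P"
  shows "N\<lparr>carrier := {y \<in> carrier N. g y = \<zero>\<^bsub>P\<^esub>}\<rparr> \<in> Obj (Rmod R)"
proof -
  have NM: "module R N" and Ns: "small TYPE('u) (carrier N)" using N by (auto simp: Rmod_simps)
  interpret P: module R P by fact
  have "module R (N\<lparr>carrier := {y \<in> carrier N. g y = \<zero>\<^bsub>P\<^esub>}\<rparr>)"
    by (rule submodule_module[OF NM])
      (auto simp: lin_map_zero[OF g NM P] module_closed[OF NM] lin_mapD[OF g] lin_map_neg[OF g NM P]
        P.minus_zero P.smult_r_null)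
  moreover have "small TYPE('u) {y \<in> carrier N. g y = \<zero>\<^bsub>P\<^esub>}"
    by (rule small_subset[OF Ns]) auto
  ultimately show ?thesis by (simp add: Rmod_simps)
qed

lemma Rmod_kernel:
  fixes N P :: "('r, 'u) module"
  assumes N: "N \<in> Obj (Rmod R)" and P: "P \<in> Obj (Rmod R)" and g: "g \<in> lin_map R N P"
    and S: "S = {y \<in> carrier N. g y = \<zero>\<^bsub>P\<^esub>}"
  shows "is_kernel (Rmod R) N P (rarr N g P) (N\<lparr>carrier := S\<rparr>) (rarr (N\<lparr>carrier := S\<rparr>) (\<lambda>x. x) N)"
proof -
  let ?K = "N\<lparr>carrier := S\<rparr>"
  have mN: "module R N" and mP: "module R P" using N P by (auto simp: Rmod_simps)
  have K: "?K \<in> Obj (Rmod R)" unfolding S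
    by (rule Rmod_kernel_Obj[OF N g mP])
  then have mK: "module R ?K" by (simp add: Rmod_simps)
  have i: "rarr ?K (\<lambda>x. x) N \<in> Hom (Rmod R) ?K N"
    by (rule rarr_Hom[OF lin_mapI mK]) (auto simp: S)
  have ex: "\<exists>!v. v \<in> Hom (Rmod R) T ?K \<and> rarr ?K (\<lambda>x. x) N \<cdot>\<^bsub>Rmod R\<^esub> v = u"
    if T: "T \<in> Obj (Rmod R)" and u: "u \<in> Hom (Rmod R) T N"
      and z: "rarr N g P \<cdot>\<^bsub>Rmod R\<^esub> u = hzero (Rmod R) T P" for T u
  proof -
    have mT: "module R T" using T by (simp add: Rmod_simps)
    obtain f where f: "f \<in> lin_map R T N" "u = rarr T f N" using u by (rule Rmod_HomE)
    have "g (f x) = \<zero>\<^bsub>P\<^esub>" if "x \<in> carrier T" for x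
      using z that unfolding f(2) by (simp add: rarr_cmp lin_mapD[OF f(1)] Rmod_simps rarr_eq)
    then have fS: "f x \<in> S" if "x \<in> carrier T" for x using that lin_mapD(1)[OF f(1)] by (simp add: S)
    have fK: "f \<in> lin_map R T ?K"
      by (rule lin_mapI) (simp_all add: fS lin_mapD[OF f(1)])
    show ?thesis
    proof (rule ex1I[of _ "rarr T f ?K"])
      show "rarr T f ?K \<in> Hom (Rmod R) T ?K \<and> rarr ?K (\<lambda>x. x) N \<cdot>\<^bsub>Rmod R\<^esub> rarr T f ?K = u"
        using rarr_Hom[OF fK mT] fS by (simp add: rarr_cmp f(2))
      fix v assume v: "v \<in> Hom (Rmod R) T ?K \<and> rarr ?K (\<lambda>x. x) N \<cdot>\<^bsub>Rmod R\<^esub> v = u"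
      then obtain h where h: "h \<in> lin_map R T ?K" "v = rarr T h ?K" by (auto elim: Rmod_HomE)
      show "v = rarr T f ?K"
        using v lin_mapD(1)[OF h(1)] unfolding h(2) f(2) by (simp add: rarr_cmp rarr_eq)
    qed
  qed
  show ?thesis unfolding is_kernel_def
  proof (intro conjI ballI impI)
    show "rarr N g P \<cdot>\<^bsub>Rmod R\<^esub> rarr ?K (\<lambda>x. x) N = hzero (Rmod R) ?K P"
      by (subst rarr_cmp) (auto simp: S Rmod_simps rarr_eq)
  qed (use K i ex in auto)
qed

lemma lin_map_factor:
  assumes f: "f \<in> lin_map R M N" and g: "g \<in> lin_map R M P"
    and M: "module R M" and N: "module R N" and P: "module R P"
    and sur: "carrier P = g ` carrier M"
    and k: "\<And>x. x \<in> carrier M \<Longrightarrow> g x = \<zero>\<^bsub>P\<^esub> \<Longrightarrow> f x = \<zero>\<^bsub>N\<^esub>"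
  shows "\<exists>v \<in> lin_map R P N. \<forall>x \<in> carrier M. v (g x) = f x"
proof -
  interpret M: module R M by fact
  interpret N: module R N by fact
  interpret P: module R P by fact
  have eq: "f x = f y" if xy: "x \<in> carrier M" "y \<in> carrier M" "g x = g y" for x y
  proof -
    have "g (x \<oplus>\<^bsub>M\<^esub> \<ominus>\<^bsub>M\<^esub> y) = \<zero>\<^bsub>P\<^esub>"
      using xy lin_mapD[OF g] lin_map_neg[OF g M P] P.r_neg by simp
    then have "f (x \<oplus>\<^bsub>M\<^esub> \<ominus>\<^bsub>M\<^esub> y) = \<zero>\<^bsub>N\<^esub>" using k xy by simp
    then have "f x \<oplus>\<^bsub>N\<^esub> \<ominus>\<^bsub>N\<^esub> f y = \<zero>\<^bsub>N\<^esub>"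
      using xy lin_mapD[OF f] lin_map_neg[OF f M N] by simp
    then show ?thesis
      using xy lin_mapD(1)[OF f] N.minus_equality[of "f x" "\<ominus>\<^bsub>N\<^esub> f y"] N.minus_minus by simp
  qed
  define v where "v = (\<lambda>z. f (inv_into (carrier M) g z))"
  have v: "v (g x) = f x" if "x \<in> carrier M" for x
    unfolding v_def by (rule eq) (use that in \<open>auto simp: inv_into_into f_inv_into_f\<close>)
  have "v \<in> lin_map R P N"
  proof (rule lin_mapI)
    show "v x \<in> carrier N" if "x \<in> carrier P" for x
      using that v lin_mapD(1)[OF f] unfolding sur by auto
    show "v (x \<oplus>\<^bsub>P\<^esub> y) = v x \<oplus>\<^bsub>N\<^esub> v y" if xy: "x \<in> carrier P" "y \<in> carrier P" for x y
    proof -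
      obtain a b where "a \<in> carrier M" "b \<in> carrier M" "x = g a" "y = g b" using xy unfolding sur by auto
      then show ?thesis using v lin_mapD(2)[OF g, of a b] lin_mapD(2)[OF f, of a b] by (metis M.a_closed)
    qed
    show "v (r \<odot>\<^bsub>P\<^esub> x) = r \<odot>\<^bsub>N\<^esub> v x" if rx: "r \<in> carrier R" "x \<in> carrier P" for r x
    proof -
      obtain a where "a \<in> carrier M" "x = g a" using rx unfolding sur by auto
      then show ?thesis using rx(1) v lin_mapD(3)[OF g, of r a] lin_mapD(3)[OF f, of r a] by (metis M.smult_closed)
    qed
  qed
  then show ?thesis using v by blast
qed

text \<open>Cokernels are recognized among surjections. This avoids the construction of quotient modules.\<close>

lemma Rmod_cokernel:
  fixes M N P :: "('r, 'u) module"
  assumes M: "M \<in> Obj (Rmod R)" and N: "N \<in> Obj (Rmod R)" and P: "P \<in> Obj (Rmod R)"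
    and f: "f \<in> lin_map R M N" and g: "g \<in> lin_map R N P" and sur: "carrier P = g ` carrier N"
    and exact: "\<And>y. y \<in> carrier N \<Longrightarrow> g y = \<zero>\<^bsub>P\<^esub> \<longleftrightarrow> y \<in> f ` carrier M"
  shows "is_cokernel (Rmod R) M N (rarr M f N) P (rarr N g P)"
proof -
  have mN: "module R N" and mP: "module R P" using N P by (auto simp: Rmod_simps)
  have ex: "\<exists>!v. v \<in> Hom (Rmod R) P T \<and> v \<cdot>\<^bsub>Rmod R\<^esub> rarr N g P = u"
    if T: "T \<in> Obj (Rmod R)" and u: "u \<in> Hom (Rmod R) N T"
      and z: "u \<cdot>\<^bsub>Rmod R\<^esub> rarr M f N = hzero (Rmod R) M T" for T u
  proof -
    have mT: "module R T" using T by (simp add: Rmod_simps)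
    obtain k where k: "k \<in> lin_map R N T" "u = rarr N k T" using u by (rule Rmod_HomE)
    have kf: "k (f x) = \<zero>\<^bsub>T\<^esub>" if "x \<in> carrier M" for x
      using z that unfolding k(2) by (simp add: rarr_cmp lin_mapD[OF f] Rmod_simps rarr_eq)
    have k0: "k x = \<zero>\<^bsub>T\<^esub>" if "x \<in> carrier N" "g x = \<zero>\<^bsub>P\<^esub>" for x
      using exact[OF that(1)] that(2) kf by auto
    obtain v where v: "v \<in> lin_map R P T" and vg: "\<And>x. x \<in> carrier N \<Longrightarrow> v (g x) = k x"
      using lin_map_factor[OF k(1) g mN mT mP sur k0] by blast
    show ?thesis
    proof (rule ex1I[of _ "rarr P v T"])
      show "rarr P v T \<in> Hom (Rmod R) P T \<and> rarr P v T \<cdot>\<^bsub>Rmod R\<^esub> rarr N g P = u"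
        using rarr_Hom[OF v mP] vg by (simp add: rarr_cmp lin_mapD[OF g] k(2) rarr_eq)
      fix a assume a: "a \<in> Hom (Rmod R) P T \<and> a \<cdot>\<^bsub>Rmod R\<^esub> rarr N g P = u"
      then obtain h where h: "h \<in> lin_map R P T" "a = rarr P h T" by (auto elim: Rmod_HomE)
      show "a = rarr P v T"
        using a vg unfolding h(2) k(2) by (simp add: rarr_cmp rarr_eq lin_mapD[OF g] sur)
    qed
  qed
  show ?thesis unfolding is_cokernel_def
  proof (intro conjI ballI impI)
    show "rarr N g P \<cdot>\<^bsub>Rmod R\<^esub> rarr M f N = hzero (Rmod R) M P"
      by (subst rarr_cmp) (auto simp: Rmod_simps rarr_eq lin_mapD[OF f] exact)
  qed (use P rarr_Hom[OF g mN] ex in auto)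
qed

definition exact_at :: "('a \<Rightarrow> 'b) \<Rightarrow> ('r, 'a) module \<Rightarrow> ('r, 'b) module \<Rightarrow> ('r, 'c) module \<Rightarrow> ('b \<Rightarrow> 'c) \<Rightarrow> bool" where
  "exact_at f M N P g \<longleftrightarrow> (\<forall>y \<in> carrier N. g y = \<zero>\<^bsub>P\<^esub> \<longleftrightarrow> y \<in> f ` carrier M)"

lemma weak_serre_Obj: "weak_serre B \<A> \<Longrightarrow> \<A> \<subseteq> Obj B"
  and weak_serre_nonempty: "weak_serre B \<A> \<Longrightarrow> \<A> \<noteq> {}"
  by (simp_all add: weak_serre_def)

lemma weak_serre_kernel: "weak_serre B \<A> \<Longrightarrow> X \<in> \<A> \<Longrightarrow> Y \<in> \<A> \<Longrightarrow> f \<in> Hom B X Y \<Longrightarrow>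
    is_kernel B X Y f K k \<Longrightarrow> K \<in> \<A>"
  unfolding weak_serre_def by meson

text \<open>The middle term is an extension of the kernel of \<open>g4\<close> by the cokernel of \<open>g1\<close>. They are realized as
  the images of \<open>g3\<close> and \<open>g2\<close>.\<close>

lemma weak_serre_five:
  fixes N1 N2 N3 N4 N5 :: "('r, 'u) module"
  assumes serre: "weak_serre (Rmod R) \<A>"
    and A: "N1 \<in> \<A>" "N2 \<in> \<A>" "N4 \<in> \<A>" "N5 \<in> \<A>" and N3: "N3 \<in> Obj (Rmod R)"
    and g: "g1 \<in> lin_map R N1 N2" "g2 \<in> lin_map R N2 N3" "g3 \<in> lin_map R N3 N4" "g4 \<in> lin_map R N4 N5"
    and e: "exact_at g1 N1 N2 N3 g2" "exact_at g2 N2 N3 N4 g3" "exact_at g3 N3 N4 N5 g4"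
  shows "N3 \<in> \<A>"
proof -
  note sub = weak_serre_Obj[OF serre]
  have O: "N1 \<in> Obj (Rmod R)" "N2 \<in> Obj (Rmod R)" "N4 \<in> Obj (Rmod R)" "N5 \<in> Obj (Rmod R)"
    using A sub by auto
  have m: "module R N1" "module R N2" "module R N3" "module R N4" "module R N5"
    using O N3 by (auto simp: Rmod_simps)
  have ker: "K \<in> \<A>" if "X \<in> \<A>" "Y \<in> \<A>" "f \<in> Hom (Rmod R) X Y" "is_kernel (Rmod R) X Y f K k" for X Y f K k
    using weak_serre_kernel[OF serre] that .
  have coker: "K \<in> \<A>" if "X \<in> \<A>" "Y \<in> \<A>" "f \<in> Hom (Rmod R) X Y" "is_cokernel (Rmod R) X Y f K k" for X Y f K k
    using serre that unfolding weak_serre_def by meson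
  have ext: "Y \<in> \<A>" if "X \<in> \<A>" "Z \<in> \<A>" "Y \<in> Obj (Rmod R)" "short_exact (Rmod R) X Y Z i p" for X Y Z i p
    using serre that unfolding weak_serre_def by meson
  define K where "K = N4\<lparr>carrier := {y \<in> carrier N4. g4 y = \<zero>\<^bsub>N5\<^esub>}\<rparr>"
  define Q where "Q = N3\<lparr>carrier := g2 ` carrier N2\<rparr>"
  have Q': "g2 ` carrier N2 = {y \<in> carrier N3. g3 y = \<zero>\<^bsub>N4\<^esub>}"
    using e(2) lin_mapD(1)[OF g(2)] by (auto simp: exact_at_def)
  have K': "carrier K = g3 ` carrier N3" "\<zero>\<^bsub>K\<^esub> = \<zero>\<^bsub>N4\<^esub>"
    using e(3) lin_mapD(1)[OF g(3)] by (auto simp: exact_at_def K_def)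
  have KA: "K \<in> \<A>"
    using ker[OF A(3,4) rarr_Hom[OF g(4) m(4)]] Rmod_kernel[OF O(3,4) g(4) refl] unfolding K_def by blast
  have KO: "K \<in> Obj (Rmod R)" using KA sub by blast
  have QO: "Q \<in> Obj (Rmod R)" unfolding Q_def by (rule Rmod_image_Obj[OF N3 g(2) m(2)])
  then have mQ: "module R Q" by (simp add: Rmod_simps)
  have g2Q: "g2 \<in> lin_map R N2 Q" by (rule lin_mapI) (auto simp: Q_def lin_mapD[OF g(2)])
  have "is_cokernel (Rmod R) N1 N2 (rarr N1 g1 N2) Q (rarr N2 g2 Q)"
    by (rule Rmod_cokernel[OF O(1,2) QO g(1) g2Q]) (use e(1) in \<open>auto simp: Q_def exact_at_def\<close>)
  then have QA: "Q \<in> \<A>" using coker[OF A(1,2) rarr_Hom[OF g(1) m(1)]] by blast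
  have g3K: "g3 \<in> lin_map R N3 K"
    by (rule lin_mapI) (use K' lin_mapD[OF g(3)] in \<open>auto simp: K_def\<close>)
  have i: "(\<lambda>x. x) \<in> lin_map R Q N3" by (rule lin_mapI) (use lin_mapD(1)[OF g(2)] in \<open>auto simp: Q_def\<close>)
  have "short_exact (Rmod R) Q N3 K (rarr Q (\<lambda>x. x) N3) (rarr N3 g3 K)"
    unfolding short_exact_def
  proof (intro conjI)
    show "is_kernel (Rmod R) N3 K (rarr N3 g3 K) Q (rarr Q (\<lambda>x. x) N3)"
      unfolding Q_def using Rmod_kernel[OF N3 KO g3K, of "g2 ` carrier N2"] Q' K'(2) by simp
    show "is_cokernel (Rmod R) Q N3 (rarr Q (\<lambda>x. x) N3) K (rarr N3 g3 K)"
    proof (rule Rmod_cokernel[OF QO N3 KO i g3K K'(1)])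
      fix y assume "y \<in> carrier N3"
      then show "g3 y = \<zero>\<^bsub>K\<^esub> \<longleftrightarrow> y \<in> (\<lambda>x. x) ` carrier Q" using Q' K'(2) by (simp add: Q_def)
    qed
  qed (use rarr_Hom i g3K mQ m in auto)
  then show ?thesis using ext[OF QA KA N3] by blast
qed

text \<open>All modules are transported to modules over \<open>'u\<close>.\<close>

lemma belongs_to_five:
  fixes \<A> :: "('r, 'u) module set" and M1 M2 M3 M4 M5 :: "('r, 'a) module"
  assumes serre: "weak_serre (Rmod R) \<A>"
    and m: "module R M1" "module R M2" "module R M3" "module R M4" "module R M5"
    and b: "belongs_to R M1 \<A>" "belongs_to R M2 \<A>" "belongs_to R M4 \<A>" "belongs_to R M5 \<A>"
    and s: "small TYPE('u) (carrier M3)"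
    and f: "f1 \<in> lin_map R M1 M2" "f2 \<in> lin_map R M2 M3" "f3 \<in> lin_map R M3 M4" "f4 \<in> lin_map R M4 M5"
    and e: "exact_at f1 M1 M2 M3 f2" "exact_at f2 M2 M3 M4 f3" "exact_at f3 M3 M4 M5 f4"
  shows "belongs_to R M3 \<A>"
proof -
  obtain N1 i1 N2 i2 N4 i4 N5 i5 where
    A: "N1 \<in> \<A>" "N2 \<in> \<A>" "N4 \<in> \<A>" "N5 \<in> \<A>"
    and i: "i1 \<in> mod_iso R M1 N1" "i2 \<in> mod_iso R M2 N2" "i4 \<in> mod_iso R M4 N4" "i5 \<in> mod_iso R M5 N5"
    using b unfolding belongs_to_def by blast
  obtain N3 i3 where N3: "N3 \<in> Obj (Rmod R :: (('r, 'u) module, _, 'r) lcat)" and i3: "i3 \<in> mod_iso R M3 N3"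
    using small_module_transfer[OF m(3) s] by blast
  note sub = weak_serre_Obj[OF serre]
  have mN: "module R N1" "module R N2" "module R N3" "module R N4" "module R N5"
    using A sub N3 by (auto simp: Rmod_simps)
  \<comment> \<open>the transport of a map along isomorphisms of its source and target\<close>
  define t where "t = (\<lambda>(M :: ('r, 'a) module) i f (j :: 'a \<Rightarrow> 'u) (x :: 'u). (j (f (inv_into (carrier M) i x))) :: 'u)"
  have tl: "t M i f j \<in> lin_map R N N'"
    if "module R M" "i \<in> mod_iso R M N" "f \<in> lin_map R M M'" "j \<in> mod_iso R M' N'"
    for M i f j N M' N'
    unfolding t_def
    by (intro lin_map_comp[OF lin_map_comp[OF mod_isoD(1)[OF mod_iso_inv[OF that(2,1)]] that(3)] mod_isoD(1)[OF that(4)]])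
  have te: "exact_at (t M i f j) N N' N'' (t M' j f' k)"
    if "module R M" "module R M'" "module R M''" "module R N''"
      "i \<in> mod_iso R M N" "f \<in> lin_map R M M'" "j \<in> mod_iso R M' N'" "f' \<in> lin_map R M' M''" "k \<in> mod_iso R M'' N''"
      and ex: "exact_at f M M' M'' f'"
    for M i f j N M' N' f' k M'' N''
    unfolding exact_at_def
  proof
    note th = that
    fix y assume y: "y \<in> carrier N'"
    note bi = mod_isoD(2)[OF th(5)] and bj = mod_isoD(2)[OF th(7)] and bk = mod_isoD(2)[OF th(9)]
    obtain x where x: "x \<in> carrier M'" "y = j x" using bj y by (auto simp: bij_betw_def)
    have inj: "inv_into (carrier M') j y = x" using bj x by (simp add: bij_betw_inv_into_left)
    have k0: "k z = \<zero>\<^bsub>N''\<^esub> \<longleftrightarrow> z = \<zero>\<^bsub>M''\<^esub>" if z: "z \<in> carrier M''" for z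
      using lin_map_zero[OF mod_isoD(1)[OF th(9)] th(3,4)] bk z module_closed(1)[OF th(3)]
      by (metis bij_betw_inv_into_left)
    have "t M' j f' k y = \<zero>\<^bsub>N''\<^esub> \<longleftrightarrow> f' x = \<zero>\<^bsub>M''\<^esub>"
      unfolding t_def inj using k0[OF lin_mapD(1)[OF th(8) x(1)]] .
    also have "\<dots> \<longleftrightarrow> x \<in> f ` carrier M" using ex x(1) by (simp add: exact_at_def)
    also have "\<dots> \<longleftrightarrow> y \<in> t M i f j ` carrier N"
    proof
      assume "x \<in> f ` carrier M"
      then obtain w where w: "w \<in> carrier M" "x = f w" by blast
      have "t M i f j (i w) = y" unfolding t_def using bij_betw_inv_into_left[OF bi w(1)] w x by simp
      then show "y \<in> t M i f j ` carrier N" using bi w(1) by (metis bij_betwE image_eqI)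
    next
      assume "y \<in> t M i f j ` carrier N"
      then obtain z where z: "z \<in> carrier N" "y = j (f (inv_into (carrier M) i z))" by (auto simp: t_def)
      let ?w = "inv_into (carrier M) i z"
      have w: "?w \<in> carrier M" using bi z(1) by (metis bij_betwE bij_betw_inv_into)
      have "f ?w = x" using bj z(2) x lin_mapD(1)[OF th(6) w] by (metis bij_betw_inv_into_left)
      then show "x \<in> f ` carrier M" using w by blast
    qed
    finally show "t M' j f' k y = \<zero>\<^bsub>N''\<^esub> \<longleftrightarrow> y \<in> t M i f j ` carrier N" .
  qed
  have "N3 \<in> \<A>"
    by (rule weak_serre_five[OF serre A N3
        tl[OF m(1) i(1) f(1) i(2)] tl[OF m(2) i(2) f(2) i3] tl[OF m(3) i3 f(3) i(3)] tl[OF m(4) i(3) f(4) i(4)]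
        te[OF m(1-3) mN(3) i(1) f(1) i(2) f(2) i3 e(1)]
        te[OF m(2-4) mN(4) i(2) f(2) i3 f(3) i(3) e(2)]
        te[OF m(3-5) mN(5) i3 f(3) i(3) f(4) i(4) e(3)]])
  then show ?thesis using i3 unfolding belongs_to_def by blast
qed

text \<open>The kernel of an identity is a zero module.\<close>

lemma belongs_to_zero:
  fixes \<A> :: "('r, 'u) module set"
  assumes serre: "weak_serre (Rmod R) \<A>" and M: "module R M" and z: "carrier M = {\<zero>\<^bsub>M\<^esub>}"
  shows "belongs_to R M \<A>"
proof -
  obtain N where N: "N \<in> \<A>" using weak_serre_nonempty[OF serre] by blast
  have NO: "N \<in> Obj (Rmod R)" using weak_serre_Obj[OF serre] N by blast
  then have mN: "module R N" by (simp add: Rmod_simps)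
  let ?K = "N\<lparr>carrier := {y \<in> carrier N. y = \<zero>\<^bsub>N\<^esub>}\<rparr>"
  have id: "(\<lambda>x. x) \<in> lin_map R N N" by (rule lin_mapI) auto
  have "is_kernel (Rmod R) N N (rarr N (\<lambda>x. x) N) ?K (rarr ?K (\<lambda>x. x) N)"
    by (rule Rmod_kernel[OF NO NO id refl])
  then have K: "?K \<in> \<A>" by (rule weak_serre_kernel[OF serre N N rarr_Hom[OF id mN]])
  then have "?K \<in> Obj (Rmod R)" using weak_serre_Obj[OF serre] by blast
  then have mK: "module R ?K" by (simp add: Rmod_simps)
  have c: "carrier ?K = {\<zero>\<^bsub>N\<^esub>}" using module_closed(1)[OF mN] by auto
  have "(\<lambda>x. \<zero>\<^bsub>N\<^esub>) \<in> mod_iso R M ?K"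
  proof (rule mod_isoI)
    interpret K: module R ?K by fact
    show "(\<lambda>x. \<zero>\<^bsub>N\<^esub>) \<in> lin_map R M ?K"
    proof (rule lin_mapI)
      have "\<zero>\<^bsub>N\<^esub> \<oplus>\<^bsub>?K\<^esub> \<zero>\<^bsub>N\<^esub> \<in> carrier ?K" using c by (intro K.a_closed) auto
      then show "\<zero>\<^bsub>N\<^esub> = \<zero>\<^bsub>N\<^esub> \<oplus>\<^bsub>?K\<^esub> \<zero>\<^bsub>N\<^esub>" using c by auto
      show "\<zero>\<^bsub>N\<^esub> = r \<odot>\<^bsub>?K\<^esub> \<zero>\<^bsub>N\<^esub>" if "r \<in> carrier R" for r
      proof -
        have "r \<odot>\<^bsub>?K\<^esub> \<zero>\<^bsub>N\<^esub> \<in> carrier ?K" using c that by (intro K.smult_closed) auto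
        then show ?thesis using c by auto
      qed
    qed (use c in auto)
    show "bij_betw (\<lambda>x. \<zero>\<^bsub>N\<^esub>) (carrier M) (carrier ?K)" using z c by (simp add: bij_betw_def)
  qed
  then show ?thesis using K unfolding belongs_to_def by blast
qed

section \<open>Exact sequences of hom-modules\<close>

context linear_category
begin

lemma post_lin: "ar f X Y \<Longrightarrow> W \<in> Obj C \<Longrightarrow> (\<lambda>x. f \<cdot> x) \<in> lin_map R (hom W X) (hom W Y)"
proof (rule lin_mapI)
  assume f: "ar f X Y" and W: "W \<in> Obj C"
  have x: "ar x W X" if "x \<in> carrier (hom W X)" for x using that f W by (simp add: ar_def)
  show "f \<cdot> x \<in> carrier (hom W Y)" if "x \<in> carrier (hom W X)" for x
    using ar_Cmp[OF x[OF that] f] arD by simp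
  show "f \<cdot> (x \<oplus>\<^bsub>hom W X\<^esub> y) = f \<cdot> x \<oplus>\<^bsub>hom W Y\<^esub> f \<cdot> y"
    if "x \<in> carrier (hom W X)" "y \<in> carrier (hom W X)" for x y
    using cmp_add_right[OF x[OF that(1)] x[OF that(2)] f] by simp
  show "f \<cdot> (r \<odot>\<^bsub>hom W X\<^esub> x) = r \<odot>\<^bsub>hom W Y\<^esub> (f \<cdot> x)" if "r \<in> carrier R" "x \<in> carrier (hom W X)" for r x
    using Cmp_hscale_right[of W X Y r x f] that f W by (simp add: ar_def)
qed

lemma pre_lin: "ar f X Y \<Longrightarrow> W \<in> Obj C \<Longrightarrow> (\<lambda>x. x \<cdot> f) \<in> lin_map R (hom Y W) (hom X W)"
proof (rule lin_mapI)
  assume f: "ar f X Y" and W: "W \<in> Obj C"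
  have x: "ar x Y W" if "x \<in> carrier (hom Y W)" for x using that f W by (simp add: ar_def)
  show "x \<cdot> f \<in> carrier (hom X W)" if "x \<in> carrier (hom Y W)" for x
    using ar_Cmp[OF f x[OF that]] arD by simp
  show "(x \<oplus>\<^bsub>hom Y W\<^esub> y) \<cdot> f = x \<cdot> f \<oplus>\<^bsub>hom X W\<^esub> y \<cdot> f"
    if "x \<in> carrier (hom Y W)" "y \<in> carrier (hom Y W)" for x y
    using cmp_add_left[OF f x[OF that(1)] x[OF that(2)]] by simp
  show "(r \<odot>\<^bsub>hom Y W\<^esub> x) \<cdot> f = r \<odot>\<^bsub>hom X W\<^esub> (x \<cdot> f)" if "r \<in> carrier R" "x \<in> carrier (hom Y W)" for r x
    using Cmp_hscale_left[of X Y W r f x] that f W by (simp add: ar_def)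
qed

lemma id_lin: "(\<lambda>x. x) \<in> lin_map R M M" by (rule lin_mapI) auto

lemma post_iso:
  assumes "isomorphic C X Y" and O: "X \<in> Obj C" "Y \<in> Obj C" and W: "W \<in> Obj C"
  shows "mod_iso R (hom W X) (hom W Y) \<noteq> {}"
proof -
  obtain f g where fg: "ar f X Y" "ar g Y X" "g \<cdot> f = Idn C X" "f \<cdot> g = Idn C Y"
    using assms(1) is_iso_ar[OF _ O] unfolding isomorphic_def by blast
  have "bij_betw (\<lambda>x. f \<cdot> x) (Hom C W X) (Hom C W Y)"
  proof (rule bij_betw_byWitness[where f' = "\<lambda>x. g \<cdot> x"])
    show "\<forall>a\<in>Hom C W X. g \<cdot> (f \<cdot> a) = a"
      using assoc[OF _ fg(1,2)] fg(3) idl O W by (metis arI)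
    show "\<forall>a\<in>Hom C W Y. f \<cdot> (g \<cdot> a) = a"
      using assoc[OF _ fg(2,1)] fg(4) idl O W by (metis arI)
    show "(\<lambda>x. f \<cdot> x) ` Hom C W X \<subseteq> Hom C W Y" "(\<lambda>x. g \<cdot> x) ` Hom C W Y \<subseteq> Hom C W X"
      using ar_Cmp[OF _ fg(1)] ar_Cmp[OF _ fg(2)] O W by (auto simp: ar_def)
  qed
  then have "(\<lambda>x. f \<cdot> x) \<in> mod_iso R (hom W X) (hom W Y)"
    using mod_isoI[OF post_lin[OF fg(1) W]] by simp
  then show ?thesis by blast
qed

lemma exact_id:
  assumes o: "orth C X Y" and g: "g \<in> lin_map R (hom X Y) M" and M: "module R M"
    and O: "X \<in> Obj C" "Y \<in> Obj C"
  shows "exact_at (\<lambda>x. x) (hom X Y) (hom X Y) M g"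
proof -
  have "g (hzero C X Y) = \<zero>\<^bsub>M\<^esub>" using lin_map_zero[OF g hom_module[OF O] M] by simp
  then show ?thesis using o by (simp add: exact_at_def orth_def)
qed

lemma exact_into_zero:
  assumes o: "orth C X Y" and g: "g \<in> lin_map R M (hom X Y)" and M: "module R M"
    and O: "X \<in> Obj C" "Y \<in> Obj C"
  shows "exact_at g M (hom X Y) (hom X Y) (\<lambda>x. x)"
proof -
  have "g \<zero>\<^bsub>M\<^esub> = hzero C X Y" using lin_map_zero[OF g M hom_module[OF O]] by simp
  then have "hzero C X Y \<in> g ` carrier M" using module_closed(1)[OF M] by (metis imageI)
  then show ?thesis using o by (simp add: exact_at_def orth_def)
qed

end

context triangulated_category
begin

lemma ShA_iso:
  assumes O: "X \<in> Obj C" "Y \<in> Obj C"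
  shows "ShA C \<in> mod_iso R (hom X Y) (hom (Sh C X) (Sh C Y))"
proof (rule mod_isoI)
  show "bij_betw (ShA C) (carrier (hom X Y)) (carrier (hom (Sh C X) (Sh C Y)))"
    using ShA_bij[OF O] by simp
  have a: "ar x X Y" if "x \<in> carrier (hom X Y)" for x using that O by (simp add: ar_def)
  show "ShA C \<in> lin_map R (hom X Y) (hom (Sh C X) (Sh C Y))"
    by (rule lin_mapI) (use arD(3)[OF ar_ShA[OF a]] ShA_add[OF a a] ShA_scale[OF _ a] in simp_all)
qed

lemma exact_post:
  assumes t: "dist_tri C X Y Z f g h" and W: "W \<in> Obj C"
  shows "exact_at (\<lambda>x. f \<cdot> x) (hom W X) (hom W Y) (hom W Z) (\<lambda>x. g \<cdot> x)"
  unfolding exact_at_def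
proof
  note a = tri_ar[OF t]
  have O: "X \<in> Obj C" "Y \<in> Obj C" "Z \<in> Obj C" using a arD by auto
  fix y assume "y \<in> carrier (hom W Y)"
  then have y: "ar y W Y" using O W by (simp add: ar_def)
  have "g \<cdot> y = hzero C W Z \<longleftrightarrow> (\<exists>v. ar v W X \<and> f \<cdot> v = y)"
    using tri_lift[OF t y] assoc[OF _ a(1,2)] tri_comp_zero[OF t] cmp_zero_left[OF _ O(3)] by metis
  then show "g \<cdot> y = \<zero>\<^bsub>hom W Z\<^esub> \<longleftrightarrow> y \<in> (\<lambda>x. f \<cdot> x) ` carrier (hom W X)"
    using O W by (auto simp: ar_def)
qed

lemma exact_pre:
  assumes t: "dist_tri C X Y Z f g h" and W: "W \<in> Obj C"
  shows "exact_at (\<lambda>x. x \<cdot> g) (hom Z W) (hom Y W) (hom X W) (\<lambda>x. x \<cdot> f)"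
  unfolding exact_at_def
proof
  note a = tri_ar[OF t]
  have O: "X \<in> Obj C" "Y \<in> Obj C" "Z \<in> Obj C" using a arD by auto
  fix y assume "y \<in> carrier (hom Y W)"
  then have y: "ar y Y W" using O W by (simp add: ar_def)
  have "y \<cdot> f = hzero C X W \<longleftrightarrow> (\<exists>v. ar v Z W \<and> v \<cdot> g = y)"
    using tri_extend[OF t y] assoc[OF a(1,2)] tri_comp_zero[OF t] cmp_zero_right[OF _ O(1)] by metis
  then show "y \<cdot> f = \<zero>\<^bsub>hom X W\<^esub> \<longleftrightarrow> y \<in> (\<lambda>x. x \<cdot> g) ` carrier (hom Z W)"
    using O W by (auto simp: ar_def)
qed

end

section \<open>Restricting the t-structure\<close>

context weight_setup
begin

text \<open>The part \<open>X\<close> of weight at most \<open>i\<close> is an extension of \<open>B\<close> by a desuspension of \<open>Y\<close>, so its weight is also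
  at least \<open>i\<close>.\<close>

lemma wge_dec:
  assumes B: "B \<in> wge i"
  shows "\<exists>X \<in> wle i \<inter> wge i. \<exists>Y \<in> wge (i + 1). \<exists>f g h. dist_tri C X B Y f g h"
proof -
  obtain X Y f g h where X: "X \<in> wle i" and Y: "Y \<in> wge (i + 1)" and t: "dist_tri C X B Y f g h"
    using w_dec[OF wge_C0[OF B], of i] by blast
  have "X \<in> wge i"
  proof (rule wgeI[OF wle_C0[OF X]])
    fix A assume A: "A \<in> wle (i - 1)"
    have "Si Y \<in> wge i" using wge_shift[OF Y, of "- 1"] by (simp add: shift_m1)
    then show "orth C A X"
      using orth_fibre[OF t] w_orth[OF A] B wle_Obj[OF A] by simp
  qed
  then show ?thesis using X Y t by blast
qed

lemma wle_dec:
  assumes A: "A \<in> wle i"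
  shows "\<exists>X \<in> wle (i - 1). \<exists>Y \<in> wle i \<inter> wge i. \<exists>f g h. dist_tri C X A Y f g h"
proof -
  obtain X Y f g h where X: "X \<in> wle (i - 1)" and Y: "Y \<in> wge i" and t: "dist_tri C X A Y f g h"
    using w_dec[OF wle_C0[OF A], of "i - 1"] by auto
  have "Y \<in> wle i"
  proof (rule wleI[OF wge_C0[OF Y]])
    fix B assume B: "B \<in> wge (i + 1)"
    have "Sh C X \<in> wle i" using wle_shift[OF X, of 1] by (simp add: shift_1)
    then show "orth C Y B" using orth_cone'[OF t] w_orth[OF _ B] A wge_Obj[OF B] by simp
  qed
  then show ?thesis using X Y t by blast
qed

lemma shift_tle: "shift C i ` tle j = tle (i + j)" and shift_tge: "shift C i ` tge j = tge (i + j)"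
proof -
  have *: "tle j \<subseteq> Obj C" "tge j \<subseteq> Obj C" for j using tle_Obj tge_Obj by auto
  show "shift C i ` tle j = tle (i + j)"
    using shift_image[OF *(1)] tle_shift[of _ j i] tle_shift[of _ "i + j" "- i"] tle_Obj
    by (auto simp: add.commute)
  show "shift C i ` tge j = tge (i + j)"
    using shift_image[OF *(2)] tge_shift[of _ j i] tge_shift[of _ "i + j" "- i"] tge_Obj
    by (auto simp: add.commute)
qed

lemma right_orth_w: "right_orth C (fst w) = tge 1" "right_orth C (snd w) = tle (- 1)"
  by (simp_all add: right_orth_def tge_def tle_def wle_0 wge_0)

lemma strictly_orthogonal_iff:
  assumes "fst t \<subseteq> Obj C" "snd t \<subseteq> Obj C"
  shows "strictly_orthogonal C t w \<longleftrightarrow> t = (tle 0, tge 0)"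
proof -
  have inj: "A = B" if "A \<subseteq> Obj C" "B \<subseteq> Obj C" "shift C i ` A = shift C i ` B" for A B i
    using shift_image[OF that(1), of "shift C i _" i] shift_image[OF that(2), of "shift C i _" i]
      that shift_cancel(2)[of _ i] shift_Obj[of _ i] by (metis (no_types, lifting) subsetI subset_antisym subsetD)
  have "tle 0 \<subseteq> Obj C" "tge 0 \<subseteq> Obj C" using tle_Obj tge_Obj by auto
  then show ?thesis unfolding strictly_orthogonal_def right_orth_w
    using inj[OF assms(1)] inj[OF assms(2)] shift_tle[of "- 1" 0] shift_tge[of 1 0] prod.collapse[of t]
    by (metis add.right_neutral fst_conv snd_conv)
qed

lemma t_structure_restriction:
  assumes S: "tri_subcat C S"
    and L: "\<And>L N R' f g h. N \<in> S \<Longrightarrow> L \<in> tge 0 \<Longrightarrow> R' \<in> tle (- 1) \<Longrightarrow> dist_tri C L N R' f g h \<Longrightarrow> L \<in> S"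
  shows "t_structure (full_sub C S) (t_restriction (tle 0, tge 0) S)"
proof -
  note SO = tri_subcatD(1)[OF S]
  have sh: "shift (full_sub C S) i ` A = shift C i ` A" if "A \<subseteq> S" for A i
    by (rule image_cong[OF refl]) (use shift_full_sub[OF S] that in blast)
  have si: "shift C i ` (A \<inter> S) = shift C i ` A \<inter> S" if "A \<subseteq> Obj C" for A i
    using shift_image[OF that] shift_image[of "A \<inter> S"] tri_subcat_shift[OF S] shift_cancel SO that
    by (auto simp: subset_iff) (metis tri_subcat_shift[OF S])+
  have tO: "tle i \<subseteq> Obj C" "tge i \<subseteq> Obj C" for i using tle_Obj tge_Obj by auto
  have s: "shift (full_sub C S) i ` (tle 0 \<inter> S) = tle i \<inter> S" "shift (full_sub C S) i ` (tge 0 \<inter> S) = tge i \<inter> S" for i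
    using sh[of "tle 0 \<inter> S" i] sh[of "tge 0 \<inter> S" i] si[OF tO(1)[of 0], of i] si[OF tO(2)[of 0], of i]
      shift_tle[of i 0] shift_tge[of i 0] by auto
  show ?thesis unfolding t_structure_def t_restriction_def fst_conv snd_conv s
  proof (intro conjI ballI)
    show "iso_closed (full_sub C S) (tle 0 \<inter> S)" "iso_closed (full_sub C S) (tge 0 \<inter> S)"
      unfolding iso_closed_def using tle_iso tge_iso SO by auto
    show "tle 0 \<inter> S \<subseteq> tle 1 \<inter> S" "tge 1 \<inter> S \<subseteq> tge 0 \<inter> S"
      using tle_mono[of 0 1] tge_mono[of 0 1] by auto
    show "class_orth (full_sub C S) (tge 1 \<inter> S) (tle 0 \<inter> S)"
      unfolding class_orth_def using t_orth[of _ 1 _ 0] by simp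
    fix N assume "N \<in> Obj (full_sub C S)"
    then have N: "N \<in> S" by simp
    obtain L R' f g h where LR: "L \<in> tge 0" "R' \<in> tle (- 1)" and t: "dist_tri C L N R' f g h"
      using t_dec[OF subsetD[OF SO N], of 0] by auto
    have LS: "L \<in> S" by (rule L[OF N LR t])
    have RS: "R' \<in> S" by (rule tri_subcatD(6)[OF S t LS N])
    have "dist_tri (full_sub C S) L N R' f g h" using tri_full_sub[OF SO LS N RS] t by simp
    then show "\<exists>L\<in>tge 0 \<inter> S. \<exists>R'\<in>tle (- 1) \<inter> S. \<exists>f g h. dist_tri (full_sub C S) L N R' f g h"
      using LS RS LR by blast
  qed (auto)
qed

lemma t_structure_orthogonal: "t_structure C (tle 0, tge 0)"
proof -
  have "tri_subcat C (Obj C)"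
    by (rule tri_subcatI) (use zero_object_exists Sh_Obj Si in \<open>auto simp: iso_closed_def is_zero_object_def dist_tri_def\<close>)
  then have "t_structure (full_sub C (Obj C)) (t_restriction (tle 0, tge 0) (Obj C))"
    by (rule t_structure_restriction) (rule tge_Obj)
  moreover have "full_sub C (Obj C) = C" by (simp add: full_sub_def)
  moreover have "t_restriction (tle 0, tge 0) (Obj C) = (tle 0, tge 0)"
    using tle_Obj tge_Obj by (auto simp: t_restriction_def)
  ultimately show ?thesis by simp
qed

text \<open>The filter tells in which direction the functor \<open>C(-,N)\<close> is bounded: \<open>at_bot\<close> gives bounds below,
  \<open>at_top\<close> bounds above, and their supremum both. This allows the three subcategories to be treated
  at once.\<close>

definition bounded_objs :: "int filter \<Rightarrow> 'o set" where
  "bounded_objs F = {N \<in> Obj C. \<forall>M \<in> C0. eventually (\<lambda>i. orth C (shift C (- i) M) N) F}"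

lemma sub_bounded: "sub_plus C C0 = bounded_objs at_bot" "sub_minus C C0 = bounded_objs at_top" "sub_b C C0 = bounded_objs (sup at_bot at_top)"
proof -
  have p: "loc_bounded_below (full_sub C C0) (\<lambda>M. hom_mod C M N) \<longleftrightarrow>
      (\<forall>M \<in> C0. eventually (\<lambda>i. orth C (shift C (- i) M) N) at_bot)" for N
    unfolding loc_bounded_below_def eventually_at_bot_linorder
    by (rule trans[OF ball_cong[OF refl]]) (simp_all add: shift_C0 orth_def)
  have m: "loc_bounded_above (full_sub C C0) (\<lambda>M. hom_mod C M N) \<longleftrightarrow>
      (\<forall>M \<in> C0. eventually (\<lambda>i. orth C (shift C (- i) M) N) at_top)" for N
    unfolding loc_bounded_above_def eventually_at_top_linorder
    by (rule trans[OF ball_cong[OF refl]]) (simp_all add: shift_C0 orth_def)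
  show "sub_plus C C0 = bounded_objs at_bot" "sub_minus C C0 = bounded_objs at_top" "sub_b C C0 = bounded_objs (sup at_bot at_top)"
    unfolding sub_plus_def sub_minus_def sub_b_def bounded_objs_def p m by (auto simp: eventually_sup)
qed

definition shift_inv :: "int filter \<Rightarrow> bool" where
  "shift_inv F \<longleftrightarrow> (\<forall>P j. eventually P F \<longrightarrow> eventually (\<lambda>i. P (i + j)) F)"

lemma shift_inv_at: "shift_inv at_bot" "shift_inv at_top" "shift_inv (sup at_bot at_top)"
proof -
  show 1: "shift_inv at_bot" unfolding shift_inv_def eventually_at_bot_linorder
  proof (intro allI impI, elim exE)
    fix P j and k :: int assume "\<forall>i\<le>k. P i"
    then show "\<exists>k. \<forall>i\<le>k. P (i + j)" by (intro exI[of _ "k - j"]) auto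
  qed
  show 2: "shift_inv at_top" unfolding shift_inv_def eventually_at_top_linorder
  proof (intro allI impI, elim exE)
    fix P j and k :: int assume "\<forall>i\<ge>k. P i"
    then show "\<exists>k. \<forall>i\<ge>k. P (i + j)" by (intro exI[of _ "k - j"]) auto
  qed
  show "shift_inv (sup at_bot at_top)" using 1 2 by (simp add: shift_inv_def eventually_sup)
qed

lemma bounded_tri:
  assumes F: "shift_inv F" shows "tri_subcat C (bounded_objs F)"
proof -
  have Sh: "Sh C X \<in> bounded_objs F" and Si: "Si X \<in> bounded_objs F" if X: "X \<in> bounded_objs F" for X
  proof -
    have XO: "X \<in> Obj C" using X by (simp add: bounded_objs_def)
    have ev: "eventually (\<lambda>i. orth C (shift C (- i) M) (shift C j X)) F" if M: "M \<in> C0" for M j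
    proof -
      have "eventually (\<lambda>i. orth C (shift C (- (i + j)) M) X) F"
        using F X M unfolding shift_inv_def bounded_objs_def by blast
      moreover have "orth C (shift C (- (i + j)) M) X \<longleftrightarrow> orth C (shift C (- i) M) (shift C j X)" for i
        using orth_shift_left[of "shift C (- i) M" X "- j"] shift_add[of M "- j" "- i"] C0_Obj[OF M] XO shift_Obj
        by (simp add: algebra_simps)
      ultimately show ?thesis by simp
    qed
    show "Sh C X \<in> bounded_objs F" "Si X \<in> bounded_objs F"
      using ev[of _ 1] ev[of _ "- 1"] Sh_Obj[OF XO] Si(1)[OF XO] by (simp_all add: bounded_objs_def shift_1 shift_m1)
  qed
  show ?thesis
  proof (rule tri_subcatI)
    obtain Z where Z: "is_zero_object C Z" using zero_object_exists by blast
    then have "Z \<in> Obj C" by (simp add: is_zero_object_def)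
    then have "Z \<in> bounded_objs F" unfolding bounded_objs_def using zero_orth(1)[OF Z] shift_Obj C0_Obj by simp
    then show "bounded_objs F \<noteq> {}" by blast
    show "iso_closed C (bounded_objs F)" unfolding iso_closed_def
    proof (intro ballI impI)
      fix X Y assume X: "X \<in> bounded_objs F" and Y: "Y \<in> Obj C" and i: "isomorphic C X Y"
      then have "orth C (shift C (- i) M) Y \<longleftrightarrow> orth C (shift C (- i) M) X" if "M \<in> C0" for M i
        using orth_iso(2)[OF i _ Y] X C0_Obj[OF that] shift_Obj by (simp add: bounded_objs_def)
      then show "Y \<in> bounded_objs F" using X Y by (simp add: bounded_objs_def)
    qed
    show "Z \<in> bounded_objs F" if t: "dist_tri C X Y Z f g h" and X: "X \<in> bounded_objs F" and Y: "Y \<in> bounded_objs F" for X Y Z f g h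
    proof -
      have "eventually (\<lambda>i. orth C (shift C (- i) M) Z) F" if M: "M \<in> C0" for M
      proof -
        have "eventually (\<lambda>i. orth C (shift C (- i) M) (Sh C X)) F" "eventually (\<lambda>i. orth C (shift C (- i) M) Y) F"
          using Sh[OF X] Y M by (auto simp: bounded_objs_def)
        then show ?thesis
          by eventually_elim (use orth_cone[OF t] shift_Obj[OF C0_Obj[OF M]] in blast)
      qed
      then show ?thesis using t by (simp add: bounded_objs_def dist_tri_def)
    qed
  qed (use Sh Si in \<open>auto simp: bounded_objs_def\<close>)
qed

lemma bounded_retract:
  assumes F: "shift_inv F" and M: "M \<in> C0" and M2: "M2 \<in> C0" and Z: "Z \<in> Obj C"
    and i: "ar i (shift C n M) M2" and p: "ar p M2 (shift C n M)" and pi: "p \<cdot> i = Idn C (shift C n M)"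
    and e: "eventually (\<lambda>i. orth C (shift C (- i) M2) Z) F"
  shows "eventually (\<lambda>i. orth C (shift C (- i) M) Z) F"
proof -
  note MO = C0_Obj[OF M] and M2O = C0_Obj[OF M2]
  have "orth C (shift C (- (k - n)) M) Z" if "orth C (shift C (- k) M2) Z" for k
  proof -
    have "orth C M2 (shift C k Z)" using that orth_shift_left[OF M2O Z] by simp
    then have "orth C (shift C n M) (shift C k Z)"
      using orth_retract[OF _ i p pi] shift_Obj[OF Z] by blast
    then have "orth C (shift C (- k) (shift C n M)) Z"
      using orth_shift_left[OF shift_Obj[OF MO] Z] by simp
    moreover have "- (k - n) = - k + n" by simp
    ultimately show ?thesis using shift_add[OF MO, of "- k" n] by metis
  qed
  then have "eventually (\<lambda>k. orth C (shift C (- (k - n)) M) Z) F"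
    using e by (auto elim: eventually_mono)
  then have "eventually (\<lambda>k. orth C (shift C (- (k + n - n)) M) Z) F"
    using F unfolding shift_inv_def by blast
  then show ?thesis by simp
qed

lemma biproduct_retract: "is_biproduct C X Y Z \<Longrightarrow> X \<in> Obj C \<Longrightarrow>
    \<exists>i p. ar i X Z \<and> ar p Z X \<and> p \<cdot> i = Idn C X"
  unfolding is_biproduct_def ar_def by blast

lemma is_biproduct_full_sub: "S \<subseteq> Obj C \<Longrightarrow> is_biproduct (full_sub C S) X Y Z \<Longrightarrow> is_biproduct C X Y Z \<and> Z \<in> S"
  unfolding is_biproduct_def by auto

text \<open>Up to a shift, \<open>M\<close> is a retract of an object \<open>M2\<close>, which is an extension of an object of weight at
  least \<open>0\<close> by a right degenerate one. No shift of the latter has arrows to \<open>tge 0\<close>.\<close>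

lemma bounded_below:
  assumes b: "ess_bounded_below (full_sub C C0) w" and Z: "Z \<in> tge 0"
    and Y: "\<And>Y. Y \<in> wge 0 \<Longrightarrow> eventually (\<lambda>i. orth C (shift C (- i) Y) Z) at_bot"
  shows "Z \<in> bounded_objs at_bot"
proof -
  note ZO = tge_Obj[OF Z]
  have "eventually (\<lambda>i. orth C (shift C (- i) M) Z) at_bot" if M: "M \<in> C0" for M
  proof -
    obtain n M2 RD Y f g h where bi: "is_biproduct (full_sub C C0) (shift C (- n) M) (shift C 1 (shift C (- n) M)) M2"
      and RD: "RD \<in> right_degenerate (full_sub C C0) w" and Y1: "Y \<in> snd w" and t: "dist_tri (full_sub C C0) RD M2 Y f g h"
      using b M C0_shift[OF M] unfolding ess_bounded_below_def ess_positive_def by (auto simp: shift_C0)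
    have M2: "M2 \<in> C0" and bi': "is_biproduct C (shift C (- n) M) (shift C 1 (shift C (- n) M)) M2"
      using is_biproduct_full_sub[OF _ bi] C0_Obj by auto
    obtain i p where ip: "ar i (shift C (- n) M) M2" "ar p M2 (shift C (- n) M)" "p \<cdot> i = Idn C (shift C (- n) M)"
      using biproduct_retract[OF bi' shift_Obj[OF C0_Obj[OF M]]] by blast
    have RDw: "RD \<in> wle k" for k using RD by (auto simp: right_degenerate_def shift_w wle_def)
    have t': "dist_tri C RD M2 Y f g h" using tri_full_subD[OF _ t] C0_Obj by blast
    have "eventually (\<lambda>i. orth C (shift C (- i) Y) Z) at_bot" using Y Y1 by (simp add: wge_0)
    then have "eventually (\<lambda>i. orth C (shift C (- i) M2) Z) at_bot"
    proof (eventually_elim)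
      case (elim i)
      obtain f g h where t'': "dist_tri C (shift C (- i) RD) (shift C (- i) M2) (shift C (- i) Y) f g h"
        using tri_shift[OF t'] by blast
      have "shift C (- i) RD \<in> wle (- 1)" using wle_shift[OF RDw[of "i - 1"], of "- i"] by simp
      then have "orth C (shift C (- i) RD) Z" using tge_orth[OF Z] by simp
      then show ?case by (rule orth_mid'[OF t'' _ elim ZO])
    qed
    then show ?thesis by (rule bounded_retract[OF shift_inv_at(1) M M2 ZO ip])
  qed
  then show ?thesis using ZO by (simp add: bounded_objs_def)
qed

text \<open>Dual to the previous lemma: no shift of a left degenerate object has arrows to \<open>tle 0\<close>.\<close>

lemma bounded_above:
  assumes b: "ess_bounded_above (full_sub C C0) w" and Z: "Z \<in> tle 0"
    and X: "\<And>X. X \<in> wle 0 \<Longrightarrow> eventually (\<lambda>i. orth C (shift C (- i) X) Z) at_top"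
  shows "Z \<in> bounded_objs at_top"
proof -
  note ZO = tle_Obj[OF Z]
  have "eventually (\<lambda>i. orth C (shift C (- i) M) Z) at_top" if M: "M \<in> C0" for M
  proof -
    obtain n M2 X LD f g h where bi: "is_biproduct (full_sub C C0) (shift C (- n) M) (shift C (- 1) (shift C (- n) M)) M2"
      and LD: "LD \<in> left_degenerate (full_sub C C0) w" and X1: "X \<in> fst w" and t: "dist_tri (full_sub C C0) X M2 LD f g h"
      using b M C0_shift[OF M] unfolding ess_bounded_above_def ess_negative_def by (auto simp: shift_C0)
    have M2: "M2 \<in> C0" and bi': "is_biproduct C (shift C (- n) M) (shift C (- 1) (shift C (- n) M)) M2"
      using is_biproduct_full_sub[OF _ bi] C0_Obj by auto
    obtain i p where ip: "ar i (shift C (- n) M) M2" "ar p M2 (shift C (- n) M)" "p \<cdot> i = Idn C (shift C (- n) M)"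
      using biproduct_retract[OF bi' shift_Obj[OF C0_Obj[OF M]]] by blast
    have LDw: "LD \<in> wge k" for k using LD by (auto simp: left_degenerate_def shift_w wge_def)
    have t': "dist_tri C X M2 LD f g h" using tri_full_subD[OF _ t] C0_Obj by blast
    have "eventually (\<lambda>i. orth C (shift C (- i) X) Z) at_top" using X X1 by (simp add: wle_0)
    then have "eventually (\<lambda>i. orth C (shift C (- i) M2) Z) at_top"
    proof (eventually_elim)
      case (elim i)
      obtain f g h where t'': "dist_tri C (shift C (- i) X) (shift C (- i) M2) (shift C (- i) LD) f g h"
        using tri_shift[OF t'] by blast
      have "shift C (- i) LD \<in> wge 1" using wge_shift[OF LDw[of "i + 1"], of "- i"] by simp
      then have "orth C (shift C (- i) LD) Z" using tle_orth[OF Z] by simp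
      then show ?case by (rule orth_mid'[OF t'' elim _ ZO])
    qed
    then show ?thesis by (rule bounded_retract[OF shift_inv_at(2) M M2 ZO ip])
  qed
  then show ?thesis using ZO by (simp add: bounded_objs_def)
qed

text \<open>Arrows from an object of weight at least \<open>0\<close> to \<open>tle 0\<close> vanish after a shift upwards, and arrows from an
  object of weight at most \<open>0\<close> to \<open>tge 0\<close> vanish after a shift downwards.\<close>

lemma heart_bounded:
  assumes Z: "Z \<in> tle 0" "Z \<in> tge 0"
  shows "ess_bounded_below (full_sub C C0) w \<Longrightarrow> Z \<in> bounded_objs at_bot"
    "ess_bounded_above (full_sub C C0) w \<Longrightarrow> Z \<in> bounded_objs at_top"
proof -
  show "Z \<in> bounded_objs at_bot" if b: "ess_bounded_below (full_sub C C0) w"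
  proof (rule bounded_below[OF b Z(2)])
    fix Y assume Y: "Y \<in> wge 0"
    show "eventually (\<lambda>i. orth C (shift C (- i) Y) Z) at_bot"
      unfolding eventually_at_bot_linorder
    proof (intro exI[of _ "- 1"] allI impI)
      fix i :: int assume "i \<le> - 1"
      then show "orth C (shift C (- i) Y) Z" using tle_orth[OF Z(1) wge_shift[OF Y]] by simp
    qed
  qed
  show "Z \<in> bounded_objs at_top" if b: "ess_bounded_above (full_sub C C0) w"
  proof (rule bounded_above[OF b Z(1)])
    fix X assume X: "X \<in> wle 0"
    show "eventually (\<lambda>i. orth C (shift C (- i) X) Z) at_top"
      unfolding eventually_at_top_linorder
    proof (intro exI[of _ 1] allI impI)
      fix i :: int assume "i \<ge> 1"
      then show "orth C (shift C (- i) X) Z" using tge_orth[OF Z(2) wle_shift[OF X]] by simp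
    qed
  qed
qed

text \<open>Objects of weight at least \<open>0\<close> have no arrows to \<open>R'\<close> and its desuspension, so that on them \<open>L\<close> inherits
  the bounds of \<open>N\<close>. Likewise, objects of weight at most \<open>0\<close> have no arrows to the shift of \<open>L\<close>, and on
  them \<open>R'\<close> inherits the bounds of \<open>N\<close>.\<close>

lemma truncation_bounded:
  assumes L: "L \<in> tge 0" and R': "R' \<in> tle (- 1)" and t: "dist_tri C L N R' f g h"
  shows "ess_bounded_below (full_sub C C0) w \<Longrightarrow> N \<in> bounded_objs at_bot \<Longrightarrow> L \<in> bounded_objs at_bot"
    "ess_bounded_above (full_sub C C0) w \<Longrightarrow> N \<in> bounded_objs at_top \<Longrightarrow> L \<in> bounded_objs at_top"
proof -
  show "L \<in> bounded_objs at_bot" if b: "ess_bounded_below (full_sub C C0) w" and N: "N \<in> bounded_objs at_bot"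
  proof (rule bounded_below[OF b L])
    fix Y assume Y: "Y \<in> wge 0"
    have "eventually (\<lambda>i. orth C (shift C (- i) Y) N) at_bot" using N wge_C0[OF Y] by (simp add: bounded_objs_def)
    moreover have "eventually (\<lambda>i::int. i \<le> 0) at_bot" by (rule eventually_le_at_bot)
    ultimately show "eventually (\<lambda>i. orth C (shift C (- i) Y) L) at_bot"
    proof eventually_elim
      case (elim i)
      have "orth C (shift C (- i) Y) (Si R')"
        using tle_orth[OF tle_Si[OF R'] wge_shift[OF Y, of "- i"]] elim(2) by simp
      then show ?case by (rule orth_fibre[OF t _ elim(1) shift_Obj[OF wge_Obj[OF Y]]])
    qed
  qed
  show "L \<in> bounded_objs at_top" if b: "ess_bounded_above (full_sub C C0) w" and N: "N \<in> bounded_objs at_top"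
  proof -
    note tr = bounded_tri[OF shift_inv_at(2)]
    have "R' \<in> bounded_objs at_top"
    proof (rule bounded_above[OF b tle_mono[OF _ R']])
      fix X assume X: "X \<in> wle 0"
      have "eventually (\<lambda>i. orth C (shift C (- i) X) N) at_top" using N wle_C0[OF X] by (simp add: bounded_objs_def)
      moreover have "eventually (\<lambda>i::int. i \<ge> 0) at_top" by (rule eventually_ge_at_top)
      ultimately show "eventually (\<lambda>i. orth C (shift C (- i) X) R') at_top"
      proof eventually_elim
        case (elim i)
        have "orth C (shift C (- i) X) (Sh C L)"
          using tge_orth[OF tge_Sh[OF L] wle_shift[OF X, of "- i"]] elim(2) by simp
        then show ?case using orth_cone[OF t elim(1)] shift_Obj[OF wle_Obj[OF X]] by blast
      qed
    qed simp
    moreover obtain h' where "dist_tri C (Si R') L N h' f g" using unrotate[OF t] by blast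
    ultimately show ?thesis using tri_subcat_cone_mid[OF tr _ tri_subcatD(5)[OF tr] N] by blast
  qed
qed

end

locale serre_setup = weight_setup R C U C0 w
  for R :: "('r, 'k) ring_scheme" and C :: "('o, 'm, 'r, 'z) tcat_scheme" (structure)
    and U :: "'u itself" and C0 :: "'o set" and w :: "'o set \<times> 'o set" +
  fixes \<A> :: "('r, 'u) module set"
  assumes serre: "weak_serre (Rmod R) \<A>"
begin

abbreviation hom_in_A :: "'o \<Rightarrow> 'o \<Rightarrow> bool" where "hom_in_A M N \<equiv> belongs_to R (hom M N) \<A>"

definition CA :: "'o set" where "CA = sub_A R C C0 \<A>"

lemma CA_iff: "N \<in> CA \<longleftrightarrow> N \<in> Obj C \<and> (\<forall>M \<in> C0. hom_in_A M N)"
  by (simp add: CA_def sub_A_def)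

lemma hom_in_A_orth: "orth C M N \<Longrightarrow> M \<in> Obj C \<Longrightarrow> N \<in> Obj C \<Longrightarrow> hom_in_A M N"
  by (rule belongs_to_zero[OF serre hom_module]) (simp_all add: orth_def)

lemma small_hom_mod: "M \<in> C0 \<Longrightarrow> N \<in> Obj C \<Longrightarrow> small TYPE('u) (carrier (hom M N))"
  using small_hom by simp

text \<open>Closure under cones is the five-term exact sequence of \<open>C(M,-)\<close>.\<close>

lemma CA_tri: "tri_subcat C CA"
proof -
  have Sh: "Sh C X \<in> CA" if X: "X \<in> CA" for X
  proof -
    have XO: "X \<in> Obj C" using X by (simp add: CA_iff)
    have "hom_in_A M (Sh C X)" if M: "M \<in> C0" for M
    proof -
      have "hom_in_A (Si M) X" using X C0_Si[OF M] by (simp add: CA_iff)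
      then show ?thesis
        using belongs_to_iso'[OF ShA_iso[OF Si(1) XO] hom_module[OF Si(1) XO], of M] Si(2) C0_Obj[OF M] by simp
    qed
    then show ?thesis using Sh_Obj[OF XO] by (simp add: CA_iff)
  qed
  have Si: "Si X \<in> CA" if X: "X \<in> CA" for X
  proof -
    have XO: "X \<in> Obj C" using X by (simp add: CA_iff)
    have "hom_in_A M (Si X)" if M: "M \<in> C0" for M
    proof -
      have "hom_in_A (Sh C M) X" using X C0_Sh[OF M] by (simp add: CA_iff)
      then show ?thesis
        using belongs_to_iso[OF ShA_iso[OF C0_Obj[OF M] Si(1)[OF XO]]] Si(2)[OF XO] by simp
    qed
    then show ?thesis using Si(1)[OF XO] by (simp add: CA_iff)
  qed
  show ?thesis
  proof (rule tri_subcatI)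
    obtain Z where Z: "is_zero_object C Z" using zero_object_exists by blast
    then have "Z \<in> Obj C" by (simp add: is_zero_object_def)
    then have "Z \<in> CA" unfolding CA_iff using hom_in_A_orth zero_orth(1)[OF Z] C0_Obj by blast
    then show "CA \<noteq> {}" by blast
    show "iso_closed C CA" unfolding iso_closed_def
    proof (intro ballI impI)
      fix X Y assume X: "X \<in> CA" and Y: "Y \<in> Obj C" and i: "isomorphic C X Y"
      have XO: "X \<in> Obj C" using X by (simp add: CA_iff)
      have "hom_in_A M Y" if M: "M \<in> C0" for M
        using post_iso[OF i XO Y C0_Obj[OF M]] belongs_to_iso'[OF _ hom_module[OF C0_Obj[OF M] XO]] X M
        by (auto simp: CA_iff)
      then show "Y \<in> CA" using Y by (simp add: CA_iff)
    qed
    show "Z \<in> CA" if t: "dist_tri C X Y Z f g h" and X: "X \<in> CA" and Y: "Y \<in> CA" for X Y Z f g h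
    proof -
      have O: "X \<in> Obj C" "Y \<in> Obj C" "Z \<in> Obj C" using t by (auto simp: dist_tri_def)
      note t1 = rotate[OF t] and t2 = rotate[OF rotate[OF t]]
      have "hom_in_A M Z" if M: "M \<in> C0" for M
      proof -
        note MO = C0_Obj[OF M] and SO = Sh_Obj
        show ?thesis
          by (rule belongs_to_five[OF serre hom_module[OF MO O(1)] hom_module[OF MO O(2)] hom_module[OF MO O(3)]
              hom_module[OF MO SO[OF O(1)]] hom_module[OF MO SO[OF O(2)]] _ _ _ _ small_hom_mod[OF M O(3)]
              post_lin[OF tri_ar(1)[OF t] MO] post_lin[OF tri_ar(2)[OF t] MO] post_lin[OF tri_ar(3)[OF t] MO]
              post_lin[OF tri_ar(3)[OF t1] MO] exact_post[OF t MO] exact_post[OF t1 MO] exact_post[OF t2 MO]])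
            (use X Y Sh M in \<open>auto simp: CA_iff\<close>)
      qed
      then show ?thesis using O by (simp add: CA_iff)
    qed
  qed (use Sh Si in \<open>auto simp: CA_iff\<close>)
qed

text \<open>Two weight decompositions present \<open>C(M,L)\<close> as the cokernel of an arrow from \<open>C(B',L)\<close> to \<open>C(B,L)\<close>, where
  \<open>B\<close> and \<open>B'\<close> have weight at least \<open>0\<close>.\<close>

lemma CA_from_wge:
  assumes L: "L \<in> tge 0" and b: "\<And>B. B \<in> wge 0 \<Longrightarrow> hom_in_A B L"
  shows "L \<in> CA"
proof -
  note LO = tge_Obj[OF L]
  have "hom_in_A M L" if M: "M \<in> C0" for M
  proof -
    note MO = C0_Obj[OF M]
    obtain A B a b c where A: "A \<in> wle (- 1)" and B: "B \<in> wge 0" and t: "dist_tri C A M B a b c"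
      using w_dec[OF M, of "- 1"] by auto
    note AO = wle_Obj[OF A] and BO = wge_Obj[OF B]
    have "Sh C A \<in> wle 0" using wle_shift[OF A, of 1] by (simp add: shift_1)
    then obtain A' B' a' p c' where A': "A' \<in> wle (- 1)" and B': "B' \<in> wge 0" and t': "dist_tri C A' (Sh C A) B' a' p c'"
      using w_dec[OF wle_C0, of "Sh C A" 0 "- 1"] by auto
    note B'O = wge_Obj[OF B']
    have oA: "orth C A L" and oA': "orth C A' L" using tge_orth[OF L A] tge_orth[OF L A'] by auto
    have pc: "ar (p \<cdot> c) B B'" using tri_ar(3)[OF t] tri_ar(2)[OF t'] by (rule ar_Cmp)
    \<comment> \<open>precomposing with \<open>p\<close> loses no arrows, because those from \<open>Sh C A\<close> to \<open>L\<close> extend to \<open>B'\<close>\<close>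
    have e1: "exact_at (\<lambda>x. x \<cdot> (p \<cdot> c)) (hom B' L) (hom B L) (hom M L) (\<lambda>x. x \<cdot> b)"
    proof -
      have "(\<lambda>x. x \<cdot> (p \<cdot> c)) ` Hom C B' L = (\<lambda>x. x \<cdot> c) ` Hom C (Sh C A) L"
      proof
        show "(\<lambda>x. x \<cdot> (p \<cdot> c)) ` Hom C B' L \<subseteq> (\<lambda>x. x \<cdot> c) ` Hom C (Sh C A) L"
        proof
          fix y assume "y \<in> (\<lambda>x. x \<cdot> (p \<cdot> c)) ` Hom C B' L"
          then obtain x where x: "ar x B' L" "y = x \<cdot> (p \<cdot> c)" using B'O LO by (auto simp: ar_def)
          have "y = (x \<cdot> p) \<cdot> c" using assoc[OF tri_ar(3)[OF t] tri_ar(2)[OF t'] x(1)] x(2) by simp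
          then show "y \<in> (\<lambda>x. x \<cdot> c) ` Hom C (Sh C A) L"
            using arD(3)[OF ar_Cmp[OF tri_ar(2)[OF t'] x(1)]] by blast
        qed
        show "(\<lambda>x. x \<cdot> c) ` Hom C (Sh C A) L \<subseteq> (\<lambda>x. x \<cdot> (p \<cdot> c)) ` Hom C B' L"
        proof
          fix y assume "y \<in> (\<lambda>x. x \<cdot> c) ` Hom C (Sh C A) L"
          then obtain x where x: "ar x (Sh C A) L" "y = x \<cdot> c" using AO Sh_Obj LO by (auto simp: ar_def)
          obtain x' where x': "ar x' B' L" "x' \<cdot> p = x"
            using tri_extend[OF t' x(1) orthD[OF oA' ar_Cmp[OF tri_ar(1)[OF t'] x(1)]]] by blast
          have "y = x' \<cdot> (p \<cdot> c)" using assoc[OF tri_ar(3)[OF t] tri_ar(2)[OF t'] x'(1)] x'(2) x(2) by simp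
          then show "y \<in> (\<lambda>x. x \<cdot> (p \<cdot> c)) ` Hom C B' L" using arD(3)[OF x'(1)] by blast
        qed
      qed
      then show ?thesis using exact_pre[OF rotate[OF t] LO] by (simp add: exact_at_def)
    qed
    show ?thesis
      by (rule belongs_to_five[OF serre hom_module[OF B'O LO] hom_module[OF BO LO] hom_module[OF MO LO]
          hom_module[OF AO LO] hom_module[OF AO LO] assms(2)[OF B'] assms(2)[OF B] hom_in_A_orth[OF oA AO LO] hom_in_A_orth[OF oA AO LO]
          small_hom_mod[OF M LO] pre_lin[OF pc LO] pre_lin[OF tri_ar(2)[OF t] LO] pre_lin[OF tri_ar(1)[OF t] LO] id_lin
          e1 exact_pre[OF t LO] exact_into_zero[OF oA pre_lin[OF tri_ar(1)[OF t] LO] hom_module[OF MO LO] AO LO]])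
  qed
  then show ?thesis using LO by (simp add: CA_iff)
qed

text \<open>On arrows from an object \<open>B\<close> of weight at least \<open>0\<close> the truncation \<open>l\<close> is bijective, because \<open>B\<close> has no
  arrows to \<open>R'\<close> and its desuspension.\<close>

lemma truncation_CA:
  assumes N: "N \<in> CA" and L: "L \<in> tge 0" and R': "R' \<in> tle (- 1)" and t: "dist_tri C L N R' l r d"
  shows "L \<in> CA"
proof (rule CA_from_wge[OF L])
  fix B assume B: "B \<in> wge 0"
  note BO = wge_Obj[OF B] and LO = tge_Obj[OF L]
  have NO: "N \<in> Obj C" using N by (simp add: CA_iff)
  have o: "orth C B R'" using tle_orth[OF R' B] by simp
  have "Sh C B \<in> wge 1" using wge_shift[OF B, of 1] by (simp add: shift_1)
  then have o': "orth C (Sh C B) R'" using tle_orth[OF R'] by simp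
  have "inj_on (\<lambda>x. l \<cdot> x) (carrier (hom B L))"
  proof (rule lin_map_inj[OF post_lin[OF tri_ar(1)[OF t] BO] hom_module[OF BO LO] hom_module[OF BO NO]])
    fix x assume "x \<in> carrier (hom B L)" "l \<cdot> x = \<zero>\<^bsub>hom B N\<^esub>"
    then have x: "ar x B L" "l \<cdot> x = hzero C B N" using BO LO by (auto simp: ar_def)
    obtain v where v: "ar v (Sh C B) R'" "d \<cdot> v = ShA C x" using Si_lift[OF t x] by blast
    have "ShA C x = hzero C (Sh C B) (Sh C L)"
      using v orthD[OF o' v(1)] cmp_zero_right[OF tri_ar(3)[OF t] Sh_Obj[OF BO]] by simp
    then show "x = \<zero>\<^bsub>hom B L\<^esub>" using ShA_zero_iff[OF x(1)] by simp
  qed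
  moreover have "(\<lambda>x. l \<cdot> x) ` Hom C B L = Hom C B N"
  proof
    show "(\<lambda>x. l \<cdot> x) ` Hom C B L \<subseteq> Hom C B N" using lin_mapD(1)[OF post_lin[OF tri_ar(1)[OF t] BO]] by auto
    show "Hom C B N \<subseteq> (\<lambda>x. l \<cdot> x) ` Hom C B L"
    proof
      fix y assume "y \<in> Hom C B N"
      then have y: "ar y B N" using BO NO by (simp add: ar_def)
      obtain v where "ar v B L" "l \<cdot> v = y"
        using tri_lift[OF t y orthD[OF o ar_Cmp[OF y tri_ar(2)[OF t]]]] by blast
      then show "y \<in> (\<lambda>x. l \<cdot> x) ` Hom C B L" using arD(3) by blast
    qed
  qed
  ultimately have "(\<lambda>x. l \<cdot> x) \<in> mod_iso R (hom B L) (hom B N)"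
    by (intro mod_isoI post_lin[OF tri_ar(1)[OF t] BO]) (simp add: bij_betw_def)
  moreover have "hom_in_A B N" using N wge_C0[OF B] by (simp add: CA_iff)
  ultimately show "hom_in_A B L" by (rule belongs_to_iso)
qed

text \<open>For \<open>B\<close> of weight at least \<open>0\<close>, two weight decompositions present \<open>C(B,N)\<close> as the kernel of an arrow from
  \<open>C(X,N)\<close> to \<open>C(X',N)\<close>, where \<open>X\<close> and \<open>X'\<close> lie in the heart of the weight structure.\<close>

lemma CA_from_heart:
  assumes N: "N \<in> tle 0" "N \<in> tge 0" and b: "\<And>Q. Q \<in> heart w \<Longrightarrow> hom_in_A Q N"
  shows "N \<in> CA"
proof (rule CA_from_wge[OF N(2)])
  note NO = tle_Obj[OF N(1)]
  have b': "hom_in_A Q N" if "Q \<in> wle 0 \<inter> wge 0" for Q using that b by (simp add: heart_def wle_0 wge_0)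
  fix B assume B: "B \<in> wge 0"
  note BO = wge_Obj[OF B]
  obtain X Y x y z where X: "X \<in> wle 0 \<inter> wge 0" and Y: "Y \<in> wge 1" and t: "dist_tri C X B Y x y z"
    using wge_dec[OF B] by auto
  have XO: "X \<in> Obj C" using X wle_Obj by blast
  note YO = wge_Obj[OF Y]
  have "Si Y \<in> wge 0" using wge_shift[OF Y, of "- 1"] by (simp add: shift_m1)
  then obtain X' Y' x' y' z' where X': "X' \<in> wle 0 \<inter> wge 0" and Y': "Y' \<in> wge 1" and t': "dist_tri C X' (Si Y) Y' x' y' z'"
    using wge_dec[of "Si Y" 0] by auto
  have X'O: "X' \<in> Obj C" using X' wle_Obj by blast
  obtain k where tk: "dist_tri C (Si Y) X B k x y" using unrotate[OF t] by blast
  have oY: "orth C Y N" "orth C Y' N" using tle_orth[OF N(1) Y] tle_orth[OF N(1) Y'] by auto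
  have kx: "ar (k \<cdot> x') X' X" using tri_ar(1)[OF t'] tri_ar(1)[OF tk] by (rule ar_Cmp)
  \<comment> \<open>an arrow from \<open>Si Y\<close> to \<open>N\<close> is determined by its restriction to \<open>X'\<close>, as \<open>Y'\<close> has no arrows to \<open>N\<close>\<close>
  have e3: "exact_at (\<lambda>u. u \<cdot> x) (hom B N) (hom X N) (hom X' N) (\<lambda>u. u \<cdot> (k \<cdot> x'))"
    unfolding exact_at_def
  proof
    fix u assume uu: "u \<in> carrier (hom X N)"
    then have u: "ar u X N" using XO NO by (simp add: ar_def)
    have uk: "ar (u \<cdot> k) (Si Y) N" using ar_Cmp[OF tri_ar(1)[OF tk] u] .
    have "u \<cdot> (k \<cdot> x') = hzero C X' N \<longleftrightarrow> u \<cdot> k = hzero C (Si Y) N"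
    proof
      assume "u \<cdot> (k \<cdot> x') = hzero C X' N"
      then have "(u \<cdot> k) \<cdot> x' = hzero C X' N" using assoc[OF tri_ar(1)[OF t'] tri_ar(1)[OF tk] u] by simp
      then obtain v where v: "ar v Y' N" "v \<cdot> y' = u \<cdot> k" using tri_extend[OF t' uk] by blast
      then show "u \<cdot> k = hzero C (Si Y) N"
        using orthD[OF oY(2) v(1)] cmp_zero_left[OF tri_ar(2)[OF t'] NO] by simp
    next
      assume "u \<cdot> k = hzero C (Si Y) N"
      then show "u \<cdot> (k \<cdot> x') = hzero C X' N"
        using assoc[OF tri_ar(1)[OF t'] tri_ar(1)[OF tk] u] cmp_zero_left[OF tri_ar(1)[OF t'] NO] by simp
    qed
    then show "u \<cdot> (k \<cdot> x') = \<zero>\<^bsub>hom X' N\<^esub> \<longleftrightarrow> u \<in> (\<lambda>u. u \<cdot> x) ` carrier (hom B N)"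
      using exact_pre[OF tk NO] uu by (simp add: exact_at_def)
  qed
  show "hom_in_A B N"
    by (rule belongs_to_five[OF serre hom_module[OF YO NO] hom_module[OF YO NO] hom_module[OF BO NO]
        hom_module[OF XO NO] hom_module[OF X'O NO] hom_in_A_orth[OF oY(1) YO NO] hom_in_A_orth[OF oY(1) YO NO] b'[OF X] b'[OF X']
        small_hom_mod[OF wge_C0[OF B] NO] id_lin pre_lin[OF tri_ar(2)[OF t] NO] pre_lin[OF tri_ar(1)[OF t] NO] pre_lin[OF kx NO]
        exact_id[OF oY(1) pre_lin[OF tri_ar(2)[OF t] NO] hom_module[OF BO NO] YO NO] exact_pre[OF t NO] e3])
qed

lemma tri_subcat_inter: assumes "tri_subcat C S" "tri_subcat C T" shows "tri_subcat C (S \<inter> T)"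
proof (rule tri_subcatI)
  show "iso_closed C (S \<inter> T)" using tri_subcatD(3)[OF assms(1)] tri_subcatD(3)[OF assms(2)]
    unfolding iso_closed_def by blast
  obtain Z where Z: "is_zero_object C Z" using zero_object_exists by blast
  have "Z \<in> S" if S: "tri_subcat C S" for S
  proof -
    obtain X where X: "X \<in> S" using tri_subcatD(2)[OF S] by blast
    have "dist_tri C X X Z (Idn C X) (hzero C X Z) (hzero C Z (Sh C X))"
      using TR1_id[OF _ Z] X tri_subcatD(1)[OF S] by blast
    then show ?thesis using tri_subcatD(6)[OF S] X by blast
  qed
  then show "S \<inter> T \<noteq> {}" using assms by blast
  show "Z \<in> S \<inter> T" if "dist_tri C X Y Z f g h" "X \<in> S \<inter> T" "Y \<in> S \<inter> T" for X Y Z f g h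
    using tri_subcatD(6)[OF assms(1) that(1)] tri_subcatD(6)[OF assms(2) that(1)] that(2,3) by blast
qed (use tri_subcatD(1,4,5)[OF assms(1)] tri_subcatD(1,4,5)[OF assms(2)] in auto)

lemma t_restricts_CA: "t_restricts C (tle 0, tge 0) CA"
  unfolding t_restricts_def using CA_tri t_structure_restriction[OF CA_tri] truncation_CA by blast

lemma t_restricts_bounded:
  assumes F: "shift_inv F"
    and tr: "\<And>N L R' f g h. L \<in> tge 0 \<Longrightarrow> R' \<in> tle (- 1) \<Longrightarrow> dist_tri C L N R' f g h \<Longrightarrow> N \<in> bounded_objs F \<Longrightarrow> L \<in> bounded_objs F"
  shows "t_restricts (full_sub C CA) (t_restriction (tle 0, tge 0) CA) (CA \<inter> bounded_objs F)"
proof -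
  have S: "tri_subcat C (CA \<inter> bounded_objs F)" by (rule tri_subcat_inter[OF CA_tri bounded_tri[OF F]])
  have 1: "tri_subcat (full_sub C CA) (CA \<inter> bounded_objs F)" by (rule tri_subcat_full_sub[OF S CA_tri]) simp
  have "t_structure (full_sub C (CA \<inter> bounded_objs F)) (t_restriction (tle 0, tge 0) (CA \<inter> bounded_objs F))"
    by (rule t_structure_restriction[OF S]) (use tr truncation_CA in blast)
  moreover have "t_restriction (t_restriction (tle 0, tge 0) CA) (CA \<inter> bounded_objs F) = t_restriction (tle 0, tge 0) (CA \<inter> bounded_objs F)"
    by (auto simp: t_restriction_def)
  ultimately show ?thesis using 1 by (simp add: t_restricts_def)
qed

definition HA :: "'o set" where "HA = tle 0 \<inter> tge 0 \<inter> CA"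

text \<open>By \<open>heart_bounded\<close> the assumption holds for each direction in which \<open>w\<close> is essentially bounded, so the
  restrictions in question share one heart.\<close>

lemma heart_bounded_HA:
  assumes "\<And>Z. Z \<in> tle 0 \<Longrightarrow> Z \<in> tge 0 \<Longrightarrow> Z \<in> bounded_objs F"
  shows "heart (t_restriction (t_restriction (tle 0, tge 0) CA) (CA \<inter> bounded_objs F)) = HA"
  using assms by (auto simp: heart_def t_restriction_def HA_def)

end

section \<open>The heart of the orthogonal t-structure\<close>

lemma iso_from_kernels:
  assumes f: "f \<in> lin_map R M N" and g: "g \<in> lin_map R M P"
    and M: "module R M" and N: "module R N" and P: "module R P"
    and fs: "f ` carrier M = carrier N" and gs: "g ` carrier M = carrier P"
    and k: "\<And>x. x \<in> carrier M \<Longrightarrow> g x = \<zero>\<^bsub>P\<^esub> \<longleftrightarrow> f x = \<zero>\<^bsub>N\<^esub>"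
  shows "\<exists>\<psi> \<in> mod_iso R P N. \<forall>x \<in> carrier M. \<psi> (g x) = f x"
proof -
  have sur: "carrier P = g ` carrier M" and k': "\<And>x. x \<in> carrier M \<Longrightarrow> g x = \<zero>\<^bsub>P\<^esub> \<Longrightarrow> f x = \<zero>\<^bsub>N\<^esub>"
    using gs k by auto
  obtain \<psi> where l: "\<psi> \<in> lin_map R P N" and \<psi>: "\<And>x. x \<in> carrier M \<Longrightarrow> \<psi> (g x) = f x"
    using lin_map_factor[OF f g M N P sur k'] by blast
  have lift: "\<exists>x \<in> carrier M. z = g x" if "z \<in> carrier P" for z using that gs by auto
  have "bij_betw \<psi> (carrier P) (carrier N)" unfolding bij_betw_def
  proof
    show "inj_on \<psi> (carrier P)"
    proof (rule lin_map_inj[OF l P N])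
      fix x assume "x \<in> carrier P" "\<psi> x = \<zero>\<^bsub>N\<^esub>"
      then show "x = \<zero>\<^bsub>P\<^esub>" using lift \<psi> k by metis
    qed
    show "\<psi> ` carrier P = carrier N"
    proof
      show "\<psi> ` carrier P \<subseteq> carrier N" using lin_mapD(1)[OF l] by auto
      show "carrier N \<subseteq> \<psi> ` carrier P"
      proof
        fix y assume "y \<in> carrier N"
        then obtain x where "x \<in> carrier M" "y = f x" using fs by auto
        then show "y \<in> \<psi> ` carrier P" using \<psi>[of x] lin_mapD(1)[OF g] by (metis imageI)
      qed
    qed
  qed
  then show ?thesis using l \<psi> by (auto simp: mod_iso_def)
qed

context weight_setup
begin

definition HW :: "'o set" where "HW = wle 0 \<inter> wge 0"

lemma HW_heart: "HW = heart w" by (simp add: HW_def heart_def wle_0 wge_0)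

lemma HW_C0: "Q \<in> HW \<Longrightarrow> Q \<in> C0" and HW_Obj: "Q \<in> HW \<Longrightarrow> Q \<in> Obj C"
  using wle_C0 wle_Obj by (auto simp: HW_def)

lemma HW_compact: "Q \<in> HW \<Longrightarrow> Q \<in> compact_objects TYPE('u) C"
  using HW_C0 C0_compact by blast

lemma HW_iso: "X \<in> HW \<Longrightarrow> Y \<in> C0 \<Longrightarrow> isomorphic C X Y \<Longrightarrow> Y \<in> HW"
  using wle_iso wge_iso unfolding HW_def by blast

lemma HW_orth_tge1: "Q \<in> HW \<Longrightarrow> Z \<in> tge 1 \<Longrightarrow> orth C Q Z"
  using tge_orth[of Z 1 Q 0] by (simp add: HW_def)

text \<open>An object of weight at most \<open>0\<close> is an extension of an object of \<open>HW\<close> by one of weight at most \<open>-1\<close>.\<close>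

lemma tge1I:
  assumes Z: "Z \<in> tge 0" and o: "\<And>Q. Q \<in> HW \<Longrightarrow> orth C Q Z"
  shows "Z \<in> tge 1"
proof -
  note ZO = tge_Obj[OF Z]
  have "orth C A Z" if A: "A \<in> wle 0" for A
  proof -
    obtain X Y f g h where X: "X \<in> wle (- 1)" and Y: "Y \<in> HW" and t: "dist_tri C X A Y f g h"
      using wle_dec[OF A] by (auto simp: HW_def)
    show ?thesis using orth_mid'[OF t] tge_orth[OF Z X] o[OF Y] ZO by simp
  qed
  then show ?thesis using ZO by (simp add: tge_def)
qed

text \<open>An arrow from an object of \<open>HW\<close> to the cone \<open>Z\<close> of a cover lifts to \<open>K\<close>, hence to \<open>G\<close>, and so it vanishes.
  This is why \<open>Z\<close> lies in \<open>tge 1\<close>.\<close>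

lemma cover_HW:
  assumes K: "K \<in> tge 0"
  obtains I G \<iota> \<epsilon> Z g h where "small TYPE('u) (I :: ('o \<times> 'm) set)"
    and "\<And>P x. (P, x) \<in> I \<Longrightarrow> P \<in> HW" and "\<And>P x. (P, x) \<in> I \<Longrightarrow> ar x P K"
    and "is_coproduct C I fst G \<iota>" and "\<And>P x. (P, x) \<in> I \<Longrightarrow> \<epsilon> \<cdot> \<iota> (P, x) = x"
    and "\<And>Q q. Q \<in> HW \<Longrightarrow> ar q Q K \<Longrightarrow> \<exists>P x e. (P, x) \<in> I \<and> ar e Q P \<and> q = x \<cdot> e"
    and "dist_tri C G K Z \<epsilon> g h" and "Z \<in> tge 1"
proof -
  note KO = tge_Obj[OF K]
  have 1: "HW \<subseteq> C0" using HW_C0 by blast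
  have "\<exists>(I :: ('o \<times> 'm) set) G \<iota> \<epsilon>. small TYPE('u) I \<and> (\<forall>P x. (P, x) \<in> I \<longrightarrow> P \<in> HW \<and> ar x P K) \<and>
    is_coproduct C I fst G \<iota> \<and> ar \<epsilon> G K \<and> (\<forall>P x. (P, x) \<in> I \<longrightarrow> \<epsilon> \<cdot> \<iota> (P, x) = x) \<and>
    (\<forall>Q \<in> HW. \<forall>q. ar q Q K \<longrightarrow> (\<exists>P x e. (P, x) \<in> I \<and> ar e Q P \<and> q = x \<cdot> e)) \<and>
    (\<forall>Q \<in> HW. \<forall>q. ar q Q K \<longrightarrow> (\<exists>q'. ar q' Q G \<and> \<epsilon> \<cdot> q' = q))"
    by (rule cover[OF 1 _ KO]) (rule HW_iso)
  then show ?thesis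
  proof (elim exE conjE)
    fix I :: "('o \<times> 'm) set" and G \<iota> \<epsilon>
    assume I: "small TYPE('u) I" "\<forall>P x. (P, x) \<in> I \<longrightarrow> P \<in> HW \<and> ar x P K"
      and c: "is_coproduct C I fst G \<iota>" and \<epsilon>: "ar \<epsilon> G K" "\<forall>P x. (P, x) \<in> I \<longrightarrow> \<epsilon> \<cdot> \<iota> (P, x) = x"
      and cov1: "\<forall>Q \<in> HW. \<forall>q. ar q Q K \<longrightarrow> (\<exists>P x e. (P, x) \<in> I \<and> ar e Q P \<and> q = x \<cdot> e)"
      and cov2: "\<forall>Q \<in> HW. \<forall>q. ar q Q K \<longrightarrow> (\<exists>q'. ar q' Q G \<and> \<epsilon> \<cdot> q' = q)"
    have G: "G \<in> tge 0" by (rule tge_coproduct[OF I(1) c]) (use I(2) wge_tge in \<open>auto simp: HW_def\<close>)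
    obtain Z g h where t: "dist_tri C G K Z \<epsilon> g h" using TR1_cone[OF tge_Obj[OF G] KO arD(3)[OF \<epsilon>(1)]] by blast
    note a = tri_ar[OF t]
    have Z: "Z \<in> tge 0" by (rule tge_cone[OF t K tge_mono[OF _ G]]) simp
    note ZO = tge_Obj[OF Z]
    have "Z \<in> tge 1"
    proof (rule tge1I[OF Z])
      fix Q assume Q: "Q \<in> HW"
      show "orth C Q Z"
      proof (rule orthI[OF HW_Obj[OF Q] ZO])
        fix q assume q: "ar q Q Z"
        have "orth C Q (Sh C G)" using HW_orth_tge1[OF Q] tge_Sh[OF G] by simp
        then obtain q1 where q1: "ar q1 Q K" "g \<cdot> q1 = q" using tri_lift2[OF t q] orthD ar_Cmp[OF q a(3)] by blast
        obtain q2 where q2: "ar q2 Q G" "\<epsilon> \<cdot> q2 = q1" using cov2 Q q1(1) by blast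
        show "q = hzero C Q Z"
          using q1 q2 assoc[OF q2(1) a(1,2)] tri_comp_zero[OF t] cmp_zero_left[OF q2(1) ZO] by simp
      qed
    qed
    then show ?thesis using that[OF I(1) _ _ c _ _ t] I(2) \<epsilon>(2) cov1 by blast
  qed
qed

text \<open>The arrow \<open>f\<close> vanishes on a cover of \<open>K\<close>, so it factors through the cone of the cover. The cone lies in
  \<open>tge 1\<close> and has no arrows to \<open>tle 0\<close>.\<close>

lemma HW_detect_zero:
  assumes K: "K \<in> tge 0" and N: "N \<in> tle 0" and f: "ar f K N"
    and z: "\<And>Q q. Q \<in> HW \<Longrightarrow> ar q Q K \<Longrightarrow> f \<cdot> q = hzero C Q N"
  shows "f = hzero C K N"
proof (rule cover_HW[OF K])
  note NO = tle_Obj[OF N]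
  fix I :: "('o \<times> 'm) set" and G \<iota> \<epsilon> Z g h
  assume I: "\<And>P x. (P, x) \<in> I \<Longrightarrow> P \<in> HW" "\<And>P x. (P, x) \<in> I \<Longrightarrow> ar x P K"
    and c: "is_coproduct C I fst G \<iota>" and \<epsilon>\<iota>: "\<And>P x. (P, x) \<in> I \<Longrightarrow> \<epsilon> \<cdot> \<iota> (P, x) = x"
    and t: "dist_tri C G K Z \<epsilon> g h" and Z: "Z \<in> tge 1"
  note a = tri_ar[OF t]
  have "f \<cdot> \<epsilon> = hzero C G N"
  proof (rule coproduct_eq[OF c ar_Cmp[OF a(1) f] ar_zero[OF arD(1)[OF a(1)] NO]])
    fix i assume i: "i \<in> I"
    obtain P x where ix: "i = (P, x)" by fastforce
    have \<iota>: "ar (\<iota> i) P G" using coproduct_ar[OF c i] ix by simp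
    have "(f \<cdot> \<epsilon>) \<cdot> \<iota> i = f \<cdot> x" using assoc[OF \<iota> a(1) f] \<epsilon>\<iota> i ix by simp
    also have "\<dots> = hzero C P N" using z I i ix by blast
    finally show "(f \<cdot> \<epsilon>) \<cdot> \<iota> i = hzero C G N \<cdot> \<iota> i" using cmp_zero_left[OF \<iota> NO] by simp
  qed
  then obtain v where v: "ar v Z N" "v \<cdot> g = f" using tri_extend[OF t f] by blast
  show ?thesis using v orthD[OF t_orth[OF Z N] v(1)] cmp_zero_left[OF a(2) NO] by simp
qed

lemma HW_faithful:
  assumes N: "N \<in> tge 0" and N': "N' \<in> tle 0" and g: "ar g N N'" "ar g' N N'"
    and e: "\<And>Q x. Q \<in> HW \<Longrightarrow> ar x Q N \<Longrightarrow> g \<cdot> x = g' \<cdot> x"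
  shows "g = g'"
proof (rule eq_diff[OF g])
  show "hadd C g (hneg N N' g') = hzero C N N'"
  proof (rule HW_detect_zero[OF N N' ar_add[OF g(1) ar_neg[OF g(2)]]])
    fix Q q assume Q: "Q \<in> HW" and q: "ar q Q N"
    show "hadd C g (hneg N N' g') \<cdot> q = hzero C Q N'"
      unfolding cmp_diff_left[OF q g] e[OF Q q] by (rule add_neg[OF ar_Cmp[OF q g(2)]])
  qed
qed

text \<open>The transformation \<open>\<theta>\<close> defines an arrow \<open>\<epsilon>'\<close> on a cover \<open>\<epsilon>\<close> of \<open>N\<close>. By compactness \<open>\<epsilon>' \<cdot> y = \<theta> (\<epsilon> \<cdot> y)\<close> for all
  arrows \<open>y\<close> from \<open>HW\<close> to the cover. So \<open>\<epsilon>'\<close> kills all arrows from \<open>HW\<close> to the fibre of \<open>\<epsilon>\<close>, hence the fibre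
  itself, and it descends to \<open>N\<close>.\<close>

lemma HW_full:
  assumes N: "N \<in> tge 0" "N \<in> tle 0" and N': "N' \<in> tle 0"
    and \<theta>: "\<And>Q x. Q \<in> HW \<Longrightarrow> ar x Q N \<Longrightarrow> ar (\<theta> Q x) Q N'"
    and \<theta>_add: "\<And>Q x y. Q \<in> HW \<Longrightarrow> ar x Q N \<Longrightarrow> ar y Q N \<Longrightarrow> \<theta> Q (hadd C x y) = hadd C (\<theta> Q x) (\<theta> Q y)"
    and \<theta>_nat: "\<And>Q Q' x f. Q \<in> HW \<Longrightarrow> Q' \<in> HW \<Longrightarrow> ar x Q N \<Longrightarrow> ar f Q' Q \<Longrightarrow> \<theta> Q' (x \<cdot> f) = \<theta> Q x \<cdot> f"
  shows "\<exists>g. ar g N N' \<and> (\<forall>Q \<in> HW. \<forall>x. ar x Q N \<longrightarrow> g \<cdot> x = \<theta> Q x)"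
proof (rule cover_HW[OF N(1)])
  note NO = tge_Obj[OF N(1)] and N'O = tle_Obj[OF N']
  fix I :: "('o \<times> 'm) set" and G \<iota> \<epsilon> Z g0 h0
  assume I: "small TYPE('u) I" "\<And>P x. (P, x) \<in> I \<Longrightarrow> P \<in> HW" "\<And>P x. (P, x) \<in> I \<Longrightarrow> ar x P N"
    and c: "is_coproduct C I fst G \<iota>" and \<epsilon>\<iota>: "\<And>P x. (P, x) \<in> I \<Longrightarrow> \<epsilon> \<cdot> \<iota> (P, x) = x"
    and cov: "\<And>Q q. Q \<in> HW \<Longrightarrow> ar q Q N \<Longrightarrow> \<exists>P x e. (P, x) \<in> I \<and> ar e Q P \<and> q = x \<cdot> e"
    and t: "dist_tri C G N Z \<epsilon> g0 h0" and Z: "Z \<in> tge 1"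
  note a = tri_ar[OF t]
  have \<theta>0: "\<theta> Q (hzero C Q N) = hzero C Q N'" if Q: "Q \<in> HW" for Q
  proof (rule add_idem[OF \<theta>[OF Q]])
    note z = ar_zero[OF HW_Obj[OF Q] NO]
    show "ar (hzero C Q N) Q N" by (rule z)
    show "hadd C (\<theta> Q (hzero C Q N)) (\<theta> Q (hzero C Q N)) = \<theta> Q (hzero C Q N)"
      using \<theta>_add[OF Q z z] add_zero(1)[OF z] by simp
  qed
  have "ar (\<theta> (fst i) (snd i)) (fst i) N'" if "i \<in> I" for i
    using \<theta>[OF I(2) I(3), of "fst i" "snd i" "snd i"] that by simp
  then obtain \<epsilon>' where \<epsilon>': "ar \<epsilon>' G N'" "\<And>i. i \<in> I \<Longrightarrow> \<epsilon>' \<cdot> \<iota> i = \<theta> (fst i) (snd i)"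
    using coproduct_map[OF c N'O, of "\<lambda>i. \<theta> (fst i) (snd i)"] by blast
  have key: "\<epsilon>' \<cdot> y = \<theta> Q (\<epsilon> \<cdot> y)" if Q: "Q \<in> HW" and y: "ar y Q G" for Q y
  proof (rule compact_induct[OF HW_compact[OF Q] I(1) c y, of "\<lambda>y. \<epsilon>' \<cdot> y = \<theta> Q (\<epsilon> \<cdot> y)"])
    note QO = HW_Obj[OF Q]
    show "\<epsilon>' \<cdot> hzero C Q G = \<theta> Q (\<epsilon> \<cdot> hzero C Q G)"
      using cmp_zero_right[OF \<epsilon>'(1) QO] cmp_zero_right[OF a(1) QO] \<theta>0[OF Q] by simp
    fix u v assume uv: "ar u Q G" "ar v Q G" "\<epsilon>' \<cdot> u = \<theta> Q (\<epsilon> \<cdot> u)" "\<epsilon>' \<cdot> v = \<theta> Q (\<epsilon> \<cdot> v)"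
    show "\<epsilon>' \<cdot> hadd C u v = \<theta> Q (\<epsilon> \<cdot> hadd C u v)"
      using uv cmp_add_right[OF uv(1,2) \<epsilon>'(1)] cmp_add_right[OF uv(1,2) a(1)]
        \<theta>_add[OF Q ar_Cmp[OF uv(1) a(1)] ar_Cmp[OF uv(2) a(1)]] by simp
  next
    fix i u assume i: "i \<in> I" and u: "ar u Q (fst i)"
    obtain P x where ix: "i = (P, x)" by fastforce
    have \<iota>: "ar (\<iota> i) (fst i) G" using coproduct_ar[OF c i] .
    have P: "P \<in> HW" "ar x P N" using I i ix by auto
    have "\<epsilon>' \<cdot> (\<iota> i \<cdot> u) = \<theta> P x \<cdot> u" using assoc[OF u \<iota> \<epsilon>'(1)] \<epsilon>'(2)[OF i] ix by simp
    moreover have "\<epsilon> \<cdot> (\<iota> i \<cdot> u) = x \<cdot> u" using assoc[OF u \<iota> a(1)] \<epsilon>\<iota> i ix by simp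
    ultimately show "\<epsilon>' \<cdot> (\<iota> i \<cdot> u) = \<theta> Q (\<epsilon> \<cdot> (\<iota> i \<cdot> u))" using \<theta>_nat[OF P(1) Q P(2)] u ix by simp
  qed
  obtain k where tk: "dist_tri C (Si Z) G N k \<epsilon> g0" using unrotate[OF t] by blast
  note k = tri_ar(1)[OF tk]
  have K: "Si Z \<in> tge 0" using tge_Si[OF Z] by simp
  have "\<epsilon>' \<cdot> k = hzero C (Si Z) N'"
  proof (rule HW_detect_zero[OF K N' ar_Cmp[OF k \<epsilon>'(1)]])
    fix Q q assume Q: "Q \<in> HW" and q: "ar q Q (Si Z)"
    have "\<epsilon> \<cdot> (k \<cdot> q) = hzero C Q N"
      using assoc[OF q k a(1)] tri_comp_zero[OF tk] cmp_zero_left[OF q NO] by simp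
    then show "\<epsilon>' \<cdot> k \<cdot> q = hzero C Q N'"
      using key[OF Q ar_Cmp[OF q k]] assoc[OF q k \<epsilon>'(1)] \<theta>0[OF Q] by simp
  qed
  then obtain g where g: "ar g N N'" "g \<cdot> \<epsilon> = \<epsilon>'" using tri_extend[OF tk \<epsilon>'(1)] by blast
  have "g \<cdot> x = \<theta> Q x" if Q: "Q \<in> HW" and x: "ar x Q N" for Q x
  proof -
    obtain P x0 e where e: "(P, x0) \<in> I" "ar e Q P" "x = x0 \<cdot> e" using cov[OF Q x] by blast
    have \<iota>: "ar (\<iota> (P, x0)) P G" using coproduct_ar[OF c e(1)] by simp
    have "g \<cdot> x0 = \<theta> P x0"
      using assoc[OF \<iota> a(1) g(1)] \<epsilon>\<iota>[OF e(1)] g(2) \<epsilon>'(2)[OF e(1)] by simp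
    then show ?thesis
      using assoc[OF e(2) I(3)[OF e(1)] g(1)] \<theta>_nat[OF I(2)[OF e(1)] Q I(3)[OF e(1)] e(2)] e(3) by simp
  qed
  then show ?thesis using g(1) by blast
qed

text \<open>The functor is presented by representable ones: \<open>G\<close> is the coproduct of a representing object for each
  element of each value, and \<open>G1\<close> covers the relations. On \<open>HW\<close> the cone \<open>E\<close> of \<open>G1 \<rightarrow> G\<close> has the
  prescribed values, as \<open>HW\<close> has no arrows to the shift of \<open>G1\<close>. The truncation \<open>N\<close> of \<open>E\<close> has the same
  values on \<open>HW\<close> and lies in the heart.\<close>

lemma HW_represent:
  fixes Fm :: "'o \<Rightarrow> ('r, 'u) module" and Fa :: "'m \<Rightarrow> 'u \<Rightarrow> 'u"
  assumes fm: "\<And>Q. Q \<in> HW \<Longrightarrow> module R (Fm Q)" and fs: "\<And>Q. Q \<in> HW \<Longrightarrow> small TYPE('u) (carrier (Fm Q))"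
    and fl: "\<And>Q Q' f. Q \<in> HW \<Longrightarrow> Q' \<in> HW \<Longrightarrow> ar f Q' Q \<Longrightarrow> Fa f \<in> lin_map R (Fm Q) (Fm Q')"
    and fid: "\<And>Q x. Q \<in> HW \<Longrightarrow> x \<in> carrier (Fm Q) \<Longrightarrow> Fa (Idn C Q) x = x"
    and fc: "\<And>Q1 Q2 Q3 f g x. Q1 \<in> HW \<Longrightarrow> Q2 \<in> HW \<Longrightarrow> Q3 \<in> HW \<Longrightarrow> ar f Q1 Q2 \<Longrightarrow> ar g Q2 Q3 \<Longrightarrow>
      x \<in> carrier (Fm Q3) \<Longrightarrow> Fa (g \<cdot> f) x = Fa f (Fa g x)"
    and fa: "\<And>Q Q' f g x. Q \<in> HW \<Longrightarrow> Q' \<in> HW \<Longrightarrow> ar f Q' Q \<Longrightarrow> ar g Q' Q \<Longrightarrow> x \<in> carrier (Fm Q) \<Longrightarrow>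
      Fa (hadd C f g) x = Fa f x \<oplus>\<^bsub>Fm Q'\<^esub> Fa g x"
    and fsc: "\<And>Q Q' f r x. Q \<in> HW \<Longrightarrow> Q' \<in> HW \<Longrightarrow> ar f Q' Q \<Longrightarrow> r \<in> carrier R \<Longrightarrow> x \<in> carrier (Fm Q) \<Longrightarrow>
      Fa (hscale C r f) x = r \<odot>\<^bsub>Fm Q'\<^esub> Fa f x"
  shows "\<exists>N \<psi>. N \<in> tle 0 \<and> N \<in> tge 0 \<and> (\<forall>Q \<in> HW. \<psi> Q \<in> mod_iso R (hom Q N) (Fm Q)) \<and>
    (\<forall>Q \<in> HW. \<forall>Q' \<in> HW. \<forall>f x. ar f Q' Q \<longrightarrow> ar x Q N \<longrightarrow> \<psi> Q' (x \<cdot> f) = Fa f (\<psi> Q x))"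
proof -
  have am: "abelian_monoid (Fm Q)" if "Q \<in> HW" for Q
    using module.axioms(2)[OF fm[OF that]] abelian_group.axioms(1) by blast
  have f0: "Fa (hzero C Q' Q) x = \<zero>\<^bsub>Fm Q'\<^esub>" if Q: "Q \<in> HW" "Q' \<in> HW" and x: "x \<in> carrier (Fm Q)" for Q Q' x
  proof (rule module_idem[OF fm[OF Q(2)]])
    note z = ar_zero[OF HW_Obj[OF Q(2)] HW_Obj[OF Q(1)]]
    show "Fa (hzero C Q' Q) x \<in> carrier (Fm Q')" by (rule lin_mapD(1)[OF fl[OF Q z] x])
    show "Fa (hzero C Q' Q) x \<oplus>\<^bsub>Fm Q'\<^esub> Fa (hzero C Q' Q) x = Fa (hzero C Q' Q) x"
      using fa[OF Q z z x] add_zero(1)[OF z] by simp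
  qed
  obtain S where S: "S \<subseteq> C0" "small TYPE('u) S" "\<forall>X \<in> C0. \<exists>Y \<in> S. isomorphic C X Y"
    using C0_skeleton by blast
  define S' where "S' = S \<inter> HW"
  have S': "small TYPE('u) S'" unfolding S'_def by (rule small_subset[OF S(2)]) auto
  have S'HW: "Q \<in> HW" if "Q \<in> S'" for Q using that by (simp add: S'_def)
  have skel: "\<exists>P e e'. P \<in> S' \<and> ar e Q P \<and> ar e' P Q \<and> e' \<cdot> e = Idn C Q" if Q: "Q \<in> HW" for Q
  proof -
    obtain P where P: "P \<in> S" "isomorphic C Q P" using S(3) HW_C0[OF Q] by blast
    have "P \<in> S'" using P HW_iso[OF Q _ P(2)] S(1) by (auto simp: S'_def)
    moreover have "P \<in> Obj C" using P(1) S(1) C0_Obj by blast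
    ultimately show ?thesis using P(2) is_iso_ar[OF _ HW_Obj[OF Q]] unfolding isomorphic_def by blast
  qed
  \<comment> \<open>the coproduct \<open>G\<close> of the generators and the evaluation \<open>\<eta>\<close> of arrows into it\<close>
  define I where "I = (SIGMA P:S'. carrier (Fm P))"
  have Is: "small TYPE('u) I" unfolding I_def
    by (rule small_Sigma[OF univ S']) (use fs S'HW in auto)
  have I1: "fst i \<in> HW" "snd i \<in> carrier (Fm (fst i))" if "i \<in> I" for i
    using that S'HW by (auto simp: I_def)
  obtain G \<iota> where c: "is_coproduct C I fst G \<iota>"
    using smashing_coproduct[OF smash Is, of fst] I1(1) HW_Obj by blast
  note \<iota> = coproduct_ar[OF c]
  have G: "G \<in> tge 0" by (rule tge_coproduct[OF Is c]) (use I1(1) wge_tge in \<open>auto simp: HW_def\<close>)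
  note GO = tge_Obj[OF G]
  obtain \<pi> where \<pi>0: "\<forall>i\<in>I. ar (\<pi> i) G (fst i) \<and>
     (\<forall>j\<in>I. \<pi> i \<cdot> \<iota> j = (if i = j then Idn C (fst i) else hzero C (fst j) (fst i)))"
    using coproduct_projections[OF c] by blast
  then have \<pi>: "ar (\<pi> i) G (fst i)" if "i \<in> I" for i using that by blast
  have \<pi>\<iota>: "\<pi> i \<cdot> \<iota> j = (if i = j then Idn C (fst i) else hzero C (fst j) (fst i))" if "i \<in> I" "j \<in> I" for i j
    using \<pi>0 that by blast
  define supp where "supp = (\<lambda>Q y. {i \<in> I. \<pi> i \<cdot> y \<noteq> hzero C Q (fst i)})"
  define tm where "tm = (\<lambda>y i. Fa (\<pi> i \<cdot> y) (snd i))"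
  define \<eta> where "\<eta> = (\<lambda>Q y. \<Oplus>\<^bsub>Fm Q\<^esub>i\<in>supp Q y. tm y i)"
  have fin: "finite (supp Q y)" if "Q \<in> HW" "ar y Q G" for Q y
    unfolding supp_def by (rule compact_components(1)[OF HW_compact[OF that(1)] Is c that(2)]) (use \<pi> \<pi>\<iota> in auto)
  have tmc: "tm y i \<in> carrier (Fm Q)" if "Q \<in> HW" "ar y Q G" "i \<in> I" for Q y i
    unfolding tm_def using lin_mapD(1)[OF fl[OF I1(1) that(1) ar_Cmp[OF that(2) \<pi>]] I1(2)] that(3) by blast
  have \<eta>eq: "\<eta> Q y = (\<Oplus>\<^bsub>Fm Q\<^esub>i\<in>K. tm y i)"
    if Q: "Q \<in> HW" and y: "ar y Q G" and K: "finite K" "supp Q y \<subseteq> K" "K \<subseteq> I" for Q y K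
    unfolding \<eta>_def
  proof -
    interpret A: abelian_monoid "Fm Q" by (rule am[OF Q])
    show "(\<Oplus>\<^bsub>Fm Q\<^esub>i\<in>supp Q y. tm y i) = (\<Oplus>\<^bsub>Fm Q\<^esub>i\<in>K. tm y i)"
    proof (rule A.add.finprod_mono_neutral_cong_left[OF K(1,2)])
      fix i assume i: "i \<in> K - supp Q y"
      then have "\<pi> i \<cdot> y = hzero C Q (fst i)" "i \<in> I" using K(3) by (auto simp: supp_def)
      then show "tm y i = \<zero>\<^bsub>Fm Q\<^esub>" using f0[OF I1(1) Q I1(2)] by (simp add: tm_def)
    qed (use tmc[OF Q y] K in auto)
    qed
    have \<eta>c: "\<eta> Q y \<in> carrier (Fm Q)" if "Q \<in> HW" "ar y Q G" for Q y
      unfolding \<eta>_def by (rule abelian_monoid.finsum_closed[OF am[OF that(1)]])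
        (use tmc[OF that] in \<open>auto simp: supp_def\<close>)
    have \<eta>add: "\<eta> Q (hadd C y z) = \<eta> Q y \<oplus>\<^bsub>Fm Q\<^esub> \<eta> Q z" if Q: "Q \<in> HW" and y: "ar y Q G" and z: "ar z Q G" for Q y z
    proof -
      note yz = ar_add[OF y z]
      define K where "K = supp Q y \<union> supp Q z \<union> supp Q (hadd C y z)"
      have K: "finite K" "K \<subseteq> I" using fin[OF Q] y z yz by (auto simp: K_def supp_def)
      have "\<eta> Q (hadd C y z) = (\<Oplus>\<^bsub>Fm Q\<^esub>i\<in>K. tm (hadd C y z) i)" by (rule \<eta>eq[OF Q yz]) (use K K_def in auto)
      also have "\<dots> = (\<Oplus>\<^bsub>Fm Q\<^esub>i\<in>K. tm y i \<oplus>\<^bsub>Fm Q\<^esub> tm z i)"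
      proof (rule abelian_monoid.finsum_cong'[OF am[OF Q] refl])
        show "(\<lambda>i. tm y i \<oplus>\<^bsub>Fm Q\<^esub> tm z i) \<in> K \<rightarrow> carrier (Fm Q)"
          using tmc[OF Q y] tmc[OF Q z] K(2) module_closed(2)[OF fm[OF Q]] by auto
        fix i assume "i \<in> K"
        then have i: "i \<in> I" using K(2) by blast
        show "tm (hadd C y z) i = tm y i \<oplus>\<^bsub>Fm Q\<^esub> tm z i"
          unfolding tm_def cmp_add_right[OF y z \<pi>[OF i]]
          by (rule fa[OF I1(1)[OF i] Q ar_Cmp[OF y \<pi>[OF i]] ar_Cmp[OF z \<pi>[OF i]] I1(2)[OF i]])
      qed
      also have "\<dots> = (\<Oplus>\<^bsub>Fm Q\<^esub>i\<in>K. tm y i) \<oplus>\<^bsub>Fm Q\<^esub> (\<Oplus>\<^bsub>Fm Q\<^esub>i\<in>K. tm z i)"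
        by (rule abelian_monoid.finsum_addf[OF am[OF Q]]) (use tmc[OF Q y] tmc[OF Q z] K(2) in auto)
      also have "(\<Oplus>\<^bsub>Fm Q\<^esub>i\<in>K. tm y i) = \<eta> Q y" by (rule \<eta>eq[OF Q y, symmetric]) (use K K_def in auto)
      also have "(\<Oplus>\<^bsub>Fm Q\<^esub>i\<in>K. tm z i) = \<eta> Q z" by (rule \<eta>eq[OF Q z, symmetric]) (use K K_def in auto)
      finally show ?thesis .
    qed
    have \<eta>\<iota>: "\<eta> Q (\<iota> i \<cdot> u) = Fa u (snd i)" if Q: "Q \<in> HW" and i: "i \<in> I" and u: "ar u Q (fst i)" for Q i u
    proof -
      note y = ar_Cmp[OF u \<iota>[OF i]]
      have p: "\<pi> j \<cdot> (\<iota> i \<cdot> u) = (if j = i then u else hzero C Q (fst j))" if j: "j \<in> I" for j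
        using assoc[OF u \<iota>[OF i] \<pi>[OF j]] \<pi>\<iota>[OF j i] idl[OF u] cmp_zero_left[OF u HW_Obj[OF I1(1)[OF j]]]
        by (cases "j = i") simp_all
      have "\<eta> Q (\<iota> i \<cdot> u) = (\<Oplus>\<^bsub>Fm Q\<^esub>j\<in>{i}. tm (\<iota> i \<cdot> u) j)"
      proof (rule \<eta>eq[OF Q y])
        show "supp Q (\<iota> i \<cdot> u) \<subseteq> {i}"
        proof
          fix j assume "j \<in> supp Q (\<iota> i \<cdot> u)"
          then have "j \<in> I" "\<pi> j \<cdot> (\<iota> i \<cdot> u) \<noteq> hzero C Q (fst j)" by (simp_all add: supp_def)
          then show "j \<in> {i}" using p[of j] by (cases "j = i") simp_all
        qed
      qed (use i in auto)
      also have "\<dots> = tm (\<iota> i \<cdot> u) i"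
        using abelian_monoid.finsum_insert[OF am[OF Q], of "{}" i "tm (\<iota> i \<cdot> u)"] tmc[OF Q y i]
          abelian_monoid.finsum_empty[OF am[OF Q], of "tm (\<iota> i \<cdot> u)"] abelian_monoid.r_zero[OF am[OF Q] tmc[OF Q y i]] by simp
      finally show ?thesis using p[OF i] by (simp add: tm_def)
    qed
    have \<eta>0: "\<eta> Q (hzero C Q G) = \<zero>\<^bsub>Fm Q\<^esub>" if Q: "Q \<in> HW" for Q
    proof (rule module_idem[OF fm[OF Q]])
      note z = ar_zero[OF HW_Obj[OF Q] GO]
      show "\<eta> Q (hzero C Q G) \<in> carrier (Fm Q)" by (rule \<eta>c[OF Q z])
      show "\<eta> Q (hzero C Q G) \<oplus>\<^bsub>Fm Q\<^esub> \<eta> Q (hzero C Q G) = \<eta> Q (hzero C Q G)"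
        using \<eta>add[OF Q z z] add_zero(1)[OF z] by simp
    qed
    have \<eta>nat: "\<eta> Q' (y \<cdot> q) = Fa q (\<eta> Q y)" if Q: "Q \<in> HW" "Q' \<in> HW" and y: "ar y Q G" and q: "ar q Q' Q" for Q Q' y q
    proof (rule compact_induct[OF HW_compact[OF Q(1)] Is c y, of "\<lambda>y. \<eta> Q' (y \<cdot> q) = Fa q (\<eta> Q y)"])
      show "\<eta> Q' (hzero C Q G \<cdot> q) = Fa q (\<eta> Q (hzero C Q G))"
        using cmp_zero_left[OF q GO] \<eta>0 Q lin_map_zero[OF fl[OF Q q] fm[OF Q(1)] fm[OF Q(2)]] by simp
      fix u v assume uv: "ar u Q G" "ar v Q G" "\<eta> Q' (u \<cdot> q) = Fa q (\<eta> Q u)" "\<eta> Q' (v \<cdot> q) = Fa q (\<eta> Q v)"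
      show "\<eta> Q' (hadd C u v \<cdot> q) = Fa q (\<eta> Q (hadd C u v))"
        unfolding cmp_add_left[OF q uv(1,2)] \<eta>add[OF Q(2) ar_Cmp[OF q uv(1)] ar_Cmp[OF q uv(2)]] \<eta>add[OF Q(1) uv(1,2)]
          lin_mapD(2)[OF fl[OF Q q] \<eta>c[OF Q(1) uv(1)] \<eta>c[OF Q(1) uv(2)]] uv(3,4) ..
    next
      fix i u assume i: "i \<in> I" and u: "ar u Q (fst i)"
      show "\<eta> Q' (\<iota> i \<cdot> u \<cdot> q) = Fa q (\<eta> Q (\<iota> i \<cdot> u))"
        unfolding assoc[OF q u \<iota>[OF i]] \<eta>\<iota>[OF Q(1) i u] \<eta>\<iota>[OF Q(2) i ar_Cmp[OF q u]]
        by (rule fc[OF Q(2,1) I1(1)[OF i] q u I1(2)[OF i]])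
    qed
    have \<eta>scale: "\<eta> Q (hscale C r y) = r \<odot>\<^bsub>Fm Q\<^esub> \<eta> Q y" if Q: "Q \<in> HW" and y: "ar y Q G" and r: "r \<in> carrier R" for Q y r
    proof (rule compact_induct[OF HW_compact[OF Q] Is c y, of "\<lambda>y. \<eta> Q (hscale C r y) = r \<odot>\<^bsub>Fm Q\<^esub> \<eta> Q y"])
      interpret H: module R "hom Q G" by (rule hom_module[OF HW_Obj[OF Q] GO])
      interpret M: module R "Fm Q" by (rule fm[OF Q])
      show "\<eta> Q (hscale C r (hzero C Q G)) = r \<odot>\<^bsub>Fm Q\<^esub> \<eta> Q (hzero C Q G)"
        using H.smult_r_null[OF r] M.smult_r_null[OF r] \<eta>0[OF Q] by simp
      fix u v assume uv: "ar u Q G" "ar v Q G" "\<eta> Q (hscale C r u) = r \<odot>\<^bsub>Fm Q\<^esub> \<eta> Q u" "\<eta> Q (hscale C r v) = r \<odot>\<^bsub>Fm Q\<^esub> \<eta> Q v"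
      have "hscale C r (hadd C u v) = hadd C (hscale C r u) (hscale C r v)"
        using H.smult_r_distr[OF r, of u v] arD(3)[OF uv(1)] arD(3)[OF uv(2)] by simp
      then show "\<eta> Q (hscale C r (hadd C u v)) = r \<odot>\<^bsub>Fm Q\<^esub> \<eta> Q (hadd C u v)"
        using \<eta>add[OF Q ar_scale[OF r uv(1)] ar_scale[OF r uv(2)]] \<eta>add[OF Q uv(1,2)] uv(3,4)
          M.smult_r_distr[OF r \<eta>c[OF Q uv(1)] \<eta>c[OF Q uv(2)]] by simp
    next
      fix i u assume i: "i \<in> I" and u: "ar u Q (fst i)"
      have "hscale C r (\<iota> i \<cdot> u) = \<iota> i \<cdot> hscale C r u"
        using Cmp_hscale_right[of Q "fst i" G r u "\<iota> i"] u \<iota>[OF i] r by (simp add: ar_def)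
      then show "\<eta> Q (hscale C r (\<iota> i \<cdot> u)) = r \<odot>\<^bsub>Fm Q\<^esub> \<eta> Q (\<iota> i \<cdot> u)"
        using \<eta>\<iota>[OF Q i u] \<eta>\<iota>[OF Q i ar_scale[OF r u]] fsc[OF I1(1)[OF i] Q u r I1(2)[OF i]] by simp
    qed
    have \<eta>lin: "\<eta> Q \<in> lin_map R (hom Q G) (Fm Q)" if Q: "Q \<in> HW" for Q
    proof -
      have "ar y Q G" if "y \<in> carrier (hom Q G)" for y using that HW_Obj[OF Q] GO by (simp add: ar_def)
      then show ?thesis by (intro lin_mapI) (simp_all add: \<eta>c[OF Q] \<eta>add[OF Q] \<eta>scale[OF Q])
    qed
    have \<eta>surj: "\<exists>y. ar y Q G \<and> \<eta> Q y = x" if Q: "Q \<in> HW" and x: "x \<in> carrier (Fm Q)" for Q x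
    proof -
      obtain P e e' where P: "P \<in> S'" and e: "ar e Q P" "ar e' P Q" "e' \<cdot> e = Idn C Q" using skel[OF Q] by blast
      note PH = S'HW[OF P]
      have i: "(P, Fa e' x) \<in> I" using P lin_mapD(1)[OF fl[OF Q PH e(2)] x] by (simp add: I_def)
      have e1: "ar e Q (fst (P, Fa e' x))" using e(1) by simp
      have "\<eta> Q (\<iota> (P, Fa e' x) \<cdot> e) = x"
        using \<eta>\<iota>[OF Q i e1] fc[OF Q PH Q e(1,2) x] e(3) fid[OF Q x] by simp
      then show ?thesis using ar_Cmp[OF e1 \<iota>[OF i]] by blast
    qed
    \<comment> \<open>the relations\<close>
    define J where "J = (SIGMA P:S'. {y \<in> Hom C P G. \<eta> P y = \<zero>\<^bsub>Fm P\<^esub>})"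
    have Js: "small TYPE('u) J" unfolding J_def
      by (rule small_Sigma[OF univ S']) (rule small_subset[OF small_hom[OF HW_C0[OF S'HW] GO]], auto)
    have J1: "fst j \<in> HW" "ar (snd j) (fst j) G" "\<eta> (fst j) (snd j) = \<zero>\<^bsub>Fm (fst j)\<^esub>" if "j \<in> J" for j
      using that S'HW HW_Obj GO by (auto simp: J_def ar_def)
    obtain G1 \<kappa> where c1: "is_coproduct C J fst G1 \<kappa>"
      using smashing_coproduct[OF smash Js, of fst] J1(1) HW_Obj by blast
    note \<kappa> = coproduct_ar[OF c1]
    have G1: "G1 \<in> tge 0" by (rule tge_coproduct[OF Js c1]) (use J1(1) wge_tge in \<open>auto simp: HW_def\<close>)
    note G1O = tge_Obj[OF G1]
    obtain d where d: "ar d G1 G" "\<And>j. j \<in> J \<Longrightarrow> d \<cdot> \<kappa> j = snd j"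
      using coproduct_map[OF c1 GO, of snd] J1(2) by blast
    have \<eta>d: "\<eta> Q (d \<cdot> z) = \<zero>\<^bsub>Fm Q\<^esub>" if Q: "Q \<in> HW" and z: "ar z Q G1" for Q z
    proof (rule compact_induct[OF HW_compact[OF Q] Js c1 z, of "\<lambda>z. \<eta> Q (d \<cdot> z) = \<zero>\<^bsub>Fm Q\<^esub>"])
      show "\<eta> Q (d \<cdot> hzero C Q G1) = \<zero>\<^bsub>Fm Q\<^esub>" using cmp_zero_right[OF d(1) HW_Obj[OF Q]] \<eta>0[OF Q] by simp
      fix u v assume uv: "ar u Q G1" "ar v Q G1" "\<eta> Q (d \<cdot> u) = \<zero>\<^bsub>Fm Q\<^esub>" "\<eta> Q (d \<cdot> v) = \<zero>\<^bsub>Fm Q\<^esub>"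
      show "\<eta> Q (d \<cdot> hadd C u v) = \<zero>\<^bsub>Fm Q\<^esub>"
        using cmp_add_right[OF uv(1,2) d(1)] \<eta>add[OF Q ar_Cmp[OF uv(1) d(1)] ar_Cmp[OF uv(2) d(1)]] uv(3,4)
          module_closed(5)[OF fm[OF Q] module_closed(1)[OF fm[OF Q]]] by simp
    next
      fix j u assume j: "j \<in> J" and u: "ar u Q (fst j)"
      have "\<eta> Q (d \<cdot> (\<kappa> j \<cdot> u)) = Fa u (\<eta> (fst j) (snd j))"
        using assoc[OF u \<kappa>[OF j] d(1)] d(2)[OF j] \<eta>nat[OF J1(1)[OF j] Q J1(2)[OF j] u] by simp
      then show "\<eta> Q (d \<cdot> (\<kappa> j \<cdot> u)) = \<zero>\<^bsub>Fm Q\<^esub>"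
        using J1(3)[OF j] lin_map_zero[OF fl[OF J1(1)[OF j] Q u] fm[OF J1(1)[OF j]] fm[OF Q]] by simp
    qed
    have ker: "\<exists>z. ar z Q G1 \<and> d \<cdot> z = y" if Q: "Q \<in> HW" and y: "ar y Q G" and z: "\<eta> Q y = \<zero>\<^bsub>Fm Q\<^esub>" for Q y
    proof -
      obtain P e e' where P: "P \<in> S'" and e: "ar e Q P" "ar e' P Q" "e' \<cdot> e = Idn C Q" using skel[OF Q] by blast
      note PH = S'HW[OF P]
      have ye: "ar (y \<cdot> e') P G" by (rule ar_Cmp[OF e(2) y])
      have "\<eta> P (y \<cdot> e') = \<zero>\<^bsub>Fm P\<^esub>"
        using \<eta>nat[OF Q PH y e(2)] z lin_map_zero[OF fl[OF Q PH e(2)] fm[OF Q] fm[OF PH]] by simp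
      then have j: "(P, y \<cdot> e') \<in> J" using P arD(3)[OF ye] by (simp add: J_def)
      have e1: "ar e Q (fst (P, y \<cdot> e'))" using e(1) by simp
      have "d \<cdot> (\<kappa> (P, y \<cdot> e') \<cdot> e) = y \<cdot> e' \<cdot> e" using assoc[OF e1 \<kappa>[OF j] d(1)] d(2)[OF j] by simp
      also have "\<dots> = y" using assoc[OF e(1,2) y] e(3) idr[OF y] by simp
      finally show ?thesis using ar_Cmp[OF e1 \<kappa>[OF j]] by blast
    qed
    \<comment> \<open>the cone of the presentation and its truncation\<close>
    obtain E e \<delta> where t: "dist_tri C G1 G E d e \<delta>" using TR1_cone[OF G1O GO arD(3)[OF d(1)]] by blast
    note a = tri_ar[OF t]
    have E: "E \<in> tge 0" by (rule tge_cone[OF t G tge_mono[OF _ G1]]) simp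
    note EO = tge_Obj[OF E]
    obtain T N b n c where T: "T \<in> tge 1" and N: "N \<in> tle 0" and tT: "dist_tri C T E N b n c"
      using t_dec[OF EO, of 1] by auto
    note aT = tri_ar[OF tT]
    have N0: "N \<in> tge 0" by (rule tge_cone[OF tT E tge_mono[OF _ T]]) simp
    note NO = tge_Obj[OF N0]
    have p: "ar (n \<cdot> e) G N" by (rule ar_Cmp[OF a(2) aT(2)])
    have psurj: "\<exists>y. ar y Q G \<and> (n \<cdot> e) \<cdot> y = x" if Q: "Q \<in> HW" and x: "ar x Q N" for Q x
    proof -
      have "orth C Q (Sh C T)" using HW_orth_tge1[OF Q tge_mono[OF _ tge_Sh[OF T]]] by simp
      then obtain x' where x': "ar x' Q E" "n \<cdot> x' = x" using tri_lift2[OF tT x] orthD ar_Cmp[OF x aT(3)] by blast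
      have "orth C Q (Sh C G1)" using HW_orth_tge1[OF Q] tge_Sh[OF G1] by simp
      then obtain y where y: "ar y Q G" "e \<cdot> y = x'" using tri_lift2[OF t x'(1)] orthD ar_Cmp[OF x'(1) a(3)] by blast
      then show ?thesis using assoc[OF y(1) a(2) aT(2)] x'(2) by auto
    qed
    have pker: "(n \<cdot> e) \<cdot> y = hzero C Q N \<longleftrightarrow> \<eta> Q y = \<zero>\<^bsub>Fm Q\<^esub>" if Q: "Q \<in> HW" and y: "ar y Q G" for Q y
    proof
      note QO = HW_Obj[OF Q]
      assume "(n \<cdot> e) \<cdot> y = hzero C Q N"
      then have "n \<cdot> (e \<cdot> y) = hzero C Q N" using assoc[OF y a(2) aT(2)] by simp
      then obtain s where s: "ar s Q T" "b \<cdot> s = e \<cdot> y" using tri_lift[OF tT ar_Cmp[OF y a(2)]] by blast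
      have "e \<cdot> y = hzero C Q E" using s orthD[OF HW_orth_tge1[OF Q T] s(1)] cmp_zero_right[OF aT(1) QO] by simp
      then obtain z where "ar z Q G1" "d \<cdot> z = y" using tri_lift[OF t y] by blast
      then show "\<eta> Q y = \<zero>\<^bsub>Fm Q\<^esub>" using \<eta>d[OF Q] by blast
    next
      assume "\<eta> Q y = \<zero>\<^bsub>Fm Q\<^esub>"
      then obtain z where z: "ar z Q G1" "d \<cdot> z = y" using ker[OF Q y] by blast
      have "e \<cdot> y = hzero C Q E" using z assoc[OF z(1) a(1,2)] tri_comp_zero[OF t] cmp_zero_left[OF z(1) EO] by simp
      then show "(n \<cdot> e) \<cdot> y = hzero C Q N"
        using assoc[OF y a(2) aT(2)] cmp_zero_right[OF aT(2) HW_Obj[OF Q]] by simp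
    qed
    have "\<exists>\<psi> \<in> mod_iso R (hom Q N) (Fm Q). \<forall>y \<in> carrier (hom Q G). \<psi> ((n \<cdot> e) \<cdot> y) = \<eta> Q y" if Q: "Q \<in> HW" for Q
    proof (rule iso_from_kernels[OF \<eta>lin[OF Q] post_lin[OF p HW_Obj[OF Q]] hom_module[OF HW_Obj[OF Q] GO] fm[OF Q]
          hom_module[OF HW_Obj[OF Q] NO]])
      note QO = HW_Obj[OF Q]
      show "\<eta> Q ` carrier (hom Q G) = carrier (Fm Q)"
        using lin_mapD(1)[OF \<eta>lin[OF Q]] \<eta>surj[OF Q] arD(3) by (auto simp: image_iff) metis
      show "(\<lambda>x. (n \<cdot> e) \<cdot> x) ` carrier (hom Q G) = carrier (hom Q N)"
        using lin_mapD(1)[OF post_lin[OF p QO]] psurj[OF Q] QO NO by (auto simp: image_iff ar_def)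
      show "(n \<cdot> e) \<cdot> x = \<zero>\<^bsub>hom Q N\<^esub> \<longleftrightarrow> \<eta> Q x = \<zero>\<^bsub>Fm Q\<^esub>" if "x \<in> carrier (hom Q G)" for x
        using pker[OF Q, of x] that QO GO by (simp add: ar_def)
    qed
    then obtain \<psi> where \<psi>: "\<And>Q. Q \<in> HW \<Longrightarrow> \<psi> Q \<in> mod_iso R (hom Q N) (Fm Q)"
      and \<psi>p: "\<And>Q y. Q \<in> HW \<Longrightarrow> y \<in> carrier (hom Q G) \<Longrightarrow> \<psi> Q ((n \<cdot> e) \<cdot> y) = \<eta> Q y" by metis
    have "\<psi> Q' (x \<cdot> f) = Fa f (\<psi> Q x)" if Q: "Q \<in> HW" "Q' \<in> HW" and f: "ar f Q' Q" and x: "ar x Q N" for Q Q' f x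
    proof -
      obtain y where y: "ar y Q G" "(n \<cdot> e) \<cdot> y = x" using psurj[OF Q(1) x] by blast
      have "x \<cdot> f = (n \<cdot> e) \<cdot> (y \<cdot> f)" using assoc[OF f y(1) p] y(2) by simp
      then show ?thesis using \<psi>p[OF Q(2), of "y \<cdot> f"] \<psi>p[OF Q(1), of y] arD(3)[OF ar_Cmp[OF f y(1)]] arD(3)[OF y(1)]
        \<eta>nat[OF Q y(1) f] y(2) by simp
    qed
    then show ?thesis using N N0 \<psi> by blast
  qed
  
  end
  
  section \<open>Equivalences of categories\<close>
  
  definition arr_src :: "('o, 'm, 'z) cat_scheme \<Rightarrow> 'm \<Rightarrow> 'o" where
    "arr_src C f = (SOME X. X \<in> Obj C \<and> (\<exists>Y \<in> Obj C. f \<in> Hom C X Y))"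
  
  definition arr_tgt :: "('o, 'm, 'z) cat_scheme \<Rightarrow> 'm \<Rightarrow> 'o" where
    "arr_tgt C f = (SOME Y. Y \<in> Obj C \<and> (\<exists>X \<in> Obj C. f \<in> Hom C X Y))"
  
  lemma (in category) arr_src_tgt:
    assumes "ar f X Y" shows "arr_src C f = X" "arr_tgt C f = Y"
    unfolding arr_src_def arr_tgt_def
    by (rule some_equality; use assms Hom_disjoint in \<open>unfold ar_def; blast\<close>)+
  
  text \<open>The quasi-inverse is chosen on objects, and full faithfulness determines it on arrows.\<close>
  
  lemma equivalence_criterion:
    assumes A: "category A" and B: "category B" and F: "is_functor A B F"
      and ff: "\<And>X Y. X \<in> Obj A \<Longrightarrow> Y \<in> Obj A \<Longrightarrow> bij_betw (far F) (Hom A X Y) (Hom B (fob F X) (fob F Y))"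
      and es: "\<And>Z. Z \<in> Obj B \<Longrightarrow> \<exists>X \<in> Obj A. isomorphic B (fob F X) Z"
    shows "is_equivalence A B F"
  proof -
    interpret A: category A by (rule A)
    interpret B: category B by (rule B)
    have FO: "fob F X \<in> Obj B" if "X \<in> Obj A" for X using F that by (auto simp: is_functor_def)
    have Far: "B.ar (far F f) (fob F X) (fob F Y)" if "A.ar f X Y" for f X Y
      using F that unfolding is_functor_def A.ar_def B.ar_def by (auto simp: Pi_iff)
    have Fid: "far F (Idn A X) = Idn B (fob F X)" if "X \<in> Obj A" for X using F that by (auto simp: is_functor_def)
    have Fcmp: "far F (g \<cdot>\<^bsub>A\<^esub> f) = far F g \<cdot>\<^bsub>B\<^esub> far F f" if "A.ar f X Y" "A.ar g Y Z" for f g X Y Z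
      using F that unfolding is_functor_def A.ar_def by metis
    have Finj: "f = g" if "A.ar f X Y" "A.ar g X Y" "far F f = far F g" for f g X Y
      using ff[of X Y] that unfolding A.ar_def bij_betw_def inj_on_def by blast
    have Fsur: "\<exists>f. A.ar f X Y \<and> far F f = h" if "B.ar h (fob F X) (fob F Y)" "X \<in> Obj A" "Y \<in> Obj A" for h X Y
      using ff[of X Y] that unfolding A.ar_def B.ar_def bij_betw_def by (metis imageE)
    have "\<exists>X e e'. X \<in> Obj A \<and> B.ar e (fob F X) Z \<and> B.ar e' Z (fob F X) \<and>
        e' \<cdot>\<^bsub>B\<^esub> e = Idn B (fob F X) \<and> e \<cdot>\<^bsub>B\<^esub> e' = Idn B Z" if Z: "Z \<in> Obj B" for Z
      using es[OF Z] B.is_iso_ar[OF _ FO Z] unfolding isomorphic_def by blast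
    then obtain g0 e e' where g0: "\<And>Z. Z \<in> Obj B \<Longrightarrow> g0 Z \<in> Obj A"
      and e: "\<And>Z. Z \<in> Obj B \<Longrightarrow> B.ar (e Z) (fob F (g0 Z)) Z"
      and e': "\<And>Z. Z \<in> Obj B \<Longrightarrow> B.ar (e' Z) Z (fob F (g0 Z))"
      and e'e: "\<And>Z. Z \<in> Obj B \<Longrightarrow> e' Z \<cdot>\<^bsub>B\<^esub> e Z = Idn B (fob F (g0 Z))"
      and ee': "\<And>Z. Z \<in> Obj B \<Longrightarrow> e Z \<cdot>\<^bsub>B\<^esub> e' Z = Idn B Z" by metis
    have "\<exists>a. \<forall>Z Z'. B.ar f Z Z' \<longrightarrow> A.ar a (g0 Z) (g0 Z') \<and> far F a = e' Z' \<cdot>\<^bsub>B\<^esub> (f \<cdot>\<^bsub>B\<^esub> e Z)" for f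
    proof (cases "\<exists>Z Z'. B.ar f Z Z'")
      case True
      then obtain Z Z' where f: "B.ar f Z Z'" by blast
      note O = B.arD(1,2)[OF f]
      obtain a where a: "A.ar a (g0 Z) (g0 Z')" "far F a = e' Z' \<cdot>\<^bsub>B\<^esub> (f \<cdot>\<^bsub>B\<^esub> e Z)"
        using Fsur[OF B.ar_Cmp[OF B.ar_Cmp[OF e[OF O(1)] f] e'[OF O(2)]] g0[OF O(1)] g0[OF O(2)]] by blast
      have "W = Z \<and> W' = Z'" if "B.ar f W W'" for W W' using B.arr_src_tgt[OF f] B.arr_src_tgt[OF that] by simp
      then show ?thesis using a by blast
    qed blast
    then obtain g1 where g1: "\<And>f Z Z'. B.ar f Z Z' \<Longrightarrow> A.ar (g1 f) (g0 Z) (g0 Z')"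
      and Fg1: "\<And>f Z Z'. B.ar f Z Z' \<Longrightarrow> far F (g1 f) = e' Z' \<cdot>\<^bsub>B\<^esub> (f \<cdot>\<^bsub>B\<^esub> e Z)" by metis
    define G where "G = \<lparr>fob = g0, far = g1\<rparr>"
    have eF: "e Z' \<cdot>\<^bsub>B\<^esub> far F (g1 f) = f \<cdot>\<^bsub>B\<^esub> e Z" if f: "B.ar f Z Z'" for f Z Z'
    proof -
      note O = B.arD(1,2)[OF f] and fe = B.ar_Cmp[OF e[OF B.arD(1)[OF f]] f]
      have "e Z' \<cdot>\<^bsub>B\<^esub> far F (g1 f) = (e Z' \<cdot>\<^bsub>B\<^esub> e' Z') \<cdot>\<^bsub>B\<^esub> (f \<cdot>\<^bsub>B\<^esub> e Z)"
        unfolding Fg1[OF f] by (rule B.assoc[OF fe e'[OF O(2)] e[OF O(2)], symmetric])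
      then show ?thesis using ee'[OF O(2)] B.idl[OF fe] by simp
    qed
    have G: "is_functor B A G"
      unfolding is_functor_def
    proof (intro conjI ballI)
      show "fob G \<in> Obj B \<rightarrow> Obj A" using g0 by (auto simp: G_def)
      fix Z assume Z: "Z \<in> Obj B"
      have "far F (g1 (Idn B Z)) = far F (Idn A (g0 Z))"
        unfolding Fg1[OF B.ar_Idn[OF Z]] Fid[OF g0[OF Z]] B.idl[OF e[OF Z]] by (rule e'e[OF Z])
      then show "far G (Idn B Z) = Idn A (fob G Z)"
        using Finj[OF g1[OF B.ar_Idn[OF Z]] A.ar_Idn[OF g0[OF Z]]] by (simp add: G_def)
      fix Y assume Y: "Y \<in> Obj B"
      show "far G \<in> Hom B Z Y \<rightarrow> Hom A (fob G Z) (fob G Y)"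
        using A.arD(3)[OF g1[OF B.arI[OF Z Y]]] by (auto simp: G_def)
      fix X f g assume X: "X \<in> Obj B" and f0: "f \<in> Hom B Z Y" and h0: "g \<in> Hom B Y X"
      note f = B.arI[OF Z Y f0] and h = B.arI[OF Y X h0]
      note he = B.ar_Cmp[OF e[OF Y] h] and fe = B.ar_Cmp[OF e[OF Z] f]
      have "far F (g1 g \<cdot>\<^bsub>A\<^esub> g1 f) = (e' X \<cdot>\<^bsub>B\<^esub> (g \<cdot>\<^bsub>B\<^esub> e Y)) \<cdot>\<^bsub>B\<^esub> far F (g1 f)"
        using Fcmp[OF g1[OF f] g1[OF h]] Fg1[OF h] by simp
      also have "\<dots> = e' X \<cdot>\<^bsub>B\<^esub> (g \<cdot>\<^bsub>B\<^esub> (e Y \<cdot>\<^bsub>B\<^esub> far F (g1 f)))"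
        using B.assoc[OF Far[OF g1[OF f]] he e'[OF X]] B.assoc[OF Far[OF g1[OF f]] e[OF Y] h] by simp
      also have "\<dots> = e' X \<cdot>\<^bsub>B\<^esub> ((g \<cdot>\<^bsub>B\<^esub> f) \<cdot>\<^bsub>B\<^esub> e Z)"
        using eF[OF f] B.assoc[OF e[OF Z] f h] by simp
      also have "\<dots> = far F (g1 (g \<cdot>\<^bsub>B\<^esub> f))" using Fg1[OF B.ar_Cmp[OF f h]] by simp
      finally show "far G (g \<cdot>\<^bsub>B\<^esub> f) = far G g \<cdot>\<^bsub>A\<^esub> far G f"
        using Finj[OF g1[OF B.ar_Cmp[OF f h]] A.ar_Cmp[OF g1[OF f] g1[OF h]]] by (simp add: G_def)
    qed
    have FG: "nat_isomorphic B B (fun_comp F G) fun_id"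
      unfolding nat_isomorphic_def
    proof (intro exI[of _ e] conjI ballI)
      show "nat_trans B B (fun_comp F G) fun_id e"
        unfolding nat_trans_def using B.arD(3)[OF e] eF[OF B.arI] by (simp add: fun_comp_def fun_id_def G_def)
      show "is_iso B (fob (fun_comp F G) Z) (fob fun_id Z) (e Z)" if "Z \<in> Obj B" for Z
        unfolding is_iso_def using B.arD(3)[OF e[OF that]] B.arD(3)[OF e'[OF that]] e'e[OF that] ee'[OF that]
        by (auto simp: fun_comp_def fun_id_def G_def)
    qed
    have "\<exists>a. A.ar a (g0 (fob F X)) X \<and> far F a = e (fob F X)" if X: "X \<in> Obj A" for X
      by (rule Fsur[OF e[OF FO[OF X]] g0[OF FO[OF X]] X])
    then obtain a where a: "\<And>X. X \<in> Obj A \<Longrightarrow> A.ar (a X) (g0 (fob F X)) X"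
      and Fa: "\<And>X. X \<in> Obj A \<Longrightarrow> far F (a X) = e (fob F X)" by metis
    have GF: "nat_isomorphic A A (fun_comp G F) fun_id"
      unfolding nat_isomorphic_def
    proof (intro exI[of _ a] conjI ballI)
      have "a Y \<cdot>\<^bsub>A\<^esub> g1 (far F f) = f \<cdot>\<^bsub>A\<^esub> a X" if f: "A.ar f X Y" for f X Y
      proof (rule Finj)
        note O = A.arD(1,2)[OF f]
        show "A.ar (a Y \<cdot>\<^bsub>A\<^esub> g1 (far F f)) (g0 (fob F X)) Y" by (rule A.ar_Cmp[OF g1[OF Far[OF f]] a[OF O(2)]])
        show "A.ar (f \<cdot>\<^bsub>A\<^esub> a X) (g0 (fob F X)) Y" by (rule A.ar_Cmp[OF a[OF O(1)] f])
        show "far F (a Y \<cdot>\<^bsub>A\<^esub> g1 (far F f)) = far F (f \<cdot>\<^bsub>A\<^esub> a X)"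
          unfolding Fcmp[OF g1[OF Far[OF f]] a[OF O(2)]] Fcmp[OF a[OF O(1)] f] Fa[OF O(1)] Fa[OF O(2)]
          by (rule eF[OF Far[OF f]])
      qed
      then show "nat_trans A A (fun_comp G F) fun_id a"
        unfolding nat_trans_def using A.arD(3)[OF a] A.arI by (simp add: fun_comp_def fun_id_def G_def)
      show "is_iso A (fob (fun_comp G F) X) (fob fun_id X) (a X)" if X: "X \<in> Obj A" for X
      proof -
        note Z = FO[OF X]
        obtain b where b: "A.ar b X (g0 (fob F X))" "far F b = e' (fob F X)"
          using Fsur[OF e'[OF Z] X g0[OF Z]] by blast
        have "b \<cdot>\<^bsub>A\<^esub> a X = Idn A (g0 (fob F X))"
          by (rule Finj[OF A.ar_Cmp[OF a[OF X] b(1)] A.ar_Idn[OF g0[OF Z]]])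
            (simp add: Fcmp[OF a[OF X] b(1)] Fa[OF X] b(2) Fid[OF g0[OF Z]] e'e[OF Z])
        moreover have "a X \<cdot>\<^bsub>A\<^esub> b = Idn A X"
          by (rule Finj[OF A.ar_Cmp[OF b(1) a[OF X]] A.ar_Idn[OF X]])
            (simp add: Fcmp[OF b(1) a[OF X]] Fa[OF X] b(2) Fid[OF X] ee'[OF Z])
        ultimately show ?thesis unfolding is_iso_def using A.arD(3)[OF a[OF X]] A.arD(3)[OF b(1)]
          by (auto simp: fun_comp_def fun_id_def G_def)
    
    qed
  qed
  show ?thesis unfolding is_equivalence_def using F G FG GF by blast
qed

section \<open>Functor categories\<close>

lemma full_sub_category:
  assumes "category C" "S \<subseteq> Obj C" shows "category (full_sub C S)"
proof -
  interpret category C by fact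
  note m = subsetD[OF assms(2)]
  show ?thesis
    by (unfold_locales; simp)
      (use m in \<open>blast intro: Idn_closed Cmp_closed Cmp_assoc Idn_left Idn_right dest: Hom_disjoint\<close>)+
qed

lemma op_cat_simps [simp]:
  "Obj (op_cat C) = Obj C" "Hom (op_cat C) X Y = Hom C Y X" "Idn (op_cat C) = Idn C"
  "g \<cdot>\<^bsub>op_cat C\<^esub> f = f \<cdot>\<^bsub>C\<^esub> g" "hadd (op_cat C) = hadd C" "hscale (op_cat C) = hscale C"
  by (simp_all add: op_cat_def)

lemma op_category:
  fixes C :: "('o, 'm, 'r, 'z) lcat_scheme"
  assumes "category C" shows "category (op_cat C)"
proof -
  interpret category C by fact
  show ?thesis
    by (unfold_locales; simp)
      (blast intro: Idn_closed Cmp_closed Cmp_assoc[symmetric] Idn_left Idn_right dest: Hom_disjoint)+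
qed

lemma fun_cat_simps:
  "F \<in> Obj (fun_cat R A B) \<longleftrightarrow> is_linear_functor R A B F \<and> fob F \<in> extensional (Obj A) \<and>
              far F \<in> extensional (\<Union>X \<in> Obj A. \<Union>Y \<in> Obj A. Hom A X Y)"
  "Hom (fun_cat R A B) F G = {(F, \<eta>, G) | \<eta>. nat_trans A B F G \<eta> \<and> \<eta> \<in> extensional (Obj A)}"
  "Idn (fun_cat R A B) F = (F, (\<lambda>X \<in> Obj A. Idn B (fob F X)), F)"
  "(F', \<theta>, H) \<cdot>\<^bsub>fun_cat R A B\<^esub> (F, \<eta>, G) = (F, (\<lambda>X \<in> Obj A. \<theta> X \<cdot>\<^bsub>B\<^esub> \<eta> X), H)"
  by (simp_all add: fun_cat_def)

lemma nat_trans_ar: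
  assumes "category A" "category B" "is_functor A B F" "is_functor A B G" "nat_trans A B F G \<eta>" "X \<in> Obj A"
  shows "category.ar B (\<eta> X) (fob F X) (fob G X)"
  using assms unfolding category.ar_def[OF assms(2)] nat_trans_def is_functor_def by auto

lemma functor_ar:
  assumes "category A" "category B" "is_functor A B F" "category.ar A f X Y"
  shows "category.ar B (far F f) (fob F X) (fob F Y)"
  using assms(3,4) unfolding category.ar_def[OF assms(1)] category.ar_def[OF assms(2)] is_functor_def
  by (auto simp: Pi_iff)

lemma nat_trans_comp:
  assumes A: "category A" and B: "category B" and F: "is_functor A B F" "is_functor A B G" "is_functor A B H"
    and \<eta>: "nat_trans A B F G \<eta>" and \<theta>: "nat_trans A B G H \<theta>"
  shows "nat_trans A B F H (\<lambda>X \<in> Obj A. \<theta> X \<cdot>\<^bsub>B\<^esub> \<eta> X)"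
proof -
  interpret A: category A by (rule A)
  interpret B: category B by (rule B)
  note \<eta>a = nat_trans_ar[OF A B F(1,2) \<eta>] and \<theta>a = nat_trans_ar[OF A B F(2,3) \<theta>]
  show ?thesis unfolding nat_trans_def
  proof (intro conjI ballI)
    show "(\<lambda>X \<in> Obj A. \<theta> X \<cdot>\<^bsub>B\<^esub> \<eta> X) X \<in> Hom B (fob F X) (fob H X)" if "X \<in> Obj A" for X
      using B.arD(3)[OF B.ar_Cmp[OF \<eta>a[OF that] \<theta>a[OF that]]] that by simp
    fix X Y f assume XY: "X \<in> Obj A" "Y \<in> Obj A" and f0: "f \<in> Hom A X Y"
    note f = A.arI[OF XY f0]
    note Ff = functor_ar[OF A B F(1) f] and Gf = functor_ar[OF A B F(2) f] and Hf = functor_ar[OF A B F(3) f]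
    have n1: "\<eta> Y \<cdot>\<^bsub>B\<^esub> far F f = far G f \<cdot>\<^bsub>B\<^esub> \<eta> X" using \<eta> XY f0 by (simp add: nat_trans_def)
    have n2: "\<theta> Y \<cdot>\<^bsub>B\<^esub> far G f = far H f \<cdot>\<^bsub>B\<^esub> \<theta> X" using \<theta> XY f0 by (simp add: nat_trans_def)
    have "(\<theta> Y \<cdot>\<^bsub>B\<^esub> \<eta> Y) \<cdot>\<^bsub>B\<^esub> far F f = \<theta> Y \<cdot>\<^bsub>B\<^esub> (far G f \<cdot>\<^bsub>B\<^esub> \<eta> X)"
      using B.assoc[OF Ff \<eta>a[OF XY(2)] \<theta>a[OF XY(2)]] n1 by simp
    also have "\<dots> = (far H f \<cdot>\<^bsub>B\<^esub> \<theta> X) \<cdot>\<^bsub>B\<^esub> \<eta> X"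
      using B.assoc[OF \<eta>a[OF XY(1)] Gf \<theta>a[OF XY(2)]] n2 by simp
    also have "\<dots> = far H f \<cdot>\<^bsub>B\<^esub> (\<theta> X \<cdot>\<^bsub>B\<^esub> \<eta> X)"
      by (rule B.assoc[OF \<eta>a[OF XY(1)] \<theta>a[OF XY(1)] Hf])
    finally show "(\<lambda>X \<in> Obj A. \<theta> X \<cdot>\<^bsub>B\<^esub> \<eta> X) Y \<cdot>\<^bsub>B\<^esub> far F f = far H f \<cdot>\<^bsub>B\<^esub> (\<lambda>X \<in> Obj A. \<theta> X \<cdot>\<^bsub>B\<^esub> \<eta> X) X"
      using XY by simp
  qed
qed

lemma fun_cat_functor: "F \<in> Obj (fun_cat R A B) \<Longrightarrow> is_functor A B F"
  by (simp add: fun_cat_simps is_linear_functor_def)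

lemma fun_cat_category:
  assumes A: "category A" and B: "category B" shows "category (fun_cat R A B)"
proof -
  interpret A: category A by (rule A)
  interpret B: category B by (rule B)
  show ?thesis
  proof
    fix X assume X: "X \<in> Obj (fun_cat R A B)"
    note FX = fun_cat_functor[OF X]
    have "nat_trans A B X X (\<lambda>x \<in> Obj A. Idn B (fob X x))"
      unfolding nat_trans_def
    proof (intro conjI ballI)
      show "(\<lambda>x \<in> Obj A. Idn B (fob X x)) x \<in> Hom B (fob X x) (fob X x)" if "x \<in> Obj A" for x
        using FX that B.Idn_closed by (auto simp: is_functor_def)
      fix x y f assume x: "x \<in> Obj A" "y \<in> Obj A" "f \<in> Hom A x y"
      show "(\<lambda>x \<in> Obj A. Idn B (fob X x)) y \<cdot>\<^bsub>B\<^esub> far X f = far X f \<cdot>\<^bsub>B\<^esub> (\<lambda>x \<in> Obj A. Idn B (fob X x)) x"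
        using x B.idl[OF functor_ar[OF A B FX A.arI[OF x]]] B.idr[OF functor_ar[OF A B FX A.arI[OF x]]] by simp
    qed
    then show "Idn (fun_cat R A B) X \<in> Hom (fun_cat R A B) X X" by (simp add: fun_cat_simps)
    fix Y f assume Y: "Y \<in> Obj (fun_cat R A B)" and f: "f \<in> Hom (fun_cat R A B) X Y"
    note FY = fun_cat_functor[OF Y]
    obtain \<eta> where \<eta>: "f = (X, \<eta>, Y)" "nat_trans A B X Y \<eta>" "\<eta> \<in> extensional (Obj A)"
      using f by (auto simp: fun_cat_simps)
    note \<eta>a = nat_trans_ar[OF A B FX FY \<eta>(2)]
    show "Idn (fun_cat R A B) Y \<cdot>\<^bsub>fun_cat R A B\<^esub> f = f" "f \<cdot>\<^bsub>fun_cat R A B\<^esub> Idn (fun_cat R A B) X = f"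
      unfolding \<eta>(1) fun_cat_simps using \<eta>(3)
      by (auto simp: fun_eq_iff restrict_def extensional_def B.idl[OF \<eta>a] B.idr[OF \<eta>a])
    fix Z g assume Z: "Z \<in> Obj (fun_cat R A B)" and g: "g \<in> Hom (fun_cat R A B) Y Z"
    note FZ = fun_cat_functor[OF Z]
    obtain \<theta> where \<theta>: "g = (Y, \<theta>, Z)" "nat_trans A B Y Z \<theta>" using g by (auto simp: fun_cat_simps)
    note \<theta>a = nat_trans_ar[OF A B FY FZ \<theta>(2)]
    show "g \<cdot>\<^bsub>fun_cat R A B\<^esub> f \<in> Hom (fun_cat R A B) X Z"
      unfolding \<eta>(1) \<theta>(1) fun_cat_simps using nat_trans_comp[OF A B FX FY FZ \<eta>(2) \<theta>(2)] by simp
    fix W h assume W: "W \<in> Obj (fun_cat R A B)" and h: "h \<in> Hom (fun_cat R A B) Z W"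
    note FW = fun_cat_functor[OF W]
    obtain \<tau> where \<tau>: "h = (Z, \<tau>, W)" "nat_trans A B Z W \<tau>" using h by (auto simp: fun_cat_simps)
    note \<tau>a = nat_trans_ar[OF A B FZ FW \<tau>(2)]
    show "h \<cdot>\<^bsub>fun_cat R A B\<^esub> g \<cdot>\<^bsub>fun_cat R A B\<^esub> f = h \<cdot>\<^bsub>fun_cat R A B\<^esub> (g \<cdot>\<^bsub>fun_cat R A B\<^esub> f)"
      unfolding \<eta>(1) \<theta>(1) \<tau>(1) fun_cat_simps
      by (auto simp: fun_eq_iff restrict_def B.assoc[OF \<eta>a \<theta>a \<tau>a])
  next
    fix X Y X' Y' f
    assume "f \<in> Hom (fun_cat R A B) X Y" "f \<in> Hom (fun_cat R A B) X' Y'"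
    then show "X = X' \<and> Y = Y'" by (auto simp: fun_cat_simps)
  qed
qed

lemma fun_cat_isomorphic:
  assumes A: "category A" and B: "category B" and F: "F \<in> Obj (fun_cat R A B)" and G: "G \<in> Obj (fun_cat R A B)"
    and \<eta>: "nat_trans A B F G \<eta>" and i: "\<And>X. X \<in> Obj A \<Longrightarrow> is_iso B (fob F X) (fob G X) (\<eta> X)"
  shows "isomorphic (fun_cat R A B) F G"
proof -
  interpret A: category A by (rule A)
  interpret B: category B by (rule B)
  note FF = fun_cat_functor[OF F] and FG = fun_cat_functor[OF G]
  have FO: "fob F X \<in> Obj B" "fob G X \<in> Obj B" if "X \<in> Obj A" for X
    using FF FG that by (auto simp: is_functor_def)
  note \<eta>a = nat_trans_ar[OF A B FF FG \<eta>]
  obtain \<theta> where \<theta>a: "\<And>X. X \<in> Obj A \<Longrightarrow> B.ar (\<theta> X) (fob G X) (fob F X)"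
    and \<theta>\<eta>: "\<And>X. X \<in> Obj A \<Longrightarrow> \<theta> X \<cdot>\<^bsub>B\<^esub> \<eta> X = Idn B (fob F X)"
    and \<eta>\<theta>: "\<And>X. X \<in> Obj A \<Longrightarrow> \<eta> X \<cdot>\<^bsub>B\<^esub> \<theta> X = Idn B (fob G X)"
    using B.is_iso_ar[OF i] FO by metis
  have \<theta>: "nat_trans A B G F \<theta>" unfolding nat_trans_def
  proof (intro conjI ballI)
    show "\<theta> X \<in> Hom B (fob G X) (fob F X)" if "X \<in> Obj A" for X using B.arD(3)[OF \<theta>a[OF that]] .
    fix X Y f assume XY: "X \<in> Obj A" "Y \<in> Obj A" and f0: "f \<in> Hom A X Y"
    note f = A.arI[OF XY f0]
    note Ff = functor_ar[OF A B FF f] and Gf = functor_ar[OF A B FG f]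
    have n: "\<eta> Y \<cdot>\<^bsub>B\<^esub> far F f = far G f \<cdot>\<^bsub>B\<^esub> \<eta> X" using \<eta> XY f0 by (simp add: nat_trans_def)
    have "\<theta> Y \<cdot>\<^bsub>B\<^esub> far G f = \<theta> Y \<cdot>\<^bsub>B\<^esub> (far G f \<cdot>\<^bsub>B\<^esub> (\<eta> X \<cdot>\<^bsub>B\<^esub> \<theta> X))"
      using \<eta>\<theta>[OF XY(1)] B.idr[OF Gf] by simp
    also have "\<dots> = \<theta> Y \<cdot>\<^bsub>B\<^esub> (\<eta> Y \<cdot>\<^bsub>B\<^esub> (far F f \<cdot>\<^bsub>B\<^esub> \<theta> X))"
      using B.assoc[OF \<theta>a[OF XY(1)] \<eta>a[OF XY(1)] Gf] B.assoc[OF \<theta>a[OF XY(1)] Ff \<eta>a[OF XY(2)]] n by simp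
    also have "\<dots> = far F f \<cdot>\<^bsub>B\<^esub> \<theta> X"
      using B.assoc[OF B.ar_Cmp[OF \<theta>a[OF XY(1)] Ff] \<eta>a[OF XY(2)] \<theta>a[OF XY(2)]] \<theta>\<eta>[OF XY(2)]
        B.idl[OF B.ar_Cmp[OF \<theta>a[OF XY(1)] Ff]] by simp
    finally show "\<theta> Y \<cdot>\<^bsub>B\<^esub> far G f = far F f \<cdot>\<^bsub>B\<^esub> \<theta> X" .
  qed
  let ?\<eta> = "restrict \<eta> (Obj A)" and ?\<theta> = "restrict \<theta> (Obj A)"
  have "nat_trans A B F G ?\<eta>" "nat_trans A B G F ?\<theta>" using \<eta> \<theta> by (simp_all add: nat_trans_def)
  then have "(F, ?\<eta>, G) \<in> Hom (fun_cat R A B) F G" "(G, ?\<theta>, F) \<in> Hom (fun_cat R A B) G F"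
    by (simp_all add: fun_cat_simps)
  moreover have "(G, ?\<theta>, F) \<cdot>\<^bsub>fun_cat R A B\<^esub> (F, ?\<eta>, G) = Idn (fun_cat R A B) F"
    "(F, ?\<eta>, G) \<cdot>\<^bsub>fun_cat R A B\<^esub> (G, ?\<theta>, F) = Idn (fun_cat R A B) G"
    unfolding fun_cat_simps by (auto simp: fun_eq_iff restrict_def \<theta>\<eta> \<eta>\<theta>)
  ultimately show ?thesis unfolding isomorphic_def is_iso_def by blast
qed

lemma rarr_iso:
  assumes f: "f \<in> mod_iso R M N" and M: "module R M" and N: "module R N"
  shows "is_iso (Rmod R) M N (rarr M f N)"
proof -
  note b = mod_isoD(2)[OF f]
  let ?g = "inv_into (carrier M) f"
  have "rarr N ?g M \<in> Hom (Rmod R) N M" by (rule rarr_Hom[OF mod_isoD(1)[OF mod_iso_inv[OF f M]] N])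
  moreover have "rarr N ?g M \<cdot>\<^bsub>Rmod R\<^esub> rarr M f N = Idn (Rmod R) M"
    unfolding Rmod_simps using b by (subst rarr_cmp) (auto simp: rarr_eq bij_betw_inv_into_left bij_betw_def)
  moreover have "rarr M f N \<cdot>\<^bsub>Rmod R\<^esub> rarr N ?g M = Idn (Rmod R) N"
    unfolding Rmod_simps using b bij_betw_inv_into[OF b]
    by (subst rarr_cmp) (auto simp: rarr_eq bij_betw_inv_into_right dest: bij_betwE)
  ultimately show ?thesis unfolding is_iso_def using rarr_Hom[OF mod_isoD(1)[OF f] M] by blast
qed

lemma Rmod_lin_simps:
  "hadd (Rmod R) (rarr M f N) (rarr M g N) = rarr M (\<lambda>x. f x \<oplus>\<^bsub>N\<^esub> g x) N"
  "hscale (Rmod R) r (rarr M f N) = rarr M (\<lambda>x. r \<odot>\<^bsub>N\<^esub> f x) N"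
  by (auto simp: Rmod_def rarr_def fun_eq_iff restrict_def)

section \<open>The restricted Yoneda functor\<close>

context serre_setup
begin

lemma A_Obj: "M \<in> \<A> \<Longrightarrow> M \<in> Obj (Rmod R)"
  using weak_serre_Obj[OF serre] by blast

lemma A_module: "M \<in> \<A> \<Longrightarrow> module R M"
  using A_Obj by (simp add: Rmod_simps)

text \<open>Hom-modules consist of arrows of \<open>C\<close>, whereas the values of the functors are modules over \<open>'u\<close> in \<open>\<A>\<close>.
  The module \<open>yval N P\<close> is a chosen copy of \<open>C(P,N)\<close> there, with chosen isomorphism \<open>\<rho> N P\<close> and inverse
  \<open>\<rho>i N P\<close>.\<close>

definition yval :: "'o \<Rightarrow> 'o \<Rightarrow> ('r, 'u) module" where
  "yval N P = (SOME M. M \<in> \<A> \<and> mod_iso R (hom P N) M \<noteq> {})"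

definition \<rho> :: "'o \<Rightarrow> 'o \<Rightarrow> 'm \<Rightarrow> 'u" where
  "\<rho> N P = (SOME f. f \<in> mod_iso R (hom P N) (yval N P))"

definition \<rho>i :: "'o \<Rightarrow> 'o \<Rightarrow> 'u \<Rightarrow> 'm" where
  "\<rho>i N P = inv_into (Hom C P N) (\<rho> N P)"

text \<open>The functor \<open>C(-,N)\<close> transported along \<open>\<rho>\<close>. Its action on an arrow depends on the source and target, which
  the arrow determines since hom-sets are disjoint.\<close>

definition Yob where
  "Yob N = \<lparr>fob = restrict (yval N) HW,
     far = restrict (\<lambda>f. rarr (yval N (arr_tgt C f)) (\<lambda>z. \<rho> N (arr_src C f) (\<rho>i N (arr_tgt C f) z \<cdot> f)) (yval N (arr_src C f)))
       (\<Union>X \<in> HW. \<Union>Y \<in> HW. Hom C Y X)\<rparr>"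

definition Yar where
  "Yar g = (Yob (arr_src C g),
     restrict (\<lambda>P. rarr (yval (arr_src C g) P) (\<lambda>z. \<rho> (arr_tgt C g) P (g \<cdot> \<rho>i (arr_src C g) P z)) (yval (arr_tgt C g) P)) HW,
     Yob (arr_tgt C g))"

abbreviation "AA \<equiv> op_cat (full_sub C HW)"
abbreviation "BB \<equiv> full_sub (Rmod R) \<A>"

lemma AA_category: "category AA" and BB_category: "category BB"
  and HA_category: "category (full_sub C HA)"
proof -
  show "category AA" by (rule op_category[OF full_sub_category]) (use HW_Obj in \<open>unfold_locales, auto\<close>)
  show "category BB" by (rule full_sub_category[OF Rmod_category]) (use A_Obj in auto)
  show "category (full_sub C HA)"
    by (rule full_sub_category) (use tle_Obj in \<open>unfold_locales, auto simp: HA_def\<close>)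
qed

lemma HA_D: assumes "N \<in> HA" shows "N \<in> Obj C" "N \<in> tle 0" "N \<in> tge 0" "N \<in> CA"
  using assms tle_Obj by (auto simp: HA_def)

lemma yval: assumes "N \<in> HA" "P \<in> HW" shows "yval N P \<in> \<A>" "\<rho> N P \<in> mod_iso R (hom P N) (yval N P)"
proof -
  have "\<exists>M. M \<in> \<A> \<and> mod_iso R (hom P N) M \<noteq> {}"
    using HA_D(4)[OF assms(1)] HW_C0[OF assms(2)] by (auto simp: CA_iff belongs_to_def)
  then have 1: "yval N P \<in> \<A> \<and> mod_iso R (hom P N) (yval N P) \<noteq> {}" unfolding yval_def by (rule someI_ex)
  then show "yval N P \<in> \<A>" by blast
  show "\<rho> N P \<in> mod_iso R (hom P N) (yval N P)" unfolding \<rho>_def using 1 some_in_eq[of "mod_iso R (hom P N) (yval N P)"] by simp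
qed

lemma \<rho>:
  assumes "N \<in> HA" "P \<in> HW"
  shows "ar x P N \<Longrightarrow> \<rho> N P x \<in> carrier (yval N P)" "ar x P N \<Longrightarrow> \<rho>i N P (\<rho> N P x) = x"
    "z \<in> carrier (yval N P) \<Longrightarrow> ar (\<rho>i N P z) P N" "z \<in> carrier (yval N P) \<Longrightarrow> \<rho> N P (\<rho>i N P z) = z"
proof -
  note b = mod_isoD(2)[OF yval(2)[OF assms], simplified]
  show "ar x P N \<Longrightarrow> \<rho> N P x \<in> carrier (yval N P)" using b arD(3) bij_betwE by blast
  show "ar x P N \<Longrightarrow> \<rho>i N P (\<rho> N P x) = x" unfolding \<rho>i_def using bij_betw_inv_into_left[OF b] arD(3) by blast
  show "z \<in> carrier (yval N P) \<Longrightarrow> ar (\<rho>i N P z) P N"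
    using bij_betw_inv_into[OF b] HA_D(1)[OF assms(1)] HW_Obj[OF assms(2)] unfolding \<rho>i_def ar_def
    by (auto dest: bij_betwE)
  show "z \<in> carrier (yval N P) \<Longrightarrow> \<rho> N P (\<rho>i N P z) = z"
    unfolding \<rho>i_def by (rule bij_betw_inv_into_right[OF b])
qed

lemma yval_module: "N \<in> HA \<Longrightarrow> P \<in> HW \<Longrightarrow> module R (yval N P)"
  using A_module yval(1) by blast

lemma \<rho>i_lin: assumes "N \<in> HA" "P \<in> HW" shows "\<rho>i N P \<in> lin_map R (yval N P) (hom P N)"
  using mod_isoD(1)[OF mod_iso_inv[OF yval(2)[OF assms] hom_module[OF HW_Obj[OF assms(2)] HA_D(1)[OF assms(1)]]]]
  by (simp add: \<rho>i_def)

lemma Yob_simps: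
  assumes N: "N \<in> HA" and P: "P \<in> HW" "P' \<in> HW"
  shows "fob (Yob N) P = yval N P"
    "ar f P' P \<Longrightarrow> far (Yob N) f = rarr (yval N P) (\<lambda>z. \<rho> N P' (\<rho>i N P z \<cdot> f)) (yval N P')"
proof -
  show "fob (Yob N) P = yval N P" using P by (simp add: Yob_def)
  assume f: "ar f P' P"
  then have "f \<in> (\<Union>X \<in> HW. \<Union>Y \<in> HW. Hom C Y X)" using P arD(3) by blast
  then show "far (Yob N) f = rarr (yval N P) (\<lambda>z. \<rho> N P' (\<rho>i N P z \<cdot> f)) (yval N P')"
    using arr_src_tgt[OF f] by (simp add: Yob_def)
qed

lemma Yob_lin:
  assumes N: "N \<in> HA" and P: "P \<in> HW" "P' \<in> HW" and f: "ar f P' P"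
  shows "(\<lambda>z. \<rho> N P' (\<rho>i N P z \<cdot> f)) \<in> lin_map R (yval N P) (yval N P')"
  using lin_map_comp[OF lin_map_comp[OF \<rho>i_lin[OF N P(1)] pre_lin[OF f HA_D(1)[OF N]]] mod_isoD(1)[OF yval(2)[OF N P(2)]]]
  by simp

lemma Yob_Obj:
  assumes N: "N \<in> HA" shows "Yob N \<in> Obj (fun_cat R AA BB)"
proof -
  note s1 = Yob_simps(1)[OF N] and s2 = Yob_simps(2)[OF N]
  have a: "ar f X Y" if "X \<in> HW" "Y \<in> HW" "f \<in> Hom C X Y" for f X Y using that HW_Obj by (simp add: ar_def)
  have "is_linear_functor R AA BB (Yob N)"
    unfolding is_linear_functor_def is_functor_def
  proof (intro conjI ballI; simp)
    show "fob (Yob N) \<in> HW \<rightarrow> \<A>" using yval(1)[OF N] s1 by auto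
    fix X assume X: "X \<in> HW"
    show "far (Yob N) (Idn C X) = Idn (Rmod R) (fob (Yob N) X)"
      unfolding s2[OF X X ar_Idn[OF HW_Obj[OF X]]] s1[OF X X] Rmod_simps rarr_eq
      using \<rho>(4)[OF N X] idr[OF \<rho>(3)[OF N X]] by simp
    fix Y assume Y: "Y \<in> HW"
    show "far (Yob N) \<in> Hom C Y X \<rightarrow> Hom (Rmod R) (fob (Yob N) X) (fob (Yob N) Y)"
      using s2[OF X Y] s1[OF X X] s1[OF Y Y] rarr_Hom[OF Yob_lin[OF N X Y] yval_module[OF N X]] a[OF Y X] by auto
    {
      fix Z f g assume Z: "Z \<in> HW" and f0: "f \<in> Hom C Y X" and g0: "g \<in> Hom C Z Y"
      note f = a[OF Y X f0] and g = a[OF Z Y g0]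
      show "far (Yob N) (f \<cdot> g) = far (Yob N) g \<cdot>\<^bsub>Rmod R\<^esub> far (Yob N) f"
        unfolding s2[OF X Y f] s2[OF Y Z g] s2[OF X Z ar_Cmp[OF g f]]
      proof (subst rarr_cmp)
        show "\<rho> N Y (\<rho>i N X x \<cdot> f) \<in> carrier (yval N Y)" if "x \<in> carrier (yval N X)" for x
          using \<rho>(1)[OF N Y ar_Cmp[OF f \<rho>(3)[OF N X that]]] .
        show "rarr (yval N X) (\<lambda>z. \<rho> N Z (\<rho>i N X z \<cdot> (f \<cdot> g))) (yval N Z) =
            rarr (yval N X) (\<lambda>x. \<rho> N Z (\<rho>i N Y (\<rho> N Y (\<rho>i N X x \<cdot> f)) \<cdot> g)) (yval N Z)"
          unfolding rarr_eq
          using \<rho>(2)[OF N Y ar_Cmp[OF f \<rho>(3)[OF N X]]] assoc[OF g f \<rho>(3)[OF N X]] by simp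
      qed
    }
    {
      fix f g assume f0: "f \<in> Hom C Y X" and g0: "g \<in> Hom C Y X"
      note f = a[OF Y X f0] and g = a[OF Y X g0]
      show "far (Yob N) (hadd C f g) = hadd (Rmod R) (far (Yob N) f) (far (Yob N) g)"
        unfolding s2[OF X Y f] s2[OF X Y g] s2[OF X Y ar_add[OF f g]] Rmod_lin_simps rarr_eq
      proof
        fix z assume "z \<in> carrier (yval N X)"
        note z = \<rho>(3)[OF N X this]
        show "\<rho> N Y (\<rho>i N X z \<cdot> hadd C f g) = \<rho> N Y (\<rho>i N X z \<cdot> f) \<oplus>\<^bsub>yval N Y\<^esub> \<rho> N Y (\<rho>i N X z \<cdot> g)"
          using lin_mapD(2)[OF mod_isoD(1)[OF yval(2)[OF N Y]], of "\<rho>i N X z \<cdot> f" "\<rho>i N X z \<cdot> g"]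
            arD(3)[OF ar_Cmp[OF f z]] arD(3)[OF ar_Cmp[OF g z]] cmp_add_right[OF f g z] by simp
      qed
    }
    {
      fix r f assume r: "r \<in> carrier R" and f0: "f \<in> Hom C Y X"
      note f = a[OF Y X f0]
      show "far (Yob N) (hscale C r f) = hscale (Rmod R) r (far (Yob N) f)"
        unfolding s2[OF X Y f] s2[OF X Y ar_scale[OF r f]] Rmod_lin_simps rarr_eq
      proof
        fix z assume "z \<in> carrier (yval N X)"
        note z = \<rho>(3)[OF N X this]
        have "\<rho>i N X z \<cdot> hscale C r f = hscale C r (\<rho>i N X z \<cdot> f)"
          using Cmp_hscale_right[of Y X N r f "\<rho>i N X z"] f z r by (simp add: ar_def)
        then show "\<rho> N Y (\<rho>i N X z \<cdot> hscale C r f) = r \<odot>\<^bsub>yval N Y\<^esub> \<rho> N Y (\<rho>i N X z \<cdot> f)"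
          using lin_mapD(3)[OF mod_isoD(1)[OF yval(2)[OF N Y]] r, of "\<rho>i N X z \<cdot> f"]
            arD(3)[OF ar_Cmp[OF f z]] by simp
      qed
    }
  qed
  then show ?thesis by (simp add: fun_cat_simps) (simp add: Yob_def)
qed

lemma Yar_simps:
  assumes "ar g N N'"
  shows "Yar g = (Yob N, restrict (\<lambda>P. rarr (yval N P) (\<lambda>z. \<rho> N' P (g \<cdot> \<rho>i N P z)) (yval N' P)) HW, Yob N')"
  using arr_src_tgt[OF assms] by (simp add: Yar_def)

lemma Yar_lin:
  assumes N: "N \<in> HA" "N' \<in> HA" and P: "P \<in> HW" and g: "ar g N N'"
  shows "(\<lambda>z. \<rho> N' P (g \<cdot> \<rho>i N P z)) \<in> lin_map R (yval N P) (yval N' P)"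
  using lin_map_comp[OF lin_map_comp[OF \<rho>i_lin[OF N(1) P] post_lin[OF g HW_Obj[OF P]]] mod_isoD(1)[OF yval(2)[OF N(2) P]]]
  by simp

lemma Yar_Hom:
  assumes N: "N \<in> HA" "N' \<in> HA" and g: "ar g N N'"
  shows "Yar g \<in> Hom (fun_cat R AA BB) (Yob N) (Yob N')"
proof -
  let ?\<eta> = "restrict (\<lambda>P. rarr (yval N P) (\<lambda>z. \<rho> N' P (g \<cdot> \<rho>i N P z)) (yval N' P)) HW"
  have "nat_trans AA BB (Yob N) (Yob N') ?\<eta>"
    unfolding nat_trans_def
  proof (intro conjI ballI; simp)
    fix X assume X: "X \<in> HW"
    show "rarr (yval N X) (\<lambda>z. \<rho> N' X (g \<cdot> \<rho>i N X z)) (yval N' X) \<in> Hom (Rmod R) (fob (Yob N) X) (fob (Yob N') X)"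
      using rarr_Hom[OF Yar_lin[OF N X g] yval_module[OF N(1) X]] Yob_simps(1) N X by simp
    fix Y f assume Y: "Y \<in> HW" and f0: "f \<in> Hom C Y X"
    have f: "ar f Y X" using f0 X Y HW_Obj by (simp add: ar_def)
    have "rarr (yval N Y) (\<lambda>z. \<rho> N' Y (g \<cdot> \<rho>i N Y z)) (yval N' Y) \<cdot>\<^bsub>Rmod R\<^esub> far (Yob N) f =
        rarr (yval N X) (\<lambda>z. \<rho> N' Y (g \<cdot> \<rho>i N Y (\<rho> N Y (\<rho>i N X z \<cdot> f)))) (yval N' Y)"
      unfolding Yob_simps(2)[OF N(1) X Y f]
      by (rule rarr_cmp) (rule lin_mapD(1)[OF Yob_lin[OF N(1) X Y f]])
    also have "\<dots> = rarr (yval N X) (\<lambda>z. \<rho> N' Y (\<rho>i N' X (\<rho> N' X (g \<cdot> \<rho>i N X z)) \<cdot> f)) (yval N' Y)"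
      unfolding rarr_eq
    proof
      fix z assume "z \<in> carrier (yval N X)"
      note z = \<rho>(3)[OF N(1) X this]
      show "\<rho> N' Y (g \<cdot> \<rho>i N Y (\<rho> N Y (\<rho>i N X z \<cdot> f))) = \<rho> N' Y (\<rho>i N' X (\<rho> N' X (g \<cdot> \<rho>i N X z)) \<cdot> f)"
        using \<rho>(2)[OF N(1) Y ar_Cmp[OF f z]] \<rho>(2)[OF N(2) X ar_Cmp[OF z g]] assoc[OF f z g] by simp
    qed
    also have "\<dots> = far (Yob N') f \<cdot>\<^bsub>Rmod R\<^esub> rarr (yval N X) (\<lambda>z. \<rho> N' X (g \<cdot> \<rho>i N X z)) (yval N' X)"
      unfolding Yob_simps(2)[OF N(2) X Y f]
      by (rule rarr_cmp[symmetric]) (rule lin_mapD(1)[OF Yar_lin[OF N X g]])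
    finally show "rarr (yval N Y) (\<lambda>z. \<rho> N' Y (g \<cdot> \<rho>i N Y z)) (yval N' Y) \<cdot>\<^bsub>Rmod R\<^esub> far (Yob N) f =
       far (Yob N') f \<cdot>\<^bsub>Rmod R\<^esub> rarr (yval N X) (\<lambda>z. \<rho> N' X (g \<cdot> \<rho>i N X z)) (yval N' X)" .
  qed
  then show ?thesis unfolding Yar_simps[OF g] fun_cat_simps by simp
qed

definition yoneda where "yoneda = \<lparr>fob = Yob, far = Yar\<rparr>"

lemma yoneda_functor: "is_functor (full_sub C HA) (fun_cat R AA BB) yoneda"
  unfolding is_functor_def yoneda_def
proof (intro conjI ballI; simp)
  show "Yob \<in> HA \<rightarrow> Obj (fun_cat R AA BB)" using Yob_Obj by blast
  fix X assume X: "X \<in> HA"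
  note XO = HA_D(1)[OF X]
  show "Yar (Idn C X) = Idn (fun_cat R AA BB) (Yob X)"
    unfolding Yar_simps[OF ar_Idn[OF XO]] fun_cat_simps
    by (auto simp: fun_eq_iff restrict_def Yob_simps(1)[OF X] Rmod_simps rarr_eq \<rho>(4)[OF X] idl[OF \<rho>(3)[OF X]])
  fix Y assume Y: "Y \<in> HA"
  note YO = HA_D(1)[OF Y]
  show "Yar \<in> Hom C X Y \<rightarrow> Hom (fun_cat R AA BB) (Yob X) (Yob Y)"
    using Yar_Hom[OF X Y arI[OF XO YO]] by blast
  fix Z f g assume Z: "Z \<in> HA" and f0: "f \<in> Hom C X Y" and g0: "g \<in> Hom C Y Z"
  note ZO = HA_D(1)[OF Z]
  note f = arI[OF XO YO f0] and g = arI[OF YO ZO g0]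
  have "rarr (yval X P) (\<lambda>z. \<rho> Z P (g \<cdot> f \<cdot> \<rho>i X P z)) (yval Z P) =
      rarr (yval Y P) (\<lambda>z. \<rho> Z P (g \<cdot> \<rho>i Y P z)) (yval Z P) \<cdot>\<^bsub>Rmod R\<^esub> rarr (yval X P) (\<lambda>z. \<rho> Y P (f \<cdot> \<rho>i X P z)) (yval Y P)"
    if P: "P \<in> HW" for P
  proof (subst rarr_cmp)
    show "\<rho> Y P (f \<cdot> \<rho>i X P x) \<in> carrier (yval Y P)" if "x \<in> carrier (yval X P)" for x
      by (rule lin_mapD(1)[OF Yar_lin[OF X Y P f] that])
    show "rarr (yval X P) (\<lambda>z. \<rho> Z P (g \<cdot> f \<cdot> \<rho>i X P z)) (yval Z P) =
      rarr (yval X P) (\<lambda>x. \<rho> Z P (g \<cdot> \<rho>i Y P (\<rho> Y P (f \<cdot> \<rho>i X P x)))) (yval Z P)"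
      unfolding rarr_eq using \<rho>(2)[OF Y P ar_Cmp[OF \<rho>(3)[OF X P] f]] assoc[OF \<rho>(3)[OF X P] f g] by simp
  qed
  then show "Yar (g \<cdot> f) = Yar g \<cdot>\<^bsub>fun_cat R AA BB\<^esub> Yar f"
    unfolding Yar_simps[OF f] Yar_simps[OF g] Yar_simps[OF ar_Cmp[OF f g]] fun_cat_simps
    by (auto simp: fun_eq_iff restrict_def)
qed

text \<open>Injectivity is \<open>HW_faithful\<close> and surjectivity is \<open>HW_full\<close>, both read through the isomorphisms \<open>\<rho>\<close>.\<close>

lemma yoneda_fully_faithful:
  assumes N: "N \<in> HA" "N' \<in> HA"
  shows "bij_betw Yar (Hom C N N') (Hom (fun_cat R AA BB) (Yob N) (Yob N'))"
  unfolding bij_betw_def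
proof
  note NO = HA_D(1)[OF N(1)] HA_D(1)[OF N(2)]
  show "inj_on Yar (Hom C N N')"
  proof (rule inj_onI)
    fix g g' assume g0: "g \<in> Hom C N N'" "g' \<in> Hom C N N'" and e: "Yar g = Yar g'"
    note g = arI[OF NO g0(1)] arI[OF NO g0(2)]
    show "g = g'"
    proof (rule HW_faithful[OF HA_D(3)[OF N(1)] HA_D(2)[OF N(2)] g])
      fix Q x assume Q: "Q \<in> HW" and x: "ar x Q N"
      have "rarr (yval N Q) (\<lambda>z. \<rho> N' Q (g \<cdot> \<rho>i N Q z)) (yval N' Q) = rarr (yval N Q) (\<lambda>z. \<rho> N' Q (g' \<cdot> \<rho>i N Q z)) (yval N' Q)"
        using e Q unfolding Yar_simps[OF g(1)] Yar_simps[OF g(2)] by (auto simp: fun_eq_iff restrict_def split: if_splits)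
      then have "\<rho> N' Q (g \<cdot> x) = \<rho> N' Q (g' \<cdot> x)"
        unfolding rarr_eq using \<rho>(1,2)[OF N(1) Q x] by metis
      then show "g \<cdot> x = g' \<cdot> x"
        using \<rho>(2)[OF N(2) Q ar_Cmp[OF x g(1)]] \<rho>(2)[OF N(2) Q ar_Cmp[OF x g(2)]] by metis
    qed
  qed
  show "Yar ` Hom C N N' = Hom (fun_cat R AA BB) (Yob N) (Yob N')"
  proof
    show "Yar ` Hom C N N' \<subseteq> Hom (fun_cat R AA BB) (Yob N) (Yob N')"
      using Yar_Hom[OF N arI[OF NO]] by blast
    show "Hom (fun_cat R AA BB) (Yob N) (Yob N') \<subseteq> Yar ` Hom C N N'"
    proof
      fix a assume "a \<in> Hom (fun_cat R AA BB) (Yob N) (Yob N')"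
      then obtain \<eta> where a: "a = (Yob N, \<eta>, Yob N')" and \<eta>: "nat_trans AA BB (Yob N) (Yob N') \<eta>"
        and ext: "\<eta> \<in> extensional HW" by (auto simp: fun_cat_simps)
      have "\<exists>h. h \<in> lin_map R (yval N P) (yval N' P) \<and> \<eta> P = rarr (yval N P) h (yval N' P)" if P: "P \<in> HW" for P
      proof -
        have "\<eta> P \<in> Hom (Rmod R) (fob (Yob N) P) (fob (Yob N') P)" using \<eta> P by (simp add: nat_trans_def)
        then have "\<eta> P \<in> Hom (Rmod R) (yval N P) (yval N' P)"
          using Yob_simps(1)[OF N(1) P P] Yob_simps(1)[OF N(2) P P] by simp
        then show ?thesis by (rule Rmod_HomE) blast
      qed
      then obtain h where h: "\<And>P. P \<in> HW \<Longrightarrow> h P \<in> lin_map R (yval N P) (yval N' P)"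
        and \<eta>h: "\<And>P. P \<in> HW \<Longrightarrow> \<eta> P = rarr (yval N P) (h P) (yval N' P)" by metis
      have nat: "h P' (\<rho> N P' (x \<cdot> f)) = \<rho> N' P' (\<rho>i N' P (h P (\<rho> N P x)) \<cdot> f)"
        if P: "P \<in> HW" "P' \<in> HW" and f: "ar f P' P" and x: "ar x P N" for P P' f x
      proof -
        have "\<eta> P' \<cdot>\<^bsub>Rmod R\<^esub> far (Yob N) f = far (Yob N') f \<cdot>\<^bsub>Rmod R\<^esub> \<eta> P"
          using \<eta> P arD(3)[OF f] by (simp add: nat_trans_def)
        then have "rarr (yval N P) (\<lambda>z. h P' (\<rho> N P' (\<rho>i N P z \<cdot> f))) (yval N' P') =
            rarr (yval N P) (\<lambda>z. \<rho> N' P' (\<rho>i N' P (h P z) \<cdot> f)) (yval N' P')"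
          by (simp add: \<eta>h[OF P(1)] \<eta>h[OF P(2)] Yob_simps(2)[OF N(1) P f] Yob_simps(2)[OF N(2) P f]
            rarr_cmp lin_mapD(1)[OF Yob_lin[OF N(1) P f]] lin_mapD(1)[OF h[OF P(1)]])
        then show ?thesis unfolding rarr_eq using \<rho>(1,2)[OF N(1) P(1) x] by auto
      qed
      have hc: "h P (\<rho> N P x) \<in> carrier (yval N' P)" if "P \<in> HW" "ar x P N" for P x
        using lin_mapD(1)[OF h[OF that(1)] \<rho>(1)[OF N(1) that]] .
      obtain g where g: "ar g N N'" and gx: "\<And>Q x. Q \<in> HW \<Longrightarrow> ar x Q N \<Longrightarrow> g \<cdot> x = \<rho>i N' Q (h Q (\<rho> N Q x))"
      proof -
        have "\<exists>g. ar g N N' \<and> (\<forall>Q \<in> HW. \<forall>x. ar x Q N \<longrightarrow> g \<cdot> x = \<rho>i N' Q (h Q (\<rho> N Q x)))"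
        proof (rule HW_full[OF HA_D(3)[OF N(1)] HA_D(2)[OF N(1)] HA_D(2)[OF N(2)]])
          show "ar (\<rho>i N' Q (h Q (\<rho> N Q x))) Q N'" if "Q \<in> HW" "ar x Q N" for Q x
            by (rule \<rho>(3)[OF N(2) that(1) hc[OF that]])
          show "\<rho>i N' Q (h Q (\<rho> N Q (hadd C x y))) = hadd C (\<rho>i N' Q (h Q (\<rho> N Q x))) (\<rho>i N' Q (h Q (\<rho> N Q y)))"
            if Q: "Q \<in> HW" and x: "ar x Q N" and y: "ar y Q N" for Q x y
            using lin_mapD(2)[OF lin_map_comp[OF lin_map_comp[OF mod_isoD(1)[OF yval(2)[OF N(1) Q]] h[OF Q]] \<rho>i_lin[OF N(2) Q]], of x y]
              arD(3)[OF x] arD(3)[OF y] by simp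
          show "\<rho>i N' Q' (h Q' (\<rho> N Q' (x \<cdot> f))) = \<rho>i N' Q (h Q (\<rho> N Q x)) \<cdot> f"
            if Q: "Q \<in> HW" "Q' \<in> HW" and x: "ar x Q N" and f: "ar f Q' Q" for Q Q' x f
            unfolding nat[OF Q f x]
            by (rule \<rho>(2)[OF N(2) Q(2) ar_Cmp[OF f \<rho>(3)[OF N(2) Q(1) hc[OF Q(1) x]]]])
        qed
        then show thesis using that by blast
      qed
      have "rarr (yval N P) (\<lambda>z. \<rho> N' P (g \<cdot> \<rho>i N P z)) (yval N' P) = \<eta> P" if P: "P \<in> HW" for P
        unfolding \<eta>h[OF P] rarr_eq
      proof
        fix z assume z: "z \<in> carrier (yval N P)"
        show "\<rho> N' P (g \<cdot> \<rho>i N P z) = h P z"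
          unfolding gx[OF P \<rho>(3)[OF N(1) P z]] \<rho>(4)[OF N(1) P z]
          by (rule \<rho>(4)[OF N(2) P lin_mapD(1)[OF h[OF P] z]])
      qed
      then have "Yar g = a"
        unfolding a Yar_simps[OF g] using ext by (auto simp: fun_eq_iff restrict_def extensional_def)
      then show "a \<in> Yar ` Hom C N N'" using arD(3)[OF g] by blast
    qed
  qed
qed

text \<open>The object provided by \<open>HW_represent\<close> lies in \<open>CA\<close> because its values on \<open>HW\<close> belong to \<open>\<A>\<close>.\<close>

lemma yoneda_ess_surj:
  assumes F: "F \<in> Obj (fun_cat R AA BB)"
  shows "\<exists>N \<in> HA. isomorphic (fun_cat R AA BB) (Yob N) F"
proof -
  have lin: "is_linear_functor R AA BB F" using F by (simp add: fun_cat_simps)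
  then have fu: "is_functor AA BB F" by (simp add: is_linear_functor_def)
  have FA: "fob F Q \<in> \<A>" if "Q \<in> HW" for Q using fu that by (auto simp: is_functor_def)
  note Fm = A_module[OF FA]
  define Fa where "Fa = (\<lambda>f. mid (far F f))"
  have H: "far F f = rarr (fob F Q) (Fa f) (fob F Q') \<and> Fa f \<in> lin_map R (fob F Q) (fob F Q')"
    if Q: "Q \<in> HW" "Q' \<in> HW" and f: "ar f Q' Q" for Q Q' f
  proof -
    have "far F f \<in> Hom (Rmod R) (fob F Q) (fob F Q')"
      using fu Q arD(3)[OF f] by (auto simp: is_functor_def Pi_iff)
    then obtain h where h: "h \<in> lin_map R (fob F Q) (fob F Q')" "far F f = rarr (fob F Q) h (fob F Q')" by (rule Rmod_HomE)
    have e: "Fa f x = h x" if "x \<in> carrier (fob F Q)" for x using mid_rarr[OF that, of h "fob F Q'"] h(2) by (simp add: Fa_def)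
    have "Fa f \<in> lin_map R (fob F Q) (fob F Q')"
      by (rule lin_mapI) (simp_all add: e lin_mapD[OF h(1)] module_closed[OF Fm[OF Q(1)]])
    then show ?thesis using h(2) e by (simp add: rarr_eq)
  qed
  note far = conjunct1[OF H] and fl = conjunct2[OF H]
  have fid: "Fa (Idn C Q) x = x" if Q: "Q \<in> HW" and x: "x \<in> carrier (fob F Q)" for Q x
  proof -
    have "far F (Idn C Q) = Idn (Rmod R) (fob F Q)" using fu Q by (simp add: is_functor_def)
    then show ?thesis using mid_rarr[OF x, of "\<lambda>x. x" "fob F Q"] by (simp add: Fa_def Rmod_simps)
  qed
  have fc: "Fa (g \<cdot> f) x = Fa f (Fa g x)" if Q: "Q1 \<in> HW" "Q2 \<in> HW" "Q3 \<in> HW" and f: "ar f Q1 Q2" and g: "ar g Q2 Q3"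
    and x: "x \<in> carrier (fob F Q3)" for Q1 Q2 Q3 f g x
  proof -
    have "\<forall>f \<in> Hom AA Q2 Q1. \<forall>g \<in> Hom AA Q3 Q2. far F (f \<cdot>\<^bsub>AA\<^esub> g) = far F f \<cdot>\<^bsub>BB\<^esub> far F g"
      using fu Q unfolding is_functor_def by simp
    then have "far F (g \<cdot> f) = far F f \<cdot>\<^bsub>Rmod R\<^esub> far F g" using arD(3)[OF f] arD(3)[OF g] by simp
    then have "rarr (fob F Q3) (Fa (g \<cdot> f)) (fob F Q1) = rarr (fob F Q3) (\<lambda>x. Fa f (Fa g x)) (fob F Q1)"
      by (simp add: far[OF Q(3,1) ar_Cmp[OF f g]] far[OF Q(2,1) f] far[OF Q(3,2) g]
        rarr_cmp lin_mapD(1)[OF fl[OF Q(3,2) g]])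
    then show ?thesis using x by (simp add: rarr_eq)
  qed
  have fa: "Fa (hadd C f g) x = Fa f x \<oplus>\<^bsub>fob F Q'\<^esub> Fa g x" if Q: "Q \<in> HW" "Q' \<in> HW" and f: "ar f Q' Q" and g: "ar g Q' Q"
    and x: "x \<in> carrier (fob F Q)" for Q Q' f g x
  proof -
    have "far F (hadd C f g) = hadd (Rmod R) (far F f) (far F g)"
      using lin Q arD(3)[OF f] arD(3)[OF g] by (simp add: is_linear_functor_def)
    then show ?thesis
      unfolding far[OF Q ar_add[OF f g]] far[OF Q f] far[OF Q g] Rmod_lin_simps rarr_eq using x by blast
  qed
  have fsc: "Fa (hscale C r f) x = r \<odot>\<^bsub>fob F Q'\<^esub> Fa f x" if Q: "Q \<in> HW" "Q' \<in> HW" and f: "ar f Q' Q" and r: "r \<in> carrier R"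
    and x: "x \<in> carrier (fob F Q)" for Q Q' f r x
  proof -
    have "far F (hscale C r f) = hscale (Rmod R) r (far F f)"
      using lin Q arD(3)[OF f] r by (simp add: is_linear_functor_def)
    then show ?thesis
      unfolding far[OF Q ar_scale[OF r f]] far[OF Q f] Rmod_lin_simps rarr_eq using x by blast
  qed
  have "\<exists>N \<psi>. N \<in> tle 0 \<and> N \<in> tge 0 \<and> (\<forall>Q \<in> HW. \<psi> Q \<in> mod_iso R (hom Q N) (fob F Q)) \<and>
    (\<forall>Q \<in> HW. \<forall>Q' \<in> HW. \<forall>f x. ar f Q' Q \<longrightarrow> ar x Q N \<longrightarrow> \<psi> Q' (x \<cdot> f) = Fa f (\<psi> Q x))"
    by (rule HW_represent) (use Fm A_Obj[OF FA] fl fid fc fa fsc in \<open>auto simp: Rmod_simps\<close>)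
  then obtain N \<psi> where N: "N \<in> tle 0" "N \<in> tge 0" and \<psi>: "\<And>Q. Q \<in> HW \<Longrightarrow> \<psi> Q \<in> mod_iso R (hom Q N) (fob F Q)"
    and \<psi>nat: "\<And>Q Q' f x. Q \<in> HW \<Longrightarrow> Q' \<in> HW \<Longrightarrow> ar f Q' Q \<Longrightarrow> ar x Q N \<Longrightarrow> \<psi> Q' (x \<cdot> f) = Fa f (\<psi> Q x)"
    by (elim exE conjE) blast
  have "N \<in> CA"
    by (rule CA_from_heart[OF N]) (use \<psi> FA in \<open>auto simp: belongs_to_def HW_heart\<close>)
  then have NH: "N \<in> HA" using N by (simp add: HA_def)
  have i: "(\<lambda>z. \<psi> P (\<rho>i N P z)) \<in> mod_iso R (yval N P) (fob F P)" if P: "P \<in> HW" for P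
    using mod_iso_comp[OF mod_iso_inv[OF yval(2)[OF NH P] hom_module[OF HW_Obj[OF P] HA_D(1)[OF NH]]] \<psi>[OF P]]
    by (simp add: \<rho>i_def)
  define \<eta> where "\<eta> = (\<lambda>P. rarr (yval N P) (\<lambda>z. \<psi> P (\<rho>i N P z)) (fob F P))"
  have "isomorphic (fun_cat R AA BB) (Yob N) F"
  proof (rule fun_cat_isomorphic[OF AA_category BB_category Yob_Obj[OF NH] F])
    show "is_iso BB (fob (Yob N) X) (fob F X) (\<eta> X)" if "X \<in> Obj AA" for X
      using rarr_iso[OF i yval_module[OF NH] Fm, of X] that Yob_simps(1)[OF NH, of X X] by (simp add: is_iso_def \<eta>_def)
    show "nat_trans AA BB (Yob N) F \<eta>" unfolding nat_trans_def
    proof (intro conjI ballI; simp)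
      fix X assume X: "X \<in> HW"
      show "\<eta> X \<in> Hom (Rmod R) (fob (Yob N) X) (fob F X)"
        using rarr_Hom[OF mod_isoD(1)[OF i[OF X]] yval_module[OF NH X]] Yob_simps(1)[OF NH X X] by (simp add: \<eta>_def)
      fix Z f assume Z: "Z \<in> HW" and f0: "f \<in> Hom C Z X"
      have f: "ar f Z X" using f0 X Z HW_Obj by (simp add: ar_def)
      have "\<eta> Z \<cdot>\<^bsub>Rmod R\<^esub> far (Yob N) f = rarr (yval N X) (\<lambda>z. \<psi> Z (\<rho>i N Z (\<rho> N Z (\<rho>i N X z \<cdot> f)))) (fob F Z)"
        unfolding \<eta>_def Yob_simps(2)[OF NH X Z f]
        by (rule rarr_cmp) (rule lin_mapD(1)[OF Yob_lin[OF NH X Z f]])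
      also have "\<dots> = rarr (yval N X) (\<lambda>z. Fa f (\<psi> X (\<rho>i N X z))) (fob F Z)"
        unfolding rarr_eq
      proof
        fix z assume "z \<in> carrier (yval N X)"
        note z = \<rho>(3)[OF NH X this]
        show "\<psi> Z (\<rho>i N Z (\<rho> N Z (\<rho>i N X z \<cdot> f))) = Fa f (\<psi> X (\<rho>i N X z))"
          using \<rho>(2)[OF NH Z ar_Cmp[OF f z]] \<psi>nat[OF X Z f z] by simp
      qed
      also have "\<dots> = far F f \<cdot>\<^bsub>Rmod R\<^esub> \<eta> X"
        unfolding \<eta>_def far[OF X Z f]
        by (rule rarr_cmp[symmetric]) (rule lin_mapD(1)[OF mod_isoD(1)[OF i[OF X]]])
      finally show "\<eta> Z \<cdot>\<^bsub>Rmod R\<^esub> far (Yob N) f = far F f \<cdot>\<^bsub>Rmod R\<^esub> \<eta> X" .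
    qed
  qed
  then show ?thesis using NH by blast
qed

lemma heart_equivalence: "naturally_equivalent R C HA (heart w) \<A>"
  unfolding naturally_equivalent_def HW_heart[symmetric]
proof (intro exI[of _ yoneda] conjI)
  show "is_equivalence (full_sub C HA) (fun_cat R AA BB) yoneda"
  proof (rule equivalence_criterion[OF HA_category fun_cat_category[OF AA_category BB_category] yoneda_functor])
    show "bij_betw (far yoneda) (Hom (full_sub C HA) N N') (Hom (fun_cat R AA BB) (fob yoneda N) (fob yoneda N'))"
      if "N \<in> Obj (full_sub C HA)" "N' \<in> Obj (full_sub C HA)" for N N'
      using yoneda_fully_faithful that by (simp add: yoneda_def)
    show "\<exists>N \<in> Obj (full_sub C HA). isomorphic (fun_cat R AA BB) (fob yoneda N) F" if "F \<in> Obj (fun_cat R AA BB)" for F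
      using yoneda_ess_surj[OF that] by (simp add: yoneda_def)
  qed
  show "is_restricted_yoneda R C HW HA yoneda"
    unfolding is_restricted_yoneda_def
  proof (intro exI[of _ \<rho>] conjI ballI)
    fix N P assume N: "N \<in> HA" and P: "P \<in> HW"
    show "\<rho> N P \<in> mod_iso R (hom_mod C P N) (fob (fob yoneda N) P)"
      using yval(2)[OF N P] Yob_simps(1)[OF N P P] by (simp add: yoneda_def)
    fix P' f x assume P': "P' \<in> HW" and f0: "f \<in> Hom C P' P" and x0: "x \<in> Hom C P N"
    note f = arI[OF HW_Obj[OF P'] HW_Obj[OF P] f0] and x = arI[OF HW_Obj[OF P] HA_D(1)[OF N] x0]
    show "\<rho> N P' (x \<cdot> f) = mid (far (fob yoneda N) f) (\<rho> N P x)"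
      by (simp add: yoneda_def Yob_simps(2)[OF N P P' f] mid_rarr[OF \<rho>(1)[OF N P x]] \<rho>(2)[OF N P x])
  next
    fix N N' P g x assume N: "N \<in> HA" "N' \<in> HA" and P: "P \<in> HW" and g0: "g \<in> Hom C N N'" and x0: "x \<in> Hom C P N"
    note g = arI[OF HA_D(1)[OF N(1)] HA_D(1)[OF N(2)] g0] and x = arI[OF HW_Obj[OF P] HA_D(1)[OF N(1)] x0]
    have "mid (far yoneda g) P = rarr (yval N P) (\<lambda>z. \<rho> N' P (g \<cdot> \<rho>i N P z)) (yval N' P)"
      unfolding yoneda_def using Yar_simps[OF g] P by (simp add: mid_def)
    then show "\<rho> N' P (g \<cdot> x) = mid (mid (far yoneda g) P) (\<rho> N P x)"
      by (simp add: mid_rarr[OF \<rho>(1)[OF N(1) P x]] \<rho>(2)[OF N(1) P x])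
  qed
qed

end

section \<open>Restrictions of the t-structure and their hearts\<close>

theorem corollary4p2p5:
  fixes R :: "('r, 'k) ring_scheme"
    and C :: "('o, 'm, 'r) tcat"
    and C0 :: "'o set"
    and w :: "'o set \<times> 'o set"
    and \<A> :: "('r, 'u) module set"
  assumes "size_universe TYPE('u)"
    and "cring R" and "noetherian_ring R"
    and "triangulated_category R C"
    and "smashing TYPE('u) C"
    and "tri_subcat C C0"
    and "essentially_small TYPE('u) (full_sub C C0)"
    and "small_homs_from TYPE('u) C C0"
    and "C0 \<subseteq> compact_objects TYPE('u) C"
    and "generates TYPE('u) C C0"
    and "weight_structure (full_sub C C0) w"
    and "ess_bounded_below (full_sub C C0) w \<or> ess_bounded_above (full_sub C C0) w"
    and "weak_serre (Rmod R) \<A>"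
  defines "CA \<equiv> sub_A R C C0 \<A>"
  shows "(\<exists>!t. t_structure C t \<and> strictly_orthogonal C t w) \<and>
    (\<forall>t tA. t_structure C t \<and> strictly_orthogonal C t w \<and> tA = t_restriction t CA \<longrightarrow>
      t_restricts C t CA \<and>
      (ess_bounded_below (full_sub C C0) w \<longrightarrow>
        t_restricts (full_sub C CA) tA (CA \<inter> sub_plus C C0) \<and>
        naturally_equivalent R C
          (heart (t_restriction tA (CA \<inter> sub_plus C C0))) (heart w) \<A>) \<and>
      (ess_bounded_above (full_sub C C0) w \<longrightarrow>
        t_restricts (full_sub C CA) tA (CA \<inter> sub_minus C C0) \<and>
        naturally_equivalent R C
          (heart (t_restriction tA (CA \<inter> sub_minus C C0))) (heart w) \<A>) \<and>
      (ess_bounded_below (full_sub C C0) w \<and> ess_bounded_above (full_sub C C0) w \<longrightarrow>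
        t_restricts (full_sub C CA) tA (CA \<inter> sub_b C C0) \<and>
        naturally_equivalent R C
          (heart (t_restriction tA (CA \<inter> sub_b C C0))) (heart w) \<A>))"
proof -
  interpret S: serre_setup R C "TYPE('u)" C0 w \<A>
    by (intro serre_setup.intro weight_setup.intro weight_setup_axioms.intro serre_setup_axioms.intro assms)
  have CA: "CA = S.CA" by (simp add: CA_def S.CA_def)
  have uniq: "t = (S.tle 0, S.tge 0)" if "t_structure C t" "strictly_orthogonal C t w" for t
    using that S.strictly_orthogonal_iff[of t] by (simp add: t_structure_def)
  have so: "strictly_orthogonal C (S.tle 0, S.tge 0) w"
    using S.strictly_orthogonal_iff[of "(S.tle 0, S.tge 0)"] S.tle_Obj S.tge_Obj by auto
  have 1: "\<exists>!t. t_structure C t \<and> strictly_orthogonal C t w"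
    using S.t_structure_orthogonal so uniq by blast
  let ?tA = "t_restriction (S.tle 0, S.tge 0) S.CA"
  have bounded_objs: "t_restricts (full_sub C S.CA) ?tA (S.CA \<inter> S.bounded_objs F) \<and>
      naturally_equivalent R C (heart (t_restriction ?tA (S.CA \<inter> S.bounded_objs F))) (heart w) \<A>"
    if "S.shift_inv F"
      and "\<And>N L R' f g h. L \<in> S.tge 0 \<Longrightarrow> R' \<in> S.tle (- 1) \<Longrightarrow> dist_tri C L N R' f g h \<Longrightarrow> N \<in> S.bounded_objs F \<Longrightarrow> L \<in> S.bounded_objs F"
      and "\<And>Z. Z \<in> S.tle 0 \<Longrightarrow> Z \<in> S.tge 0 \<Longrightarrow> Z \<in> S.bounded_objs F" for F
    using S.t_restricts_bounded[OF that(1,2)] S.heart_bounded_HA[OF that(3)] S.heart_equivalence by simp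
  have b_iff: "Z \<in> S.bounded_objs (sup at_bot at_top) \<longleftrightarrow> Z \<in> S.bounded_objs at_bot \<and> Z \<in> S.bounded_objs at_top" for Z
    by (auto simp: S.bounded_objs_def eventually_sup)
  have below: "t_restricts (full_sub C S.CA) ?tA (S.CA \<inter> S.bounded_objs at_bot) \<and>
      naturally_equivalent R C (heart (t_restriction ?tA (S.CA \<inter> S.bounded_objs at_bot))) (heart w) \<A>"
    if "ess_bounded_below (full_sub C C0) w"
    by (rule bounded_objs[OF S.shift_inv_at(1)]) (use S.truncation_bounded(1) S.heart_bounded(1) that in blast)+
  have above: "t_restricts (full_sub C S.CA) ?tA (S.CA \<inter> S.bounded_objs at_top) \<and>
      naturally_equivalent R C (heart (t_restriction ?tA (S.CA \<inter> S.bounded_objs at_top))) (heart w) \<A>"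
    if "ess_bounded_above (full_sub C C0) w"
    by (rule bounded_objs[OF S.shift_inv_at(2)]) (use S.truncation_bounded(2) S.heart_bounded(2) that in blast)+
  have both: "t_restricts (full_sub C S.CA) ?tA (S.CA \<inter> S.bounded_objs (sup at_bot at_top)) \<and>
      naturally_equivalent R C (heart (t_restriction ?tA (S.CA \<inter> S.bounded_objs (sup at_bot at_top)))) (heart w) \<A>"
    if "ess_bounded_below (full_sub C C0) w" "ess_bounded_above (full_sub C C0) w"
    by (rule bounded_objs[OF S.shift_inv_at(3)]; unfold b_iff) (use S.truncation_bounded S.heart_bounded that in blast)+
  show ?thesis
    unfolding CA S.sub_bounded using 1 uniq S.t_restricts_CA below above both by blast
qed

end
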